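(* Let $d,n\ge1$ be integers and, for $j\in\{1,\dots,d\}$ and $U\in\mathbb{R}^n$, let $A_j(U)$ be a real $n\times n$ matrix whose entries are polynomial functions of $U$. Suppose there are an open set $\mathcal{U}\subset\mathbb{R}^n$ with $0\in\mathcal{U}$, a matrix-valued map $S(\cdot)$ with polynomial entries such that $S(U)$ is real, symmetric positive definite for all $U\in\mathcal{U}$, and, for each $j\in\{1,\dots,d\}$, a real symmetric constant matrix $S_j^0$ such that $$A_j(U)=S_j^0\,S(U)\qquad\text{for all }U\in\mathcal{U}.$$ Let $s>d/2+1$, $M>0$ and let $\mathcal{K}\subset\mathcal{U}$ be compact. There exist $C>0$ and $T>0$, depending only on $s$, $M$ and $\mathcal{K}$, such that for every $N\in\mathbb{N}$ and every $U^0\in H^s((2\pi\mathbb{T})^d)^n$ with $|U^0|_{H^s}\le M$ and taking values in $\mathcal{K}$, there exists a unique maximal-in-time classical solution $U_N\in\mathcal{C}(I_N;H^s((2\pi\mathbb{T})^d)^n)$ to $$\partial_t U_N+\mathsf{P}_N\Big(\sum_{j=1}^d A_j(U_N)\partial_{x_j}U_N\Big)=0,\qquad U_N|_{t=0}=\mathsf{P}_N U^0.$$ The open time interval $I_N$ satisfies $I_N\supset[0,T/|U^0|_{H^s}]$ and for all $0\le t\le T/|U^0|_{H^s}$, $$|U_N(t,\cdot)|_{H^s}\le C|U^0|_{H^s}\exp(C|U^0|_{H^s}t)\le 2C|U^0|_{H^s}.$$ Moreover, for any $s'\ge s$, one has $U_N\in\mathcal{C}^1(I_N;H^{s'}((2\pi\mathbb{T})^d)^n)$,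 and for any $0<T^*\in I_N$, $M^*>0$ and compact $\mathcal{K}^*\subset\mathcal{U}$ such that $\sup_{t\in[0,T^*]}|U_N(t,\cdot)|_{H^s}\le M^*$ and $U_N([0,T^*]\times\mathbb{R}^d)\subset\mathcal{K}^*$, there exists $C^*>0$ depending only on $s$, $s'$, $M^*$ and $\mathcal{K}^*$ such that for all $0\le t\le T^*$, $$|U_N(t,\cdot)|_{H^{s'}}\le C^*|U^0|_{H^{s'}}\exp(C^*M^*t).$$
   Context: $(2\pi\mathbb{T})^d$ is the torus of period $2\pi$ in each of the $d$ variables; functions on it are real-valued and identified with $2\pi$-periodic functions on $\mathbb{R}^d$. For real $s\ge0$, $H^s((2\pi\mathbb{T})^d)^n$ is the space of $U\in L^2((2\pi\mathbb{T})^d)^n$ with $|U|_{H^s}^2=\sum_{k\in\mathbb{Z}^d}\langle k\rangle^{2s}|\widehat U_k|^2<\infty$, where $\widehat U_k$ is the $k$-th Fourier coefficient and $\langle k\rangle=(1+|k|^2)^{1/2}$; $|U^0|_{H^{s'}}=+\infty$ if $U^0\notin H^{s'}$. $\mathcal{C}(I;X)$, $\mathcal{C}^1(I;X)$ denote continuous, resp. continuously differentiable, functions on the interval $I$ with values in the Banach space $X$. $\mathbb{N}$ denotes the positive integers. $\mathsf{P}_N$ (sharp low-pass filter) acts componentwise as the Fourier multiplier with symbol $\mathbf{1}_{\{-N,\dots,N\}^d}$, i.e. $\widehat{(\mathsf{P}_NU)}_k=\widehat U_k$ if $\max_j|k_j|\le N$ and $0$ otherwise. A maximal-in-time classical solution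 in $\mathcal{C}(I;H^s)$ is a solution on an open interval $I\ni0$ which cannot be extended to a solution in the same class on a strictly larger interval. If $U^0=0$, $[0,T/|U^0|_{H^s}]$ is read as $[0,\infty)$. Constants said to depend "only" on certain quantities may also depend on the fixed data $d,n,A_1,\dots,A_d,S,\mathcal{U}$, but never on $N$. *)

theory Defs
  imports "HOL-Analysis.Analysis"
begin

section \<open>Sobolev spaces on the torus\<close>

text \<open>
  Functions on the torus of period \<open>2 * pi\<close> in each variable are represented by periodic
  functions on \<open>real ^ 'd\<close>; an element of \<open>L\<^sup>2\<close> is represented by any of its Lebesgue-measurable
  periodic representatives. Frequencies are vectors in \<open>int ^ 'd\<close>.
\<close>

definition periodic :: "(real ^ 'd \<Rightarrow> 'b) \<Rightarrow> bool" where
  "periodic f \<longleftrightarrow> (\<forall>x j. f (x + (2 * pi) *\<^sub>R axis j 1) = f x)"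

definition torus_cell :: "(real ^ 'd) set" where
  "torus_cell = cbox 0 (\<chi> j. 2 * pi)"

definition torus_L2 :: "(real ^ 'd \<Rightarrow> real ^ 'n) set" where
  "torus_L2 = {f. periodic f \<and> f \<in> borel_measurable lebesgue \<and>
     set_integrable lebesgue torus_cell (\<lambda>x. (norm (f x))\<^sup>2)}"

definition freq_dot :: "int ^ 'd \<Rightarrow> real ^ 'd \<Rightarrow> real" where
  "freq_dot k x = (\<Sum>j\<in>UNIV. real_of_int (k $ j) * x $ j)"

definition japanese_bracket :: "int ^ 'd \<Rightarrow> real" where
  "japanese_bracket k = sqrt (1 + (\<Sum>j\<in>UNIV. (real_of_int (k $ j))\<^sup>2))"

text \<open>Normalised so that \<open>f x = (\<Sum>k. fourier_coeff f k * exp (\<i> * (k \<bullet> x)))\<close>.\<close>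

definition fourier_coeff :: "(real ^ 'd \<Rightarrow> real ^ 'n) \<Rightarrow> int ^ 'd \<Rightarrow> complex ^ 'n" where
  "fourier_coeff f k = (\<chi> i.
     (LINT x:torus_cell|lebesgue. complex_of_real (f x $ i) * cis (- freq_dot k x))
       / complex_of_real ((2 * pi) ^ CARD('d)))"

definition Hs :: "real \<Rightarrow> (real ^ 'd \<Rightarrow> real ^ 'n) set" where
  "Hs s = {f \<in> torus_L2.
     (\<lambda>k. japanese_bracket k powr (2 * s) * (norm (fourier_coeff f k))\<^sup>2) summable_on UNIV}"

definition Hs_norm :: "real \<Rightarrow> (real ^ 'd \<Rightarrow> real ^ 'n) \<Rightarrow> real" where
  "Hs_norm s f =
     sqrt (\<Sum>\<^sub>\<infinity>k. japanese_bracket k powr (2 * s) * (norm (fourier_coeff f k))\<^sup>2)"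

text \<open>\<open>Hs_norm\<close> is meaningful only on \<open>Hs\<close>, the infinite sum being \<open>0\<close> when it diverges.\<close>

definition Hs_enorm :: "real \<Rightarrow> (real ^ 'd \<Rightarrow> real ^ 'n) \<Rightarrow> ennreal" where
  "Hs_enorm s f = (if f \<in> Hs s then ennreal (Hs_norm s f) else \<infinity>)"

definition Hs_continuous_on :: "real \<Rightarrow> real set \<Rightarrow> (real \<Rightarrow> real ^ 'd \<Rightarrow> real ^ 'n) \<Rightarrow> bool" where
  "Hs_continuous_on s I u \<longleftrightarrow> (\<forall>t\<in>I. u t \<in> Hs s) \<and>
     (\<forall>t\<in>I. ((\<lambda>\<tau>. Hs_norm s (\<lambda>x. u \<tau> x - u t x)) \<longlongrightarrow> 0) (at t within I))"

definition Hs_C1_on :: "real \<Rightarrow> real set \<Rightarrow> (real \<Rightarrow> real ^ 'd \<Rightarrow> real ^ 'n) \<Rightarrow> bool" where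
  "Hs_C1_on s I u \<longleftrightarrow> Hs_continuous_on s I u \<and>
     (\<exists>v. Hs_continuous_on s I v \<and>
       (\<forall>t\<in>I. ((\<lambda>\<tau>. Hs_norm s (\<lambda>x. (u \<tau> x - u t x) /\<^sub>R (\<tau> - t) - v t x)) \<longlongrightarrow> 0)
          (at t within I)))"

section \<open>The filtered system\<close>

text \<open>
  The Fourier multiplier with symbol the indicator function of \<open>{-N..N}\<^sup>d\<close>, written as a
  trigonometric polynomial. The set of frequencies is symmetric and \<open>f\<close> is real-valued,
  so the sum is already real and \<open>Re\<close> only changes its type.
\<close>

definition lowpass :: "nat \<Rightarrow> (real ^ 'd \<Rightarrow> real ^ 'n) \<Rightarrow> real ^ 'd \<Rightarrow> real ^ 'n" where
  "lowpass N f x = (\<chi> i.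
     Re (\<Sum>k\<in>{k. \<forall>j. \<bar>k $ j\<bar> \<le> int N}. fourier_coeff f k $ i * cis (freq_dot k x)))"

definition partial_x :: "'d \<Rightarrow> (real ^ 'd \<Rightarrow> real ^ 'n) \<Rightarrow> real ^ 'd \<Rightarrow> real ^ 'n" where
  "partial_x j f x = vector_derivative (\<lambda>h. f (x + h *\<^sub>R axis j 1)) (at 0)"

definition spacetime_C1_on :: "real set \<Rightarrow> (real \<Rightarrow> real ^ 'd \<Rightarrow> real ^ 'n) \<Rightarrow> bool" where
  "spacetime_C1_on I u \<longleftrightarrow>
     (\<exists>D :: (real \<times> (real ^ 'd)) \<Rightarrow> ((real \<times> (real ^ 'd)) \<Rightarrow>\<^sub>L (real ^ 'n)).
        (\<forall>z \<in> I \<times> UNIV. ((\<lambda>(t, x). u t x) has_derivative blinfun_apply (D z)) (at z)) \<and>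
        continuous_on (I \<times> UNIV) D)"

text \<open>
  Since \<open>u\<close> is \<open>C\<^sup>1\<close> in space-time, each \<open>u t\<close> is the continuous representative of its class,
  and both the equation and the initial condition are imposed at every point.
\<close>

definition classical_solution ::
  "('d \<Rightarrow> real ^ 'n \<Rightarrow> real ^ 'n ^ 'n) \<Rightarrow> nat \<Rightarrow> real \<Rightarrow> (real ^ 'd \<Rightarrow> real ^ 'n) \<Rightarrow>
   real set \<Rightarrow> (real \<Rightarrow> real ^ 'd \<Rightarrow> real ^ 'n) \<Rightarrow> bool" where
  "classical_solution A N s U0 I u \<longleftrightarrow>
     open I \<and> is_interval I \<and> 0 \<in> I \<and>
     Hs_continuous_on s I u \<and> spacetime_C1_on I u \<and>
     (\<forall>t\<in>I. \<forall>x. vector_derivative (\<lambda>\<tau>. u \<tau> x) (at t)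
        + lowpass N (\<lambda>y. \<Sum>j\<in>UNIV. A j (u t y) *v partial_x j (u t) y) x = 0) \<and>
     (\<forall>x. u 0 x = lowpass N U0 x)"

definition maximal_solution ::
  "('d \<Rightarrow> real ^ 'n \<Rightarrow> real ^ 'n ^ 'n) \<Rightarrow> nat \<Rightarrow> real \<Rightarrow> (real ^ 'd \<Rightarrow> real ^ 'n) \<Rightarrow>
   real set \<Rightarrow> (real \<Rightarrow> real ^ 'd \<Rightarrow> real ^ 'n) \<Rightarrow> bool" where
  "maximal_solution A N s U0 I u \<longleftrightarrow> classical_solution A N s U0 I u \<and>
     \<not> (\<exists>J v. I \<subset> J \<and> classical_solution A N s U0 J v \<and> (\<forall>t\<in>I. v t = u t))"

text \<open>The interval from \<open>0\<close> to \<open>T / r\<close>, read as unbounded when \<open>r = 0\<close>.\<close>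

definition lifespan :: "real \<Rightarrow> real \<Rightarrow> real set" where
  "lifespan T r = (if r = 0 then {0..} else {0..T / r})"

text \<open>
  \<open>U0\<close> is an arbitrary representative of its \<open>L\<^sup>2\<close> class, hence "almost every". For closed \<open>K\<close>
  this says that the continuous representative, if there is one, takes all its values in \<open>K\<close>.
\<close>

definition admissible_data ::
  "real \<Rightarrow> real \<Rightarrow> (real ^ 'n) set \<Rightarrow> (real ^ 'd \<Rightarrow> real ^ 'n) \<Rightarrow> bool" where
  "admissible_data s M K U0 \<longleftrightarrow>
     U0 \<in> Hs s \<and> Hs_norm s U0 \<le> M \<and> (AE x in lebesgue. U0 x \<in> K)"

end

theory Submission
  imports Defs
begin

text \<open>
  The initial data and every term of the equation except the time derivative are filtered, so a classical solution is at
  each time a trigonometric polynomial of degree \<open>N\<close> (\<open>classical_solution_bandlimited\<close>). For fixed \<open>N\<close> the system is therefore an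
  ordinary differential equation, with a field that is Lipschitz on balls. Existence, uniqueness, maximality and the
  smoothness in every \<open>H\<^sup>s\<^sup>'\<close> are those of ordinary differential equations, and a solution ends only if it becomes
  unbounded (\<open>filtered_system_maximal_solution\<close>). What has to be shown is that all estimates are uniform in \<open>N\<close>.

  The norm that makes this work is \<open>\<parallel>U\<parallel> = \<Sum> \<langle>k\<rangle> \<bar>U\<^sub>k\<bar>\<close>, the sum running over the frequencies. It dominates \<open>U\<close> and its
  gradient in \<open>L\<^sup>\<infinity>\<close>, is submultiplicative up to a constant, and for \<open>s > d/2 + 1\<close> it is dominated by the \<open>H\<^sup>s\<close> norm
  (\<open>weighted_l1_le_l2\<close>). The sharp filter, which is unbounded on \<open>L\<^sup>\<infinity>\<close> as \<open>N\<close> grows, is a contraction for this norm and for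
  its unweighted variant; hence \<open>\<partial>\<^sub>t U\<close> is bounded by a multiple of \<open>\<parallel>U\<parallel>\<close> (\<open>filtered_rhs_wiener_bound\<close>).

  The uniform estimate is an energy estimate with \<open>S\<close> as symmetrizer, for
  \<open>E = \<integral> \<langle>D\<rangle>\<^sup>r U \<bullet> S(U) \<langle>D\<rangle>\<^sup>r U\<close>, which is comparable to the square of the \<open>H\<^sup>r\<close> norm as long as \<open>U\<close> stays in a compact
  subset of \<open>\<U>\<close>. In \<open>dE/dt\<close> the term with \<open>\<partial>\<^sub>t S(U)\<close> is bounded by \<open>\<parallel>U\<parallel>\<close> times the energy. In the other term put
  \<open>V = S(U) \<langle>D\<rangle>\<^sup>r U\<close>. Since \<open>A\<^sub>j = S\<^sub>j\<^sup>0 S\<close> with \<open>S\<^sub>j\<^sup>0\<close> constant, moving \<open>\<langle>D\<rangle>\<^sup>r\<close> onto \<open>U\<close> turns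
  \<open>P\<^sub>N \<langle>D\<rangle>\<^sup>r (A\<^sub>j(U) \<partial>\<^sub>j U)\<close> into \<open>P\<^sub>N S\<^sub>j\<^sup>0 \<partial>\<^sub>j V\<close> up to commutators. The pairing of \<open>P\<^sub>N S\<^sub>j\<^sup>0 \<partial>\<^sub>j V\<close> with \<open>V\<close> vanishes, because
  \<open>S\<^sub>j\<^sup>0\<close> is symmetric and \<open>P\<^sub>N\<close> is an orthogonal projection commuting with the constant matrices and with \<open>\<partial>\<^sub>j\<close>
  (\<open>energy_pairing_bound\<close>). This is where the factorisation of \<open>A\<^sub>j\<close> is indispensable: a symmetrizer that does not commute
  with the filter in this way would leave a commutator of \<open>P\<^sub>N\<close> with a function, which applied to \<open>\<partial>\<^sub>j U\<close> is not bounded uniformly in \<open>N\<close>. The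
  commutators with \<open>\<langle>D\<rangle>\<^sup>r\<close> are bounded by Young's inequality on the Fourier side (\<open>commutator_bound\<close>) and by Moser-type
  bounds for \<open>S(U)\<close> (\<open>polynomial_composition_bounds\<close>). Gronwall's argument gives \<open>energy_estimate\<close>,
  \<open>|U(t)|\<^sub>r \<le> \<kappa> |U(0)|\<^sub>r exp (C w t)\<close> if \<open>\<parallel>U\<parallel> \<le> w\<close>. With \<open>r = s'\<close> this is the estimate of higher regularity
  (\<open>higher_regularity_bound\<close>).

  For the uniform existence time, let \<open>m = |U\<^sup>0|\<^sub>s\<close>. As long as \<open>|U|\<^sub>s \<le> 2 \<kappa> m\<close>, the solution moves in \<open>L\<^sup>\<infinity>\<close> at a speed
  of order \<open>m\<close>, so during a time of order \<open>1/m\<close> it stays near the values of \<open>P\<^sub>N U\<^sup>0\<close>. If these are near \<open>K \<union> {0}\<close>, the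
  energy estimate applies on a compact neighbourhood of this set and improves the bound \<open>2 \<kappa> m\<close>, which therefore
  persists by continuity. They are near \<open>K\<close> if \<open>N\<close> is large, since \<open>P\<^sub>N U\<^sup>0\<close> converges to \<open>U\<^sup>0\<close> uniformly at rate \<open>m/N\<close>
  (\<open>lowpass_near_values\<close>), and near \<open>0\<close> if \<open>m\<close> is small. In the remaining case, \<open>N\<close> bounded and \<open>m\<close> bounded below,
  \<open>P\<^sub>N U\<^sup>0\<close> may take values outside \<open>\<U>\<close>, where the system need not be symmetrizable; but there all norms of functions of
  degree \<open>N\<close> are equivalent with constants independent of \<open>N\<close>, so the bound on \<open>\<partial>\<^sub>t U\<close> alone controls the \<open>H\<^sup>s\<close> norm on a
  short interval (\<open>uniform_existence_time\<close>).
\<close>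

section \<open>Fourier analysis on the torus\<close>

definition character :: "int ^ 'd \<Rightarrow> real ^ 'd \<Rightarrow> complex" where
  "character k x = cis (freq_dot k x)"

definition torus_mean :: "(real ^ 'd \<Rightarrow> complex) \<Rightarrow> complex" where
  "torus_mean f = (LINT x:torus_cell|lebesgue. f x) / complex_of_real ((2 * pi) ^ CARD('d))"

definition fhat :: "(real ^ 'd \<Rightarrow> complex) \<Rightarrow> int ^ 'd \<Rightarrow> complex" where
  "fhat f k = torus_mean (\<lambda>x. f x * character (- k) x)"

lemma freq_dot_add: "freq_dot (k + l) x = freq_dot k x + freq_dot l x"
  by (simp add: freq_dot_def sum.distrib distrib_right)

lemma freq_dot_minus: "freq_dot (- k) x = - freq_dot k x"
  by (simp add: freq_dot_def sum_negf)

lemma freq_dot_0 [simp]: "freq_dot 0 x = 0"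
  by (simp add: freq_dot_def)

lemma character_add: "character (k + l) x = character k x * character l x"
  by (simp add: character_def freq_dot_add cis_mult)

lemma character_minus: "character (- k) x = cnj (character k x)"
  by (simp add: character_def freq_dot_minus cis_cnj)

lemma character_0 [simp]: "character 0 x = 1"
  by (simp add: character_def)

lemma norm_character [simp]: "norm (character k x) = 1"
  by (simp add: character_def)

lemma continuous_character [continuous_intros]: "continuous_on A (character k)"
  unfolding character_def freq_dot_def cis_conv_exp
  by (intro continuous_intros)

lemma fourier_coeff_eq_fhat:
  "fourier_coeff f k $ i = fhat (\<lambda>x. complex_of_real (f x $ i)) k"
  by (simp add: fourier_coeff_def fhat_def torus_mean_def character_def freq_dot_minus)

lemma torus_integrable:
  fixes f :: "real ^ 'd \<Rightarrow> complex"
  assumes "continuous_on UNIV f"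
  shows "set_integrable lebesgue torus_cell f"
  unfolding torus_cell_def
  by (rule absolutely_integrable_continuous) (rule continuous_on_subset[OF assms], simp)

lemma torus_mean_integral:
  fixes f :: "real ^ 'd \<Rightarrow> complex"
  assumes "continuous_on UNIV f"
  shows "torus_mean f = integral torus_cell f / complex_of_real ((2 * pi) ^ CARD('d))"
  unfolding torus_mean_def
  by (subst set_lebesgue_integral_eq_integral) (use torus_integrable[OF assms] in auto)

lemma torus_mean_add:
  assumes "continuous_on UNIV f" "continuous_on UNIV g"
  shows "torus_mean (\<lambda>x. f x + g x) = torus_mean f + torus_mean g"
  unfolding torus_mean_def
  by (subst set_integral_add) (auto intro: torus_integrable assms simp: add_divide_distrib)

lemma torus_mean_cmult: "torus_mean (\<lambda>x. c * f x) = c * torus_mean f"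
  unfolding torus_mean_def by simp

lemma torus_mean_cnj: "torus_mean (\<lambda>x. cnj (f x)) = cnj (torus_mean f)"
proof -
  have "(LINT x:torus_cell|lebesgue. cnj (f x)) = cnj (LINT x:torus_cell|lebesgue. f x)"
    unfolding set_lebesgue_integral_def
    by (subst Bochner_Integration.integral_cnj[symmetric]) (simp only: complex_cnj_scaleR)
  then show ?thesis unfolding torus_mean_def by simp
qed

lemma content_torus_cell: "measure lebesgue (torus_cell :: (real ^ 'd) set) = (2 * pi) ^ CARD('d)"
proof -
  have ne: "cbox 0 (\<chi> j. (2 * pi :: real)) \<noteq> ({} :: (real ^ 'd) set)"
    by (auto simp: interval_ne_empty_cart)
  have "measure lebesgue (torus_cell :: (real ^ 'd) set) = measure lborel (cbox 0 (\<chi> j. 2 * pi) :: (real ^ 'd) set)"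
    by (simp add: torus_cell_def)
  also have "\<dots> = (2 * pi) ^ CARD('d)"
    using content_cbox_cart[OF ne] by simp
  finally show ?thesis .
qed

lemma torus_cell_lmeasurable [simp]: "torus_cell \<in> lmeasurable"
  by (simp add: torus_cell_def)

lemma torus_mean_bound:
  fixes f :: "real ^ 'd \<Rightarrow> complex"
  assumes c: "continuous_on UNIV f" and b: "\<And>x. norm (f x) \<le> B"
  shows "norm (torus_mean f) \<le> B"
proof -
  have "norm (integral torus_cell f) \<le> B * measure lborel (cbox 0 (\<chi> j. 2 * pi) :: (real ^ 'd) set)"
    unfolding torus_cell_def
  proof (rule order_trans[OF integral_norm_bound_integral[where g = "\<lambda>_. B"]])
    show "f integrable_on cbox 0 (\<chi> j. 2 * pi)"
      by (rule integrable_continuous) (rule continuous_on_subset[OF c], simp)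
  qed (use b in auto)
  then have "norm (integral torus_cell f) \<le> B * (2 * pi) ^ CARD('d)"
    using content_torus_cell[where 'd = 'd] by (simp add: torus_cell_def)
  then show ?thesis
    by (simp add: torus_mean_integral[OF c] norm_divide norm_power norm_mult pos_divide_le_eq power_mult_distrib)
qed

lemma torus_mean_const: "torus_mean (\<lambda>x::real^'d. c) = c"
proof -
  have "(LINT x:(torus_cell::(real^'d) set)|lebesgue. c) = measure lebesgue (torus_cell :: (real ^ 'd) set) *\<^sub>R c"
    using fmeasurableD2[OF torus_cell_lmeasurable] fmeasurableD[OF torus_cell_lmeasurable]
    unfolding infinity_ennreal_def[symmetric] by (intro set_integral_const)
  then show ?thesis
    by (simp add: torus_mean_def content_torus_cell scaleR_conv_of_real)
qed

text \<open>Lebesgue measure on \<open>real ^ 'd\<close> is the image of a product measure indexed by the standard basis, so Fubini's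
  theorem for finite products applies once basis vectors are identified with their indices.\<close>

lemma integral_prod_coordinates:
  fixes f :: "'d::finite \<Rightarrow> real \<Rightarrow> complex"
  assumes "\<And>j. integrable lborel (f j)"
  shows "(LINT x|lborel. (\<Prod>j\<in>UNIV. f j ((x::real^'d) $ j))) = (\<Prod>j\<in>UNIV. LINT y|lborel. f j y)"
proof -
  have B: "Basis = (\<lambda>j. axis j (1::real)) ` (UNIV :: 'd set)"
    by (auto simp: Basis_vec_def)
  define idx :: "(real^'d) \<Rightarrow> 'd" where "idx b = (SOME j. b = axis j 1)" for b
  have idx: "idx (axis j 1) = j" for j :: 'd
    unfolding idx_def by (rule some_equality) (auto simp: axis_eq_axis)
  have inj: "inj_on (\<lambda>j. axis j (1::real)) (UNIV :: 'd set)"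
    by (auto simp: inj_on_def axis_eq_axis)
  interpret product_sigma_finite "\<lambda>_::real^'d. lborel :: real measure" ..
  have meas: "f j \<in> borel_measurable lborel" for j
    using assms by (rule borel_measurable_integrable)
  have "(LINT x|lborel. (\<Prod>j\<in>UNIV. f j ((x::real^'d) $ j)))
      = (LINT x|distr (\<Pi>\<^sub>M b\<in>(Basis::(real^'d) set). lborel) borel (\<lambda>f. \<Sum>b\<in>Basis. f b *\<^sub>R b). (\<Prod>b\<in>Basis. f (idx b) (x \<bullet> b)))"
    by (subst lborel_eq, subst B, subst prod.reindex[OF inj])
       (simp add: idx o_def inner_axis)
  also have "\<dots> = (LINT g|(\<Pi>\<^sub>M b\<in>(Basis::(real^'d) set). lborel). (\<Prod>b\<in>Basis. f (idx b) ((\<Sum>b\<in>Basis. g b *\<^sub>R b) \<bullet> b)))"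
  proof (rule integral_distr)
    show "(\<lambda>f. \<Sum>b\<in>(Basis::(real^'d) set). f b *\<^sub>R b) \<in> (\<Pi>\<^sub>M b\<in>Basis. lborel) \<rightarrow>\<^sub>M borel"
      by measurable
    show "(\<lambda>x. \<Prod>b\<in>(Basis::(real^'d) set). f (idx b) (x \<bullet> b)) \<in> borel_measurable borel"
      using meas by (intro borel_measurable_prod) (auto intro!: measurable_compose[OF _ meas[simplified]])
  qed
  also have "\<dots> = (LINT g|(\<Pi>\<^sub>M b\<in>(Basis::(real^'d) set). lborel). (\<Prod>b\<in>Basis. f (idx b) (g b)))"
    by (intro Bochner_Integration.integral_cong refl prod.cong) (simp add: inner_sum_left_Basis)
  also have "\<dots> = (\<Prod>b\<in>(Basis::(real^'d) set). LINT y|lborel. f (idx b) y)"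
    by (rule product_integral_prod) (auto intro: assms)
  also have "\<dots> = (\<Prod>j\<in>UNIV. LINT y|lborel. f j y)"
    by (subst B, subst prod.reindex[OF inj]) (simp add: idx o_def)
  finally show ?thesis .
qed

lemma integral_cis_period:
  assumes "q \<noteq> (0::int)"
  shows "(LINT y|lborel. indicator {0..2*pi} y *\<^sub>R cis (q * y)) = 0"
proof -
  have "((\<lambda>y. cis (q * y)) has_integral (cis (q * (2*pi)) / (\<i> * q) - cis (q * (0::real)) / (\<i> * q))) {0..2*pi}"
  proof (rule fundamental_theorem_of_calculus)
    fix y :: real
    show "((\<lambda>y. cis (q * y) / (\<i> * q)) has_vector_derivative cis (q * y)) (at y within {0..2*pi})"
      unfolding cis_conv_exp using assms
      by (auto intro!: derivative_eq_intros has_vector_derivative_real_field simp: field_simps)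
  qed simp
  moreover have "cis (real_of_int q * (2*pi)) = 1"
    by (metis cis_multiple_2pi Ints_of_int mult.commute mult.assoc mult.left_commute)
  ultimately have h: "((\<lambda>y. cis (q * y)) has_integral 0) {0..2*pi}"
    by simp
  have "set_integrable lborel {0..2*pi} (\<lambda>y. cis (q * y))"
    by (rule borel_integrable_compact[folded set_integrable_def])
       (auto simp: cis_conv_exp intro!: continuous_intros)
  then have "(LINT y:{0..2*pi}|lborel. cis (q * y)) = integral {0..2*pi} (\<lambda>y. cis (q * y))"
    by (rule set_borel_integral_eq_integral)
  with h show ?thesis
    by (simp add: set_lebesgue_integral_def integral_unique)
qed

text \<open>A character is a product of functions of one coordinate, and a coordinate with nonzero frequency integrates to
  \<open>0\<close>.\<close>

lemma torus_mean_character: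
  "torus_mean (character k) = (if k = 0 then 1 else 0)"
proof (cases "k = 0")
  case True
  then show ?thesis using torus_mean_const[of 1, where 'd = 'a] by (simp add: character_def[abs_def])
next
  case False
  then obtain j0 where j0: "k $ j0 \<noteq> 0" by (auto simp: vec_eq_iff)
  define f where "f j y = indicator {0..2*pi} y *\<^sub>R cis (k $ j * y)" for j and y :: real
  have int: "integrable lborel (f j)" for j
    unfolding f_def
    by (rule borel_integrable_compact) (auto simp: cis_conv_exp intro!: continuous_intros)
  have eq: "indicator torus_cell x *\<^sub>R character k x = (\<Prod>j\<in>UNIV. f j (x $ j))" for x
  proof (cases "x \<in> torus_cell")
    case True
    then have "\<And>j. 0 \<le> x $ j \<and> x $ j \<le> 2 * pi" by (simp add: torus_cell_def mem_box_cart)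
    then have "(\<Prod>j\<in>UNIV. f j (x $ j)) = (\<Prod>j\<in>UNIV. cis (k $ j * x $ j))"
      by (simp add: f_def)
    also have "\<dots> = character k x"
      by (simp add: character_def freq_dot_def cis_conv_exp exp_sum sum_distrib_left)
    finally show ?thesis using True by simp
  next
    case False
    then obtain j where "\<not> (0 \<le> x $ j \<and> x $ j \<le> 2 * pi)" by (auto simp: torus_cell_def mem_box_cart)
    then have "f j (x $ j) = 0" by (simp add: f_def)
    then have "(\<Prod>j\<in>UNIV. f j (x $ j)) = 0" by (intro prod_zero) auto
    then show ?thesis using False by simp
  qed
  have "(LINT x:torus_cell|lebesgue. character k x) = (LINT x|lborel. indicator torus_cell x *\<^sub>R character k x)"
    unfolding set_lebesgue_integral_def
  proof (rule integral_completion)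
    show "(\<lambda>x. indicat_real torus_cell x *\<^sub>R character k x) \<in> borel_measurable lborel"
      unfolding torus_cell_def
      using borel_measurable_continuous_onI[OF continuous_character[of UNIV k]]
      by (intro borel_measurable_scaleR borel_measurable_indicator) auto
  qed
  also have "\<dots> = (\<Prod>j\<in>UNIV. LINT y|lborel. f j y)"
    unfolding eq by (rule integral_prod_coordinates) (rule int)
  also have "\<dots> = 0"
    using integral_cis_period[OF j0] by (intro prod_zero) (auto simp: f_def)
  finally show ?thesis using False by (simp add: torus_mean_def)
qed

section \<open>Trigonometric polynomials\<close>

definition trig_poly :: "(real ^ 'd \<Rightarrow> complex) \<Rightarrow> bool" where
  "trig_poly f \<longleftrightarrow> (\<exists>F c. finite F \<and> f = (\<lambda>x. \<Sum>k\<in>F. c k * character k x))"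

abbreviation spectrum :: "(real ^ 'd \<Rightarrow> complex) \<Rightarrow> (int ^ 'd) set" where
  "spectrum f \<equiv> {k. fhat f k \<noteq> 0}"

lemma trig_polyI: "finite F \<Longrightarrow> trig_poly (\<lambda>x. \<Sum>k\<in>F. c k * character k x)"
  unfolding trig_poly_def by blast

lemma trig_poly_continuous: "trig_poly f \<Longrightarrow> continuous_on A f"
  unfolding trig_poly_def by (auto intro!: continuous_intros)

lemma fhat_add:
  assumes "continuous_on UNIV f" "continuous_on UNIV g"
  shows "fhat (\<lambda>x. f x + g x) k = fhat f k + fhat g k"
  unfolding fhat_def distrib_right
  by (rule torus_mean_add) (auto intro!: continuous_intros assms)

lemma fhat_cmult: "fhat (\<lambda>x. c * f x) k = c * fhat f k"
  unfolding fhat_def by (simp add: mult.assoc torus_mean_cmult)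

lemma fhat_zero [simp]: "fhat (\<lambda>x. 0) k = 0"
  using fhat_cmult[of 0 "\<lambda>x. 0" k] by simp

lemma fhat_sum:
  assumes "\<And>i. i \<in> I \<Longrightarrow> continuous_on UNIV (f i)"
  shows "fhat (\<lambda>x. \<Sum>i\<in>I. f i x) k = (\<Sum>i\<in>I. fhat (f i) k)"
proof (cases "finite I")
  case True
  then show ?thesis using assms
    by (induction I rule: finite_induct) (auto simp: fhat_add continuous_on_sum)
qed simp

lemma fhat_diff:
  assumes "continuous_on UNIV f" "continuous_on UNIV g"
  shows "fhat (\<lambda>x. f x - g x) k = fhat f k - fhat g k"
  using fhat_add[OF assms(1), of "\<lambda>x. - 1 * g x" k] assms(2) fhat_cmult[of "-1" g k]
  by (simp add: continuous_on_minus)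

lemma fhat_cnj: "fhat (\<lambda>x. cnj (f x)) k = cnj (fhat f (- k))"
proof -
  have "torus_mean (\<lambda>x. cnj (f x * character (- (- k)) x)) = cnj (torus_mean (\<lambda>x. f x * character (- (- k)) x))"
    by (rule torus_mean_cnj)
  then show ?thesis by (simp add: fhat_def character_minus)
qed

lemma fhat_bound:
  assumes "continuous_on UNIV f" "\<And>x. norm (f x) \<le> B"
  shows "norm (fhat f k) \<le> B"
  unfolding fhat_def
  by (rule torus_mean_bound) (auto intro!: continuous_intros assms simp: norm_mult)

lemma fhat_character: "fhat (character l) k = (if k = l then 1 else 0)"
proof -
  have "fhat (character l) k = torus_mean (character (l - k))"
    unfolding fhat_def diff_conv_add_uminus
    by (rule arg_cong[of _ _ torus_mean]) (simp add: character_add[symmetric] fun_eq_iff)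
  then show ?thesis by (auto simp: torus_mean_character)
qed

lemma fhat_character_sum:
  assumes "finite F"
  shows "fhat (\<lambda>x. \<Sum>k\<in>F. c k * character k x) l = (if l \<in> F then c l else 0)"
proof -
  have "fhat (\<lambda>x. \<Sum>k\<in>F. c k * character k x) l = (\<Sum>k\<in>F. c k * (if l = k then 1 else 0))"
    by (subst fhat_sum) (auto intro!: continuous_intros simp: fhat_cmult fhat_character)
  also have "\<dots> = (\<Sum>k\<in>F. if l = k then c k else 0)"
    by (rule sum.cong) auto
  finally show ?thesis using assms by simp
qed

lemma trig_poly_finite_spectrum: "trig_poly f \<Longrightarrow> finite (spectrum f)"
  unfolding trig_poly_def
  by (elim exE conjE) (rule finite_subset, auto simp: fhat_character_sum split: if_splits)

text \<open>The expansion over any finite superset of the spectrum: it lets sums over spectra of different functions be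
  taken over a common set such as a frequency box.\<close>

lemma trig_poly_expand:
  assumes "trig_poly f" "finite F" "spectrum f \<subseteq> F"
  shows "f x = (\<Sum>k\<in>F. fhat f k * character k x)"
proof -
  from assms(1) obtain G c where G: "finite G" and f: "f = (\<lambda>x. \<Sum>k\<in>G. c k * character k x)"
    unfolding trig_poly_def by auto
  have h: "fhat f k = (if k \<in> G then c k else 0)" for k
    unfolding f by (rule fhat_character_sum[OF G])
  have "f x = (\<Sum>k\<in>G. fhat f k * character k x)"
    unfolding f by (rule sum.cong) (simp_all add: h[unfolded f])
  also have "\<dots> = (\<Sum>k\<in>F \<union> G. fhat f k * character k x)"
    by (rule sum.mono_neutral_left) (use G assms h in auto)
  also have "\<dots> = (\<Sum>k\<in>F. fhat f k * character k x)"
    by (rule sum.mono_neutral_right) (use G assms in auto)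
  finally show ?thesis .
qed

lemma trig_poly_eqI:
  assumes "trig_poly f" "trig_poly g" "\<And>k. fhat f k = fhat g k"
  shows "f = g"
  using trig_poly_expand[OF assms(1) trig_poly_finite_spectrum[OF assms(1)] order_refl]
        trig_poly_expand[OF assms(2) trig_poly_finite_spectrum[OF assms(2)] order_refl] assms(3)
  by (intro ext) simp

lemma trig_poly_character: "trig_poly (character k)"
  using trig_polyI[of "{k}" "\<lambda>_. 1"] by simp

lemma trig_poly_cmult: "trig_poly f \<Longrightarrow> trig_poly (\<lambda>x. c * f x)"
  unfolding trig_poly_def
  by (elim exE conjE, rule_tac x=F in exI, rule_tac x="\<lambda>k. c * ca k" in exI)
     (simp add: sum_distrib_left mult.assoc)

lemma trig_poly_zero: "trig_poly (\<lambda>x. 0)"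
  using trig_polyI[of "{}" "\<lambda>_. 0"] by simp

lemma trig_poly_add:
  assumes "trig_poly f" "trig_poly g" shows "trig_poly (\<lambda>x. f x + g x)"
proof -
  let ?F = "spectrum f \<union> spectrum g"
  have fin: "finite ?F" using assms trig_poly_finite_spectrum by auto
  have "(\<lambda>x. f x + g x) = (\<lambda>x. \<Sum>k\<in>?F. (fhat f k + fhat g k) * character k x)"
    using trig_poly_expand[OF assms(1) fin] trig_poly_expand[OF assms(2) fin]
    by (simp add: distrib_right sum.distrib)
  then show ?thesis using trig_polyI[OF fin] by simp
qed

lemma trig_poly_sum: "(\<And>i. i \<in> I \<Longrightarrow> trig_poly (f i)) \<Longrightarrow> trig_poly (\<lambda>x. \<Sum>i\<in>I. f i x)"
  by (induction I rule: infinite_finite_induct) (auto intro: trig_poly_add trig_poly_zero)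

lemma trig_poly_const: "trig_poly (\<lambda>x. c)"
  using trig_poly_cmult[OF trig_poly_character[of 0], of c] by simp

lemma trig_poly_uminus: "trig_poly f \<Longrightarrow> trig_poly (\<lambda>x. - f x)"
  using trig_poly_cmult[of f "-1"] by simp

lemma trig_poly_diff: "trig_poly f \<Longrightarrow> trig_poly g \<Longrightarrow> trig_poly (\<lambda>x. f x - g x)"
  using trig_poly_add[of f "\<lambda>x. - g x"] trig_poly_uminus by auto

lemma trig_poly_mult:
  assumes f: "trig_poly f" and g: "trig_poly g" shows "trig_poly (\<lambda>x. f x * g x)"
proof -
  have "(\<lambda>x. f x * g x) = (\<lambda>x. \<Sum>k\<in>spectrum f. \<Sum>l\<in>spectrum g. (fhat f k * fhat g l) * character (k + l) x)"
  proof
    fix x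
    have "f x * g x = (\<Sum>k\<in>spectrum f. fhat f k * character k x) * (\<Sum>l\<in>spectrum g. fhat g l * character l x)"
      using trig_poly_expand[OF f trig_poly_finite_spectrum[OF f] order_refl]
        trig_poly_expand[OF g trig_poly_finite_spectrum[OF g] order_refl] by simp
    then show "f x * g x = (\<Sum>k\<in>spectrum f. \<Sum>l\<in>spectrum g. (fhat f k * fhat g l) * character (k + l) x)"
      by (simp add: sum_product character_add algebra_simps)
  qed
  then show ?thesis
    by (simp only:) (intro trig_poly_sum trig_poly_cmult trig_poly_character)
qed

lemma trig_poly_prod: "(\<And>i. i \<in> I \<Longrightarrow> trig_poly (f i)) \<Longrightarrow> trig_poly (\<lambda>x. \<Prod>i\<in>I. f i x)"
  by (induction I rule: infinite_finite_induct) (auto intro: trig_poly_mult trig_poly_const)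

lemma trig_poly_cnj: assumes "trig_poly f" shows "trig_poly (\<lambda>x. cnj (f x))"
proof -
  have "(\<lambda>x. cnj (f x)) = (\<lambda>x. \<Sum>k\<in>spectrum f. cnj (fhat f k) * character (- k) x)"
    using trig_poly_expand[OF assms trig_poly_finite_spectrum[OF assms] order_refl]
    by (auto simp: character_minus)
  then show ?thesis
    by (simp only:) (intro trig_poly_sum trig_poly_cmult trig_poly_character)
qed

text \<open>The set \<open>F\<close> is left free, since in a commutator the factor \<open>g\<close> occurs with several multipliers applied to it and
  their convolution sums are to be combined term by term.\<close>

lemma fhat_mult:
  assumes f: "trig_poly f" and g: "trig_poly g" and F: "finite F" "spectrum g \<subseteq> F"
  shows "fhat (\<lambda>x. f x * g x) k = (\<Sum>l\<in>F. fhat f (k - l) * fhat g l)"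
proof -
  have "(\<lambda>x. f x * g x) = (\<lambda>x. \<Sum>l\<in>F. fhat g l * (f x * character l x))"
    using trig_poly_expand[OF g F] by (auto simp: sum_distrib_left algebra_simps)
  moreover have "fhat (\<lambda>x. f x * character l x) k = fhat f (k - l)" for l
  proof -
    have "character (- (k - l)) x = character l x * character (- k) x" for x
      by (simp add: character_add[symmetric])
    then show ?thesis by (simp add: fhat_def mult.assoc)
  qed
  ultimately show ?thesis
    by (simp add: fhat_sum fhat_cmult trig_poly_continuous[OF f] continuous_intros mult.commute)
qed

lemma torus_mean_parseval:
  assumes f: "trig_poly f" and g: "trig_poly g" and F: "finite F" "spectrum g \<subseteq> F"
  shows "torus_mean (\<lambda>x. f x * cnj (g x)) = (\<Sum>k\<in>F. fhat f k * cnj (fhat g k))"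
proof -
  have sp: "spectrum (\<lambda>x. cnj (g x)) \<subseteq> uminus ` F"
    using F(2) by (force simp: fhat_cnj)
  have "torus_mean (\<lambda>x. f x * cnj (g x)) = fhat (\<lambda>x. f x * cnj (g x)) 0"
    by (simp add: fhat_def)
  also have "\<dots> = (\<Sum>l\<in>uminus ` F. fhat f (0 - l) * fhat (\<lambda>x. cnj (g x)) l)"
    by (rule fhat_mult) (use f g F sp trig_poly_cnj in auto)
  also have "\<dots> = (\<Sum>k\<in>F. fhat f k * cnj (fhat g k))"
    by (subst sum.reindex) (auto simp: fhat_cnj)
  finally show ?thesis .
qed

section \<open>Frequency weights\<close>

lemma japanese_bracket_norm:
  "japanese_bracket k = norm (1::real, (\<chi> j. real_of_int (k $ j)))"
  by (simp add: japanese_bracket_def norm_prod_def norm_vec_def L2_set_def sum_nonneg)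

lemma japanese_bracket_ge_1: "1 \<le> japanese_bracket k"
  by (simp add: japanese_bracket_def sum_nonneg)

lemma japanese_bracket_pos [simp]: "0 < japanese_bracket k"
  using japanese_bracket_ge_1[of k] by linarith

lemma japanese_bracket_nonneg [simp]: "0 \<le> japanese_bracket k"
  using japanese_bracket_ge_1[of k] by linarith

lemma japanese_bracket_neq_0 [simp]: "japanese_bracket k \<noteq> 0"
  using japanese_bracket_ge_1[of k] by linarith

lemma japanese_bracket_minus [simp]: "japanese_bracket (- k) = japanese_bracket k"
  by (simp add: japanese_bracket_def)

lemma japanese_bracket_add: "japanese_bracket (k + l) \<le> japanese_bracket k + japanese_bracket l"
proof -
  let ?v = "\<lambda>k::int^'a. (\<chi> j. real_of_int (k $ j)) :: real^'a"
  have "japanese_bracket (k + l) = norm ((1::real, ?v k) + (0, ?v l))"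
    by (simp add: japanese_bracket_norm) (rule arg_cong[of _ _ norm], simp add: vec_eq_iff)
  also have "\<dots> \<le> norm (1::real, ?v k) + norm (0::real, ?v l)"
    by (rule norm_triangle_ineq)
  also have "norm (0::real, ?v l) \<le> norm (1::real, ?v l)"
    by (simp add: norm_prod_def real_le_rsqrt)
  finally show ?thesis by (simp add: japanese_bracket_norm)
qed

lemma japanese_bracket_lipschitz:
  "\<bar>japanese_bracket k - japanese_bracket l\<bar> \<le> japanese_bracket (k - l)"
  using japanese_bracket_add[of "k - l" l] japanese_bracket_add[of "l - k" k]
    japanese_bracket_minus[of "k - l"] by simp

lemma abs_component_le_japanese_bracket: "\<bar>real_of_int (k $ j)\<bar> \<le> japanese_bracket k"
proof -
  have "(real_of_int (k $ j))\<^sup>2 \<le> (\<Sum>j\<in>UNIV. (real_of_int (k $ j))\<^sup>2)"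
    by (rule member_le_sum) auto
  then have "\<bar>real_of_int (k $ j)\<bar> \<le> sqrt (\<Sum>j\<in>UNIV. (real_of_int (k $ j))\<^sup>2)"
    by (rule real_le_rsqrt[OF order_trans, rotated]) simp
  then show ?thesis unfolding japanese_bracket_def
    by (rule order_trans) simp
qed

lemma powr_add_le:
  fixes x y :: real
  assumes "0 \<le> x" "0 \<le> y" "0 \<le> r"
  shows "(x + y) powr r \<le> 2 powr r * (x powr r + y powr r)"
proof -
  have "(x + y) powr r \<le> (2 * max x y) powr r"
    by (rule powr_mono2) (use assms in auto)
  also have "\<dots> = 2 powr r * max x y powr r"
    using assms by (simp add: powr_mult)
  also have "max x y powr r \<le> x powr r + y powr r"
    by (simp add: max_def)
  finally show ?thesis by simp
qed

text \<open>The mean value theorem, with the intermediate point bounded by \<open>z + y\<close>. In the application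
  \<open>z\<close> is the weight of a frequency difference: one factor \<open>z\<close> is gained, and the other \<open>r - 1\<close> powers fall on \<open>z\<close> or on
  \<open>y\<close>.\<close>

lemma powr_diff_le:
  fixes x y z r :: real
  assumes xyz: "0 < x" "0 < y" "0 \<le> z" "\<bar>x - y\<bar> \<le> z" and r: "1 \<le> r"
  shows "\<bar>x powr r - y powr r\<bar> \<le> r * 2 powr r * z * (z powr (r - 1) + y powr (r - 1))"
proof -
  have mvt: "\<bar>b powr r - a powr r\<bar> \<le> r * b powr (r - 1) * (b - a)" if ab: "0 < a" "a \<le> b" for a b :: real
  proof (cases "a = b")
    case False
    with ab have "a < b" by simp
    have "\<exists>w. a < w \<and> w < b \<and> b powr r - a powr r = (b - a) * (r * w powr (r - 1))"
      by (rule MVT2[OF \<open>a < b\<close>]) (use ab in \<open>auto intro!: has_real_derivative_powr\<close>)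
    then obtain w where w: "a < w" "w < b" "b powr r - a powr r = (b - a) * (r * w powr (r - 1))"
      by blast
    have "0 \<le> (b - a) * (r * w powr (r - 1))" using ab r by simp
    moreover have "(b - a) * (r * w powr (r - 1)) \<le> (b - a) * (r * b powr (r - 1))"
      by (intro mult_left_mono powr_mono2) (use ab r w in auto)
    ultimately show ?thesis using w(3) by (simp add: mult_ac)
  qed simp
  have key: "max x y powr (r - 1) \<le> 2 powr r * (z powr (r - 1) + y powr (r - 1))"
  proof -
    have "max x y powr (r - 1) \<le> (z + y) powr (r - 1)"
      by (rule powr_mono2) (use xyz r in auto)
    also have "\<dots> \<le> 2 powr (r - 1) * (z powr (r - 1) + y powr (r - 1))"
      by (rule powr_add_le) (use xyz r in auto)
    also have "\<dots> \<le> 2 powr r * (z powr (r - 1) + y powr (r - 1))"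
      by (intro mult_right_mono) auto
    finally show ?thesis .
  qed
  have "\<bar>x powr r - y powr r\<bar> \<le> r * max x y powr (r - 1) * \<bar>x - y\<bar>"
    using mvt[of x y] mvt[of y x] xyz by (cases "x \<le> y") (auto simp: max_def abs_if split: if_splits)
  also have "\<dots> \<le> r * (2 powr r * (z powr (r - 1) + y powr (r - 1))) * z"
    by (intro mult_mono mult_left_mono key) (use xyz r in auto)
  finally show ?thesis by (simp add: mult_ac)
qed

text \<open>The symbol vanishes at \<open>k = l\<close>, and this gains one power: in each of the two products on the right, the total
  exponent is \<open>r + 1\<close> but never more than \<open>r\<close> falls on one frequency. So no derivative is lost.\<close>

lemma commutator_symbol_bound:
  fixes k l :: "int ^ 'd"
  assumes r: "1 \<le> r"
  shows "\<bar>japanese_bracket k powr r * real_of_int (l $ j) - real_of_int (k $ j) * japanese_bracket l powr r\<bar>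
    \<le> (r * 2 powr r + 1) * (japanese_bracket (k - l) powr r * japanese_bracket l powr 1
        + japanese_bracket (k - l) powr 1 * japanese_bracket l powr r)"
proof -
  define x y z where "x = japanese_bracket k" and "y = japanese_bracket l" and "z = japanese_bracket (k - l)"
  have pos: "0 < x" "0 < y" "0 < z" by (simp_all add: x_def y_def z_def)
  have zz: "z * z powr (r - 1) = z powr r" and yy: "y powr (r - 1) * y = y powr r"
    using pos by (simp_all add: powr_diff)
  let ?D = "\<bar>x powr r - y powr r\<bar>"
  have "\<bar>x powr r * real_of_int (l $ j) - real_of_int (k $ j) * y powr r\<bar>
      = \<bar>(x powr r - y powr r) * real_of_int (l $ j) + real_of_int ((l - k) $ j) * y powr r\<bar>"
    by (simp add: algebra_simps)
  also have "\<dots> \<le> ?D * \<bar>real_of_int (l $ j)\<bar> + \<bar>real_of_int ((l - k) $ j)\<bar> * y powr r"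
    by (rule order_trans[OF abs_triangle_ineq]) (simp add: abs_mult)
  also have "\<dots> \<le> (r * 2 powr r * z * (z powr (r - 1) + y powr (r - 1))) * y + z * y powr r"
  proof (intro add_mono mult_mono)
    show "?D \<le> r * 2 powr r * z * (z powr (r - 1) + y powr (r - 1))"
      using japanese_bracket_lipschitz[of k l] pos r by (intro powr_diff_le) (auto simp: x_def y_def z_def)
    show "\<bar>real_of_int (l $ j)\<bar> \<le> y" unfolding y_def by (rule abs_component_le_japanese_bracket)
    show "\<bar>real_of_int ((l - k) $ j)\<bar> \<le> z"
      using abs_component_le_japanese_bracket[of "k - l" j] by (simp add: z_def abs_minus_commute)
  qed (use pos r in auto)
  also have "\<dots> = r * 2 powr r * ((z * z powr (r - 1)) * y + z * (y powr (r - 1) * y)) + z * y powr r"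
    by (simp only: algebra_simps)
  also have "\<dots> = r * 2 powr r * (z powr r * y + z * y powr r) + z * y powr r"
    by (simp only: zz yy)
  also have "\<dots> \<le> (r * 2 powr r + 1) * (z powr r * y powr 1 + z powr 1 * y powr r)"
    using pos by (simp add: algebra_simps)
  finally show ?thesis by (simp add: x_def y_def z_def)
qed

definition freq_box :: "nat \<Rightarrow> (int ^ 'd) set" where
  "freq_box N = {k. \<forall>j. \<bar>k $ j\<bar> \<le> int N}"

lemma freq_box_eq: "freq_box N = vec_lambda ` (PiE UNIV (\<lambda>_. {- int N..int N}))"
proof (intro set_eqI iffI)
  fix k :: "int^'d" assume "k \<in> freq_box N"
  then have "vec_nth k \<in> PiE UNIV (\<lambda>_. {- int N..int N})" by (auto simp: freq_box_def abs_le_iff minus_le_iff)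
  then show "k \<in> vec_lambda ` (PiE UNIV (\<lambda>_. {- int N..int N}))"
    by (metis image_eqI vec_nth_inverse)
qed (auto simp: freq_box_def PiE_iff abs_le_iff minus_le_iff)

lemma finite_freq_box [simp]: "finite (freq_box N :: (int ^ 'd) set)"
  unfolding freq_box_eq by (intro finite_imageI finite_PiE) auto

lemma freq_box_minus [simp]: "- k \<in> freq_box N \<longleftrightarrow> k \<in> freq_box N"
  by (simp add: freq_box_def)

lemma finite_subset_freq_box:
  assumes "finite (F :: (int ^ 'd) set)"
  obtains N where "F \<subseteq> freq_box N"
proof -
  define N where "N = nat (\<Sum>k\<in>F. \<Sum>j\<in>UNIV. \<bar>k $ j\<bar>)"
  have "\<bar>k $ j\<bar> \<le> int N" if "k \<in> F" for k j
  proof -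
    have "\<bar>k $ j\<bar> \<le> (\<Sum>j\<in>UNIV. \<bar>k $ j\<bar>)" by (rule member_le_sum) auto
    also have "\<dots> \<le> (\<Sum>k\<in>F. \<Sum>j\<in>UNIV. \<bar>k $ j\<bar>)"
      by (rule member_le_sum[OF that]) (auto intro: sum_nonneg assms)
    finally show ?thesis by (simp add: N_def sum_nonneg)
  qed
  then show ?thesis by (intro that[of N]) (auto simp: freq_box_def)
qed

lemma sum_powr_1d_bound:
  assumes q: "q > (1::real)"
  shows "\<exists>C. \<forall>N. (\<Sum>m\<in>{- int N..int N}. sqrt (1 + (real_of_int m)\<^sup>2) powr (- q)) \<le> C"
proof -
  let ?b = "\<lambda>m::int. sqrt (1 + (real_of_int m)\<^sup>2) powr (- q)"
  have sm: "summable (\<lambda>n. real n powr (- q))" using q by (simp add: summable_real_powr_iff)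
  have bn: "?b (int n) \<le> (if n = 0 then 1 else 0) + real n powr (- q)" for n
  proof (cases "n = 0")
    case False
    have "real n \<le> sqrt (1 + (real n)\<^sup>2)" by (rule real_le_rsqrt) simp
    then have "?b (int n) \<le> real n powr (- q)" using False q by (auto intro!: powr_mono2')
    then show ?thesis using False by simp
  qed simp
  have "(\<Sum>m\<in>{- int N..int N}. ?b m) \<le> 2 * (1 + (\<Sum>n. real n powr (- q)))" for N
  proof -
    have sub: "{- int N..int N} \<subseteq> int ` {..N} \<union> (\<lambda>n. - int n) ` {..N}"
    proof
      fix m assume "m \<in> {- int N..int N}"
      then show "m \<in> int ` {..N} \<union> (\<lambda>n. - int n) ` {..N}"
        by (cases m rule: int_cases2) auto
    qed
    have "(\<Sum>m\<in>{- int N..int N}. ?b m) \<le> (\<Sum>m\<in>int ` {..N} \<union> (\<lambda>n. - int n) ` {..N}. ?b m)"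
      by (rule sum_mono2) (use sub in auto)
    also have "\<dots> \<le> (\<Sum>m\<in>int ` {..N}. ?b m) + (\<Sum>m\<in>(\<lambda>n. - int n) ` {..N}. ?b m)"
      by (subst sum.union_inter[symmetric]) (auto intro: sum_nonneg)
    also have "\<dots> = 2 * (\<Sum>n\<le>N. ?b (int n))"
      by (subst (1 2) sum.reindex) (auto simp: inj_on_def)
    also have "(\<Sum>n\<le>N. ?b (int n)) \<le> (\<Sum>n\<le>N. (if n = 0 then 1 else 0) + real n powr (- q))"
      by (intro sum_mono bn)
    also have "\<dots> = 1 + (\<Sum>n\<le>N. real n powr (- q))" by (simp add: sum.distrib)
    also have "(\<Sum>n\<le>N. real n powr (- q)) \<le> (\<Sum>n. real n powr (- q))"
      by (rule sum_le_suminf[OF sm]) auto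
    finally show ?thesis by simp
  qed
  then show ?thesis by blast
qed

text \<open>As \<open>\<langle>k\<rangle>\<close> dominates each \<open>\<langle>k\<^sub>j\<rangle>\<close>, the sum is at most the \<open>d\<close>-th power of the sum over the integers of
  \<open>\<langle>m\<rangle>\<close> to the power \<open>-p/d\<close>, which converges since \<open>p/d > 1\<close>.\<close>

lemma sum_bracket_powr_bounded:
  assumes p: "p > real CARD('d)"
  shows "\<exists>C\<ge>0. \<forall>F. finite F \<longrightarrow> (\<Sum>k\<in>F. japanese_bracket (k :: int ^ 'd) powr (- p)) \<le> C"
proof -
  define q where "q = p / real CARD('d)"
  have q: "q > 1" using p by (simp add: q_def)
  let ?b = "\<lambda>m::int. sqrt (1 + (real_of_int m)\<^sup>2) powr (- q)"
  obtain C1 where C1: "\<And>N. (\<Sum>m\<in>{- int N..int N}. ?b m) \<le> C1"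
    using sum_powr_1d_bound[OF q] by blast
  have C1nn: "0 \<le> C1" using order_trans[OF sum_nonneg C1] by auto
  have le: "japanese_bracket k powr (- p) \<le> (\<Prod>j\<in>UNIV. ?b (k $ j))" for k :: "int ^ 'd"
  proof -
    have "japanese_bracket k powr (- q) \<le> ?b (k $ j)" for j
    proof (rule powr_mono2')
      have "(real_of_int (k $ j))\<^sup>2 \<le> (\<Sum>j\<in>UNIV. (real_of_int (k $ j))\<^sup>2)"
        by (rule member_le_sum) auto
      then show "sqrt (1 + (real_of_int (k $ j))\<^sup>2) \<le> japanese_bracket k"
        by (simp add: japanese_bracket_def)
      show "0 < sqrt (1 + (real_of_int (k $ j))\<^sup>2)" by (simp add: add_pos_nonneg)
    qed (use q in auto)
    then have "(\<Prod>j\<in>(UNIV::'d set). japanese_bracket k powr (- q)) \<le> (\<Prod>j\<in>UNIV. ?b (k $ j))"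
      by (intro prod_mono) auto
    moreover have "(\<Prod>j\<in>(UNIV::'d set). japanese_bracket k powr (- q)) = japanese_bracket k powr (- p)"
      by (simp add: powr_power q_def)
    ultimately show ?thesis by simp
  qed
  have "(\<Sum>k\<in>F. japanese_bracket k powr (- p)) \<le> C1 ^ CARD('d)" if fin: "finite F" for F :: "(int ^ 'd) set"
  proof -
    obtain N where N: "F \<subseteq> freq_box N" using finite_subset_freq_box[OF fin] .
    have "(\<Sum>k\<in>F. japanese_bracket k powr (- p)) \<le> (\<Sum>k\<in>freq_box N. japanese_bracket (k :: int ^ 'd) powr (- p))"
      by (rule sum_mono2) (use N in auto)
    also have "\<dots> \<le> (\<Sum>k\<in>(freq_box N :: (int ^ 'd) set). \<Prod>j\<in>UNIV. ?b (k $ j))"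
      by (intro sum_mono le)
    also have "\<dots> = (\<Sum>g\<in>PiE UNIV (\<lambda>_::'d. {- int N..int N}). \<Prod>j\<in>UNIV. ?b (g j))"
      unfolding freq_box_eq by (subst sum.reindex) (auto simp: inj_on_def vec_lambda_inject)
    also have "\<dots> = (\<Prod>j\<in>(UNIV::'d set). \<Sum>m\<in>{- int N..int N}. ?b m)"
      by (rule prod_sum_PiE[symmetric]) auto
    also have "\<dots> \<le> (\<Prod>j\<in>(UNIV::'d set). C1)"
      by (intro prod_mono) (auto intro: C1 sum_nonneg)
    finally show ?thesis by simp
  qed
  then show ?thesis using C1nn by (intro exI[of _ "C1 ^ CARD('d)"]) auto
qed

text \<open>This is where \<open>s > d/2 + 1\<close> enters: the Cauchy--Schwarz inequality turns square summability
  with weight \<open>\<langle>k\<rangle>\<^sup>s\<close> into summability with weight \<open>\<langle>k\<rangle>\<close>.\<close>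

lemma weighted_l1_le_l2:
  assumes s: "s > real CARD('d) / 2 + 1"
  shows "\<exists>C>0. \<forall>F a. finite F \<longrightarrow>
     (\<Sum>k\<in>F. japanese_bracket (k :: int ^ 'd) * \<bar>a k\<bar>) \<le> C * L2_set (\<lambda>k. japanese_bracket k powr s * a k) F"
proof -
  have "2 * (s - 1) > real CARD('d)" using s by simp
  from sum_bracket_powr_bounded[OF this] obtain C where C: "C \<ge> 0"
    "\<And>F. finite F \<Longrightarrow> (\<Sum>k\<in>F. japanese_bracket (k :: int ^ 'd) powr (- (2 * (s - 1)))) \<le> C" by blast
  have "(\<Sum>k\<in>F. japanese_bracket k * \<bar>a k\<bar>) \<le> sqrt (C + 1) * L2_set (\<lambda>k. japanese_bracket k powr s * a k) F"
    if F: "finite F" for F :: "(int ^ 'd) set" and a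
  proof -
    have "(\<Sum>k\<in>F. japanese_bracket k * \<bar>a k\<bar>)
        = (\<Sum>k\<in>F. \<bar>japanese_bracket k powr (1 - s)\<bar> * \<bar>japanese_bracket k powr s * a k\<bar>)"
      by (intro sum.cong refl) (simp add: abs_mult mult.assoc[symmetric] powr_add[symmetric])
    also have "\<dots> \<le> L2_set (\<lambda>k. japanese_bracket k powr (1 - s)) F * L2_set (\<lambda>k. japanese_bracket k powr s * a k) F"
      by (rule L2_set_mult_ineq)
    also have "L2_set (\<lambda>k. japanese_bracket k powr (1 - s)) F \<le> sqrt (C + 1)"
    proof -
      have "(japanese_bracket k powr (1 - s))\<^sup>2 = japanese_bracket k powr (- (2 * (s - 1)))" for k :: "int^'d"
        using powr_powr[of "japanese_bracket k" "1 - s" 2] by (simp add: algebra_simps)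
      then show ?thesis using C(2)[OF F] by (simp add: L2_set_def)
    qed
    finally show ?thesis by (simp add: mult_right_mono)
  qed
  then show ?thesis using C(1) by (intro exI[of _ "sqrt (C + 1)"]) auto
qed

section \<open>Wiener and Sobolev norms of trigonometric polynomials\<close>

definition wiener_norm :: "real \<Rightarrow> (real ^ 'd \<Rightarrow> complex) \<Rightarrow> real" where
  "wiener_norm r f = (\<Sum>k\<in>spectrum f. japanese_bracket k powr r * norm (fhat f k))"

definition sobolev_norm :: "real \<Rightarrow> (real ^ 'd \<Rightarrow> complex) \<Rightarrow> real" where
  "sobolev_norm r f = L2_set (\<lambda>k. japanese_bracket k powr r * norm (fhat f k)) (spectrum f)"

lemma wiener_norm_nonneg [simp]: "0 \<le> wiener_norm r f"
  by (simp add: wiener_norm_def sum_nonneg)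

lemma sobolev_norm_nonneg [simp]: "0 \<le> sobolev_norm r f"
  by (simp add: sobolev_norm_def)

lemma wiener_norm_eq:
  assumes "trig_poly f" "finite F" "spectrum f \<subseteq> F"
  shows "wiener_norm r f = (\<Sum>k\<in>F. japanese_bracket k powr r * norm (fhat f k))"
  unfolding wiener_norm_def by (rule sum.mono_neutral_left) (use assms in auto)

lemma sobolev_norm_eq:
  assumes "trig_poly f" "finite F" "spectrum f \<subseteq> F"
  shows "sobolev_norm r f = L2_set (\<lambda>k. japanese_bracket k powr r * norm (fhat f k)) F"
  unfolding sobolev_norm_def L2_set_def
  by (rule arg_cong[of _ _ sqrt], rule sum.mono_neutral_left) (use assms in auto)

lemma L2_set_mono_set: "finite B \<Longrightarrow> A \<subseteq> B \<Longrightarrow> L2_set f A \<le> L2_set f B"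
  unfolding L2_set_def by (intro real_sqrt_le_mono sum_mono2) auto

lemma wiener_norm_ge:
  assumes "trig_poly f" "finite F"
  shows "(\<Sum>k\<in>F. japanese_bracket k powr r * norm (fhat f k)) \<le> wiener_norm r f"
proof -
  have fin: "finite (F \<union> spectrum f)" using assms trig_poly_finite_spectrum by auto
  show ?thesis
    unfolding wiener_norm_eq[OF assms(1) fin Un_upper2] by (rule sum_mono2) (use fin in auto)
qed

lemma sobolev_norm_ge:
  assumes "trig_poly f" "finite F"
  shows "L2_set (\<lambda>k. japanese_bracket k powr r * norm (fhat f k)) F \<le> sobolev_norm r f"
proof -
  have fin: "finite (F \<union> spectrum f)" using assms trig_poly_finite_spectrum by auto
  show ?thesis
    unfolding sobolev_norm_eq[OF assms(1) fin Un_upper2] by (rule L2_set_mono_set) (use fin in auto)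
qed

lemma norm_le_wiener_norm:
  assumes "trig_poly f" shows "norm (f x) \<le> wiener_norm 0 f"
proof -
  have "norm (f x) \<le> (\<Sum>k\<in>spectrum f. norm (fhat f k * character k x))"
    unfolding trig_poly_expand[OF assms trig_poly_finite_spectrum[OF assms] order_refl, of x]
    by (rule norm_sum)
  then show ?thesis by (simp add: wiener_norm_def norm_mult)
qed

lemma fhat_le_wiener_norm:
  assumes "trig_poly f" shows "norm (fhat f k) \<le> wiener_norm 0 f"
  using wiener_norm_ge[OF assms, of "{k}" 0] by simp

lemma wiener_norm_mono:
  assumes "r \<le> r'" shows "wiener_norm r f \<le> wiener_norm r' f"
  unfolding wiener_norm_def
  by (intro sum_mono mult_right_mono powr_mono) (use assms japanese_bracket_ge_1 in auto)

lemma wiener_norm_add: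
  assumes f: "trig_poly f" and g: "trig_poly g"
  shows "wiener_norm r (\<lambda>x. f x + g x) \<le> wiener_norm r f + wiener_norm r g"
proof -
  let ?h = "\<lambda>x. f x + g x"
  have fin: "finite (spectrum ?h)" using trig_poly_add[OF f g] trig_poly_finite_spectrum by blast
  have "wiener_norm r ?h \<le> (\<Sum>k\<in>spectrum ?h. japanese_bracket k powr r * norm (fhat f k) + japanese_bracket k powr r * norm (fhat g k))"
    unfolding wiener_norm_def distrib_left[symmetric]
    by (intro sum_mono mult_left_mono) (auto simp: fhat_add trig_poly_continuous f g norm_triangle_ineq)
  also have "\<dots> \<le> wiener_norm r f + wiener_norm r g"
    unfolding sum.distrib by (intro add_mono wiener_norm_ge f g fin)
  finally show ?thesis .
qed

lemma sobolev_norm_add: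
  assumes f: "trig_poly f" and g: "trig_poly g"
  shows "sobolev_norm r (\<lambda>x. f x + g x) \<le> sobolev_norm r f + sobolev_norm r g"
proof -
  let ?h = "\<lambda>x. f x + g x"
  have fin: "finite (spectrum ?h)" using trig_poly_add[OF f g] trig_poly_finite_spectrum by blast
  have "sobolev_norm r ?h \<le> L2_set (\<lambda>k. japanese_bracket k powr r * norm (fhat f k) + japanese_bracket k powr r * norm (fhat g k)) (spectrum ?h)"
    unfolding sobolev_norm_def distrib_left[symmetric]
    by (intro L2_set_mono mult_left_mono) (auto simp: fhat_add trig_poly_continuous f g norm_triangle_ineq)
  also have "\<dots> \<le> L2_set (\<lambda>k. japanese_bracket k powr r * norm (fhat f k)) (spectrum ?h) + L2_set (\<lambda>k. japanese_bracket k powr r * norm (fhat g k)) (spectrum ?h)"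
    by (rule L2_set_triangle_ineq)
  also have "\<dots> \<le> sobolev_norm r f + sobolev_norm r g"
    by (intro add_mono sobolev_norm_ge f g fin)
  finally show ?thesis .
qed

lemma wiener_norm_cmult: "trig_poly f \<Longrightarrow> wiener_norm r (\<lambda>x. c * f x) = norm c * wiener_norm r f"
  by (subst (1 2) wiener_norm_eq[where F = "spectrum f"])
     (auto simp: trig_poly_cmult trig_poly_finite_spectrum fhat_cmult norm_mult sum_distrib_left mult_ac)

lemma sobolev_norm_cmult: "trig_poly f \<Longrightarrow> sobolev_norm r (\<lambda>x. c * f x) = norm c * sobolev_norm r f"
  by (subst (1 2) sobolev_norm_eq[where F = "spectrum f"])
     (auto simp: trig_poly_cmult trig_poly_finite_spectrum fhat_cmult norm_mult L2_set_right_distrib mult_ac)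

lemma wiener_norm_zero [simp]: "wiener_norm r (\<lambda>x. 0) = 0"
  by (simp add: wiener_norm_def)

lemma sobolev_norm_zero [simp]: "sobolev_norm r (\<lambda>x. 0) = 0"
  by (simp add: sobolev_norm_def)

lemma wiener_norm_sum:
  assumes "\<And>i. i \<in> I \<Longrightarrow> trig_poly (f i)"
  shows "wiener_norm r (\<lambda>x. \<Sum>i\<in>I. f i x) \<le> (\<Sum>i\<in>I. wiener_norm r (f i))"
  using assms
proof (induction I rule: infinite_finite_induct)
  case (insert i I)
  then show ?case
    using wiener_norm_add[of "f i" "\<lambda>x. \<Sum>i\<in>I. f i x" r] trig_poly_sum[of I f] by fastforce
qed auto

lemma sobolev_norm_sum:
  assumes "\<And>i. i \<in> I \<Longrightarrow> trig_poly (f i)"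
  shows "sobolev_norm r (\<lambda>x. \<Sum>i\<in>I. f i x) \<le> (\<Sum>i\<in>I. sobolev_norm r (f i))"
  using assms
proof (induction I rule: infinite_finite_induct)
  case (insert i I)
  then show ?case
    using sobolev_norm_add[of "f i" "\<lambda>x. \<Sum>i\<in>I. f i x" r] trig_poly_sum[of I f] by fastforce
qed auto

lemma L2_set_sum_le: "L2_set (\<lambda>k. \<Sum>l\<in>A. g l k) F \<le> (\<Sum>l\<in>A. L2_set (g l) F)"
proof (induction A rule: infinite_finite_induct)
  case (insert l A)
  then show ?case using L2_set_triangle_ineq[of "g l" "\<lambda>k. \<Sum>l\<in>A. g l k" F] by simp
qed (auto simp: L2_set_0')

text \<open>Young's inequality for convolution of \<open>\<ell>\<^sup>1\<close> with \<open>\<ell>\<^sup>2\<close>: a convolution is a superposition of translates, and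
  translates have equal \<open>\<ell>\<^sup>2\<close> norms.\<close>

lemma young_l1_l2:
  fixes a b :: "'k::ab_group_add \<Rightarrow> real"
  assumes F: "finite F" and b: "\<And>G. finite G \<Longrightarrow> L2_set b G \<le> \<beta>" and a: "\<And>l. 0 \<le> a l"
  shows "L2_set (\<lambda>k. \<Sum>l\<in>A. a l * b (k - l)) F \<le> (\<Sum>l\<in>A. a l) * \<beta>"
proof -
  have "L2_set (\<lambda>k. \<Sum>l\<in>A. a l * b (k - l)) F \<le> (\<Sum>l\<in>A. L2_set (\<lambda>k. a l * b (k - l)) F)"
    by (rule L2_set_sum_le)
  also have "\<dots> \<le> (\<Sum>l\<in>A. a l * \<beta>)"
  proof (rule sum_mono)
    fix l
    have "L2_set (\<lambda>k. b (k - l)) F = L2_set b ((\<lambda>k. k - l) ` F)"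
      unfolding L2_set_def by (subst sum.reindex) (auto simp: inj_on_def)
    then have "L2_set (\<lambda>k. b (k - l)) F \<le> \<beta>" using b F by simp
    then have "a l * L2_set (\<lambda>k. b (k - l)) F \<le> a l * \<beta>" by (intro mult_left_mono a)
    then show "L2_set (\<lambda>k. a l * b (k - l)) F \<le> a l * \<beta>"
      by (simp add: L2_set_right_distrib[OF a])
  qed
  finally show ?thesis by (simp add: sum_distrib_right)
qed

text \<open>The factor that carries the smaller weight \<open>q\<close> is taken in \<open>\<ell>\<^sup>1\<close>, the other one in \<open>\<ell>\<^sup>2\<close>. Both the product estimate
  (\<open>q = 0\<close>) and the commutator estimate (\<open>q = 1\<close>) are instances.\<close>

lemma bilinear_multiplier_bound:
  assumes f: "trig_poly f" and g: "trig_poly g" and F: "finite F" and C: "0 \<le> C"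
    and h: "\<And>k. k \<in> F \<Longrightarrow> \<bar>h k\<bar> \<le> (\<Sum>l\<in>spectrum g. C *
        (japanese_bracket (k - l) powr r * japanese_bracket l powr q
          + japanese_bracket (k - l) powr q * japanese_bracket l powr r)
        * (norm (fhat f (k - l)) * norm (fhat g l)))"
  shows "L2_set h F \<le> C * (sobolev_norm r f * wiener_norm q g + wiener_norm q f * sobolev_norm r g)"
proof -
  define fr fq gr gq where
    "fr k = japanese_bracket k powr r * norm (fhat f k)" and
    "fq k = japanese_bracket k powr q * norm (fhat f k)" and
    "gr k = japanese_bracket k powr r * norm (fhat g k)" and
    "gq k = japanese_bracket k powr q * norm (fhat g k)" for k
  let ?P = "\<lambda>k. \<Sum>l\<in>spectrum g. gq l * fr (k - l)"
  let ?Q = "\<lambda>k. \<Sum>m\<in>spectrum f. fq m * gr (k - m)"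
  have finf: "finite (spectrum f)" and fing: "finite (spectrum g)"
    using f g trig_poly_finite_spectrum by auto
  have swap: "(\<Sum>l\<in>spectrum g. fq (k - l) * gr l) = ?Q k" for k
  proof -
    have "(\<Sum>l\<in>spectrum g. fq (k - l) * gr l) = (\<Sum>m\<in>(\<lambda>l. k - l) ` spectrum g. fq m * gr (k - m))"
      by (subst sum.reindex) (auto simp: inj_on_def)
    also have "\<dots> = (\<Sum>m\<in>(\<lambda>l. k - l) ` spectrum g \<union> spectrum f. fq m * gr (k - m))"
    proof (rule sum.mono_neutral_left)
      show "\<forall>m\<in>(\<lambda>l. k - l) ` spectrum g \<union> spectrum f - (\<lambda>l. k - l) ` spectrum g. fq m * gr (k - m) = 0"
      proof
        fix m assume m: "m \<in> (\<lambda>l. k - l) ` spectrum g \<union> spectrum f - (\<lambda>l. k - l) ` spectrum g"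
        have "k - m \<notin> spectrum g"
        proof
          assume "k - m \<in> spectrum g"
          then have "k - (k - m) \<in> (\<lambda>l. k - l) ` spectrum g" by (rule imageI)
          with m show False by simp
        qed
        then show "fq m * gr (k - m) = 0" by (simp add: gr_def)
      qed
    qed (use finf fing in auto)
    also have "\<dots> = ?Q k"
      by (rule sum.mono_neutral_right) (use finf fing in \<open>auto simp: fq_def\<close>)
    finally show ?thesis .
  qed
  have "L2_set h F = L2_set (\<lambda>k. \<bar>h k\<bar>) F" by (simp add: L2_set_def)
  also have "\<dots> \<le> L2_set (\<lambda>k. C * (?P k + ?Q k)) F"
  proof (rule L2_set_mono)
    fix k assume "k \<in> F"
    from h[OF this] show "\<bar>h k\<bar> \<le> C * (?P k + ?Q k)"
      unfolding swap[symmetric] sum.distrib[symmetric] sum_distrib_left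
      by (simp add: fr_def fq_def gr_def gq_def algebra_simps)
  qed simp
  also have "\<dots> = C * L2_set (\<lambda>k. ?P k + ?Q k) F"
    by (simp add: L2_set_right_distrib[OF C])
  also have "\<dots> \<le> C * (L2_set ?P F + L2_set ?Q F)"
    by (intro mult_left_mono L2_set_triangle_ineq C)
  also have "\<dots> \<le> C * (wiener_norm q g * sobolev_norm r f + wiener_norm q f * sobolev_norm r g)"
  proof (intro mult_left_mono add_mono C)
    show "L2_set ?P F \<le> wiener_norm q g * sobolev_norm r f"
      unfolding wiener_norm_def gq_def[symmetric]
      by (rule young_l1_l2[OF F]) (auto simp: gq_def fr_def intro: sobolev_norm_ge f)
    show "L2_set ?Q F \<le> wiener_norm q f * sobolev_norm r g"
      unfolding wiener_norm_def fq_def[symmetric]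
      by (rule young_l1_l2[OF F]) (auto simp: fq_def gr_def intro: sobolev_norm_ge g)
  qed
  finally show ?thesis by (simp add: mult_ac)
qed

lemma sobolev_norm_mult:
  assumes f: "trig_poly f" and g: "trig_poly g" and r: "0 \<le> r"
  shows "sobolev_norm r (\<lambda>x. f x * g x)
    \<le> 2 powr r * (sobolev_norm r f * wiener_norm 0 g + wiener_norm 0 f * sobolev_norm r g)"
  unfolding sobolev_norm_def[of r "\<lambda>x. f x * g x"]
proof (rule bilinear_multiplier_bound[OF f g])
  show "finite (spectrum (\<lambda>x. f x * g x))" using trig_poly_mult[OF f g] trig_poly_finite_spectrum by blast
  fix k
  have "norm (fhat (\<lambda>x. f x * g x) k) \<le> (\<Sum>l\<in>spectrum g. norm (fhat f (k - l)) * norm (fhat g l))"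
    unfolding fhat_mult[OF f g trig_poly_finite_spectrum[OF g] order_refl]
    by (rule order_trans[OF norm_sum]) (simp add: norm_mult)
  then have "japanese_bracket k powr r * norm (fhat (\<lambda>x. f x * g x) k)
      \<le> (\<Sum>l\<in>spectrum g. japanese_bracket k powr r * (norm (fhat f (k - l)) * norm (fhat g l)))"
    unfolding sum_distrib_left[symmetric] by (rule mult_left_mono) simp
  also have "\<dots> \<le> (\<Sum>l\<in>spectrum g. 2 powr r *
      (japanese_bracket (k - l) powr r + japanese_bracket l powr r) * (norm (fhat f (k - l)) * norm (fhat g l)))"
  proof (intro sum_mono mult_right_mono)
    fix l
    have "japanese_bracket k powr r \<le> (japanese_bracket (k - l) + japanese_bracket l) powr r"
      using japanese_bracket_add[of "k - l" l] by (intro powr_mono2) (use r in auto)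
    also have "\<dots> \<le> 2 powr r * (japanese_bracket (k - l) powr r + japanese_bracket l powr r)"
      by (rule powr_add_le) (use r in auto)
    finally show "japanese_bracket k powr r \<le> 2 powr r * (japanese_bracket (k - l) powr r + japanese_bracket l powr r)" .
  qed auto
  finally show "\<bar>japanese_bracket k powr r * norm (fhat (\<lambda>x. f x * g x) k)\<bar>
     \<le> (\<Sum>l\<in>spectrum g. 2 powr r * (japanese_bracket (k - l) powr r * japanese_bracket l powr 0
          + japanese_bracket (k - l) powr 0 * japanese_bracket l powr r) * (norm (fhat f (k - l)) * norm (fhat g l)))"
    by simp
qed auto

lemma wiener_norm_mult:
  assumes f: "trig_poly f" and g: "trig_poly g" and r: "0 \<le> r"
  shows "wiener_norm r (\<lambda>x. f x * g x) \<le> 2 powr r * wiener_norm r f * wiener_norm r g"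
proof -
  let ?h = "\<lambda>x. f x * g x"
  have fing: "finite (spectrum g)" and finh: "finite (spectrum ?h)"
    using g trig_poly_mult[OF f g] trig_poly_finite_spectrum by blast+
  let ?w = "\<lambda>f k. japanese_bracket k powr r * norm (fhat f k)"
  have "?w ?h k \<le> (\<Sum>l\<in>spectrum g. 2 powr r * ?w f (k - l) * ?w g l)" for k
  proof -
    have "norm (fhat ?h k) \<le> (\<Sum>l\<in>spectrum g. norm (fhat f (k - l)) * norm (fhat g l))"
      unfolding fhat_mult[OF f g fing order_refl]
      by (rule order_trans[OF norm_sum]) (simp add: norm_mult)
    then have "?w ?h k \<le> (\<Sum>l\<in>spectrum g. japanese_bracket k powr r * (norm (fhat f (k - l)) * norm (fhat g l)))"
      unfolding sum_distrib_left[symmetric] by (rule mult_left_mono) simp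
    also have "\<dots> \<le> (\<Sum>l\<in>spectrum g. (2 powr r * japanese_bracket (k - l) powr r * japanese_bracket l powr r) * (norm (fhat f (k - l)) * norm (fhat g l)))"
    proof (intro sum_mono mult_right_mono)
      fix l
      define x y where "x = japanese_bracket (k - l)" and "y = japanese_bracket l"
      have xy: "1 \<le> x" "1 \<le> y" by (simp_all add: x_def y_def japanese_bracket_ge_1)
      have "0 \<le> x * (y - 1) + y * (x - 1)" using xy by simp
      then have "x + y \<le> 2 * x * y" by (simp add: algebra_simps)
      then have "japanese_bracket k powr r \<le> (2 * x * y) powr r"
        using japanese_bracket_add[of "k - l" l] r by (intro powr_mono2) (auto simp: x_def y_def)
      then show "japanese_bracket k powr r \<le> 2 powr r * japanese_bracket (k - l) powr r * japanese_bracket l powr r"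
        using xy by (simp add: powr_mult x_def y_def)
    qed auto
    finally show ?thesis by (simp add: mult_ac)
  qed
  then have "wiener_norm r ?h \<le> (\<Sum>k\<in>spectrum ?h. \<Sum>l\<in>spectrum g. 2 powr r * ?w f (k - l) * ?w g l)"
    unfolding wiener_norm_def by (rule sum_mono)
  also have "\<dots> = (\<Sum>l\<in>spectrum g. 2 powr r * (\<Sum>k\<in>spectrum ?h. ?w f (k - l)) * ?w g l)"
    by (subst sum.swap) (simp add: sum_distrib_left sum_distrib_right)
  also have "\<dots> \<le> (\<Sum>l\<in>spectrum g. 2 powr r * wiener_norm r f * ?w g l)"
  proof (intro sum_mono mult_right_mono mult_left_mono)
    fix l
    have "(\<Sum>k\<in>spectrum ?h. ?w f (k - l)) = (\<Sum>k\<in>(\<lambda>k. k - l) ` spectrum ?h. ?w f k)"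
      by (subst sum.reindex) (auto simp: inj_on_def)
    also have "\<dots> \<le> wiener_norm r f" by (rule wiener_norm_ge[OF f]) (use finh in auto)
    finally show "(\<Sum>k\<in>spectrum ?h. ?w f (k - l)) \<le> wiener_norm r f" .
  qed auto
  finally show ?thesis by (simp add: wiener_norm_def sum_distrib_left)
qed

section \<open>Fourier multipliers and the low-pass filter\<close>

definition fourier_multiplier :: "(int ^ 'd \<Rightarrow> complex) \<Rightarrow> (real ^ 'd \<Rightarrow> complex) \<Rightarrow> real ^ 'd \<Rightarrow> complex" where
  "fourier_multiplier m f x = (\<Sum>k\<in>spectrum f. m k * fhat f k * character k x)"

lemma fourier_multiplier_eq:
  assumes "trig_poly f" "finite F" "spectrum f \<subseteq> F"
  shows "fourier_multiplier m f x = (\<Sum>k\<in>F. m k * fhat f k * character k x)"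
  unfolding fourier_multiplier_def by (rule sum.mono_neutral_left) (use assms in auto)

lemma trig_poly_multiplier: "trig_poly f \<Longrightarrow> trig_poly (fourier_multiplier m f)"
  unfolding fourier_multiplier_def[abs_def] by (rule trig_polyI) (rule trig_poly_finite_spectrum)

lemma fhat_multiplier:
  assumes "trig_poly f" shows "fhat (fourier_multiplier m f) k = m k * fhat f k"
  unfolding fourier_multiplier_def[abs_def]
  by (subst fhat_character_sum) (auto simp: trig_poly_finite_spectrum[OF assms])

abbreviation cplx :: "('x \<Rightarrow> real) \<Rightarrow> 'x \<Rightarrow> complex" where
  "cplx g \<equiv> \<lambda>x. complex_of_real (g x)"

abbreviation cpt :: "('x \<Rightarrow> real ^ 'n) \<Rightarrow> 'n \<Rightarrow> 'x \<Rightarrow> complex" where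
  "cpt f i \<equiv> \<lambda>x. complex_of_real (f x $ i)"

lemma fhat_real_minus: "fhat (cplx g) (- k) = cnj (fhat (cplx g) k)"
  using fhat_cnj[of "cplx g" k] by simp

lemma of_real_Re_cnj: "cnj z = z \<Longrightarrow> complex_of_real (Re z) = z"
  by (simp add: complex_eq_iff)

text \<open>Multipliers with \<open>m (- k) = cnj (m k)\<close>, in particular derivatives and \<open>\<langle>D\<rangle>\<^sup>r\<close>, preserve real-valuedness; the
  symmetry \<open>k \<mapsto> - k\<close> of the spectrum is what is used.\<close>

lemma real_multiplier:
  assumes "trig_poly (cplx g)" "\<And>k. m (- k) = cnj (m k)"
  shows "fourier_multiplier m (cplx g) x = complex_of_real (Re (fourier_multiplier m (cplx g) x))"
proof -
  let ?F = "spectrum (cplx g)"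
  have img: "uminus ` ?F = ?F"
  proof -
    have sub: "uminus ` ?F \<subseteq> ?F" by (auto simp: fhat_real_minus)
    then have "uminus ` uminus ` ?F \<subseteq> uminus ` ?F" by (rule image_mono)
    then show ?thesis using sub by (simp add: image_image)
  qed
  have "cnj (fourier_multiplier m (cplx g) x) = (\<Sum>k\<in>?F. m (- k) * fhat (cplx g) (- k) * character (- k) x)"
    by (simp add: fourier_multiplier_def assms(2) fhat_real_minus character_minus)
  also have "\<dots> = (\<Sum>k\<in>uminus ` ?F. m k * fhat (cplx g) k * character k x)"
    by (subst sum.reindex) auto
  also have "\<dots> = fourier_multiplier m (cplx g) x"
    by (simp add: img fourier_multiplier_def)
  finally show ?thesis by (rule of_real_Re_cnj[symmetric])
qed

definition bandlimited :: "nat \<Rightarrow> (real ^ 'd \<Rightarrow> real ^ 'n) \<Rightarrow> bool" where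
  "bandlimited N f \<longleftrightarrow> (\<forall>i. trig_poly (cpt f i) \<and> spectrum (cpt f i) \<subseteq> freq_box N)"

lemma bandlimited_trig_poly: "bandlimited N f \<Longrightarrow> trig_poly (cpt f i)"
  by (simp add: bandlimited_def)

lemma bandlimited_spectrum: "bandlimited N f \<Longrightarrow> spectrum (cpt f i) \<subseteq> freq_box N"
  by (simp add: bandlimited_def)

lemma bandlimited_fhat_0: "bandlimited N f \<Longrightarrow> k \<notin> freq_box N \<Longrightarrow> fhat (cpt f i) k = 0"
  unfolding bandlimited_def by blast

lemma lowpass_complex:
  fixes f :: "real ^ 'd \<Rightarrow> real ^ 'n"
  shows "complex_of_real (lowpass N f x $ i) = (\<Sum>k\<in>freq_box N. fhat (cpt f i) k * character k x)"
proof -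
  let ?z = "\<Sum>k\<in>freq_box N. fhat (cpt f i) k * character k x"
  have img: "uminus ` (freq_box N :: (int ^ 'd) set) = freq_box N"
    by (metis (no_types, lifting) freq_box_minus image_eqI image_subset_iff minus_minus subsetI subset_antisym)
  have "cnj ?z = (\<Sum>k\<in>freq_box N. fhat (cpt f i) (- k) * character (- k) x)"
    by (simp add: fhat_real_minus character_minus)
  also have "\<dots> = (\<Sum>k\<in>uminus ` freq_box N. fhat (cpt f i) k * character k x)"
    by (subst sum.reindex) auto
  also have "\<dots> = ?z" by (simp only: img)
  finally have "complex_of_real (Re ?z) = ?z" by (rule of_real_Re_cnj)
  moreover have "lowpass N f x $ i = Re ?z"
    by (simp add: lowpass_def fourier_coeff_eq_fhat character_def freq_box_def)
  ultimately show ?thesis by simp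
qed

lemma fhat_lowpass: "fhat (cpt (lowpass N f) i) k = (if k \<in> freq_box N then fhat (cpt f i) k else 0)"
  unfolding lowpass_complex by (subst fhat_character_sum) auto

lemma bandlimited_lowpass: "bandlimited N (lowpass N f)"
  unfolding bandlimited_def fhat_lowpass by (auto simp: lowpass_complex intro: trig_polyI)

lemma bandlimited_eqI:
  assumes "bandlimited N f" "bandlimited N g" "\<And>i k. k \<in> freq_box N \<Longrightarrow> fhat (cpt f i) k = fhat (cpt g i) k"
  shows "f = g"
proof -
  have "cpt f i = cpt g i" for i
  proof (rule trig_poly_eqI)
    fix k show "fhat (cpt f i) k = fhat (cpt g i) k"
      using assms(3)[of k i] bandlimited_fhat_0[OF assms(1), of k i] bandlimited_fhat_0[OF assms(2), of k i]
      by (cases "k \<in> freq_box N") auto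
  qed (rule bandlimited_trig_poly[OF assms(1)] bandlimited_trig_poly[OF assms(2)])+
  then show ?thesis by (simp add: fun_eq_iff vec_eq_iff)
qed

lemma lowpass_bandlimited: "bandlimited N f \<Longrightarrow> lowpass N f = f"
  by (rule bandlimited_eqI[OF bandlimited_lowpass]) (auto simp: fhat_lowpass)

lemma bandlimited_diff:
  assumes "bandlimited N f" "bandlimited N g" shows "bandlimited N (\<lambda>x. f x - g x)"
proof -
  have "fhat (\<lambda>x. cpt f i x - cpt g i x) k = fhat (cpt f i) k - fhat (cpt g i) k" for i k
    by (intro fhat_diff trig_poly_continuous bandlimited_trig_poly[OF assms(1)] bandlimited_trig_poly[OF assms(2)])
  moreover have "trig_poly (\<lambda>x. cpt f i x - cpt g i x)" for i
    by (intro trig_poly_diff bandlimited_trig_poly[OF assms(1)] bandlimited_trig_poly[OF assms(2)])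
  ultimately show ?thesis
    using bandlimited_fhat_0[OF assms(1)] bandlimited_fhat_0[OF assms(2)]
    unfolding bandlimited_def by (auto intro: ccontr)
qed

lemma bandlimited_scaleR:
  assumes "bandlimited N f" shows "bandlimited N (\<lambda>x. c *\<^sub>R f x)"
  using assms unfolding bandlimited_def by (auto simp: fhat_cmult intro: trig_poly_cmult)

lemma continuous_cpt_imp:
  assumes "\<And>i. continuous_on A (cpt f i)" shows "continuous_on A f"
proof -
  have "continuous_on A (\<lambda>x. f x $ i)" for i
    using continuous_on_Re[OF assms[of i]] by simp
  then have "continuous_on A (\<lambda>x. \<chi> i. f x $ i)" by (rule continuous_on_vec_lambda)
  then show ?thesis by simp
qed

lemma bandlimited_continuous: "bandlimited N f \<Longrightarrow> continuous_on A f"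
  by (intro continuous_cpt_imp trig_poly_continuous) (rule bandlimited_trig_poly)

lemma has_derivative_vecI:
  fixes f :: "'a::real_normed_vector \<Rightarrow> real ^ 'n"
  assumes "\<And>i. ((\<lambda>x. f x $ i) has_derivative (\<lambda>h. f' h $ i)) F"
  shows "(f has_derivative f') F"
proof -
  have "((\<lambda>x. \<Sum>i\<in>UNIV. (f x $ i) *\<^sub>R axis i (1::real)) has_derivative (\<lambda>h. \<Sum>i\<in>UNIV. (f' h $ i) *\<^sub>R axis i 1)) F"
    by (auto intro!: derivative_eq_intros assms)
  moreover have "(\<Sum>i\<in>UNIV. (v $ i) *\<^sub>R axis i (1::real)) = v" for v :: "real ^ 'n"
    using basis_expansion[of v] by (simp add: scalar_mult_eq_scaleR)
  ultimately show ?thesis by simp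
qed

lemma has_vector_derivative_vecI:
  fixes f :: "real \<Rightarrow> real ^ 'n"
  assumes "\<And>i. ((\<lambda>x. f x $ i) has_real_derivative (D $ i)) F"
  shows "(f has_vector_derivative D) F"
  unfolding has_vector_derivative_def
  by (rule has_derivative_vecI) (use assms in \<open>simp add: has_field_derivative_def mult_commute_abs\<close>)

lemma freq_dot_shift: "freq_dot k (x + h *\<^sub>R axis j 1) = freq_dot k x + real_of_int (k $ j) * h"
proof -
  have "(\<Sum>i\<in>UNIV. real_of_int (k $ i) * axis j 1 $ i) = real_of_int (k $ j)"
    by (simp add: axis_def if_distrib cong: if_cong)
  then show ?thesis
    by (simp add: freq_dot_def distrib_left sum.distrib mult.left_commute[of _ h] sum_distrib_left[symmetric])
qed

lemma character_shift: "character k (x + h *\<^sub>R axis j 1) = character k x * cis (real_of_int (k $ j) * h)"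
  by (simp add: character_def freq_dot_shift cis_mult)

lemma partial_x_bandlimited:
  assumes "bandlimited N f"
  shows "cpt (partial_x j f) i = fourier_multiplier (\<lambda>k. \<i> * of_int (k $ j)) (cpt f i)"
proof
  fix x
  let ?m = "\<lambda>k::int^'a. \<i> * of_int (k $ j)"
  have tp: "trig_poly (cpt f i)" for i using assms by (rule bandlimited_trig_poly)
  define D where "D = (\<chi> i. Re (fourier_multiplier ?m (cpt f i) x))"
  have D: "complex_of_real (D $ i) = fourier_multiplier ?m (cpt f i) x" for i
    unfolding D_def by (subst real_multiplier[OF tp]) auto
  have "((\<lambda>h. f (x + h *\<^sub>R axis j 1) $ i) has_real_derivative D $ i) (at 0)" for i
  proof -
    have sub: "spectrum (cpt f i) \<subseteq> freq_box N" using assms by (rule bandlimited_spectrum)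
    have "((\<lambda>h::real. \<Sum>k\<in>freq_box N. fhat (cpt f i) k * (character k x * cis (real_of_int (k $ j) * h)))
        has_vector_derivative (\<Sum>k\<in>freq_box N. fhat (cpt f i) k * (character k x * ?m k))) (at 0)"
      unfolding cis_conv_exp
      by (auto intro!: derivative_eq_intros has_vector_derivative_real_field simp: sum_distrib_left mult_ac)
    also have "(\<lambda>h::real. \<Sum>k\<in>freq_box N. fhat (cpt f i) k * (character k x * cis (real_of_int (k $ j) * h)))
        = (\<lambda>h. cpt f i (x + h *\<^sub>R axis j 1))"
    proof
      fix h
      show "(\<Sum>k\<in>freq_box N. fhat (cpt f i) k * (character k x * cis (real_of_int (k $ j) * h)))
        = cpt f i (x + h *\<^sub>R axis j 1)"
        using trig_poly_expand[OF tp finite_freq_box sub, of "x + h *\<^sub>R axis j 1"]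
        by (simp add: character_shift)
    qed
    also have "(\<Sum>k\<in>freq_box N. fhat (cpt f i) k * (character k x * ?m k)) = fourier_multiplier ?m (cpt f i) x"
      by (simp add: fourier_multiplier_eq[OF tp finite_freq_box sub] mult_ac)
    finally have "((\<lambda>h. complex_of_real (f (x + h *\<^sub>R axis j 1) $ i)) has_vector_derivative complex_of_real (D $ i)) (at 0)"
      unfolding D .
    then have "((\<lambda>h. Re (complex_of_real (f (x + h *\<^sub>R axis j 1) $ i))) has_vector_derivative Re (complex_of_real (D $ i))) (at 0)"
      by (rule bounded_linear.has_vector_derivative[OF bounded_linear_Re])
    then show ?thesis by (simp add: has_real_derivative_iff_has_vector_derivative)
  qed
  then have "((\<lambda>h. f (x + h *\<^sub>R axis j 1)) has_vector_derivative D) (at 0)"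
    by (rule has_vector_derivative_vecI)
  then have "partial_x j f x = D" unfolding partial_x_def by (rule vector_derivative_at)
  then show "complex_of_real (partial_x j f x $ i) = fourier_multiplier ?m (cpt f i) x"
    by (simp add: D)
qed

lemma bandlimited_partial_x: "bandlimited N f \<Longrightarrow> bandlimited N (partial_x j f)"
  unfolding bandlimited_def[of N "partial_x j f"]
  by (auto simp: partial_x_bandlimited trig_poly_multiplier fhat_multiplier bandlimited_trig_poly
      dest: subsetD[OF bandlimited_spectrum])

lemma wiener_norm_partial_x:
  assumes "bandlimited N f" shows "wiener_norm 0 (cpt (partial_x j f) i) \<le> wiener_norm 1 (cpt f i)"
proof -
  have tp: "trig_poly (cpt f i)" using assms by (rule bandlimited_trig_poly)
  have "wiener_norm 0 (cpt (partial_x j f) i) = (\<Sum>k\<in>spectrum (cpt f i). \<bar>real_of_int (k $ j)\<bar> * norm (fhat (cpt f i) k))"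
    unfolding partial_x_bandlimited[OF assms]
    by (subst wiener_norm_eq[where F = "spectrum (cpt f i)"])
       (auto simp: trig_poly_multiplier tp fhat_multiplier trig_poly_finite_spectrum norm_mult)
  also have "\<dots> \<le> wiener_norm 1 (cpt f i)"
    unfolding wiener_norm_def
    by (intro sum_mono mult_right_mono) (auto simp: abs_component_le_japanese_bracket)
  finally show ?thesis .
qed

section \<open>The Sobolev norm of vector-valued trigonometric polynomials\<close>

lemma norm_fourier_coeff_sq: "(norm (fourier_coeff f k))\<^sup>2 = (\<Sum>i\<in>UNIV. (norm (fhat (cpt f i) k))\<^sup>2)"
  by (simp add: norm_vec_def L2_set_def sum_nonneg fourier_coeff_eq_fhat)

lemma powr_double: "0 \<le> x \<Longrightarrow> x powr (2 * r) = (x powr r)\<^sup>2" for x :: real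
  by (metis mult.commute powr_ge_zero powr_numeral powr_powr)

lemma bandlimited_periodic:
  assumes "bandlimited N f" shows "periodic f"
proof -
  have "character k (x + (2 * pi) *\<^sub>R axis j 1) = character k x" for k j and x :: "real ^ 'a"
  proof -
    have "cis (real_of_int (k $ j) * (2 * pi)) = 1"
      using cis_multiple_2pi[of "real_of_int (k $ j)"] by (simp add: mult_ac)
    then show ?thesis by (simp add: character_shift)
  qed
  then have "cpt f i (x + (2 * pi) *\<^sub>R axis j 1) = cpt f i x" for i j x
    using trig_poly_expand[OF bandlimited_trig_poly[OF assms, of i] finite_freq_box bandlimited_spectrum[OF assms], where x = x]
      trig_poly_expand[OF bandlimited_trig_poly[OF assms, of i] finite_freq_box bandlimited_spectrum[OF assms], where x = "x + (2 * pi) *\<^sub>R axis j 1"]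
    by simp
  then show ?thesis by (simp add: periodic_def vec_eq_iff)
qed

lemma bandlimited_torus_L2:
  assumes "bandlimited N (f :: real ^ 'd \<Rightarrow> real ^ 'n)" shows "f \<in> torus_L2"
proof -
  have c: "continuous_on A f" for A using assms by (rule bandlimited_continuous)
  have "(\<lambda>x. (norm (f x))\<^sup>2) absolutely_integrable_on torus_cell"
    unfolding torus_cell_def by (intro absolutely_integrable_continuous continuous_intros c)
  then show ?thesis
    using bandlimited_periodic[OF assms] borel_measurable_continuous_onI[OF c]
    by (simp add: torus_L2_def measurable_completion)
qed

lemma Hs_norm_bandlimited:
  assumes "bandlimited N f"
  shows "f \<in> Hs s" "Hs_norm s f = sqrt (\<Sum>i\<in>UNIV. (sobolev_norm s (cpt f i))\<^sup>2)"
proof -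
  let ?h = "\<lambda>k. japanese_bracket k powr (2 * s) * (norm (fourier_coeff f k))\<^sup>2"
  have z: "?h k = 0" if "k \<notin> freq_box N" for k
    using that bandlimited_fhat_0[OF assms] by (simp add: norm_fourier_coeff_sq)
  have "?h summable_on freq_box N" by simp
  then have "?h summable_on UNIV"
    by (rule summable_on_cong_neutral[THEN iffD1, rotated -1]) (use z in auto)
  then show "f \<in> Hs s" using bandlimited_torus_L2[OF assms] by (simp add: Hs_def)
  have "(\<Sum>\<^sub>\<infinity>k. ?h k) = (\<Sum>\<^sub>\<infinity>k\<in>freq_box N. ?h k)"
    by (rule infsum_cong_neutral) (use z in auto)
  also have "\<dots> = (\<Sum>k\<in>freq_box N. ?h k)" by simp
  also have "\<dots> = (\<Sum>i\<in>UNIV. \<Sum>k\<in>freq_box N. (japanese_bracket k powr s * norm (fhat (cpt f i) k))\<^sup>2)"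
    by (subst sum.swap) (simp add: norm_fourier_coeff_sq powr_double power_mult_distrib sum_distrib_left)
  also have "\<dots> = (\<Sum>i\<in>UNIV. (sobolev_norm s (cpt f i))\<^sup>2)"
    by (simp add: sobolev_norm_eq[OF bandlimited_trig_poly[OF assms] finite_freq_box bandlimited_spectrum[OF assms]]
        L2_set_def sum_nonneg)
  finally show "Hs_norm s f = sqrt (\<Sum>i\<in>UNIV. (sobolev_norm s (cpt f i))\<^sup>2)"
    by (simp add: Hs_norm_def)
qed

lemma sobolev_norm_le_Hs_norm:
  assumes "bandlimited N f" shows "sobolev_norm s (cpt f i) \<le> Hs_norm s f"
  unfolding Hs_norm_bandlimited(2)[OF assms]
  by (rule real_le_rsqrt) (rule member_le_sum, auto)

lemma Hs_norm_nonneg: "0 \<le> Hs_norm s f"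
  unfolding Hs_norm_def by (intro real_sqrt_ge_zero infsum_nonneg) auto

lemma Hs_norm_L2_set: "bandlimited N f \<Longrightarrow> Hs_norm s f = L2_set (\<lambda>i. sobolev_norm s (cpt f i)) UNIV"
  by (simp add: Hs_norm_bandlimited L2_set_def)

lemma Hs_norm_le_sum:
  assumes "bandlimited N f" shows "Hs_norm s f \<le> (\<Sum>i\<in>UNIV. sobolev_norm s (cpt f i))"
  unfolding Hs_norm_L2_set[OF assms] by (rule L2_set_le_sum) simp

text \<open>A trigonometric polynomial of degree \<open>N\<close> is controlled in every \<open>H\<^sup>s\<close> by its coefficients; the
  constant depends on \<open>N\<close>, so this serves for qualitative statements and for bounded \<open>N\<close>.\<close>

lemma Hs_norm_le_coefficients:
  assumes "bandlimited N (f :: real ^ 'd \<Rightarrow> real ^ 'n)"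
    and "\<And>i k. k \<in> freq_box N \<Longrightarrow> norm (fhat (cpt f i) k) \<le> B"
  shows "Hs_norm s f \<le> (real CARD('n) * (\<Sum>k\<in>(freq_box N :: (int ^ 'd) set). japanese_bracket k powr s)) * B"
proof -
  have "Hs_norm s f \<le> (\<Sum>i\<in>UNIV. sobolev_norm s (cpt f i))" by (rule Hs_norm_le_sum[OF assms(1)])
  also have "\<dots> \<le> (\<Sum>i\<in>(UNIV::'n set). \<Sum>k\<in>(freq_box N :: (int ^ 'd) set). japanese_bracket k powr s * B)"
  proof (rule sum_mono)
    fix i
    have "sobolev_norm s (cpt f i) \<le> (\<Sum>k\<in>freq_box N. japanese_bracket k powr s * norm (fhat (cpt f i) k))"
      unfolding sobolev_norm_eq[OF bandlimited_trig_poly[OF assms(1)] finite_freq_box bandlimited_spectrum[OF assms(1)]]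
      by (rule L2_set_le_sum) simp
    also have "\<dots> \<le> (\<Sum>k\<in>(freq_box N :: (int ^ 'd) set). japanese_bracket k powr s * B)"
      by (intro sum_mono mult_left_mono assms(2)) auto
    finally show "sobolev_norm s (cpt f i) \<le> (\<Sum>k\<in>(freq_box N :: (int ^ 'd) set). japanese_bracket k powr s * B)" .
  qed
  finally show ?thesis by (simp add: sum_distrib_left sum_distrib_right mult_ac)
qed

lemma Hs_norm_triangle_diff:
  assumes f: "bandlimited N f" and g: "bandlimited N g"
  shows "Hs_norm s f \<le> Hs_norm s g + Hs_norm s (\<lambda>x. f x - g x)"
proof -
  note d = bandlimited_diff[OF f g]
  have "sobolev_norm s (cpt f i) \<le> sobolev_norm s (cpt g i) + sobolev_norm s (cpt (\<lambda>x. f x - g x) i)" for i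
  proof -
    have "sobolev_norm s (\<lambda>x. cpt g i x + cpt (\<lambda>x. f x - g x) i x)
        \<le> sobolev_norm s (cpt g i) + sobolev_norm s (cpt (\<lambda>x. f x - g x) i)"
      by (rule sobolev_norm_add[OF bandlimited_trig_poly[OF g] bandlimited_trig_poly[OF d]])
    then show ?thesis by simp
  qed
  then have "Hs_norm s f \<le> L2_set (\<lambda>i. sobolev_norm s (cpt g i) + sobolev_norm s (cpt (\<lambda>x. f x - g x) i)) UNIV"
    unfolding Hs_norm_L2_set[OF f] by (intro L2_set_mono) auto
  also have "\<dots> \<le> Hs_norm s g + Hs_norm s (\<lambda>x. f x - g x)"
    unfolding Hs_norm_L2_set[OF g] Hs_norm_L2_set[OF d] by (rule L2_set_triangle_ineq)
  finally show ?thesis .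
qed

lemma Hs_partial_sum_le:
  assumes "f \<in> Hs s" "finite F"
  shows "(\<Sum>k\<in>F. japanese_bracket k powr (2 * s) * (norm (fourier_coeff f k))\<^sup>2) \<le> (Hs_norm s f)\<^sup>2"
proof -
  have "(\<Sum>k\<in>F. japanese_bracket k powr (2 * s) * (norm (fourier_coeff f k))\<^sup>2)
      \<le> (\<Sum>\<^sub>\<infinity>k. japanese_bracket k powr (2 * s) * (norm (fourier_coeff f k))\<^sup>2)"
    by (rule finite_sum_le_infsum) (use assms in \<open>auto simp: Hs_def\<close>)
  then show ?thesis by (simp add: Hs_norm_def infsum_nonneg)
qed

lemma Hs_L2_set_le:
  assumes "f \<in> Hs s" "finite F"
  shows "L2_set (\<lambda>k. japanese_bracket k powr s * norm (fhat (cpt f i) k)) F \<le> Hs_norm s f"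
proof -
  have "(\<Sum>k\<in>F. (japanese_bracket k powr s * norm (fhat (cpt f i) k))\<^sup>2)
      \<le> (\<Sum>k\<in>F. japanese_bracket k powr (2 * s) * (norm (fourier_coeff f k))\<^sup>2)"
    by (intro sum_mono) (auto simp: power_mult_distrib powr_double norm_fourier_coeff_sq
        intro!: mult_left_mono member_le_sum)
  also have "\<dots> \<le> (Hs_norm s f)\<^sup>2" by (rule Hs_partial_sum_le[OF assms])
  finally show ?thesis unfolding L2_set_def
    by (intro real_le_lsqrt) (auto simp: sum_nonneg Hs_norm_nonneg)
qed

lemma Hs_norm_lowpass_le:
  assumes "f \<in> Hs s" shows "Hs_norm s (lowpass N f) \<le> Hs_norm s f"
proof -
  have "(\<Sum>\<^sub>\<infinity>k. japanese_bracket k powr (2 * s) * (norm (fourier_coeff (lowpass N f) k))\<^sup>2)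
     = (\<Sum>\<^sub>\<infinity>k\<in>freq_box N. japanese_bracket k powr (2 * s) * (norm (fourier_coeff f k))\<^sup>2)"
    by (rule infsum_cong_neutral) (auto simp: norm_fourier_coeff_sq fhat_lowpass)
  also have "\<dots> \<le> (Hs_norm s f)\<^sup>2"
    using Hs_partial_sum_le[OF assms finite_freq_box] by simp
  finally show ?thesis
    unfolding Hs_norm_def[of s "lowpass N f"] by (intro real_le_lsqrt) (auto simp: infsum_nonneg Hs_norm_nonneg)
qed

section \<open>Composition with polynomials and commutators\<close>

lemma linear_functional_expand:
  fixes f :: "real ^ 'n \<Rightarrow> real"
  assumes "bounded_linear f"
  shows "f v = (\<Sum>i\<in>UNIV. f (axis i 1) * v $ i)"
proof -
  have "f v = f (\<Sum>i\<in>UNIV. (v $ i) *\<^sub>R axis i 1)"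
    using basis_expansion[of v] by (simp add: scalar_mult_eq_scaleR)
  also have "\<dots> = (\<Sum>i\<in>UNIV. f (axis i 1) * v $ i)"
    by (simp add: linear_sum[OF bounded_linear.linear[OF assms]] linear_cmul[OF bounded_linear.linear[OF assms]] mult.commute)
  finally show ?thesis .
qed

lemma wiener_norm_0_le_1: "wiener_norm 0 f \<le> wiener_norm 1 f"
  by (rule wiener_norm_mono) simp

lemma trig_poly_real_polynomial:
  fixes U :: "real ^ 'd \<Rightarrow> real ^ 'n"
  assumes "real_polynomial_function p" "\<And>i. trig_poly (cpt U i)"
  shows "trig_poly (\<lambda>x. complex_of_real (p (U x)))"
  using assms(1)
proof (induction p rule: real_polynomial_function.induct)
  case (linear f)
  have "f (U x) = (\<Sum>i\<in>UNIV. f (axis i 1) * U x $ i)" for x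
    by (rule linear_functional_expand[OF linear])
  then show ?case by (simp add: trig_poly_sum trig_poly_cmult assms(2))
qed (auto intro: trig_poly_const trig_poly_add trig_poly_mult)

text \<open>Moser-type bounds, by induction on the polynomial: a product is estimated with one factor in the strong norm and the
  others in the Wiener algebra, so the strong norm enters linearly. Subtracting \<open>p 0\<close> makes the bound small with \<open>U\<close>,
  from which the factor \<open>w\<close> in the energy estimate and in the end the lifespan of order \<open>1/m\<close> arise.\<close>

lemma polynomial_composition_bounds:
  fixes p :: "real ^ 'n \<Rightarrow> real"
  assumes p: "real_polynomial_function p" and r: "0 \<le> r" and R: "0 \<le> R"
  shows "\<exists>C\<ge>0. \<forall>(U :: real ^ 'd \<Rightarrow> real ^ 'n) w \<eta>.
     (\<forall>i. trig_poly (cpt U i) \<and> wiener_norm 1 (cpt U i) \<le> w \<and> sobolev_norm r (cpt U i) \<le> \<eta>) \<and> w \<le> R \<longrightarrow>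
     wiener_norm 1 (\<lambda>x. complex_of_real (p (U x) - p 0)) \<le> C * w \<and>
     sobolev_norm r (\<lambda>x. complex_of_real (p (U x) - p 0)) \<le> C * \<eta>"
    (is "\<exists>C\<ge>0. \<forall>U w \<eta>. ?H U w \<eta> \<longrightarrow> ?P p C U w \<eta>")
  using p
proof (induction p rule: real_polynomial_function.induct)
  case (linear f)
  let ?c = "\<lambda>i. f (axis i 1)"
  have f: "f v = (\<Sum>i\<in>UNIV. ?c i * v $ i)" for v
    by (rule linear_functional_expand[OF linear])
  have "?P f (\<Sum>i\<in>UNIV. \<bar>?c i\<bar>) U w \<eta>" if H: "?H U w \<eta>" for U :: "real ^ 'd \<Rightarrow> real ^ 'n" and w \<eta>
  proof -
    have e: "complex_of_real (f (U x) - f 0) = (\<Sum>i\<in>UNIV. complex_of_real (?c i) * cpt U i x)" for x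
      using f[of "U x"] f[of 0] by simp
    have tp: "trig_poly (\<lambda>x. complex_of_real (?c i) * cpt U i x)" for i
      using H by (intro trig_poly_cmult) auto
    have each: "wiener_norm 1 (\<lambda>x. complex_of_real (?c i) * cpt U i x) \<le> \<bar>?c i\<bar> * w"
      "sobolev_norm r (\<lambda>x. complex_of_real (?c i) * cpt U i x) \<le> \<bar>?c i\<bar> * \<eta>" for i
    proof -
      have i: "trig_poly (cpt U i)" "wiener_norm 1 (cpt U i) \<le> w" "sobolev_norm r (cpt U i) \<le> \<eta>"
        using H by blast+
      show "wiener_norm 1 (\<lambda>x. complex_of_real (?c i) * cpt U i x) \<le> \<bar>?c i\<bar> * w"
        unfolding wiener_norm_cmult[OF i(1)] norm_of_real by (rule mult_left_mono[OF i(2)]) simp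
      show "sobolev_norm r (\<lambda>x. complex_of_real (?c i) * cpt U i x) \<le> \<bar>?c i\<bar> * \<eta>"
        unfolding sobolev_norm_cmult[OF i(1)] norm_of_real by (rule mult_left_mono[OF i(3)]) simp
    qed
    have "wiener_norm 1 (\<lambda>x. complex_of_real (f (U x) - f 0)) \<le> (\<Sum>i\<in>UNIV. \<bar>?c i\<bar> * w)"
      unfolding e
      by (rule order_trans[OF wiener_norm_sum[OF tp] sum_mono]) (rule each)
    moreover have "sobolev_norm r (\<lambda>x. complex_of_real (f (U x) - f 0)) \<le> (\<Sum>i\<in>UNIV. \<bar>?c i\<bar> * \<eta>)"
      unfolding e
      by (rule order_trans[OF sobolev_norm_sum[OF tp] sum_mono]) (rule each)
    ultimately show ?thesis by (simp add: sum_distrib_right)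
  qed
  moreover have "0 \<le> (\<Sum>i\<in>UNIV. \<bar>?c i\<bar>)" by (simp add: sum_nonneg)
  ultimately show ?case by blast
next
  case (const c)
  show ?case by (rule exI[of _ 0]) simp
next
  case (add f g)
  then obtain C1 C2 where C: "C1 \<ge> 0" "C2 \<ge> 0"
    and C1: "\<And>U w \<eta>. ?H U w \<eta> \<Longrightarrow> ?P f C1 U w \<eta>" and C2: "\<And>U w \<eta>. ?H U w \<eta> \<Longrightarrow> ?P g C2 U w \<eta>"
    by blast
  have "?P (\<lambda>x. f x + g x) (C1 + C2) U w \<eta>" if H: "?H U w \<eta>" for U :: "real ^ 'd \<Rightarrow> real ^ 'n" and w \<eta>
  proof -
    have tpU: "trig_poly (cpt U i)" for i using H by blast
    have tf: "trig_poly (\<lambda>x. complex_of_real (f (U x) - f 0))" and tg: "trig_poly (\<lambda>x. complex_of_real (g (U x) - g 0))"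
      unfolding of_real_diff
      by (intro trig_poly_diff trig_poly_const
          trig_poly_real_polynomial[where p = f and U = U, OF add.hyps(1) tpU]
          trig_poly_real_polynomial[where p = g and U = U, OF add.hyps(2) tpU])+
    have e: "complex_of_real (f (U x) + g (U x) - (f 0 + g 0))
       = complex_of_real (f (U x) - f 0) + complex_of_real (g (U x) - g 0)" for x by simp
    show ?thesis
      unfolding e distrib_right
      by (intro conjI order_trans[OF wiener_norm_add[OF tf tg] add_mono] order_trans[OF sobolev_norm_add[OF tf tg] add_mono]
          conjunct1[OF C1[OF H]] conjunct1[OF C2[OF H]] conjunct2[OF C1[OF H]] conjunct2[OF C2[OF H]])
  qed
  moreover have "0 \<le> C1 + C2" using C by simp
  ultimately show ?case by blast
next
  case (mult f g)
  then obtain C1 C2 where C: "C1 \<ge> 0" "C2 \<ge> 0"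
    and C1: "\<And>U w \<eta>. ?H U w \<eta> \<Longrightarrow> ?P f C1 U w \<eta>" and C2: "\<And>U w \<eta>. ?H U w \<eta> \<Longrightarrow> ?P g C2 U w \<eta>"
    by blast
  define C3 where "C3 = (2 + 2 * 2 powr r) * C1 * C2 * R + \<bar>g 0\<bar> * C1 + \<bar>f 0\<bar> * C2"
  have "?P (\<lambda>x. f x * g x) C3 U w \<eta>" if H: "?H U w \<eta>" for U :: "real ^ 'd \<Rightarrow> real ^ 'n" and w \<eta>
  proof -
    define F G where "F x = complex_of_real (f (U x) - f 0)" and "G x = complex_of_real (g (U x) - g 0)" for x
    have tpU: "trig_poly (cpt U i)" for i using H by blast
    have tf: "trig_poly F" and tg: "trig_poly G"
      unfolding F_def G_def of_real_diff
      by (intro trig_poly_diff trig_poly_const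
          trig_poly_real_polynomial[where p = f and U = U, OF mult.hyps(1) tpU]
          trig_poly_real_polynomial[where p = g and U = U, OF mult.hyps(2) tpU])+
    have w: "0 \<le> w" "w \<le> R" and \<eta>: "0 \<le> \<eta>"
      using H wiener_norm_nonneg[of 1 "cpt U undefined"] sobolev_norm_nonneg[of r "cpt U undefined"] order_trans by blast+
    have e: "complex_of_real (f (U x) * g (U x) - f 0 * g 0)
       = (F x * G x + complex_of_real (g 0) * F x) + complex_of_real (f 0) * G x" for x
      by (simp add: F_def G_def algebra_simps)
    have t1: "trig_poly (\<lambda>x. F x * G x)" "trig_poly (\<lambda>x. complex_of_real (g 0) * F x)"
       "trig_poly (\<lambda>x. complex_of_real (f 0) * G x)" "trig_poly (\<lambda>x. F x * G x + complex_of_real (g 0) * F x)"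
      using tf tg by (auto intro: trig_poly_mult trig_poly_cmult trig_poly_add)
    have F: "wiener_norm 1 F \<le> C1 * w" "sobolev_norm r F \<le> C1 * \<eta>"
      and G: "wiener_norm 1 G \<le> C2 * w" "sobolev_norm r G \<le> C2 * \<eta>"
      unfolding F_def[abs_def] G_def[abs_def] using C1[OF H] C2[OF H] by blast+
    have FR: "wiener_norm 1 F \<le> C1 * R" and GR: "wiener_norm 1 G \<le> C2 * R"
      using F G C w by (auto intro: order_trans mult_left_mono)
    have F0: "wiener_norm 0 F \<le> C1 * R" and G0: "wiener_norm 0 G \<le> C2 * R"
      using FR GR wiener_norm_0_le_1 order_trans by blast+
    have "wiener_norm 1 (\<lambda>x. (F x * G x + complex_of_real (g 0) * F x) + complex_of_real (f 0) * G x)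
        \<le> wiener_norm 1 (\<lambda>x. F x * G x) + \<bar>g 0\<bar> * wiener_norm 1 F + \<bar>f 0\<bar> * wiener_norm 1 G"
      using wiener_norm_add[OF t1(4,3), of 1] wiener_norm_add[OF t1(1,2), of 1]
      by (simp add: wiener_norm_cmult tf tg)
    also have "\<dots> \<le> 2 * ((C1 * R) * (C2 * w)) + \<bar>g 0\<bar> * (C1 * w) + \<bar>f 0\<bar> * (C2 * w)"
    proof (intro add_mono mult_left_mono)
      have "wiener_norm 1 F * wiener_norm 1 G \<le> (C1 * R) * (C2 * w)"
        by (intro mult_mono FR G) (use C R in auto)
      then show "wiener_norm 1 (\<lambda>x. F x * G x) \<le> 2 * ((C1 * R) * (C2 * w))"
        using wiener_norm_mult[OF tf tg, of 1] by simp
    qed (use F G in auto)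
    also have "\<dots> = (2 * C1 * C2 * R + \<bar>g 0\<bar> * C1 + \<bar>f 0\<bar> * C2) * w"
      by (simp add: algebra_simps)
    also have "\<dots> \<le> C3 * w"
      unfolding C3_def by (intro mult_right_mono add_mono) (use C R w in auto)
    finally have 1: "wiener_norm 1 (\<lambda>x. (F x * G x + complex_of_real (g 0) * F x) + complex_of_real (f 0) * G x) \<le> C3 * w" .
    have "sobolev_norm r (\<lambda>x. (F x * G x + complex_of_real (g 0) * F x) + complex_of_real (f 0) * G x)
        \<le> sobolev_norm r (\<lambda>x. F x * G x) + \<bar>g 0\<bar> * sobolev_norm r F + \<bar>f 0\<bar> * sobolev_norm r G"
      using sobolev_norm_add[OF t1(4,3), of r] sobolev_norm_add[OF t1(1,2), of r]
      by (simp add: sobolev_norm_cmult tf tg)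
    also have "\<dots> \<le> 2 powr r * ((C1 * \<eta>) * (C2 * R) + (C1 * R) * (C2 * \<eta>)) + \<bar>g 0\<bar> * (C1 * \<eta>) + \<bar>f 0\<bar> * (C2 * \<eta>)"
    proof (intro add_mono mult_left_mono)
      have "sobolev_norm r F * wiener_norm 0 G + wiener_norm 0 F * sobolev_norm r G \<le> (C1 * \<eta>) * (C2 * R) + (C1 * R) * (C2 * \<eta>)"
        by (intro add_mono mult_mono F0 G0 F G) (use C R \<eta> in auto)
      then show "sobolev_norm r (\<lambda>x. F x * G x) \<le> 2 powr r * ((C1 * \<eta>) * (C2 * R) + (C1 * R) * (C2 * \<eta>))"
        by (intro order_trans[OF sobolev_norm_mult[OF tf tg r]] mult_left_mono) auto
    qed (use F G in auto)
    also have "\<dots> = (2 * 2 powr r * C1 * C2 * R + \<bar>g 0\<bar> * C1 + \<bar>f 0\<bar> * C2) * \<eta>"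
      by (simp add: algebra_simps)
    also have "\<dots> \<le> C3 * \<eta>"
      unfolding C3_def by (intro mult_right_mono add_mono) (use C R \<eta> in auto)
    finally show ?thesis using 1 unfolding e by simp
  qed
  moreover have "0 \<le> C3" using C R by (simp add: C3_def)
  ultimately show ?case by blast
qed

text \<open>The commutator of \<open>\<langle>D\<rangle>\<^sup>r\<close> with the operator \<open>v \<mapsto> a \<partial>\<^sub>j v\<close>, in the form
  \<open>\<langle>D\<rangle>\<^sup>r (a \<partial>\<^sub>j v) - \<partial>\<^sub>j (a \<langle>D\<rangle>\<^sup>r v)\<close>. With the
  derivative outside, the subtracted terms of all components add up to \<open>\<partial>\<^sub>j V\<close>, where \<open>V = S(u) \<langle>D\<rangle>\<^sup>r u\<close>.\<close>

definition commutator_coeff :: "real \<Rightarrow> 'd \<Rightarrow> (real ^ 'd \<Rightarrow> complex) \<Rightarrow> (real ^ 'd \<Rightarrow> complex) \<Rightarrow> int ^ 'd \<Rightarrow> complex" where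
  "commutator_coeff r j a v k =
     of_real (japanese_bracket k powr r) * fhat (\<lambda>x. a x * fourier_multiplier (\<lambda>k. \<i> * of_int (k $ j)) v x) k
     - \<i> * of_int (k $ j) * fhat (\<lambda>x. a x * fourier_multiplier (\<lambda>k. of_real (japanese_bracket k powr r)) v x) k"

text \<open>The symbol of the commutator vanishes on the diagonal, hence \<open>a\<close> may be replaced by \<open>a - c\<close> for any constant \<open>c\<close>.
  With \<open>a\<close> an entry of \<open>S(U)\<close> and \<open>c\<close> its value at \<open>0\<close>, the bound is then proportional to \<open>U\<close>.\<close>

lemma commutator_bound:
  fixes a v :: "real ^ 'd \<Rightarrow> complex"
  assumes a: "trig_poly a" and v: "trig_poly v" and r: "1 \<le> r" and F: "finite F"
  shows "L2_set (\<lambda>k. norm (commutator_coeff r j a v k)) F \<le>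
     (r * 2 powr r + 1) * (sobolev_norm r (\<lambda>x. a x - c) * wiener_norm 1 v + wiener_norm 1 (\<lambda>x. a x - c) * sobolev_norm r v)"
proof (rule bilinear_multiplier_bound[OF _ v F])
  show t: "trig_poly (\<lambda>x. a x - c)" by (intro trig_poly_diff a trig_poly_const)
  show "0 \<le> r * 2 powr r + 1" using r by simp
  fix k :: "int ^ 'd"
  let ?b = "\<lambda>x. a x - c"
  let ?m = "\<lambda>l. japanese_bracket k powr r * real_of_int (l $ j) - real_of_int (k $ j) * japanese_bracket l powr r"
  have fin: "finite (spectrum v)" by (rule trig_poly_finite_spectrum[OF v])
  have ab: "fhat ?b m = fhat a m" if "m \<noteq> 0" for m
  proof -
    have "fhat (\<lambda>x::real^'d. c) m = 0"
      using that fhat_cmult[of c "character 0" m] by (simp add: fhat_character)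
    then show ?thesis using fhat_diff[of a "\<lambda>x. c" m] trig_poly_continuous[OF a] by simp
  qed
  have sub: "spectrum (fourier_multiplier m v) \<subseteq> spectrum v" for m
    by (auto simp: fhat_multiplier[OF v])
  have "commutator_coeff r j a v k = (\<Sum>l\<in>spectrum v. \<i> * of_real (?m l) * (fhat a (k - l) * fhat v l))"
    unfolding commutator_coeff_def
    by (subst (1 2) fhat_mult[OF a trig_poly_multiplier[OF v] fin sub])
       (simp add: fhat_multiplier[OF v] sum_distrib_left sum_subtractf[symmetric] algebra_simps)
  also have "\<dots> = (\<Sum>l\<in>spectrum v. \<i> * of_real (?m l) * (fhat ?b (k - l) * fhat v l))"
  proof (rule sum.cong[OF refl])
    fix l
    show "\<i> * of_real (?m l) * (fhat a (k - l) * fhat v l) = \<i> * of_real (?m l) * (fhat ?b (k - l) * fhat v l)"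
      using ab[of "k - l"] by (cases "k = l") auto
  qed
  finally have "norm (commutator_coeff r j a v k) \<le> (\<Sum>l\<in>spectrum v. \<bar>?m l\<bar> * (norm (fhat ?b (k - l)) * norm (fhat v l)))"
    by (simp only:) (rule order_trans[OF norm_sum], simp only: norm_mult norm_ii norm_of_real mult_1 order_refl)
  also have "\<dots> \<le> (\<Sum>l\<in>spectrum v. (r * 2 powr r + 1) *
      (japanese_bracket (k - l) powr r * japanese_bracket l powr 1 + japanese_bracket (k - l) powr 1 * japanese_bracket l powr r)
      * (norm (fhat ?b (k - l)) * norm (fhat v l)))"
    by (intro sum_mono mult_right_mono commutator_symbol_bound r) auto
  finally show "\<bar>norm (commutator_coeff r j a v k)\<bar> \<le> (\<Sum>l\<in>spectrum v. (r * 2 powr r + 1) *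
      (japanese_bracket (k - l) powr r * japanese_bracket l powr 1 + japanese_bracket (k - l) powr 1 * japanese_bracket l powr r)
      * (norm (fhat ?b (k - l)) * norm (fhat v l)))"
    by simp
qed

section \<open>The energy identity\<close>

lemma Im_eq_0_cnj: "cnj z = z \<Longrightarrow> Im z = 0"
  by (simp add: complex_eq_iff)

lemma Re_imaginary_times: "Im z = 0 \<Longrightarrow> Re (\<i> * of_int m * z) = 0"
  by simp

text \<open>At a fixed time, with \<open>V = S(u) \<langle>D\<rangle>\<^sup>r u\<close>, the principal part \<open>\<langle>S\<^sub>j\<^sup>0 P\<^sub>N \<partial>\<^sub>j V, V\<rangle>\<close> of the pairing vanishes because
  \<open>S\<^sub>j\<^sup>0\<close> is symmetric and \<open>P\<^sub>N\<close>, an orthogonal projection commuting with \<open>\<partial>\<^sub>j\<close>, may be placed on both factors: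
  frequency by frequency, a real number is multiplied by \<open>i k\<^sub>j\<close>. Only commutators survive, with a bound
  independent of \<open>N\<close>.\<close>

lemma energy_pairing_bound:
  fixes S0 :: "'d::finite \<Rightarrow> real ^ 'n ^ 'n" and \<sigma> :: "'n \<Rightarrow> 'n \<Rightarrow> real ^ 'd \<Rightarrow> complex"
    and u :: "'n \<Rightarrow> real ^ 'd \<Rightarrow> complex"
  assumes S0: "\<And>j a c. S0 j $ a $ c = S0 j $ c $ a"
    and \<sigma>: "\<And>a b. trig_poly (\<sigma> a b)" and u: "\<And>b. trig_poly (u b)"
    and F: "finite F" and B: "finite B"
    and V: "\<And>a k. k \<in> B \<Longrightarrow> Vh a k = (\<Sum>b\<in>UNIV. fhat (\<lambda>x. \<sigma> a b x * fourier_multiplier (\<lambda>k. of_real (japanese_bracket k powr r)) (u b) x) k)"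
    and w: "\<And>a k. k \<in> B \<Longrightarrow> wh a k = - (\<Sum>j\<in>UNIV. \<Sum>c\<in>UNIV. \<Sum>b\<in>UNIV. of_real (S0 j $ a $ c) *
              fhat (\<lambda>x. \<sigma> c b x * fourier_multiplier (\<lambda>k. \<i> * of_int (k $ j)) (u b) x) k)"
    and K: "\<And>j c b. L2_set (\<lambda>k. norm (commutator_coeff r j (\<sigma> c b) (u b) k)) B \<le> K" "0 \<le> K"
    and L: "\<And>a. L2_set (\<lambda>k. norm (Vh a k)) B \<le> L"
  shows "\<bar>Re (\<Sum>a\<in>UNIV. \<Sum>k\<in>B. of_real (japanese_bracket k powr r) * wh a k * cnj (Vh a k))\<bar>
     \<le> (\<Sum>a\<in>UNIV. \<Sum>j\<in>UNIV. \<Sum>c\<in>UNIV. \<bar>S0 j $ a $ c\<bar>) * real CARD('n) * K * L"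
proof -
  let ?c = "\<lambda>j c b k. commutator_coeff r j (\<sigma> c b) (u b) k"
  let ?q = "\<lambda>j k. \<Sum>a\<in>UNIV. \<Sum>c\<in>UNIV. of_real (S0 j $ a $ c) * Vh c k * cnj (Vh a k)"
  define P where "P = (\<Sum>k\<in>B. \<Sum>j\<in>UNIV. \<i> * of_int (k $ j) * ?q j k)"
  define Q where "Q = (\<Sum>a\<in>UNIV. \<Sum>j\<in>UNIV. \<Sum>c\<in>UNIV. \<Sum>b\<in>UNIV. of_real (S0 j $ a $ c) * (\<Sum>k\<in>B. ?c j c b k * cnj (Vh a k)))"
  have wk: "of_real (japanese_bracket k powr r) * wh a k
      = - (\<Sum>j\<in>UNIV. \<Sum>c\<in>UNIV. of_real (S0 j $ a $ c) * (\<i> * of_int (k $ j) * Vh c k))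
        - (\<Sum>j\<in>UNIV. \<Sum>c\<in>UNIV. \<Sum>b\<in>UNIV. of_real (S0 j $ a $ c) * ?c j c b k)" if "k \<in> B" for a k
  proof -
    have "of_real (japanese_bracket k powr r) * wh a k
       = - (\<Sum>j\<in>UNIV. \<Sum>c\<in>UNIV. \<Sum>b\<in>UNIV. of_real (S0 j $ a $ c) *
            (of_real (japanese_bracket k powr r) * fhat (\<lambda>x. \<sigma> c b x * fourier_multiplier (\<lambda>k. \<i> * of_int (k $ j)) (u b) x) k))"
      by (simp add: w[OF that] sum_distrib_left mult_ac)
    also have "\<dots> = - (\<Sum>j\<in>UNIV. \<Sum>c\<in>UNIV. \<Sum>b\<in>UNIV. of_real (S0 j $ a $ c) *
            (\<i> * of_int (k $ j) * fhat (\<lambda>x. \<sigma> c b x * fourier_multiplier (\<lambda>k. of_real (japanese_bracket k powr r)) (u b) x) k + ?c j c b k))"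
      by (simp add: commutator_coeff_def)
    also have "\<dots> = - (\<Sum>j\<in>UNIV. \<Sum>c\<in>UNIV. of_real (S0 j $ a $ c) * (\<i> * of_int (k $ j) * Vh c k))
        - (\<Sum>j\<in>UNIV. \<Sum>c\<in>UNIV. \<Sum>b\<in>UNIV. of_real (S0 j $ a $ c) * ?c j c b k)"
      by (simp add: V[OF that] sum_distrib_left distrib_left sum.distrib mult_ac)
    finally show ?thesis .
  qed
  have "(\<Sum>a\<in>UNIV. \<Sum>k\<in>B. of_real (japanese_bracket k powr r) * wh a k * cnj (Vh a k))
     = - (\<Sum>a\<in>UNIV. \<Sum>k\<in>B. \<Sum>j\<in>UNIV. \<Sum>c\<in>UNIV. \<i> * of_int (k $ j) * (of_real (S0 j $ a $ c) * Vh c k * cnj (Vh a k)))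
       - (\<Sum>a\<in>UNIV. \<Sum>k\<in>B. \<Sum>j\<in>UNIV. \<Sum>c\<in>UNIV. \<Sum>b\<in>UNIV. of_real (S0 j $ a $ c) * (?c j c b k * cnj (Vh a k)))"
    unfolding sum_negf[symmetric] sum_subtractf[symmetric]
  proof (intro sum.cong refl)
    fix a k assume k: "k \<in> B"
    show "of_real (japanese_bracket k powr r) * wh a k * cnj (Vh a k)
      = (\<Sum>j\<in>UNIV. \<Sum>c\<in>UNIV. - (\<i> * of_int (k $ j) * (of_real (S0 j $ a $ c) * Vh c k * cnj (Vh a k)))
          - (\<Sum>b\<in>UNIV. of_real (S0 j $ a $ c) * (?c j c b k * cnj (Vh a k))))"
      unfolding wk[OF k]
      by (simp add: left_diff_distrib right_diff_distrib sum_subtractf sum_distrib_left sum_distrib_right sum_negf mult_ac)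
  qed
  also have "(\<Sum>a\<in>UNIV. \<Sum>k\<in>B. \<Sum>j\<in>UNIV. \<Sum>c\<in>UNIV. \<i> * of_int (k $ j) * (of_real (S0 j $ a $ c) * Vh c k * cnj (Vh a k))) = P"
  proof -
    have "P = (\<Sum>k\<in>B. \<Sum>j\<in>UNIV. \<Sum>a\<in>UNIV. \<Sum>c\<in>UNIV. \<i> * of_int (k $ j) * (of_real (S0 j $ a $ c) * Vh c k * cnj (Vh a k)))"
      by (simp add: P_def sum_distrib_left)
    also have "\<dots> = (\<Sum>k\<in>B. \<Sum>a\<in>UNIV. \<Sum>j\<in>UNIV. \<Sum>c\<in>UNIV. \<i> * of_int (k $ j) * (of_real (S0 j $ a $ c) * Vh c k * cnj (Vh a k)))"
      by (intro sum.cong refl) (rule sum.swap)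
    also have "\<dots> = (\<Sum>a\<in>UNIV. \<Sum>k\<in>B. \<Sum>j\<in>UNIV. \<Sum>c\<in>UNIV. \<i> * of_int (k $ j) * (of_real (S0 j $ a $ c) * Vh c k * cnj (Vh a k)))"
      by (rule sum.swap)
    finally show ?thesis by simp
  qed
  also have "(\<Sum>a\<in>UNIV. \<Sum>k\<in>B. \<Sum>j\<in>UNIV. \<Sum>c\<in>UNIV. \<Sum>b\<in>UNIV. of_real (S0 j $ a $ c) * (?c j c b k * cnj (Vh a k))) = Q"
  proof -
    have "Q = (\<Sum>a\<in>UNIV. \<Sum>j\<in>UNIV. \<Sum>c\<in>UNIV. \<Sum>b\<in>UNIV. \<Sum>k\<in>B. of_real (S0 j $ a $ c) * (?c j c b k * cnj (Vh a k)))"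
      by (simp add: Q_def sum_distrib_left)
    also have "\<dots> = (\<Sum>a\<in>UNIV. \<Sum>j\<in>UNIV. \<Sum>c\<in>UNIV. \<Sum>k\<in>B. \<Sum>b\<in>UNIV. of_real (S0 j $ a $ c) * (?c j c b k * cnj (Vh a k)))"
      by (intro sum.cong refl) (rule sum.swap)
    also have "\<dots> = (\<Sum>a\<in>UNIV. \<Sum>j\<in>UNIV. \<Sum>k\<in>B. \<Sum>c\<in>UNIV. \<Sum>b\<in>UNIV. of_real (S0 j $ a $ c) * (?c j c b k * cnj (Vh a k)))"
      by (intro sum.cong refl) (rule sum.swap)
    also have "\<dots> = (\<Sum>a\<in>UNIV. \<Sum>k\<in>B. \<Sum>j\<in>UNIV. \<Sum>c\<in>UNIV. \<Sum>b\<in>UNIV. of_real (S0 j $ a $ c) * (?c j c b k * cnj (Vh a k)))"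
      by (intro sum.cong refl) (rule sum.swap)
    finally show ?thesis by simp
  qed
  finally have split: "(\<Sum>a\<in>UNIV. \<Sum>k\<in>B. of_real (japanese_bracket k powr r) * wh a k * cnj (Vh a k)) = - P - Q" .
  have "Re P = 0"
  proof -
    have "Im (?q j k) = 0" for j k
    proof -
      have "cnj (?q j k) = (\<Sum>a\<in>UNIV. \<Sum>c\<in>UNIV. of_real (S0 j $ c $ a) * Vh a k * cnj (Vh c k))"
        by (simp add: S0[of j] mult_ac)
      also have "\<dots> = ?q j k" by (rule sum.swap)
      finally show ?thesis by (rule Im_eq_0_cnj)
    qed
    then have "Re (\<i> * of_int (k $ j) * ?q j k) = 0" for j k by (intro Re_imaginary_times) auto
    then show ?thesis unfolding P_def Re_sum by (intro sum.neutral ballI) auto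
  qed
  moreover have "norm Q \<le> (\<Sum>a\<in>UNIV. \<Sum>j\<in>UNIV. \<Sum>c\<in>UNIV. \<bar>S0 j $ a $ c\<bar>) * real CARD('n) * K * L"
  proof -
    have pair: "norm (\<Sum>k\<in>B. ?c j c b k * cnj (Vh a k)) \<le> K * L" for a j c b
    proof -
      have "norm (\<Sum>k\<in>B. ?c j c b k * cnj (Vh a k)) \<le> (\<Sum>k\<in>B. \<bar>norm (?c j c b k)\<bar> * \<bar>norm (Vh a k)\<bar>)"
        by (rule order_trans[OF norm_sum]) (simp add: norm_mult)
      also have "\<dots> \<le> L2_set (\<lambda>k. norm (?c j c b k)) B * L2_set (\<lambda>k. norm (Vh a k)) B"
        by (rule L2_set_mult_ineq)
      also have "\<dots> \<le> K * L" by (intro mult_mono K L) simp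
      finally show ?thesis .
    qed
    have "norm Q \<le> (\<Sum>a\<in>UNIV. \<Sum>j\<in>UNIV. \<Sum>c\<in>UNIV. \<Sum>b\<in>(UNIV::'n set). \<bar>S0 j $ a $ c\<bar> * (K * L))"
      unfolding Q_def
      by (intro order_trans[OF norm_sum] sum_mono) (auto simp: norm_mult intro!: mult_left_mono pair)
    then show ?thesis by (simp add: sum_distrib_left sum_distrib_right mult_ac)
  qed
  moreover have "\<bar>Re Q\<bar> \<le> norm Q" by (rule abs_Re_le_cmod)
  ultimately show ?thesis unfolding split by simp
qed

lemma polynomial_wiener_bound:
  fixes p :: "real ^ 'n \<Rightarrow> real"
  assumes p: "real_polynomial_function p" and R: "0 \<le> R"
  shows "\<exists>C\<ge>0. \<forall>U :: real ^ 'd \<Rightarrow> real ^ 'n.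
     (\<forall>i. trig_poly (cpt U i) \<and> wiener_norm 1 (cpt U i) \<le> R) \<longrightarrow> wiener_norm 0 (\<lambda>x. complex_of_real (p (U x))) \<le> C"
proof -
  obtain C where C: "C \<ge> 0" and bd: "\<And>(U :: real ^ 'd \<Rightarrow> real ^ 'n) w \<eta>.
     (\<forall>i. trig_poly (cpt U i) \<and> wiener_norm 1 (cpt U i) \<le> w \<and> sobolev_norm 0 (cpt U i) \<le> \<eta>) \<and> w \<le> R \<Longrightarrow>
     wiener_norm 1 (\<lambda>x. complex_of_real (p (U x) - p 0)) \<le> C * w"
    using polynomial_composition_bounds[where 'd = 'd, OF p order_refl R] by blast
  have "wiener_norm 0 (\<lambda>x. complex_of_real (p (U x))) \<le> C * R + \<bar>p 0\<bar>"
    if U: "\<forall>i. trig_poly (cpt U i) \<and> wiener_norm 1 (cpt U i) \<le> R" for U :: "real ^ 'd \<Rightarrow> real ^ 'n"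
  proof -
    have sob: "sobolev_norm 0 (cpt U i) \<le> (\<Sum>i\<in>UNIV. sobolev_norm 0 (cpt U i))" for i
      by (rule member_le_sum) auto
    have tpU: "trig_poly (cpt U i)" for i using U by blast
    have tp: "trig_poly (\<lambda>x. complex_of_real (p (U x) - p 0))"
      unfolding of_real_diff
      by (intro trig_poly_diff trig_poly_const trig_poly_real_polynomial[where p = p and U = U, OF p tpU])
    have c: "wiener_norm 0 (\<lambda>x::real^'d. complex_of_real (p 0)) \<le> \<bar>p 0\<bar>"
    proof -
      have f: "fhat (\<lambda>x::real^'d. complex_of_real (p 0)) m = (if m = 0 then complex_of_real (p 0) else 0)" for m
        using fhat_cmult[of "complex_of_real (p 0)" "character 0" m] by (simp add: fhat_character)
      show ?thesis
        by (subst wiener_norm_eq[where F = "{0}"]) (auto simp: f trig_poly_const split: if_splits)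
    qed
    have "wiener_norm 0 (\<lambda>x. complex_of_real (p (U x))) = wiener_norm 0 (\<lambda>x. complex_of_real (p (U x) - p 0) + complex_of_real (p 0))"
      by simp
    also have "\<dots> \<le> wiener_norm 0 (\<lambda>x. complex_of_real (p (U x) - p 0)) + wiener_norm 0 (\<lambda>x::real^'d. complex_of_real (p 0))"
      by (rule wiener_norm_add[OF tp trig_poly_const])
    also have "\<dots> \<le> C * R + \<bar>p 0\<bar>"
      using bd[of U R "\<Sum>i\<in>UNIV. sobolev_norm 0 (cpt U i)"] U sob c
        wiener_norm_0_le_1[of "\<lambda>x. complex_of_real (p (U x) - p 0)"] by fastforce
    finally show ?thesis .
  qed
  then show ?thesis using C R by (intro exI[of _ "C * R + \<bar>p 0\<bar>"]) auto
qed

lemma polynomial_gradient: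
  fixes p :: "real ^ 'n \<Rightarrow> real"
  assumes "real_polynomial_function p"
  shows "\<exists>dp. (\<forall>i. real_polynomial_function (dp i)) \<and> (\<forall>x. (p has_derivative (\<lambda>h. \<Sum>i\<in>UNIV. dp i x * h $ i)) (at x))"
  using assms
proof (induction p rule: real_polynomial_function.induct)
  case (linear f)
  have "(\<lambda>h. \<Sum>i\<in>UNIV. f (axis i 1) * h $ i) = f"
    by (rule ext) (rule linear_functional_expand[OF linear, symmetric])
  then have "\<forall>x. (f has_derivative (\<lambda>h. \<Sum>i\<in>UNIV. f (axis i 1) * h $ i)) (at x)"
    using bounded_linear_imp_has_derivative[OF linear] by simp
  then show ?case
    by (intro exI[of _ "\<lambda>i x. f (axis i 1)"] conjI allI real_polynomial_function.intros(2)) blast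
next
  case (const c)
  show ?case by (intro exI[of _ "\<lambda>i x. 0"]) auto
next
  case (add f g)
  then obtain df dg where d: "\<And>i. real_polynomial_function (df i)" "\<And>i. real_polynomial_function (dg i)"
    "\<And>x. (f has_derivative (\<lambda>h. \<Sum>i\<in>UNIV. df i x * h $ i)) (at x)"
    "\<And>x. (g has_derivative (\<lambda>h. \<Sum>i\<in>UNIV. dg i x * h $ i)) (at x)" by blast
  show ?case
  proof (intro exI[of _ "\<lambda>i x. df i x + dg i x"] conjI allI)
    fix x
    show "((\<lambda>x. f x + g x) has_derivative (\<lambda>h. \<Sum>i\<in>UNIV. (df i x + dg i x) * h $ i)) (at x)"
      using has_derivative_add[OF d(3,4)] by (simp add: distrib_right sum.distrib)
  qed (use d in auto)
next
  case (mult f g)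
  then obtain df dg where d: "\<And>i. real_polynomial_function (df i)" "\<And>i. real_polynomial_function (dg i)"
    "\<And>x. (f has_derivative (\<lambda>h. \<Sum>i\<in>UNIV. df i x * h $ i)) (at x)"
    "\<And>x. (g has_derivative (\<lambda>h. \<Sum>i\<in>UNIV. dg i x * h $ i)) (at x)" by blast
  show ?case
  proof (intro exI[of _ "\<lambda>i x. f x * dg i x + df i x * g x"] conjI allI)
    fix x
    have "(\<lambda>h. f x * (\<Sum>i\<in>UNIV. dg i x * h $ i) + (\<Sum>i\<in>UNIV. df i x * h $ i) * g x)
        = (\<lambda>h. \<Sum>i\<in>UNIV. (f x * dg i x + df i x * g x) * h $ i)"
      unfolding sum_distrib_left sum_distrib_right sum.distrib[symmetric] distrib_right
      by (intro ext sum.cong refl) (simp add: mult_ac)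
    then show "((\<lambda>x. f x * g x) has_derivative (\<lambda>h. \<Sum>i\<in>UNIV. (f x * dg i x + df i x * g x) * h $ i)) (at x)"
      using has_derivative_mult[OF d(3)[of x] d(4)[of x]] by (simp only:)
  qed (intro real_polynomial_function.intros(3,4) d mult.hyps)
qed

lemma continuous_on_real_polynomial:
  "real_polynomial_function p \<Longrightarrow> continuous_on A f \<Longrightarrow> continuous_on A (\<lambda>x. p (f x))"
  using continuous_on_compose2[OF continuous_on_polymonial_function[of p UNIV]]
  by (simp add: real_polynomial_function_eq)

section \<open>The right-hand side of the filtered system\<close>

definition filtered_rhs :: "('d \<Rightarrow> real ^ 'n \<Rightarrow> real ^ 'n ^ 'n) \<Rightarrow> nat \<Rightarrow> (real ^ 'd \<Rightarrow> real ^ 'n) \<Rightarrow> real ^ 'd \<Rightarrow> real ^ 'n" where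
  "filtered_rhs A N f x = - lowpass N (\<lambda>y. \<Sum>j\<in>UNIV. A j (f y) *v partial_x j f y) x"

lemma bandlimited_uminus: "bandlimited N f \<Longrightarrow> bandlimited N (\<lambda>x. - f x)"
  using bandlimited_scaleR[of N f "-1"] by simp

lemma bandlimited_filtered_rhs: "bandlimited N (filtered_rhs A N f)"
  unfolding filtered_rhs_def[abs_def] by (intro bandlimited_uminus bandlimited_lowpass)

lemma fhat_uminus: "fhat (\<lambda>x. - f x) k = - fhat f k"
  using fhat_cmult[of "-1" f k] by simp

lemma wiener_norm_lowpass:
  assumes "trig_poly (cpt f i)"
  shows "wiener_norm r (cpt (lowpass N f) i) \<le> wiener_norm r (cpt f i)"
proof -
  have "wiener_norm r (cpt (lowpass N f) i) = (\<Sum>k\<in>freq_box N. japanese_bracket k powr r * norm (fhat (cpt f i) k))"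
    by (subst wiener_norm_eq[OF bandlimited_trig_poly[OF bandlimited_lowpass] finite_freq_box bandlimited_spectrum[OF bandlimited_lowpass]])
       (simp add: fhat_lowpass)
  also have "\<dots> \<le> wiener_norm r (cpt f i)" by (rule wiener_norm_ge[OF assms]) simp
  finally show ?thesis .
qed

lemma flux_component:
  "cpt (\<lambda>y. \<Sum>j\<in>UNIV. A j (f y) *v partial_x j f y) a =
    (\<lambda>y. \<Sum>j\<in>UNIV. \<Sum>b\<in>UNIV. complex_of_real (A j (f y) $ a $ b) * cpt (partial_x j f) b y)"
  by (simp add: matrix_vector_mult_def)

text \<open>The constant does not depend on \<open>N\<close>, because the filter only discards terms of the sum that defines a Wiener norm. In
  \<open>L\<^sup>\<infinity>\<close> the norm of the filter would be unbounded in \<open>N\<close>.\<close>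

lemma filtered_rhs_wiener_bound:
  fixes A :: "'d::finite \<Rightarrow> real ^ 'n \<Rightarrow> real ^ 'n ^ 'n"
  assumes A: "\<And>j a b. real_polynomial_function (\<lambda>U. A j U $ a $ b)" and R: "0 \<le> R"
  shows "\<exists>C>0. \<forall>N U w. bandlimited N U \<and> (\<forall>i. wiener_norm 1 (cpt U i) \<le> w) \<and> w \<le> R \<longrightarrow>
     (\<forall>a. wiener_norm 0 (cpt (filtered_rhs A N U) a) \<le> C * w)"
proof -
  have "\<forall>j a b. \<exists>C\<ge>0. \<forall>U :: real ^ 'd \<Rightarrow> real ^ 'n.
     (\<forall>i. trig_poly (cpt U i) \<and> wiener_norm 1 (cpt U i) \<le> R) \<longrightarrow> wiener_norm 0 (\<lambda>x. complex_of_real (A j (U x) $ a $ b)) \<le> C"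
    using polynomial_wiener_bound[OF A R] by blast
  then obtain c where c0: "\<And>j a b. c j a b \<ge> 0" and c: "\<And>j a b (U :: real ^ 'd \<Rightarrow> real ^ 'n).
     (\<forall>i. trig_poly (cpt U i) \<and> wiener_norm 1 (cpt U i) \<le> R) \<Longrightarrow> wiener_norm 0 (\<lambda>x. complex_of_real (A j (U x) $ a $ b)) \<le> c j a b"
    by metis
  define C where "C = 1 + (\<Sum>a\<in>UNIV. \<Sum>j\<in>UNIV. \<Sum>b\<in>UNIV. c j a b)"
  have Cpos: "C > 0" using c0 by (auto simp: C_def intro!: add_pos_nonneg sum_nonneg)
  have "wiener_norm 0 (cpt (filtered_rhs A N U) a) \<le> C * w"
    if U: "bandlimited N U" and w: "\<forall>i. wiener_norm 1 (cpt U i) \<le> w" and wR: "w \<le> R" for N U w a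
  proof -
    have tpU: "trig_poly (cpt U i)" for i using U by (rule bandlimited_trig_poly)
    have w0: "0 \<le> w" using w wiener_norm_nonneg order_trans by blast
    have wR': "\<forall>i. trig_poly (cpt U i) \<and> wiener_norm 1 (cpt U i) \<le> R" using tpU w wR order_trans by blast
    have tpA: "trig_poly (\<lambda>y. complex_of_real (A j (U y) $ a $ b))" for j a b
      by (rule trig_poly_real_polynomial[where p = "\<lambda>U. A j U $ a $ b" and U = U, OF A tpU])
    have tpd: "trig_poly (cpt (partial_x j U) b)" for j b
      by (rule bandlimited_trig_poly[OF bandlimited_partial_x[OF U]])
    have tpm: "trig_poly (\<lambda>y. complex_of_real (A j (U y) $ a $ b) * cpt (partial_x j U) b y)" for j a b
      by (rule trig_poly_mult[OF tpA tpd])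
    let ?F = "\<lambda>y. \<Sum>j\<in>UNIV. A j (U y) *v partial_x j U y"
    have tpF: "trig_poly (cpt ?F a)"
      unfolding flux_component by (intro trig_poly_sum tpm)
    have "wiener_norm 0 (cpt (filtered_rhs A N U) a) = wiener_norm 0 (\<lambda>x. -1 * cpt (lowpass N ?F) a x)"
      by (simp add: filtered_rhs_def)
    also have "\<dots> = wiener_norm 0 (cpt (lowpass N ?F) a)"
      by (subst wiener_norm_cmult[OF bandlimited_trig_poly[OF bandlimited_lowpass]]) simp
    also have "\<dots> \<le> wiener_norm 0 (cpt ?F a)" by (rule wiener_norm_lowpass[OF tpF])
    also have "\<dots> \<le> (\<Sum>j\<in>UNIV. wiener_norm 0 (\<lambda>y. \<Sum>b\<in>UNIV. complex_of_real (A j (U y) $ a $ b) * cpt (partial_x j U) b y))"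
      unfolding flux_component by (intro wiener_norm_sum trig_poly_sum tpm)
    also have "\<dots> \<le> (\<Sum>j\<in>UNIV. \<Sum>b\<in>UNIV. wiener_norm 0 (\<lambda>y. complex_of_real (A j (U y) $ a $ b) * cpt (partial_x j U) b y))"
      by (intro sum_mono wiener_norm_sum tpm)
    also have "\<dots> \<le> (\<Sum>j\<in>UNIV. \<Sum>b\<in>UNIV. c j a b * w)"
    proof (intro sum_mono)
      fix j b
      have "wiener_norm 0 (\<lambda>y. complex_of_real (A j (U y) $ a $ b) * cpt (partial_x j U) b y)
         \<le> wiener_norm 0 (\<lambda>y. complex_of_real (A j (U y) $ a $ b)) * wiener_norm 0 (cpt (partial_x j U) b)"
        using wiener_norm_mult[OF tpA tpd, of 0 j a b j b] by simp
      also have "\<dots> \<le> c j a b * w"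
        by (intro mult_mono c wR' order_trans[OF wiener_norm_partial_x[OF U]] w[rule_format] c0 wiener_norm_nonneg)
      finally show "wiener_norm 0 (\<lambda>y. complex_of_real (A j (U y) $ a $ b) * cpt (partial_x j U) b y) \<le> c j a b * w" .
    qed
    also have "\<dots> = (\<Sum>j\<in>UNIV. \<Sum>b\<in>UNIV. c j a b) * w" by (simp add: sum_distrib_right)
    also have "\<dots> \<le> C * w"
    proof (rule mult_right_mono[OF _ w0])
      have "(\<Sum>j\<in>UNIV. \<Sum>b\<in>UNIV. c j a b) \<le> (\<Sum>a\<in>UNIV. \<Sum>j\<in>UNIV. \<Sum>b\<in>UNIV. c j a b)"
        by (rule member_le_sum) (auto intro!: sum_nonneg c0)
      then show "(\<Sum>j\<in>UNIV. \<Sum>b\<in>UNIV. c j a b) \<le> C" by (simp add: C_def)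
    qed
    finally show ?thesis .
  qed
  then show ?thesis using Cpos by blast
qed

section \<open>Structure of classical solutions\<close>

lemma classical_solution_time_derivative:
  assumes "classical_solution A N s U0 I u"
  obtains ut where "\<And>t x. t \<in> I \<Longrightarrow> ((\<lambda>\<tau>. u \<tau> x) has_vector_derivative ut t x) (at t)"
    "continuous_on (I \<times> UNIV) (\<lambda>(t, x). ut t x)" "continuous_on (I \<times> UNIV) (\<lambda>(t, x). u t x)"
    "\<And>t x. t \<in> I \<Longrightarrow> ut t x = filtered_rhs A N (u t) x"
proof -
  from assms obtain D :: "(real \<times> (real ^ 'a)) \<Rightarrow> ((real \<times> (real ^ 'a)) \<Rightarrow>\<^sub>L (real ^ 'b))"
    where D: "\<And>z. z \<in> I \<times> UNIV \<Longrightarrow> ((\<lambda>(t, x). u t x) has_derivative blinfun_apply (D z)) (at z)"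
      and cD: "continuous_on (I \<times> UNIV) D"
    unfolding classical_solution_def spacetime_C1_on_def by blast
  define ut where "ut t x = D (t, x) (1, 0)" for t x
  have 1: "((\<lambda>\<tau>. u \<tau> x) has_vector_derivative ut t x) (at t)" if "t \<in> I" for t x
  proof -
    have "((\<lambda>\<tau>. (\<tau>, x)) has_derivative (\<lambda>h. (h, 0))) (at t)"
      by (auto intro!: derivative_eq_intros)
    from has_derivative_compose[OF this, of "\<lambda>(t, x). u t x" "D (t, x)"] D[of "(t, x)"] that
    have "((\<lambda>\<tau>. u \<tau> x) has_derivative (\<lambda>h. D (t, x) (h, 0))) (at t)" by simp
    moreover have "D (t, x) (h, 0) = h *\<^sub>R ut t x" for h
      unfolding ut_def blinfun.scaleR_right[symmetric] by simp
    ultimately show ?thesis by (simp add: has_vector_derivative_def)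
  qed
  have 2: "continuous_on (I \<times> UNIV) (\<lambda>(t, x). ut t x)"
    using cD by (auto simp: ut_def split_beta intro!: continuous_intros)
  have 3: "continuous_on (I \<times> UNIV) (\<lambda>(t, x). u t x)"
    by (rule has_derivative_continuous_on[OF has_derivative_at_withinI[OF D]])
  have 4: "ut t x = filtered_rhs A N (u t) x" if "t \<in> I" for t x
  proof -
    have "vector_derivative (\<lambda>\<tau>. u \<tau> x) (at t) = ut t x"
      using 1[OF that] by (rule vector_derivative_at)
    moreover have "vector_derivative (\<lambda>\<tau>. u \<tau> x) (at t) + lowpass N (\<lambda>y. \<Sum>j\<in>UNIV. A j (u t y) *v partial_x j (u t) y) x = 0"
      using assms that unfolding classical_solution_def by blast
    ultimately show ?thesis by (simp only: filtered_rhs_def eq_neg_iff_add_eq_0)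
  qed
  show ?thesis by (rule that[OF 1 2 3 4])
qed

lemma continuous_on_slice:
  assumes "continuous_on (I \<times> UNIV) (\<lambda>(t, x). f t x)" "t \<in> I"
  shows "continuous_on B (f t)"
proof -
  have "continuous_on B (\<lambda>x. (\<lambda>(t, x). f t x) (t, x))"
    by (rule continuous_on_compose2[OF assms(1) continuous_on_Pair[OF continuous_on_const continuous_on_id]])
       (use assms(2) in auto)
  then show ?thesis by simp
qed

lemma fhat_param:
  fixes f :: "real \<Rightarrow> real ^ 'd \<Rightarrow> real"
  assumes c: "continuous_on (I \<times> UNIV) (\<lambda>(t, x). f t x :: real)" and t: "t \<in> I"
  shows "fhat (cplx (f t)) k = integral torus_cell (\<lambda>x. cplx (f t) x * character (- k) x) / complex_of_real ((2 * pi) ^ CARD('d))"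
proof -
  have "continuous_on UNIV (\<lambda>x. f t x)"
    using continuous_on_slice[OF c t] by simp
  then show ?thesis unfolding fhat_def by (intro torus_mean_integral continuous_intros) auto
qed

lemma continuous_on_fhat_param:
  fixes f :: "real \<Rightarrow> real ^ 'd \<Rightarrow> real"
  assumes c: "continuous_on (I \<times> UNIV) (\<lambda>(t, x). f t x)"
  shows "continuous_on I (\<lambda>t. fhat (cplx (f t)) k)"
proof -
  have "continuous_on (I \<times> cbox 0 (\<chi> j. 2 * pi)) (\<lambda>(t, x). f t x)"
    by (rule continuous_on_subset[OF c]) auto
  then have "continuous_on (I \<times> cbox 0 (\<chi> j. 2 * pi)) (\<lambda>(t, x). cplx (f t) x * character (- k) x)"
    by (auto simp: split_beta character_def freq_dot_def cis_conv_exp intro!: continuous_intros)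
  then have "continuous_on I (\<lambda>t. integral torus_cell (\<lambda>x. cplx (f t) x * character (- k) x))"
    unfolding torus_cell_def by (rule integral_continuous_on_param)
  then have "continuous_on I (\<lambda>t. integral torus_cell (\<lambda>x. cplx (f t) x * character (- k) x) / complex_of_real ((2 * pi) ^ CARD('d)))"
    by (intro continuous_intros) auto
  then show ?thesis by (rule continuous_on_eq) (simp add: fhat_param[OF c])
qed

lemma has_vector_derivative_fhat_param:
  fixes f :: "real \<Rightarrow> real ^ 'd \<Rightarrow> real"
  assumes I: "open I" "is_interval I" "t \<in> I"
    and d: "\<And>t x. t \<in> I \<Longrightarrow> ((\<lambda>\<tau>. f \<tau> x) has_vector_derivative ft t x) (at t)"
    and c: "continuous_on (I \<times> UNIV) (\<lambda>(t, x). f t x)" and ct: "continuous_on (I \<times> UNIV) (\<lambda>(t, x). ft t x)"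
  shows "((\<lambda>t. fhat (cplx (f t)) k) has_vector_derivative fhat (cplx (ft t)) k) (at t)"
proof -
  let ?h = "\<lambda>f t x. cplx (f t) x * character (- k) x"
  have "continuous_on (I \<times> cbox 0 (\<chi> j. 2 * pi)) (\<lambda>(t, x). ft t x)"
    by (rule continuous_on_subset[OF ct]) auto
  then have cc: "continuous_on (I \<times> cbox 0 (\<chi> j. 2 * pi)) (\<lambda>(t, x). ?h ft t x)"
    by (auto simp: split_beta character_def freq_dot_def cis_conv_exp intro!: continuous_intros)
  have "((\<lambda>t. integral (cbox 0 (\<chi> j. 2 * pi)) (?h f t)) has_vector_derivative integral (cbox 0 (\<chi> j. 2 * pi)) (?h ft t)) (at t within I)"
  proof (rule leibniz_rule_vector_derivative[OF _ _ cc I(3) is_interval_convex[OF I(2)]])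
    fix t x assume t: "t \<in> I"
    have "((\<lambda>\<tau>. complex_of_real (f \<tau> x)) has_vector_derivative complex_of_real (ft t x)) (at t)"
      by (rule bounded_linear.has_vector_derivative[OF bounded_linear_of_real d[OF t]])
    then have "((\<lambda>t. ?h f t x) has_vector_derivative ?h ft t x) (at t)"
      by (rule has_vector_derivative_mult_left)
    then show "((\<lambda>t. ?h f t x) has_vector_derivative ?h ft t x) (at t within I)"
      by (rule has_vector_derivative_at_within)
  next
    fix t assume t: "t \<in> I"
    have "continuous_on (cbox 0 (\<chi> j. 2 * pi)) (\<lambda>x. f t x)"
      using continuous_on_slice[OF c t] by simp
    then show "?h f t integrable_on cbox 0 (\<chi> j. 2 * pi)"
      by (intro integrable_continuous continuous_intros) auto
  qed
  note L = this[unfolded at_within_open[OF I(3,1)]]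
  have "((\<lambda>t. integral torus_cell (?h f t) / complex_of_real ((2 * pi) ^ CARD('d)))
      has_vector_derivative integral torus_cell (?h ft t) / complex_of_real ((2 * pi) ^ CARD('d))) (at t)"
    unfolding torus_cell_def by (rule has_vector_derivative_divide[OF L])
  then have "((\<lambda>t. integral torus_cell (?h f t) / complex_of_real ((2 * pi) ^ CARD('d)))
      has_vector_derivative fhat (cplx (ft t)) k) (at t)"
    by (simp only: fhat_param[OF ct I(3)])
  then show ?thesis
    by (rule has_vector_derivative_transform_within_open[OF _ I(1,3)]) (simp add: fhat_param[OF c])
qed

text \<open>Outside the band nothing evolves and nothing is present initially. Pointwise in \<open>x\<close>, the difference
  \<open>u - P\<^sub>N u\<close> has zero time derivative, since the right-hand side is bandlimited.\<close>

lemma bandlimited_evolution: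
  fixes u w :: "real \<Rightarrow> real ^ 'd \<Rightarrow> real ^ 'n"
  assumes I: "is_interval I" "0 \<in> I" "t \<in> I" and init: "bandlimited N (u 0)"
    and w: "\<And>t. t \<in> I \<Longrightarrow> bandlimited N (w t)"
    and du: "\<And>t x i. t \<in> I \<Longrightarrow> ((\<lambda>\<tau>. u \<tau> x $ i) has_vector_derivative w t x $ i) (at t)"
    and dhat: "\<And>t i k. t \<in> I \<Longrightarrow> ((\<lambda>\<tau>. fhat (cpt (u \<tau>) i) k) has_vector_derivative fhat (cpt (w t) i) k) (at t)"
  shows "bandlimited N (u t)"
proof -
  have "lowpass N (u t) x $ i = u t x $ i" for x i
  proof -
    define q where "q t = cpt (u t) i x - (\<Sum>k\<in>freq_box N. fhat (cpt (u t) i) k * character k x)" for t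
    have dq: "(q has_vector_derivative 0) (at t)" if t: "t \<in> I" for t
    proof -
      have "((\<lambda>t. cpt (u t) i x) has_vector_derivative cpt (w t) i x) (at t)"
        by (rule bounded_linear.has_vector_derivative[OF bounded_linear_of_real du[OF t]])
      then have "(q has_vector_derivative cpt (w t) i x - (\<Sum>k\<in>freq_box N. fhat (cpt (w t) i) k * character k x)) (at t)"
        unfolding q_def[abs_def]
        by (intro has_vector_derivative_diff has_vector_derivative_sum has_vector_derivative_mult_left dhat[OF t])
      moreover have "cpt (w t) i x = (\<Sum>k\<in>freq_box N. fhat (cpt (w t) i) k * character k x)"
        by (rule trig_poly_expand[OF bandlimited_trig_poly[OF w[OF t]] finite_freq_box bandlimited_spectrum[OF w[OF t]]])
      ultimately show ?thesis by simp
    qed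
    have "\<exists>c. \<forall>t\<in>I. q t = c"
      by (rule has_vector_derivative_zero_constant[OF is_interval_convex[OF I(1)]])
         (auto intro: has_vector_derivative_at_within dq)
    then have "q t = q 0" using I by auto
    also have "q 0 = 0"
      unfolding q_def
      using trig_poly_expand[OF bandlimited_trig_poly[OF init, of i] finite_freq_box bandlimited_spectrum[OF init], where x = x] by simp
    finally have "cpt (u t) i x = complex_of_real (lowpass N (u t) x $ i)"
      unfolding q_def lowpass_complex by simp
    then show ?thesis by simp
  qed
  then have "lowpass N (u t) = u t" by (simp add: fun_eq_iff vec_eq_iff)
  then show ?thesis using bandlimited_lowpass[of N "u t"] by simp
qed

lemma classical_solution_coefficient_derivative:
  assumes sol: "classical_solution A N s U0 I u" and t: "t \<in> I"
  shows "((\<lambda>t. fhat (cpt (u t) i) k) has_vector_derivative fhat (cpt (filtered_rhs A N (u t)) i) k) (at t)"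
    and "((\<lambda>t. u t x $ i) has_vector_derivative filtered_rhs A N (u t) x $ i) (at t)"
proof -
  obtain ut where ut: "\<And>t x. t \<in> I \<Longrightarrow> ((\<lambda>\<tau>. u \<tau> x) has_vector_derivative ut t x) (at t)"
    "continuous_on (I \<times> UNIV) (\<lambda>(t, x). ut t x)" "continuous_on (I \<times> UNIV) (\<lambda>(t, x). u t x)"
    "\<And>t x. t \<in> I \<Longrightarrow> ut t x = filtered_rhs A N (u t) x"
    using classical_solution_time_derivative[OF sol] by blast
  have I: "open I" "is_interval I" using sol unfolding classical_solution_def by auto
  have di: "((\<lambda>\<tau>. u \<tau> x $ i) has_vector_derivative ut t x $ i) (at t)" if "t \<in> I" for t x
    by (rule bounded_linear.has_vector_derivative[OF bounded_linear_vec_nth ut(1)[OF that]])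
  have ci: "continuous_on (I \<times> UNIV) (\<lambda>(t, x). ut t x $ i)" "continuous_on (I \<times> UNIV) (\<lambda>(t, x). u t x $ i)"
    using ut(2,3) by (auto simp: split_beta intro!: continuous_intros)
  have utr: "ut t = filtered_rhs A N (u t)" using ut(4)[OF t] by auto
  have "((\<lambda>t. fhat (cpt (u t) i) k) has_vector_derivative fhat (cpt (ut t) i) k) (at t)"
    by (rule has_vector_derivative_fhat_param[OF I t di ci(2,1)])
  then show "((\<lambda>t. fhat (cpt (u t) i) k) has_vector_derivative fhat (cpt (filtered_rhs A N (u t)) i) k) (at t)"
    unfolding utr .
  show "((\<lambda>t. u t x $ i) has_vector_derivative filtered_rhs A N (u t) x $ i) (at t)"
    using di[OF t] unfolding utr .
qed

lemma classical_solution_bandlimited: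
  assumes sol: "classical_solution A N s U0 I u" and t: "t \<in> I"
  shows "bandlimited N (u t)"
proof (rule bandlimited_evolution[where w = "\<lambda>t. filtered_rhs A N (u t)" and I = I])
  have "u 0 = lowpass N U0" using sol unfolding classical_solution_def by auto
  then show "bandlimited N (u 0)" by (simp add: bandlimited_lowpass)
qed (use sol t in \<open>auto simp: classical_solution_def bandlimited_filtered_rhs
      intro: classical_solution_coefficient_derivative[OF sol]\<close>)

section \<open>Energy estimates\<close>

definition bessel :: "real \<Rightarrow> (real ^ 'd \<Rightarrow> real) \<Rightarrow> real ^ 'd \<Rightarrow> real" where
  "bessel r g x = Re (fourier_multiplier (\<lambda>k. of_real (japanese_bracket k powr r)) (cplx g) x)"

lemma cplx_bessel:
  assumes "trig_poly (cplx g)"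
  shows "cplx (bessel r g) = fourier_multiplier (\<lambda>k. of_real (japanese_bracket k powr r)) (cplx g)"
  unfolding bessel_def by (rule ext, rule real_multiplier[symmetric, OF assms]) simp

lemma trig_poly_bessel: "trig_poly (cplx g) \<Longrightarrow> trig_poly (cplx (bessel r g))"
  unfolding cplx_bessel by (rule trig_poly_multiplier)

lemma fhat_bessel: "trig_poly (cplx g) \<Longrightarrow> fhat (cplx (bessel r g)) k = of_real (japanese_bracket k powr r) * fhat (cplx g) k"
  by (simp only: cplx_bessel fhat_multiplier)

lemma sobolev_norm_bessel:
  assumes "trig_poly (cplx g)" shows "sobolev_norm 0 (cplx (bessel r g)) = sobolev_norm r (cplx g)"
  by (subst (1 2) sobolev_norm_eq[where F = "spectrum (cplx g)"])
     (auto simp: assms trig_poly_bessel fhat_bessel trig_poly_finite_spectrum norm_mult)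

lemma trig_poly_cplx_continuous: "trig_poly (cplx g) \<Longrightarrow> continuous_on A g"
  using continuous_on_Re[OF trig_poly_continuous[of "cplx g" A]] by simp

lemma integral_parseval:
  fixes g h :: "real ^ 'd \<Rightarrow> real"
  assumes g: "trig_poly (cplx g)" and h: "trig_poly (cplx h)" and F: "finite F" "spectrum (cplx g) \<subseteq> F"
  shows "integral torus_cell (\<lambda>x. g x * h x) = (2 * pi) ^ CARD('d) * Re (\<Sum>k\<in>F. fhat (cplx g) k * cnj (fhat (cplx h) k))"
proof -
  have fin: "finite (F \<union> spectrum (cplx h))" using F trig_poly_finite_spectrum[OF h] by simp
  let ?f = "\<lambda>x. cplx g x * cnj (cplx h x)"
  have cont: "continuous_on UNIV ?f"
    by (intro continuous_intros trig_poly_continuous g h)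
  have "torus_mean ?f = (\<Sum>k\<in>F \<union> spectrum (cplx h). fhat (cplx g) k * cnj (fhat (cplx h) k))"
    by (rule torus_mean_parseval[OF g h fin Un_upper2])
  also have "\<dots> = (\<Sum>k\<in>F. fhat (cplx g) k * cnj (fhat (cplx h) k))"
    by (rule sum.mono_neutral_right[OF fin]) (use F in auto)
  finally have e: "torus_mean ?f = (\<Sum>k\<in>F. fhat (cplx g) k * cnj (fhat (cplx h) k))" .
  have int: "?f integrable_on torus_cell"
    unfolding torus_cell_def by (rule integrable_continuous) (rule continuous_on_subset[OF cont], simp)
  have "integral torus_cell (\<lambda>x. g x * h x) = integral torus_cell (Re \<circ> ?f)"
    by (simp add: o_def)
  also have "\<dots> = Re (integral torus_cell ?f)"
    by (rule integral_linear[OF int bounded_linear_Re])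
  also have "integral torus_cell ?f = of_real ((2 * pi) ^ CARD('d)) * torus_mean ?f"
    unfolding torus_mean_integral[OF cont] by simp
  also have "Re \<dots> = (2 * pi) ^ CARD('d) * Re (torus_mean ?f)" by (simp only: Re_complex_of_real Im_complex_of_real times_complex.simps)
  finally show ?thesis unfolding e .
qed

lemma integral_bessel_square:
  fixes U :: "real ^ 'd \<Rightarrow> real ^ 'n"
  assumes "bandlimited N U"
  shows "integral torus_cell (\<lambda>x. \<Sum>a\<in>UNIV. (bessel r (\<lambda>x. U x $ a) x)\<^sup>2) = (2 * pi) ^ CARD('d) * (Hs_norm r U)\<^sup>2"
proof -
  let ?g = "\<lambda>a. bessel r (\<lambda>x. U x $ a)"
  have tp: "trig_poly (cpt U a)" for a by (rule bandlimited_trig_poly[OF assms])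
  note tg = trig_poly_bessel[OF tp]
  have "integral torus_cell (\<lambda>x. (?g a x)\<^sup>2) = (2 * pi) ^ CARD('d) * (sobolev_norm r (cpt U a))\<^sup>2" for a
  proof -
    have fin: "finite (spectrum (cplx (?g a)))" by (rule trig_poly_finite_spectrum[OF tg])
    have "integral torus_cell (\<lambda>x. (?g a x)\<^sup>2) = (2 * pi) ^ CARD('d) *
       Re (\<Sum>k\<in>spectrum (cplx (?g a)). fhat (cplx (?g a)) k * cnj (fhat (cplx (?g a)) k))"
      unfolding power2_eq_square by (rule integral_parseval[OF tg tg fin order_refl])
    also have "Re (\<Sum>k\<in>spectrum (cplx (?g a)). fhat (cplx (?g a)) k * cnj (fhat (cplx (?g a)) k))
        = (\<Sum>k\<in>spectrum (cplx (?g a)). (norm (fhat (cplx (?g a)) k))\<^sup>2)"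
      by (simp add: cmod_power2) (simp add: power2_eq_square)
    also have "\<dots> = (sobolev_norm 0 (cplx (?g a)))\<^sup>2"
      by (simp add: sobolev_norm_def L2_set_def sum_nonneg)
    finally show ?thesis by (simp only: sobolev_norm_bessel[OF tp])
  qed
  moreover have "(\<lambda>x. (?g a x)\<^sup>2) integrable_on torus_cell" for a
    unfolding torus_cell_def by (intro integrable_continuous continuous_intros trig_poly_cplx_continuous tg)
  ultimately show ?thesis
    by (subst integral_sum) (auto simp: Hs_norm_bandlimited(2)[OF assms] sum_distrib_left sum_nonneg)
qed

lemma L2_set_fhat_mult:
  assumes f: "trig_poly f" and g: "trig_poly g" and F: "finite F"
  shows "L2_set (\<lambda>k. norm (fhat (\<lambda>x. f x * g x) k)) F \<le> wiener_norm 0 f * sobolev_norm 0 g"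
proof -
  have fin: "finite (spectrum f)" by (rule trig_poly_finite_spectrum[OF f])
  have e: "(\<lambda>x. f x * g x) = (\<lambda>x. g x * f x)" by (simp add: mult.commute)
  have "L2_set (\<lambda>k. norm (fhat (\<lambda>x. f x * g x) k)) F
      \<le> L2_set (\<lambda>k. \<Sum>l\<in>spectrum f. norm (fhat f l) * norm (fhat g (k - l))) F"
    unfolding e fhat_mult[OF g f fin order_refl]
    by (intro L2_set_mono order_trans[OF norm_sum]) (auto simp: norm_mult mult.commute)
  also have "\<dots> \<le> (\<Sum>l\<in>spectrum f. norm (fhat f l)) * sobolev_norm 0 g"
  proof (rule young_l1_l2[OF F])
    fix G :: "(int ^ 'a) set" assume "finite G"
    from sobolev_norm_ge[OF g this, of 0] show "L2_set (\<lambda>k. norm (fhat g k)) G \<le> sobolev_norm 0 g" by simp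
  qed simp
  finally show ?thesis by (simp add: wiener_norm_def)
qed

lemma uniform_bound_finite:
  fixes P :: "'i::finite \<Rightarrow> real \<Rightarrow> bool"
  assumes "\<And>i. \<exists>C\<ge>0. P i C" and mono: "\<And>i C C'. P i C \<Longrightarrow> C \<le> C' \<Longrightarrow> P i C'"
  shows "\<exists>C\<ge>0. \<forall>i. P i C"
proof -
  from assms(1) obtain c where c: "\<And>i. c i \<ge> 0" "\<And>i. P i (c i)" by metis
  have "P i (\<Sum>i\<in>UNIV. c i)" for i
    by (rule mono[OF c(2)]) (rule member_le_sum, auto simp: c)
  then show ?thesis using c by (intro exI[of _ "\<Sum>i\<in>UNIV. c i"]) (auto intro: sum_nonneg)
qed

lemma polynomial_family_composition_bounds:
  fixes P :: "'i::finite \<Rightarrow> real ^ 'n \<Rightarrow> real"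
  assumes P: "\<And>i. real_polynomial_function (P i)" and r: "0 \<le> r" and R: "0 \<le> R"
  shows "\<exists>C\<ge>0. \<forall>i. \<forall>(U :: real ^ 'd \<Rightarrow> real ^ 'n) w \<eta>.
     (\<forall>j. trig_poly (cpt U j) \<and> wiener_norm 1 (cpt U j) \<le> w \<and> sobolev_norm r (cpt U j) \<le> \<eta>) \<and> w \<le> R \<longrightarrow>
     wiener_norm 1 (\<lambda>x. complex_of_real (P i (U x) - P i 0)) \<le> C * w \<and>
     sobolev_norm r (\<lambda>x. complex_of_real (P i (U x) - P i 0)) \<le> C * \<eta>"
    (is "\<exists>C\<ge>0. \<forall>i. \<forall>U w \<eta>. ?H U w \<eta> \<longrightarrow> ?Q i C U w \<eta>")
proof (rule uniform_bound_finite)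
  show "\<exists>C\<ge>0. \<forall>U w \<eta>. ?H U w \<eta> \<longrightarrow> ?Q i C U w \<eta>" for i
    by (rule polynomial_composition_bounds[OF P r R])
next
  fix i and C C' :: real
  assume H: "\<forall>U w \<eta>. ?H U w \<eta> \<longrightarrow> ?Q i C U w \<eta>" and CC: "C \<le> C'"
  show "\<forall>U w \<eta>. ?H U w \<eta> \<longrightarrow> ?Q i C' U w \<eta>"
  proof (intro allI impI)
    fix U :: "real ^ 'd \<Rightarrow> real ^ 'n" and w \<eta>
    assume U: "?H U w \<eta>"
    have "0 \<le> w" "0 \<le> \<eta>"
      using U wiener_norm_nonneg[of 1 "cpt U undefined"] sobolev_norm_nonneg[of r "cpt U undefined"] order_trans by blast+
    then have "C * w \<le> C' * w" "C * \<eta> \<le> C' * \<eta>" using CC by (simp_all add: mult_right_mono)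
    then show "?Q i C' U w \<eta>" using H[rule_format, OF U] by (meson order_trans)
  qed
qed

lemma polynomial_family_wiener_bound:
  fixes P :: "'i::finite \<Rightarrow> real ^ 'n \<Rightarrow> real"
  assumes P: "\<And>i. real_polynomial_function (P i)" and R: "0 \<le> R"
  shows "\<exists>C\<ge>0. \<forall>i. \<forall>U :: real ^ 'd \<Rightarrow> real ^ 'n.
     (\<forall>j. trig_poly (cpt U j) \<and> wiener_norm 1 (cpt U j) \<le> R) \<longrightarrow>
       wiener_norm 0 (\<lambda>x. complex_of_real (P i (U x))) \<le> C"
  by (rule uniform_bound_finite[OF polynomial_wiener_bound[OF P R]]) (meson order_trans)

locale symmetrizable_system =
  fixes A :: "'d::finite \<Rightarrow> real ^ 'n::finite \<Rightarrow> real ^ 'n ^ 'n"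
    and S :: "real ^ 'n \<Rightarrow> real ^ 'n ^ 'n"
    and S0 :: "'d \<Rightarrow> real ^ 'n ^ 'n"
    and \<U> :: "(real ^ 'n) set"
  assumes A_poly: "\<And>j a b. real_polynomial_function (\<lambda>U. A j U $ a $ b)"
    and U_open: "open \<U>" and U_zero: "0 \<in> \<U>"
    and S_poly: "\<And>a b. real_polynomial_function (\<lambda>U. S U $ a $ b)"
    and S_sym: "\<And>U. U \<in> \<U> \<Longrightarrow> transpose (S U) = S U"
    and S_pos: "\<And>U v. U \<in> \<U> \<Longrightarrow> v \<noteq> 0 \<Longrightarrow> v \<bullet> (S U *v v) > 0"
    and S0_sym: "\<And>j. transpose (S0 j) = S0 j"
    and A_eq: "\<And>j U. U \<in> \<U> \<Longrightarrow> A j U = S0 j ** S U"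
begin

lemma quadratic_form_sum: "v \<bullet> (S U *v v) = (\<Sum>a\<in>UNIV. \<Sum>b\<in>UNIV. v $ a * S U $ a $ b * v $ b)"
  by (simp add: inner_vec_def matrix_vector_mult_def sum_distrib_left mult.assoc)

text \<open>The quadratic form attains a positive minimum and a maximum over pairs of a point of \<open>K\<close> and a unit vector; both
  bounds extend to all vectors by homogeneity.\<close>

lemma symmetrizer_bounds:
  assumes K: "compact K" "K \<subseteq> \<U>"
  shows "\<exists>c>0. \<exists>C>0. \<forall>U\<in>K. \<forall>v. c * (norm v)\<^sup>2 \<le> v \<bullet> (S U *v v) \<and> v \<bullet> (S U *v v) \<le> C * (norm v)\<^sup>2"
proof (cases "K = {}")
  case False
  let ?h = "\<lambda>(U, v). v \<bullet> (S U *v v)"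
  let ?D = "K \<times> sphere (0 :: real ^ 'n) 1"
  have "axis undefined 1 \<in> sphere (0 :: real ^ 'n) 1" by simp
  then have ne: "?D \<noteq> {}" using False by blast
  have cpt: "compact ?D" by (intro compact_Times K compact_sphere)
  have contS: "continuous_on ?D (\<lambda>z. S (fst z) $ a $ b)" for a b
    by (rule continuous_on_real_polynomial[OF S_poly]) (intro continuous_intros)
  then have cont: "continuous_on ?D ?h"
    unfolding quadratic_form_sum split_beta
    by (intro continuous_on_sum continuous_on_mult contS) (intro continuous_intros)+
  obtain z where z: "z \<in> ?D" "\<And>y. y \<in> ?D \<Longrightarrow> ?h z \<le> ?h y"
    using continuous_attains_inf[OF cpt ne cont] by blast
  obtain z' where z': "z' \<in> ?D" "\<And>y. y \<in> ?D \<Longrightarrow> ?h y \<le> ?h z'"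
    using continuous_attains_sup[OF cpt ne cont] by blast
  have zpos: "0 < ?h z"
    using z(1) K(2) by (cases z) (auto simp: dist_norm intro!: S_pos)
  have hom: "?h z * (norm v)\<^sup>2 \<le> v \<bullet> (S U *v v) \<and> v \<bullet> (S U *v v) \<le> ?h z' * (norm v)\<^sup>2" if U: "U \<in> K" for U v
  proof (cases "v = 0")
    case False
    define e where "e = v /\<^sub>R norm v"
    have ve: "v = norm v *\<^sub>R e" using False by (simp add: e_def)
    have "(U, e) \<in> ?D" using U False by (simp add: e_def)
    then have b: "?h z \<le> e \<bullet> (S U *v e)" "e \<bullet> (S U *v e) \<le> ?h z'" using z(2)[of "(U, e)"] z'(2)[of "(U, e)"] by auto
    have "v \<bullet> (S U *v v) = (norm v *\<^sub>R e) \<bullet> (S U *v (norm v *\<^sub>R e))"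
      using ve by (rule arg_cong2[where f = "\<lambda>x y. x \<bullet> (S U *v y)", OF _ ve])
    also have "\<dots> = (e \<bullet> (S U *v e)) * (norm v)\<^sup>2"
      by (simp add: matrix_vector_mult_scaleR power2_eq_square)
    finally have q: "v \<bullet> (S U *v v) = (e \<bullet> (S U *v e)) * (norm v)\<^sup>2" .
    then show ?thesis using mult_right_mono[OF b(1), of "(norm v)\<^sup>2"] mult_right_mono[OF b(2), of "(norm v)\<^sup>2"] by simp
  qed simp
  have "0 < ?h z'" using zpos z'(2)[OF z(1)] by simp
  then show ?thesis using zpos hom by (intro exI[of _ "?h z"] conjI exI[of _ "?h z'"]) auto
qed (auto intro!: exI[of _ 1])

text \<open>Half of the part of \<open>dE/dt\<close> that comes from differentiating the two factors \<open>\<langle>D\<rangle>\<^sup>r u\<close>: the pairing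
  \<open>\<langle>\<langle>D\<rangle>\<^sup>r \<partial>\<^sub>t u, V\<rangle>\<close>, with \<open>\<partial>\<^sub>t u\<close> replaced by the right-hand side of the equation.\<close>

definition pairing_rate :: "real \<Rightarrow> nat \<Rightarrow> (real ^ 'd \<Rightarrow> real ^ 'n) \<Rightarrow> real" where
  "pairing_rate r N U = integral torus_cell (\<lambda>x. \<Sum>a\<in>UNIV. bessel r (\<lambda>x. filtered_rhs A N U x $ a) x *
        (\<Sum>b\<in>UNIV. S (U x) $ a $ b * bessel r (\<lambda>x. U x $ b) x))"

text \<open>By Parseval's identity the pairing is a sum over the frequency box, in which \<open>P\<^sub>N\<close> has disappeared. Of the three
  factors of size \<open>U\<close>, the two in \<open>H\<^sup>r\<close> come from \<open>V\<close> and from the strong factor of the commutator; the remaining factor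
  is in the Wiener norm.\<close>

lemma energy_pairing_rate:
  assumes r: "1 \<le> r" and R: "0 \<le> R"
  shows "\<exists>C\<ge>0. \<forall>N U w. bandlimited N U \<and> (\<forall>x. U x \<in> \<U>) \<and> (\<forall>i. wiener_norm 1 (cpt U i) \<le> w) \<and> w \<le> R \<longrightarrow>
    \<bar>pairing_rate r N U\<bar> \<le> C * w * (Hs_norm r U)\<^sup>2"
proof -
  have r0: "0 \<le> r" using r by simp
  note polynomial_family_composition_bounds[where P = "\<lambda>p U. S U $ fst p $ snd p" and 'd = 'd, OF S_poly r0 R]
  then obtain C1 where C1: "C1 \<ge> 0" and H1: "\<And>a b (U :: real ^ 'd \<Rightarrow> real ^ 'n) w \<eta>.
     (\<forall>i. trig_poly (cpt U i) \<and> wiener_norm 1 (cpt U i) \<le> w \<and> sobolev_norm r (cpt U i) \<le> \<eta>) \<and> w \<le> R \<Longrightarrow>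
     wiener_norm 1 (\<lambda>x. complex_of_real (S (U x) $ a $ b - S 0 $ a $ b)) \<le> C1 * w \<and>
     sobolev_norm r (\<lambda>x. complex_of_real (S (U x) $ a $ b - S 0 $ a $ b)) \<le> C1 * \<eta>"
    by (elim exE conjE) (rule that, assumption, drule_tac x = "(a, b)" in spec, unfold fst_conv snd_conv, blast)
  note polynomial_family_wiener_bound[where P = "\<lambda>p U. S U $ fst p $ snd p" and 'd = 'd, OF S_poly R]
  then obtain C2 where C2: "C2 \<ge> 0" and H2: "\<And>a b (U :: real ^ 'd \<Rightarrow> real ^ 'n).
     (\<forall>i. trig_poly (cpt U i) \<and> wiener_norm 1 (cpt U i) \<le> R) \<Longrightarrow> wiener_norm 0 (\<lambda>x. complex_of_real (S (U x) $ a $ b)) \<le> C2"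
    by (elim exE conjE) (rule that, assumption, drule_tac x = "(a, b)" in spec, unfold fst_conv snd_conv, blast)
  define Z where "Z = (\<Sum>a\<in>UNIV. \<Sum>j\<in>UNIV. \<Sum>c\<in>UNIV. \<bar>S0 j $ a $ c\<bar>) * real CARD('n)"
  have Z: "0 \<le> Z" unfolding Z_def by (intro mult_nonneg_nonneg sum_nonneg) auto
  define C where "C = (2 * pi) ^ CARD('d) * (Z * ((r * 2 powr r + 1) * (2 * C1)) * (real CARD('n) * C2))"
  have C: "0 \<le> C" unfolding C_def using Z C1 C2 r by simp
  have "\<bar>pairing_rate r N U\<bar> \<le> C * w * (Hs_norm r U)\<^sup>2"
    if U: "bandlimited N U" and UU: "\<forall>x. U x \<in> \<U>" and w: "\<forall>i. wiener_norm 1 (cpt U i) \<le> w" and wR: "w \<le> R" for N U w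
  proof -
    define \<eta> where "\<eta> = Hs_norm r U"
    have \<eta>: "0 \<le> \<eta>" by (simp add: \<eta>_def Hs_norm_nonneg)
    have w0: "0 \<le> w" using w wiener_norm_nonneg order_trans by blast
    have tpU: "trig_poly (cpt U i)" for i by (rule bandlimited_trig_poly[OF U])
    have sobU: "sobolev_norm r (cpt U i) \<le> \<eta>" for i unfolding \<eta>_def by (rule sobolev_norm_le_Hs_norm[OF U])
    have hyp: "(\<forall>i. trig_poly (cpt U i) \<and> wiener_norm 1 (cpt U i) \<le> w \<and> sobolev_norm r (cpt U i) \<le> \<eta>) \<and> w \<le> R"
      using tpU w sobU wR by blast
    have hypR: "\<forall>i. trig_poly (cpt U i) \<and> wiener_norm 1 (cpt U i) \<le> R"
      using tpU w wR order_trans by blast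
    define \<sigma> where "\<sigma> a b x = complex_of_real (S (U x) $ a $ b)" for a b x
    have tps: "trig_poly (\<sigma> a b)" for a b
      unfolding \<sigma>_def by (rule trig_poly_real_polynomial[where p = "\<lambda>U. S U $ a $ b" and U = U, OF S_poly tpU])
    let ?L = "\<lambda>k. complex_of_real (japanese_bracket k powr r)"
    define W where "W = filtered_rhs A N U"
    have bW: "bandlimited N W" unfolding W_def by (rule bandlimited_filtered_rhs)
    have tpW: "trig_poly (cpt W a)" for a by (rule bandlimited_trig_poly[OF bW])
    define V where "V a x = (\<Sum>b\<in>UNIV. S (U x) $ a $ b * bessel r (\<lambda>x. U x $ b) x)" for a x
    have cV: "cplx (V a) = (\<lambda>x. \<Sum>b\<in>UNIV. \<sigma> a b x * fourier_multiplier ?L (cpt U b) x)" for a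
    proof
      fix x
      have "complex_of_real (bessel r (\<lambda>x. U x $ b) x) = fourier_multiplier ?L (cpt U b) x" for b
        using cplx_bessel[OF tpU, of r b] by metis
      then show "cplx (V a) x = (\<Sum>b\<in>UNIV. \<sigma> a b x * fourier_multiplier ?L (cpt U b) x)"
        by (simp add: V_def \<sigma>_def)
    qed
    have tpm: "trig_poly (\<lambda>x. \<sigma> a b x * fourier_multiplier m (cpt U c) x)" for a b c m
      by (intro trig_poly_mult tps trig_poly_multiplier tpU)
    have tpV: "trig_poly (cplx (V a))" for a unfolding cV by (intro trig_poly_sum tpm)
    have Vh: "fhat (cplx (V a)) k = (\<Sum>b\<in>UNIV. fhat (\<lambda>x. \<sigma> a b x * fourier_multiplier ?L (cpt U b) x) k)" for a k
      unfolding cV by (rule fhat_sum) (rule trig_poly_continuous[OF tpm])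
    have wh: "fhat (cpt W a) k = - (\<Sum>j\<in>UNIV. \<Sum>c\<in>UNIV. \<Sum>b\<in>UNIV. of_real (S0 j $ a $ c) *
              fhat (\<lambda>x. \<sigma> c b x * fourier_multiplier (\<lambda>k. \<i> * of_int (k $ j)) (cpt U b) x) k)"
      if k: "k \<in> freq_box N" for a k
    proof -
      let ?F = "\<lambda>y. \<Sum>j\<in>UNIV. A j (U y) *v partial_x j U y"
      let ?G = "\<lambda>j c b x. \<sigma> c b x * fourier_multiplier (\<lambda>k. \<i> * of_int (k $ j)) (cpt U b) x"
      have "cpt ?F a = (\<lambda>y. \<Sum>j\<in>UNIV. \<Sum>c\<in>UNIV. \<Sum>b\<in>UNIV. of_real (S0 j $ a $ c) * ?G j c b y)"
      proof
        fix y
        have p: "complex_of_real (partial_x j U y $ b) = fourier_multiplier (\<lambda>k. \<i> * of_int (k $ j)) (cpt U b) y" for j b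
          using partial_x_bandlimited[OF U, of j b] by metis
        have Aab: "complex_of_real (A j (U y) $ a $ b) = (\<Sum>c\<in>UNIV. of_real (S0 j $ a $ c) * \<sigma> c b y)" for j b
          by (simp add: A_eq UU matrix_matrix_mult_def \<sigma>_def)
        have "cpt ?F a y = (\<Sum>j\<in>UNIV. \<Sum>b\<in>UNIV. \<Sum>c\<in>UNIV. of_real (S0 j $ a $ c) * ?G j c b y)"
          using fun_cong[OF flux_component[of A U a], of y]
          by (simp only: p Aab sum_distrib_right mult.assoc)
        also have "\<dots> = (\<Sum>j\<in>UNIV. \<Sum>c\<in>UNIV. \<Sum>b\<in>UNIV. of_real (S0 j $ a $ c) * ?G j c b y)"
          by (rule sum.cong[OF refl], rule sum.swap)
        finally show "cpt ?F a y = (\<Sum>j\<in>UNIV. \<Sum>c\<in>UNIV. \<Sum>b\<in>UNIV. of_real (S0 j $ a $ c) * ?G j c b y)" .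
      qed
      then have "fhat (cpt ?F a) k = (\<Sum>j\<in>UNIV. \<Sum>c\<in>UNIV. \<Sum>b\<in>UNIV. of_real (S0 j $ a $ c) * fhat (?G j c b) k)"
        by (simp only:) (subst fhat_sum, rule trig_poly_continuous, intro trig_poly_sum trig_poly_cmult tpm,
            intro sum.cong refl, subst fhat_sum, rule trig_poly_continuous, intro trig_poly_sum trig_poly_cmult tpm,
            intro sum.cong refl, subst fhat_sum, rule trig_poly_continuous, intro trig_poly_cmult tpm,
            intro sum.cong refl, rule fhat_cmult)
      moreover have "fhat (cpt W a) k = - fhat (cpt ?F a) k"
        using k fhat_uminus[of "cpt (lowpass N ?F) a" k] fhat_lowpass[of N ?F a k]
        by (simp add: W_def filtered_rhs_def)
      ultimately show ?thesis by simp
    qed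
    define Kc where "Kc = (r * 2 powr r + 1) * (2 * C1) * w * \<eta>"
    have K: "L2_set (\<lambda>k. norm (commutator_coeff r j (\<sigma> c b) (cpt U b) k)) (freq_box N) \<le> Kc" for j c b
    proof -
      have "L2_set (\<lambda>k. norm (commutator_coeff r j (\<sigma> c b) (cpt U b) k)) (freq_box N)
        \<le> (r * 2 powr r + 1) * (sobolev_norm r (\<lambda>x. \<sigma> c b x - of_real (S 0 $ c $ b)) * wiener_norm 1 (cpt U b)
            + wiener_norm 1 (\<lambda>x. \<sigma> c b x - of_real (S 0 $ c $ b)) * sobolev_norm r (cpt U b))"
        by (rule commutator_bound[OF tps tpU r finite_freq_box])
      also have "\<dots> \<le> (r * 2 powr r + 1) * ((C1 * \<eta>) * w + (C1 * w) * \<eta>)"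
      proof (intro mult_left_mono add_mono mult_mono)
        show "sobolev_norm r (\<lambda>x. \<sigma> c b x - of_real (S 0 $ c $ b)) \<le> C1 * \<eta>"
          "wiener_norm 1 (\<lambda>x. \<sigma> c b x - of_real (S 0 $ c $ b)) \<le> C1 * w"
          using H1[OF hyp, of c b] by (simp_all add: \<sigma>_def)
      qed (use w sobU C1 \<eta> w0 r in auto)
      also have "\<dots> = Kc" by (simp add: Kc_def algebra_simps)
      finally show ?thesis .
    qed
    have Kc0: "0 \<le> Kc" unfolding Kc_def using r C1 w0 \<eta> by simp
    define Lc where "Lc = real CARD('n) * C2 * \<eta>"
    have L: "L2_set (\<lambda>k. norm (fhat (cplx (V a)) k)) (freq_box N) \<le> Lc" for a
    proof -
      have "L2_set (\<lambda>k. norm (fhat (cplx (V a)) k)) (freq_box N)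
         \<le> L2_set (\<lambda>k. \<Sum>b\<in>UNIV. norm (fhat (\<lambda>x. \<sigma> a b x * fourier_multiplier ?L (cpt U b) x) k)) (freq_box N)"
        unfolding Vh by (intro L2_set_mono norm_sum) simp
      also have "\<dots> \<le> (\<Sum>b\<in>UNIV. L2_set (\<lambda>k. norm (fhat (\<lambda>x. \<sigma> a b x * fourier_multiplier ?L (cpt U b) x) k)) (freq_box N))"
        by (rule L2_set_sum_le)
      also have "\<dots> \<le> (\<Sum>b\<in>(UNIV::'n set). C2 * \<eta>)"
      proof (rule sum_mono)
        fix b
        have "L2_set (\<lambda>k. norm (fhat (\<lambda>x. \<sigma> a b x * fourier_multiplier ?L (cpt U b) x) k)) (freq_box N)
            \<le> wiener_norm 0 (\<sigma> a b) * sobolev_norm 0 (fourier_multiplier ?L (cpt U b))"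
          by (rule L2_set_fhat_mult[OF tps trig_poly_multiplier[OF tpU] finite_freq_box])
        also have "\<dots> \<le> C2 * \<eta>"
          using H2[OF hypR, of a b] sobU[of b] sobolev_norm_bessel[OF tpU, of r b] cplx_bessel[OF tpU, of r b] C2
          by (intro mult_mono) (simp_all add: \<sigma>_def[abs_def])
        finally show "L2_set (\<lambda>k. norm (fhat (\<lambda>x. \<sigma> a b x * fourier_multiplier ?L (cpt U b) x) k)) (freq_box N) \<le> C2 * \<eta>" .
      qed
      finally show ?thesis by (simp add: Lc_def)
    qed
    have hb: "trig_poly (cplx (bessel r (\<lambda>x. W x $ a)))" for a by (rule trig_poly_bessel[OF tpW])
    have sph: "spectrum (cplx (bessel r (\<lambda>x. W x $ a))) \<subseteq> freq_box N" for a
      using bandlimited_spectrum[OF bW, of a] by (auto simp: fhat_bessel[OF tpW])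
    have "integral torus_cell (\<lambda>x. \<Sum>a\<in>UNIV. bessel r (\<lambda>x. W x $ a) x * V a x)
       = (\<Sum>a\<in>UNIV. integral torus_cell (\<lambda>x. bessel r (\<lambda>x. W x $ a) x * V a x))"
      unfolding torus_cell_def
      by (rule integral_sum, simp, intro integrable_continuous continuous_on_mult trig_poly_cplx_continuous hb tpV)
    also have "\<dots> = (\<Sum>a\<in>UNIV. (2 * pi) ^ CARD('d) * Re (\<Sum>k\<in>freq_box N. fhat (cplx (bessel r (\<lambda>x. W x $ a))) k * cnj (fhat (cplx (V a)) k)))"
      by (intro sum.cong refl integral_parseval hb tpV sph finite_freq_box)
    also have "\<dots> = (2 * pi) ^ CARD('d) * Re (\<Sum>a\<in>UNIV. \<Sum>k\<in>freq_box N. ?L k * fhat (cpt W a) k * cnj (fhat (cplx (V a)) k))"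
      by (simp only: fhat_bessel[OF tpW] sum_distrib_left Re_sum)
    finally have int: "integral torus_cell (\<lambda>x. \<Sum>a\<in>UNIV. bessel r (\<lambda>x. W x $ a) x * V a x)
       = (2 * pi) ^ CARD('d) * Re (\<Sum>a\<in>UNIV. \<Sum>k\<in>freq_box N. ?L k * fhat (cpt W a) k * cnj (fhat (cplx (V a)) k))" .
    have S0s: "S0 j $ a $ c = S0 j $ c $ a" for j a c
      using S0_sym[of j] by (metis transpose_def vec_lambda_beta)
    have "\<bar>Re (\<Sum>a\<in>UNIV. \<Sum>k\<in>freq_box N. ?L k * fhat (cpt W a) k * cnj (fhat (cplx (V a)) k))\<bar>
       \<le> (\<Sum>a\<in>UNIV. \<Sum>j\<in>UNIV. \<Sum>c\<in>UNIV. \<bar>S0 j $ a $ c\<bar>) * real CARD('n) * Kc * Lc"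
      by (rule energy_pairing_bound[where \<sigma> = \<sigma> and u = "cpt U", OF S0s tps tpU finite_freq_box finite_freq_box Vh wh K Kc0 L])
    then have "\<bar>integral torus_cell (\<lambda>x. \<Sum>a\<in>UNIV. bessel r (\<lambda>x. W x $ a) x * V a x)\<bar> \<le> (2 * pi) ^ CARD('d) * (Z * Kc * Lc)"
      unfolding int Z_def[symmetric] abs_mult by (simp add: mult_left_mono)
    also have "\<dots> = C * w * \<eta>\<^sup>2"
      by (simp add: C_def Kc_def Lc_def power2_eq_square mult_ac)
    finally show ?thesis by (simp only: pairing_rate_def W_def V_def \<eta>_def)
  qed
  then show ?thesis using C by blast
qed

end

text \<open>Serves for the part of \<open>dE/dt\<close> with the time derivative of \<open>S(u)\<close>, for which only a pointwise bound on the
  coefficients is available.\<close>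

lemma quadratic_integral_bound:
  fixes U :: "real ^ 'd \<Rightarrow> real ^ 'n"
  assumes U: "bandlimited N U" and P: "\<And>a b. continuous_on UNIV (P a b)" "\<And>a b x. \<bar>P a b x\<bar> \<le> M"
  shows "\<bar>integral torus_cell (\<lambda>x. \<Sum>a\<in>UNIV. \<Sum>b\<in>UNIV. bessel r (\<lambda>x. U x $ a) x * P a b x * bessel r (\<lambda>x. U x $ b) x)\<bar>
    \<le> real CARD('n) * M * ((2 * pi) ^ CARD('d) * (Hs_norm r U)\<^sup>2)"
proof -
  let ?g = "\<lambda>a. bessel r (\<lambda>x. U x $ a)"
  have cg: "continuous_on B (?g a)" for a B
    by (intro trig_poly_cplx_continuous trig_poly_bessel bandlimited_trig_poly[OF U])
  have cP: "continuous_on B (P a b)" for a b B by (rule continuous_on_subset[OF P(1)]) simp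
  have M: "0 \<le> M" using P(2) abs_ge_zero order_trans by blast
  have pw: "norm (\<Sum>a\<in>UNIV. \<Sum>b\<in>UNIV. ?g a x * P a b x * ?g b x) \<le> real CARD('n) * M * (\<Sum>a\<in>UNIV. (?g a x)\<^sup>2)" for x
  proof -
    have "norm (\<Sum>a\<in>UNIV. \<Sum>b\<in>UNIV. ?g a x * P a b x * ?g b x) \<le> (\<Sum>a\<in>UNIV. \<Sum>b\<in>UNIV. M * (((?g a x)\<^sup>2 + (?g b x)\<^sup>2) / 2))"
    proof (intro order_trans[OF norm_sum] sum_mono)
      fix a b
      have "\<bar>?g a x\<bar> * \<bar>?g b x\<bar> \<le> ((?g a x)\<^sup>2 + (?g b x)\<^sup>2) / 2"
        using sum_squares_bound[of "\<bar>?g a x\<bar>" "\<bar>?g b x\<bar>"] by simp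
      then have "\<bar>P a b x\<bar> * (\<bar>?g a x\<bar> * \<bar>?g b x\<bar>) \<le> M * (((?g a x)\<^sup>2 + (?g b x)\<^sup>2) / 2)"
        by (intro mult_mono P M) auto
      then show "norm (?g a x * P a b x * ?g b x) \<le> M * (((?g a x)\<^sup>2 + (?g b x)\<^sup>2) / 2)"
        by (simp add: abs_mult mult_ac)
    qed
    also have "\<dots> = M * (\<Sum>a\<in>(UNIV::'n set). \<Sum>b\<in>(UNIV::'n set). ((?g a x)\<^sup>2 + (?g b x)\<^sup>2) / 2)"
      by (simp only: sum_distrib_left)
    also have "(\<Sum>a\<in>(UNIV::'n set). \<Sum>b\<in>(UNIV::'n set). ((?g a x)\<^sup>2 + (?g b x)\<^sup>2) / 2) = real CARD('n) * (\<Sum>a\<in>UNIV. (?g a x)\<^sup>2)"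
      by (simp add: add_divide_distrib sum.distrib sum_distrib_left[symmetric] sum_divide_distrib[symmetric])
    finally show ?thesis by (simp add: mult_ac)
  qed
  have "norm (integral torus_cell (\<lambda>x. \<Sum>a\<in>UNIV. \<Sum>b\<in>UNIV. ?g a x * P a b x * ?g b x))
     \<le> integral torus_cell (\<lambda>x. real CARD('n) * M * (\<Sum>a\<in>UNIV. (?g a x)\<^sup>2))"
  proof (rule integral_norm_bound_integral)
    show "(\<lambda>x. \<Sum>a\<in>UNIV. \<Sum>b\<in>UNIV. ?g a x * P a b x * ?g b x) integrable_on torus_cell"
      unfolding torus_cell_def by (intro integrable_continuous continuous_on_sum continuous_on_mult cg cP)
    show "(\<lambda>x. real CARD('n) * M * (\<Sum>a\<in>UNIV. (?g a x)\<^sup>2)) integrable_on torus_cell"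
      unfolding torus_cell_def by (intro integrable_continuous continuous_on_sum continuous_on_mult continuous_on_power continuous_on_const cg)
  qed (rule pw)
  also have "\<dots> = real CARD('n) * M * ((2 * pi) ^ CARD('d) * (Hs_norm r U)\<^sup>2)"
    by (simp add: integral_bessel_square[OF U])
  finally show ?thesis by simp
qed

context symmetrizable_system
begin

definition energy :: "real \<Rightarrow> (real ^ 'd \<Rightarrow> real ^ 'n) \<Rightarrow> real" where
  "energy r U = integral torus_cell (\<lambda>x. \<Sum>a\<in>UNIV. \<Sum>b\<in>UNIV.
     bessel r (\<lambda>x. U x $ a) x * S (U x) $ a $ b * bessel r (\<lambda>x. U x $ b) x)"

text \<open>The part of \<open>dE/dt\<close> that comes from differentiating \<open>S(u)\<close>. The function \<open>dS a b i\<close> stands for the \<open>i\<close>-th partial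
  derivative of the entry \<open>S $ a $ b\<close>.\<close>

definition metric_rate :: "('n \<Rightarrow> 'n \<Rightarrow> 'n \<Rightarrow> real ^ 'n \<Rightarrow> real) \<Rightarrow> real \<Rightarrow> nat \<Rightarrow> (real ^ 'd \<Rightarrow> real ^ 'n) \<Rightarrow> real" where
  "metric_rate dS r N U = integral torus_cell (\<lambda>x. \<Sum>a\<in>UNIV. \<Sum>b\<in>UNIV. bessel r (\<lambda>x. U x $ a) x *
        (\<Sum>i\<in>UNIV. dS a b i (U x) * filtered_rhs A N U x $ i) * bessel r (\<lambda>x. U x $ b) x)"

text \<open>The factor \<open>(2 \<pi>)\<^sup>d\<close> is the volume of the cell, since Fourier coefficients are normalised by the mean.\<close>

lemma energy_equivalent:
  assumes U: "bandlimited N U" and c: "\<And>x v. c * (norm v)\<^sup>2 \<le> v \<bullet> (S (U x) *v v)" "\<And>x v. v \<bullet> (S (U x) *v v) \<le> C * (norm v)\<^sup>2"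
  shows "c * ((2 * pi) ^ CARD('d) * (Hs_norm r U)\<^sup>2) \<le> energy r U"
    "energy r U \<le> C * ((2 * pi) ^ CARD('d) * (Hs_norm r U)\<^sup>2)"
proof -
  let ?g = "\<lambda>a. bessel r (\<lambda>x. U x $ a)"
  have cg: "continuous_on B (?g a)" for a B
    by (intro trig_poly_cplx_continuous trig_poly_bessel bandlimited_trig_poly[OF U])
  have cS: "continuous_on B (\<lambda>x. S (U x) $ a $ b)" for a b B
    by (rule continuous_on_real_polynomial[OF S_poly bandlimited_continuous[OF U]])
  have q: "(\<Sum>a\<in>UNIV. \<Sum>b\<in>UNIV. ?g a x * S (U x) $ a $ b * ?g b x) = (\<chi> a. ?g a x) \<bullet> (S (U x) *v (\<chi> a. ?g a x))" for x
    by (simp add: quadratic_form_sum)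
  have n: "(norm (\<chi> a. ?g a x))\<^sup>2 = (\<Sum>a\<in>UNIV. (?g a x)\<^sup>2)" for x
    by (simp add: norm_vec_def L2_set_def sum_nonneg)
  have i1: "(\<lambda>x. \<Sum>a\<in>UNIV. \<Sum>b\<in>UNIV. ?g a x * S (U x) $ a $ b * ?g b x) integrable_on torus_cell"
    unfolding torus_cell_def by (intro integrable_continuous continuous_on_sum continuous_on_mult cg cS)
  have i2: "(\<lambda>x. k * (\<Sum>a\<in>UNIV. (?g a x)\<^sup>2)) integrable_on torus_cell" for k
    unfolding torus_cell_def by (intro integrable_continuous continuous_on_sum continuous_on_mult continuous_on_power continuous_on_const cg)
  have "integral torus_cell (\<lambda>x. c * (\<Sum>a\<in>UNIV. (?g a x)\<^sup>2)) \<le> energy r U"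
    unfolding energy_def by (rule integral_le[OF i2 i1]) (unfold q n[symmetric], rule c)
  then show "c * ((2 * pi) ^ CARD('d) * (Hs_norm r U)\<^sup>2) \<le> energy r U"
    by (simp add: integral_bessel_square[OF U])
  have "energy r U \<le> integral torus_cell (\<lambda>x. C * (\<Sum>a\<in>UNIV. (?g a x)\<^sup>2))"
    unfolding energy_def by (rule integral_le[OF i1 i2]) (unfold q n[symmetric], rule c)
  then show "energy r U \<le> C * ((2 * pi) ^ CARD('d) * (Hs_norm r U)\<^sup>2)"
    by (simp add: integral_bessel_square[OF U])
qed

text \<open>Differentiation under the integral over a compact cell. The two contributions of the factors \<open>\<langle>D\<rangle>\<^sup>r u\<close> agree by the
  symmetry of \<open>S(u)\<close>; this uses that \<open>u t\<close> takes its values in \<open>\<U>\<close>.\<close>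

lemma energy_has_derivative:
  assumes sol: "classical_solution A N s V0 I u" and t: "t \<in> I" and UU: "\<And>x. u t x \<in> \<U>"
    and dS: "\<And>a b i. real_polynomial_function (dS a b i)"
      "\<And>a b v. ((\<lambda>U. S U $ a $ b) has_derivative (\<lambda>h. \<Sum>i\<in>UNIV. dS a b i v * h $ i)) (at v)"
  shows "((\<lambda>t. energy r (u t)) has_real_derivative
     metric_rate dS r N (u t) + 2 * pairing_rate r N (u t)) (at t)"
proof -
  obtain ut where ut: "\<And>t x. t \<in> I \<Longrightarrow> ((\<lambda>\<tau>. u \<tau> x) has_vector_derivative ut t x) (at t)"
    and cut: "continuous_on (I \<times> UNIV) (\<lambda>(t, x). ut t x)" and cu: "continuous_on (I \<times> UNIV) (\<lambda>(t, x). u t x)"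
    and utr: "\<And>t x. t \<in> I \<Longrightarrow> ut t x = filtered_rhs A N (u t) x"
    using classical_solution_time_derivative[OF sol] by blast
  have I: "open I" "is_interval I" using sol unfolding classical_solution_def by auto
  have bu: "bandlimited N (u t)" if "t \<in> I" for t by (rule classical_solution_bandlimited[OF sol that])
  have utr': "ut t = filtered_rhs A N (u t)" if "t \<in> I" for t using utr[OF that] by auto
  have but: "bandlimited N (ut t)" if "t \<in> I" for t
    unfolding utr'[OF that] by (rule bandlimited_filtered_rhs)
  have di: "((\<lambda>\<tau>. u \<tau> x $ i) has_vector_derivative ut t x $ i) (at t)" if "t \<in> I" for t x i
    by (rule bounded_linear.has_vector_derivative[OF bounded_linear_vec_nth ut[OF that]])
  have ci: "continuous_on (I \<times> UNIV) (\<lambda>(t, x). ut t x $ i)" "continuous_on (I \<times> UNIV) (\<lambda>(t, x). u t x $ i)" for i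
    using cut cu by (auto simp: split_beta intro!: continuous_intros)
  define G where "G f a t x = Re (\<Sum>k\<in>freq_box N. of_real (japanese_bracket k powr r) * fhat (cpt (f t) a) k * character k x)"
    for f :: "real \<Rightarrow> real ^ 'd \<Rightarrow> real ^ 'n" and a t x
  have Gb: "G f a t x = bessel r (\<lambda>x. f t x $ a) x" if "bandlimited N (f t)" for f a t x
    unfolding G_def bessel_def
    by (simp only: fourier_multiplier_eq[OF bandlimited_trig_poly[OF that] finite_freq_box bandlimited_spectrum[OF that]])
  have cG: "continuous_on (I \<times> UNIV) (\<lambda>z. G f a (fst z) (snd z))"
    if "\<And>i. continuous_on (I \<times> UNIV) (\<lambda>(t, x). f t x $ i)" for f a
  proof -
    have "continuous_on (I \<times> UNIV) (\<lambda>z. fhat (cpt (f (fst z)) a) k)" for k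
      by (rule continuous_on_compose2[OF continuous_on_fhat_param[OF that] continuous_on_fst[OF continuous_on_id]]) auto
    moreover have "continuous_on (I \<times> UNIV) (\<lambda>z. character k (snd z))" for k :: "int ^ 'd"
      by (rule continuous_on_compose2[OF continuous_character[of UNIV] continuous_on_snd[OF continuous_on_id]]) auto
    ultimately show ?thesis
      unfolding G_def by (intro continuous_on_Re continuous_on_sum continuous_on_mult continuous_on_const)
  qed
  have dG: "((\<lambda>t. G u a t x) has_vector_derivative G ut a t x) (at t)" if "t \<in> I" for a t x
  proof -
    have "((\<lambda>t. fhat (cpt (u t) a) k) has_vector_derivative fhat (cpt (ut t) a) k) (at t)" for k
      by (rule has_vector_derivative_fhat_param[OF I that di ci(2,1)])
    then show ?thesis unfolding G_def
      by (intro bounded_linear.has_vector_derivative[OF bounded_linear_Re] has_vector_derivative_sum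
          has_vector_derivative_mult_left has_vector_derivative_mult_right)
  qed
  define Q where "Q a b t x = S (u t x) $ a $ b" for a b t x
  define Q' where "Q' a b t x = (\<Sum>i\<in>UNIV. dS a b i (u t x) * ut t x $ i)" for a b t x
  have cu': "continuous_on (I \<times> UNIV) (\<lambda>z. u (fst z) (snd z))" using cu by (simp add: split_beta)
  have cQ: "continuous_on (I \<times> UNIV) (\<lambda>z. Q a b (fst z) (snd z))" for a b
    unfolding Q_def by (rule continuous_on_real_polynomial[OF S_poly cu'])
  have cQ': "continuous_on (I \<times> UNIV) (\<lambda>z. Q' a b (fst z) (snd z))" for a b
    unfolding Q'_def using ci(1)
    by (intro continuous_on_sum continuous_on_mult continuous_on_real_polynomial[OF dS(1) cu']) (simp add: split_beta)
  have dQ: "((\<lambda>t. Q a b t x) has_vector_derivative Q' a b t x) (at t)" if "t \<in> I" for a b t x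
  proof -
    have "((\<lambda>t. S (u t x) $ a $ b) has_derivative (\<lambda>h. \<Sum>i\<in>UNIV. dS a b i (u t x) * (h *\<^sub>R ut t x) $ i)) (at t)"
      by (rule has_derivative_compose[OF ut[OF that, unfolded has_vector_derivative_def] dS(2)])
    moreover have "(\<Sum>i\<in>UNIV. dS a b i (u t x) * (h *\<^sub>R ut t x) $ i) = h *\<^sub>R Q' a b t x" for h
      by (simp add: Q'_def sum_distrib_left mult_ac)
    ultimately show ?thesis by (simp add: has_vector_derivative_def Q_def)
  qed
  define h where "h t x = (\<Sum>a\<in>UNIV. \<Sum>b\<in>UNIV. G u a t x * Q a b t x * G u b t x)" for t x
  define h' where "h' t x = (\<Sum>a\<in>UNIV. \<Sum>b\<in>UNIV. G u a t x * Q a b t x * G ut b t x + (G u a t x * Q' a b t x + G ut a t x * Q a b t x) * G u b t x)" for t x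
  have dh: "((\<lambda>t. h t x) has_vector_derivative h' t x) (at t)" if "t \<in> I" for t x
    unfolding h_def h'_def
    by (intro has_vector_derivative_sum has_vector_derivative_mult dG dQ that)
  note cGu = cG[OF ci(2)] and cGut = cG[OF ci(1)]
  have ch: "continuous_on (I \<times> UNIV) (\<lambda>z. h (fst z) (snd z))"
    unfolding h_def by (intro continuous_on_sum continuous_on_mult cGu cQ)
  have ch': "continuous_on (I \<times> UNIV) (\<lambda>z. h' (fst z) (snd z))"
    unfolding h'_def by (intro continuous_on_sum continuous_on_mult continuous_on_add cGu cGut cQ cQ')
  have slice: "continuous_on B (f t)" if "continuous_on (I \<times> UNIV) (\<lambda>z. f (fst z) (snd z))" "t \<in> I" for f :: "real \<Rightarrow> real ^ 'd \<Rightarrow> real" and B t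
    by (rule continuous_on_slice[OF _ that(2)]) (use that(1) in \<open>simp add: split_beta\<close>)
  have "((\<lambda>t. integral (cbox 0 (\<chi> j. 2 * pi)) (h t)) has_vector_derivative integral (cbox 0 (\<chi> j. 2 * pi)) (h' t)) (at t within I)"
  proof (rule leibniz_rule_vector_derivative[OF _ _ _ t is_interval_convex[OF I(2)]])
    show "continuous_on (I \<times> cbox 0 (\<chi> j. 2 * pi)) (\<lambda>(t, x). h' t x)"
      using continuous_on_subset[OF ch', of "I \<times> cbox 0 (\<chi> j. 2 * pi)"] by (simp add: split_beta Sigma_mono)
  qed (auto intro: has_vector_derivative_at_within dh integrable_continuous slice[OF ch])
  note L = this[unfolded at_within_open[OF t I(1)], folded torus_cell_def]
  have "((\<lambda>t. energy r (u t)) has_vector_derivative integral torus_cell (h' t)) (at t)"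
  proof (rule has_vector_derivative_transform_within_open[OF L I(1) t])
    fix t assume "t \<in> I"
    show "integral torus_cell (h t) = energy r (u t)"
      unfolding energy_def h_def[abs_def] by (simp only: Gb[of u, OF bu[OF \<open>t \<in> I\<close>]] Q_def)
  qed
  moreover have "integral torus_cell (h' t) =
     integral torus_cell (\<lambda>x. \<Sum>a\<in>UNIV. \<Sum>b\<in>UNIV. G u a t x * Q' a b t x * G u b t x)
     + 2 * integral torus_cell (\<lambda>x. \<Sum>a\<in>UNIV. G ut a t x * (\<Sum>b\<in>UNIV. Q a b t x * G u b t x))"
  proof -
    have sym: "Q a b t x = Q b a t x" for a b x
      unfolding Q_def using arg_cong[where f = "\<lambda>M. M $ b $ a", OF S_sym[OF UU[of x]]]
      by (simp only: transpose_def vec_lambda_beta)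
    have e: "h' t x = (\<Sum>a\<in>UNIV. \<Sum>b\<in>UNIV. G u a t x * Q' a b t x * G u b t x)
       + 2 * (\<Sum>a\<in>UNIV. G ut a t x * (\<Sum>b\<in>UNIV. Q a b t x * G u b t x))" for x
    proof -
      have "(\<Sum>a\<in>UNIV. \<Sum>b\<in>UNIV. G u a t x * Q a b t x * G ut b t x) = (\<Sum>b\<in>UNIV. \<Sum>a\<in>UNIV. G u a t x * Q a b t x * G ut b t x)"
        by (rule sum.swap)
      also have "\<dots> = (\<Sum>b\<in>UNIV. \<Sum>a\<in>UNIV. G ut b t x * Q b a t x * G u a t x)"
        by (intro sum.cong refl) (simp only: sym[of _ _ x] mult_ac)
      finally have swap: "(\<Sum>a\<in>UNIV. \<Sum>b\<in>UNIV. G u a t x * Q a b t x * G ut b t x)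
        = (\<Sum>b\<in>UNIV. \<Sum>a\<in>UNIV. G ut b t x * Q b a t x * G u a t x)" .
      show ?thesis
        unfolding h'_def sum.distrib distrib_right swap by (simp add: sum_distrib_left mult.assoc)
    qed
    have i1: "(\<lambda>x. \<Sum>a\<in>UNIV. \<Sum>b\<in>UNIV. G u a t x * Q' a b t x * G u b t x) integrable_on torus_cell"
      and i2: "(\<lambda>x. 2 * (\<Sum>a\<in>UNIV. G ut a t x * (\<Sum>b\<in>UNIV. Q a b t x * G u b t x))) integrable_on torus_cell"
      unfolding torus_cell_def
      by (intro integrable_continuous continuous_on_sum continuous_on_mult continuous_on_const slice[OF cGu t] slice[OF cGut t] slice[OF cQ t] slice[OF cQ' t])+
    show ?thesis unfolding e by (subst integral_add[OF i1 i2]) simp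
  qed
  ultimately show ?thesis
    unfolding has_real_derivative_iff_has_vector_derivative
    by (simp only: metric_rate_def pairing_rate_def Gb[of u, OF bu[OF t]] Gb[of ut, OF but[OF t]] Q_def Q'_def utr'[OF t])
qed

lemma energy_rate_bound:
  assumes r: "1 \<le> r" and R: "0 \<le> R"
    and dS: "\<And>a b i. real_polynomial_function (dS a b i)"
  shows "\<exists>C\<ge>0. \<forall>N U w. bandlimited N U \<and> (\<forall>x. U x \<in> \<U>) \<and> (\<forall>i. wiener_norm 1 (cpt U i) \<le> w) \<and> w \<le> R \<longrightarrow>
    \<bar>metric_rate dS r N U + 2 * pairing_rate r N U\<bar> \<le> C * w * (Hs_norm r U)\<^sup>2"
proof -
  obtain C1 where C1: "C1 \<ge> 0" and H1: "\<forall>N U w. bandlimited N U \<and> (\<forall>x. U x \<in> \<U>) \<and> (\<forall>i. wiener_norm 1 (cpt U i) \<le> w) \<and> w \<le> R \<longrightarrow>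
    \<bar>pairing_rate r N U\<bar> \<le> C1 * w * (Hs_norm r U)\<^sup>2"
    using energy_pairing_rate[OF r R] by (elim exE conjE) (rule that)
  obtain C2 where C2: "C2 > 0" and H2: "\<forall>N U w. bandlimited N U \<and> (\<forall>i. wiener_norm 1 (cpt U i) \<le> w) \<and> w \<le> R \<longrightarrow>
     (\<forall>a. wiener_norm 0 (cpt (filtered_rhs A N U) a) \<le> C2 * w)"
    using filtered_rhs_wiener_bound[of A, OF A_poly R] by (elim exE conjE) (rule that)
  note polynomial_family_wiener_bound[where P = "\<lambda>p. dS (fst p) (fst (snd p)) (snd (snd p))" and 'd = 'd, OF dS R]
  then obtain C3 where C3: "C3 \<ge> 0" and H3: "\<And>a b i (U :: real ^ 'd \<Rightarrow> real ^ 'n).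
     (\<forall>i. trig_poly (cpt U i) \<and> wiener_norm 1 (cpt U i) \<le> R) \<Longrightarrow> wiener_norm 0 (\<lambda>x. complex_of_real (dS a b i (U x))) \<le> C3"
    by (metis fst_conv snd_conv)
  define C where "C = real CARD('n) * (real CARD('n) * (C3 * C2)) * (2 * pi) ^ CARD('d) + 2 * C1"
  have "\<bar>metric_rate dS r N U + 2 * pairing_rate r N U\<bar> \<le> C * w * (Hs_norm r U)\<^sup>2"
    if H: "bandlimited N U \<and> (\<forall>x. U x \<in> \<U>) \<and> (\<forall>i. wiener_norm 1 (cpt U i) \<le> w) \<and> w \<le> R" for N U w
  proof -
    have U: "bandlimited N U" and w: "\<forall>i. wiener_norm 1 (cpt U i) \<le> w" "w \<le> R" using H by auto
    have w0: "0 \<le> w" using w wiener_norm_nonneg order_trans by blast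
    have tpU: "trig_poly (cpt U i)" for i by (rule bandlimited_trig_poly[OF U])
    have hypR: "\<forall>i. trig_poly (cpt U i) \<and> wiener_norm 1 (cpt U i) \<le> R" using tpU w order_trans by blast
    have bd: "\<bar>\<Sum>i\<in>UNIV. dS a b i (U x) * filtered_rhs A N U x $ i\<bar> \<le> real CARD('n) * (C3 * C2) * w" for a b x
    proof -
      have "\<bar>\<Sum>i\<in>UNIV. dS a b i (U x) * filtered_rhs A N U x $ i\<bar> \<le> (\<Sum>i\<in>(UNIV::'n set). C3 * (C2 * w))"
      proof (intro order_trans[OF sum_abs] sum_mono)
        fix i
        have "\<bar>dS a b i (U x)\<bar> = norm (complex_of_real (dS a b i (U x)))" by simp
        also have "\<dots> \<le> wiener_norm 0 (\<lambda>x. complex_of_real (dS a b i (U x)))"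
          by (rule norm_le_wiener_norm[OF trig_poly_real_polynomial[where p = "dS a b i" and U = U, OF dS tpU]])
        also have "\<dots> \<le> C3" by (rule H3[OF hypR])
        finally have 1: "\<bar>dS a b i (U x)\<bar> \<le> C3" .
        have "\<bar>filtered_rhs A N U x $ i\<bar> = norm (complex_of_real (filtered_rhs A N U x $ i))" by simp
        also have "\<dots> \<le> wiener_norm 0 (cpt (filtered_rhs A N U) i)"
          by (rule norm_le_wiener_norm[OF bandlimited_trig_poly[OF bandlimited_filtered_rhs]])
        also have "\<dots> \<le> C2 * w" using H2 U w by blast
        finally have 2: "\<bar>filtered_rhs A N U x $ i\<bar> \<le> C2 * w" .
        show "\<bar>dS a b i (U x) * filtered_rhs A N U x $ i\<bar> \<le> C3 * (C2 * w)"
          unfolding abs_mult by (intro mult_mono 1 2 C3) simp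
      qed
      then show ?thesis by (simp add: mult_ac)
    qed
    have cont: "continuous_on UNIV (\<lambda>x. \<Sum>i\<in>UNIV. dS a b i (U x) * filtered_rhs A N U x $ i)" for a b
      by (intro continuous_on_sum continuous_on_mult continuous_on_real_polynomial[OF dS bandlimited_continuous[OF U]]
          trig_poly_cplx_continuous bandlimited_trig_poly[OF bandlimited_filtered_rhs])
    have add: "\<bar>X + 2 * Y\<bar> \<le> p + 2 * q" if "\<bar>X\<bar> \<le> p" "\<bar>Y\<bar> \<le> q" for X Y p q :: real
      using that by linarith
    note add[OF quadratic_integral_bound[where P = "\<lambda>a b x. \<Sum>i\<in>UNIV. dS a b i (U x) * filtered_rhs A N U x $ i" and r = r, OF U cont bd]
        H1[rule_format, OF H], folded metric_rate_def]
    also have "real CARD('n) * (real CARD('n) * (C3 * C2) * w) * ((2 * pi) ^ CARD('d) * (Hs_norm r U)\<^sup>2) + 2 * (C1 * w * (Hs_norm r U)\<^sup>2)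
        = C * w * (Hs_norm r U)\<^sup>2"
      unfolding C_def by (simp only: algebra_simps)
    finally show ?thesis .
  qed
  moreover have "0 \<le> C" unfolding C_def using C1 C2 C3 by simp
  ultimately show ?thesis by blast
qed

text \<open>The bound is required with the rate \<open>C * w\<close> for every \<open>w\<close> below \<open>R\<close>, and not only with the rate \<open>C * R\<close>: with \<open>w\<close>
  proportional to the size of the data it holds over times inversely proportional to that size.\<close>

definition energy_growth :: "(real ^ 'n) set \<Rightarrow> real \<Rightarrow> real \<Rightarrow> real \<Rightarrow> real \<Rightarrow> bool" where
  "energy_growth K \<kappa> r R C \<longleftrightarrow> (\<forall>N s V0 I u T w.
     classical_solution A N s V0 I u \<and> {0..T} \<subseteq> I \<and> w \<le> R \<and>
     (\<forall>t\<in>{0..T}. (\<forall>x. u t x \<in> K) \<and> (\<forall>i. wiener_norm 1 (cpt (u t) i) \<le> w)) \<longrightarrow>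
     (\<forall>t\<in>{0..T}. Hs_norm r (u t) \<le> \<kappa> * Hs_norm r (u 0) * exp (C * w * t)))"

text \<open>The energy estimate. The factor \<open>\<kappa>\<close> only compares \<open>S\<close> with the identity on \<open>K\<close>; it does not depend on the bound
  \<open>R\<close>, and this is what allows \<open>R\<close> to be chosen in terms of \<open>\<kappa>\<close> in the continuation argument.\<close>

lemma energy_estimate:
  assumes K: "compact K" "K \<subseteq> \<U>"
  shows "\<exists>\<kappa>\<ge>1. \<forall>r\<ge>1. \<forall>R\<ge>0. \<exists>C>0. energy_growth K \<kappa> r R C"
proof -
  obtain c0 C0 where c: "c0 > 0" "C0 > 0"
    and cb: "\<And>U v. U \<in> K \<Longrightarrow> c0 * (norm v)\<^sup>2 \<le> v \<bullet> (S U *v v)" "\<And>U v. U \<in> K \<Longrightarrow> v \<bullet> (S U *v v) \<le> C0 * (norm v)\<^sup>2"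
    using symmetrizer_bounds[OF K] by blast
  define \<kappa> where "\<kappa> = sqrt (max 1 (C0 / c0))"
  have \<kappa>: "1 \<le> \<kappa>" "\<kappa>\<^sup>2 \<ge> C0 / c0" by (simp_all add: \<kappa>_def)
  have "\<forall>a b. \<exists>dp. (\<forall>i. real_polynomial_function (dp i)) \<and> (\<forall>x. ((\<lambda>U. S U $ a $ b) has_derivative (\<lambda>h. \<Sum>i\<in>UNIV. dp i x * h $ i)) (at x))"
    using polynomial_gradient[OF S_poly] by blast
  from this[unfolded choice_iff] obtain dS where dS': "\<forall>a b. (\<forall>i. real_polynomial_function (dS a b i)) \<and>
      (\<forall>v. ((\<lambda>U. S U $ a $ b) has_derivative (\<lambda>h. \<Sum>i\<in>UNIV. dS a b i v * h $ i)) (at v))"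
    by (elim exE) (rule that)
  have dS: "real_polynomial_function (dS a b i)"
      "((\<lambda>U. S U $ a $ b) has_derivative (\<lambda>h. \<Sum>i\<in>UNIV. dS a b i v * h $ i)) (at v)" for a b i v
    by (rule dS'[rule_format, THEN conjunct1, rule_format]) (rule dS'[rule_format, THEN conjunct2, rule_format])
  let ?vol = "(2 * pi) ^ CARD('d)"
  have vol: "0 < ?vol" by simp
  show ?thesis
  proof (rule exI[of _ \<kappa>], intro conjI \<kappa>(1) allI impI)
    fix r R :: real assume r: "1 \<le> r" and R: "0 \<le> R"
    let ?E' = "\<lambda>N U. metric_rate dS r N U + 2 * pairing_rate r N U"
    obtain C1 where C1: "C1 \<ge> 0" and H1: "\<forall>N U w. bandlimited N U \<and> (\<forall>x. U x \<in> \<U>) \<and> (\<forall>i. wiener_norm 1 (cpt U i) \<le> w) \<and> w \<le> R \<longrightarrow>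
       \<bar>?E' N U\<bar> \<le> C1 * w * (Hs_norm r U)\<^sup>2"
      using energy_rate_bound[where dS = dS, OF r R dS(1)] by (elim exE conjE) (rule that)
    define C where "C = C1 / (c0 * ?vol) + 1"
    have C: "C > 0" using C1 c by (simp add: C_def add_nonneg_pos)
    show "\<exists>C>0. energy_growth K \<kappa> r R C"
      unfolding energy_growth_def
    proof (rule exI[of _ C], intro conjI C allI impI ballI)
      fix N s V0 I u T w t
      assume H: "classical_solution A N s V0 I u \<and> {0..T} \<subseteq> I \<and> w \<le> R \<and>
        (\<forall>t\<in>{0..T}. (\<forall>x. u t x \<in> K) \<and> (\<forall>i. wiener_norm 1 (cpt (u t) i) \<le> w))" and t: "t \<in> {0..T}"
      have sol: "classical_solution A N s V0 I u" and TI: "{0..T} \<subseteq> I" and wR: "w \<le> R" using H by auto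
      have uK: "u \<tau> x \<in> K" if "\<tau> \<in> {0..T}" for \<tau> x using H that by blast
      have W1: "\<forall>i. wiener_norm 1 (cpt (u \<tau>) i) \<le> w" if "\<tau> \<in> {0..T}" for \<tau> using H that by blast
      have w0: "0 \<le> w" using W1[OF t] wiener_norm_nonneg order_trans by blast
      let ?E = "\<lambda>\<tau>. energy r (u \<tau>)"
      have bu: "bandlimited N (u \<tau>)" if "\<tau> \<in> {0..T}" for \<tau>
        using classical_solution_bandlimited[OF sol] TI that by blast
      have eq: "c0 * (?vol * (Hs_norm r (u \<tau>))\<^sup>2) \<le> ?E \<tau>" "?E \<tau> \<le> C0 * (?vol * (Hs_norm r (u \<tau>))\<^sup>2)" if "\<tau> \<in> {0..T}" for \<tau>
        by (rule energy_equivalent[OF bu[OF that]], rule cb[OF uK[OF that]], rule cb[OF uK[OF that]])+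
      have dE: "(?E has_real_derivative ?E' N (u \<tau>)) (at \<tau>)" if "\<tau> \<in> {0..T}" for \<tau>
        by (rule energy_has_derivative[OF sol _ _ dS]) (use that TI uK[OF that] K in auto)
      have E'b: "?E' N (u \<tau>) \<le> (2 * (C * w)) * ?E \<tau>" if "\<tau> \<in> {0..T}" for \<tau>
      proof -
        have E0: "0 \<le> ?E \<tau>" using eq(1)[OF that] c vol by (meson mult_nonneg_nonneg less_imp_le order_trans zero_le_power2)
        have "?E' N (u \<tau>) \<le> C1 * w * (Hs_norm r (u \<tau>))\<^sup>2"
          using H1[rule_format, of N "u \<tau>" w] bu[OF that] uK[OF that] K(2) W1[OF that] wR
          by (meson abs_le_D1 subsetD)
        also have "\<dots> = (C1 / (c0 * ?vol)) * w * (c0 * (?vol * (Hs_norm r (u \<tau>))\<^sup>2))"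
          using c(1) vol by simp
        also have "\<dots> \<le> (C1 / (c0 * ?vol)) * w * ?E \<tau>"
          by (intro mult_left_mono eq(1)[OF that]) (use C1 c w0 in auto)
        also have "\<dots> \<le> (2 * (C * w)) * ?E \<tau>"
        proof (rule mult_right_mono[OF _ E0])
          have "(C1 / (c0 * ?vol)) * w \<le> C * w" by (rule mult_right_mono[OF _ w0]) (simp add: C_def)
          then show "(C1 / (c0 * ?vol)) * w \<le> 2 * (C * w)" using C w0 mult_nonneg_nonneg[of C w] by linarith
        qed
        finally show ?thesis .
      qed
      \<comment> \<open>Gronwall's inequality: \<open>E\<close> times the decaying exponential is nonincreasing.\<close>
      have "?E t * exp (- (2 * (C * w)) * t) \<le> ?E 0 * exp (- (2 * (C * w)) * 0)"
      proof (rule DERIV_nonpos_imp_nonincreasing[where f = "\<lambda>\<tau>. ?E \<tau> * exp (- (2 * (C * w)) * \<tau>)" and a = 0 and b = t])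
        show "0 \<le> t" using t by simp
        fix \<tau> assume "0 \<le> \<tau>" "\<tau> \<le> t"
        then have \<tau>: "\<tau> \<in> {0..T}" using t by simp
        have "((\<lambda>\<tau>. exp (- (2 * (C * w)) * \<tau>)) has_real_derivative - (2 * (C * w)) * exp (- (2 * (C * w)) * \<tau>)) (at \<tau>)"
          by (auto intro!: derivative_eq_intros)
        note D = DERIV_mult[OF dE[OF \<tau>] this]
        have alg: "p * e + (- k * e) * q = (p - k * q) * e" for p q e k :: real
          by (simp add: algebra_simps)
        have "((\<lambda>\<tau>. ?E \<tau> * exp (- (2 * (C * w)) * \<tau>)) has_real_derivative
            (?E' N (u \<tau>) - (2 * (C * w)) * ?E \<tau>) * exp (- (2 * (C * w)) * \<tau>)) (at \<tau>)"
          by (rule DERIV_cong[OF D alg])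
        moreover have "(?E' N (u \<tau>) - (2 * (C * w)) * ?E \<tau>) * exp (- (2 * (C * w)) * \<tau>) \<le> 0"
          using E'b[OF \<tau>] by (intro mult_nonpos_nonneg) auto
        ultimately show "\<exists>y. ((\<lambda>\<tau>. ?E \<tau> * exp (- (2 * (C * w)) * \<tau>)) has_real_derivative y) (at \<tau>) \<and> y \<le> 0" by blast
      qed
      then have "?E t \<le> ?E 0 * exp (2 * (C * w) * t)"
        by (simp add: exp_minus field_simps)
      then have "c0 * (?vol * (Hs_norm r (u t))\<^sup>2) \<le> C0 * (?vol * (Hs_norm r (u 0))\<^sup>2) * exp (2 * (C * w) * t)"
      proof (intro order_trans[OF eq(1)[OF t]] order_trans[OF _ mult_right_mono[OF eq(2)[of 0]]])
        show "0 \<in> {0..T}" using t by simp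
      qed auto
      then have "(Hs_norm r (u t))\<^sup>2 \<le> (C0 / c0) * ((Hs_norm r (u 0))\<^sup>2 * exp (2 * (C * w) * t))"
        using c(1) vol by (simp add: field_simps)
      also have "\<dots> \<le> \<kappa>\<^sup>2 * ((Hs_norm r (u 0))\<^sup>2 * exp (2 * (C * w) * t))"
        by (rule mult_right_mono[OF \<kappa>(2)]) simp
      also have "\<dots> = (\<kappa> * Hs_norm r (u 0) * exp (C * w * t))\<^sup>2"
        by (simp add: power_mult_distrib exp_double[symmetric] mult_ac)
      finally show "Hs_norm r (u t) \<le> \<kappa> * Hs_norm r (u 0) * exp (C * w * t)"
        by (rule power2_le_imp_le) (use \<kappa>(1) in \<open>simp add: Hs_norm_nonneg\<close>)
    qed
  qed
qed

end

section \<open>Ordinary differential equations in Banach spaces\<close>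

definition lipschitz_on_balls :: "('a::real_normed_vector \<Rightarrow> 'b::real_normed_vector) \<Rightarrow> bool" where
  "lipschitz_on_balls f \<longleftrightarrow> (\<forall>R. \<exists>L\<ge>0. \<forall>x y. norm x \<le> R \<longrightarrow> norm y \<le> R \<longrightarrow> norm (f x - f y) \<le> L * norm (x - y))"

definition ode_solution :: "('a::real_normed_vector \<Rightarrow> 'a) \<Rightarrow> 'a \<Rightarrow> real set \<Rightarrow> (real \<Rightarrow> 'a) \<Rightarrow> bool" where
  "ode_solution f x0 I y \<longleftrightarrow> open I \<and> is_interval I \<and> 0 \<in> I \<and> y 0 = x0 \<and>
     (\<forall>t\<in>I. (y has_vector_derivative f (y t)) (at t))"

lemma lipschitz_on_balls_continuous:
  assumes "lipschitz_on_balls f" shows "continuous_on UNIV f"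
proof -
  have "isCont f x" for x
  proof -
    obtain L where L: "L \<ge> 0" "\<And>y z. norm y \<le> norm x + 1 \<Longrightarrow> norm z \<le> norm x + 1 \<Longrightarrow> norm (f y - f z) \<le> L * norm (y - z)"
      using assms unfolding lipschitz_on_balls_def by blast
    have "continuous_on (ball x 1) f"
    proof (rule lipschitz_on_continuous_on)
      show "L-lipschitz_on (ball x 1) f"
      proof (rule lipschitz_onI[OF _ L(1)])
        fix y z assume yz: "y \<in> ball x 1" "z \<in> ball x 1"
        then have "norm y \<le> norm x + 1" "norm z \<le> norm x + 1"
          using norm_triangle_sub[of y x] norm_triangle_sub[of z x] by (auto simp: dist_norm norm_minus_commute)
        then show "dist (f y) (f z) \<le> L * dist y z" using L(2) by (simp add: dist_norm)
      qed
    qed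
    then show ?thesis by (simp add: continuous_on_eq_continuous_at)
  qed
  then show ?thesis by (simp add: continuous_at_imp_continuous_on)
qed

lemma norm_integral_difference_le:
  fixes g :: "real \<Rightarrow> 'a::banach"
  assumes g: "continuous_on {a..b} g" and B: "\<And>t. t \<in> {a..b} \<Longrightarrow> norm (g t) \<le> B"
    and st: "s \<in> {a..b}" "t \<in> {a..b}"
  shows "norm (integral {a..t} g - integral {a..s} g) \<le> B * \<bar>t - s\<bar>"
proof -
  have main: "norm (integral {a..t} g - integral {a..s} g) \<le> B * (t - s)" if "s \<le> t" "a \<le> s" "t \<le> b" for s t
  proof -
    have sub: "continuous_on {c..d} g" if "a \<le> c" "d \<le> b" for c d
      by (rule continuous_on_subset[OF g]) (use that in auto)
    have "integral {a..s} g + integral {s..t} g = integral {a..t} g"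
      by (rule Henstock_Kurzweil_Integration.integral_combine) (use that in \<open>auto intro!: integrable_continuous_real sub\<close>)
    then have "integral {a..t} g - integral {a..s} g = integral {s..t} g" by (simp add: algebra_simps)
    moreover have "norm (integral {s..t} g) \<le> B * (t - s)"
      by (rule integral_bound) (use that B sub in auto)
    ultimately show ?thesis by simp
  qed
  show ?thesis
  proof (cases "s \<le> t")
    case True then show ?thesis using main[of s t] st by simp
  next
    case False then show ?thesis using main[of t s] st by (simp add: norm_minus_commute)
  qed
qed

text \<open>The Picard--Lindelof theorem, with an existence time uniform on balls.\<close>

lemma picard_lindelof:
  fixes f :: "'a::banach \<Rightarrow> 'a"
  assumes f: "lipschitz_on_balls f"
  shows "\<exists>h>0. \<forall>x0. norm x0 \<le> R \<longrightarrow> (\<exists>y. y 0 = x0 \<and> (\<forall>t. \<bar>t\<bar> < h \<longrightarrow> (y has_vector_derivative f (y t)) (at t)))"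
proof -
  obtain L where L: "L \<ge> 0" and lip: "\<And>x y. norm x \<le> R + 1 \<Longrightarrow> norm y \<le> R + 1 \<Longrightarrow> norm (f x - f y) \<le> L * norm (x - y)"
    using f unfolding lipschitz_on_balls_def by blast
  have cf: "continuous_on UNIV f" by (rule lipschitz_on_balls_continuous[OF f])
  define B where "B = norm (f 0) + L * (\<bar>R\<bar> + 1) + 1"
  have B1: "1 \<le> B" using L by (simp add: B_def)
  define h where "h = min (1 / B) (1 / (2 * (L + 1)))"
  have h: "0 < h" using B1 L by (simp add: h_def)
  have hB: "B * h \<le> 1"
    using mult_left_mono[of h "1 / B" B] B1 by (simp add: h_def)
  have hL: "L * h \<le> 1 / 2"
  proof -
    have "(L + 1) * h \<le> (L + 1) * (1 / (2 * (L + 1)))" using L by (intro mult_left_mono) (auto simp: h_def)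
    also have "\<dots> = 1 / 2" using L by simp
    finally show ?thesis using h by (simp add: algebra_simps)
  qed
  show ?thesis
  proof (intro exI[of _ h] conjI h allI impI)
    fix x0 :: 'a assume x0: "norm x0 \<le> R"
    then have R0: "0 \<le> R" using norm_ge_zero order_trans by blast
    have near: "norm y \<le> R + 1" if "norm (y - x0) \<le> 1" for y
      using norm_triangle_sub[of y x0] x0 that by simp
    have fB: "norm (f y) \<le> B" if "norm (y - x0) \<le> 1" for y
    proof -
      have "norm (f y) \<le> norm (f 0) + norm (f y - f 0)" using norm_triangle_sub[of "f y" "f 0"] by simp
      also have "norm (f y - f 0) \<le> L * norm (y - 0)" by (rule lip) (use near[OF that] R0 in auto)
      also have "L * norm (y - 0) \<le> L * (\<bar>R\<bar> + 1)" using near[OF that] L by (intro mult_left_mono) auto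
      finally show ?thesis by (simp add: B_def)
    qed
    define X where "X = {y :: real \<Rightarrow>\<^sub>C 'a. \<forall>t. norm (y t - x0) \<le> 1}"
    define c where "c t = max (- h) (min h t)" for t
    have ch: "c t \<in> {- h..h}" "c 0 = 0" "\<bar>c t - c s\<bar> \<le> \<bar>t - s\<bar>" "\<bar>c t\<bar> \<le> h" for t s
      using h by (auto simp: c_def)
    have c_id: "c t = t" if "\<bar>t\<bar> \<le> h" for t using that by (auto simp: c_def)
    define J where "J y t = x0 + (integral {- h..c t} (\<lambda>\<tau>. f (apply_bcontfun y \<tau>)) - integral {- h..0} (\<lambda>\<tau>. f (apply_bcontfun y \<tau>)))" for y t
    have cy: "continuous_on A (\<lambda>\<tau>. f (apply_bcontfun y \<tau>))" for y A
      by (rule continuous_on_compose2[OF cf]) auto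
    have J_lip: "norm (J y t - J y s) \<le> B * \<bar>t - s\<bar>" if "y \<in> X" for y t s
    proof -
      have "norm (J y t - J y s) \<le> B * \<bar>c t - c s\<bar>"
        unfolding J_def using norm_integral_difference_le[OF cy, of "-h" h y B "c s" "c t"] ch fB that by (simp add: X_def)
      also have "\<dots> \<le> B * \<bar>t - s\<bar>" using ch B1 by (intro mult_left_mono) auto
      finally show ?thesis .
    qed
    have J0: "norm (J y t - x0) \<le> 1" if "y \<in> X" for y t
    proof -
      have "norm (J y t - x0) \<le> B * \<bar>c t - 0\<bar>"
        unfolding J_def using norm_integral_difference_le[OF cy, of "-h" h y B 0 "c t"] ch fB that h by (simp add: X_def)
      also have "\<dots> \<le> B * h" using ch B1 by (intro mult_left_mono) auto
      finally show ?thesis using hB by simp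
    qed
    have Jb: "J y \<in> bcontfun" if "y \<in> X" for y
    proof -
      have "continuous_on UNIV (J y)"
        by (rule lipschitz_on_continuous_on[OF lipschitz_onI[of _ _ B]]) (use J_lip[OF that] B1 in \<open>auto simp: dist_norm\<close>)
      moreover have "bounded (range (J y))"
      proof (rule boundedI)
        fix v assume "v \<in> range (J y)"
        then obtain t where "v = J y t" by blast
        then show "norm v \<le> norm x0 + 1" using J0[OF that, of t] norm_triangle_sub[of "J y t" x0] by simp
      qed
      ultimately show ?thesis by (simp add: bcontfun_def)
    qed
    define \<Phi> where "\<Phi> y = Bcontfun (J y)" for y
    have \<Phi>: "apply_bcontfun (\<Phi> y) = J y" if "y \<in> X" for y
      unfolding \<Phi>_def by (rule Bcontfun_inverse[OF Jb[OF that]])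
    have "\<exists>!y. y \<in> X \<and> \<Phi> y = y"
    proof (rule Banach_fix[of X "1 / 2" \<Phi>])
      have "closed X"
      proof -
        have "X = PiC UNIV (\<lambda>_. cball x0 1)"
          by (simp add: set_eq_iff X_def mem_PiC_iff dist_norm norm_minus_commute[of x0] Pi_iff)
        then show ?thesis by (simp add: closed_PiC)
      qed
      then show "complete X" by (simp add: complete_eq_closed)
      have "const_bcontfun x0 \<in> X" by (simp add: X_def const_bcontfun.rep_eq)
      then show "X \<noteq> {}" by blast
      show "\<Phi> ` X \<subseteq> X" using J0 \<Phi> by (auto simp: X_def)
      show "dist (\<Phi> y) (\<Phi> z) \<le> 1 / 2 * dist y z" if yz: "y \<in> X" "z \<in> X" for y z
      proof (rule dist_bound)
        fix t
        let ?g = "\<lambda>\<tau>. f (apply_bcontfun y \<tau>) - f (apply_bcontfun z \<tau>)"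
        have int: "(\<lambda>\<tau>. f (apply_bcontfun y \<tau>)) integrable_on {a..b}" for y :: "real \<Rightarrow>\<^sub>C 'a" and a b :: real
          by (intro integrable_continuous_real cy)
        have e: "J y t - J z t = integral {- h..c t} ?g - integral {- h..0} ?g"
          unfolding J_def by (subst (1 2) integral_diff[OF int int]) (simp add: algebra_simps)
        have "norm (J y t - J z t) \<le> (L * dist y z) * \<bar>c t - 0\<bar>"
          unfolding e
        proof (rule norm_integral_difference_le[where b = h])
          fix \<tau>
          have "norm (?g \<tau>) \<le> L * norm (apply_bcontfun y \<tau> - apply_bcontfun z \<tau>)"
            using yz by (intro lip near) (auto simp: X_def)
          also have "\<dots> \<le> L * dist y z" using dist_bounded[of y \<tau> z] L by (intro mult_left_mono) (auto simp: dist_norm)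
          finally show "norm (?g \<tau>) \<le> L * dist y z" .
        qed (use ch h in \<open>auto intro!: continuous_intros cy\<close>)
        also have "\<dots> \<le> (L * dist y z) * h" using ch L by (intro mult_left_mono) auto
        also have "\<dots> = (L * h) * dist y z" by simp
        also have "\<dots> \<le> 1 / 2 * dist y z" by (rule mult_right_mono[OF hL]) simp
        finally show "dist (apply_bcontfun (\<Phi> y) t) (apply_bcontfun (\<Phi> z) t) \<le> 1 / 2 * dist y z"
          using yz by (simp add: \<Phi> dist_norm)
      qed
    qed auto
    then obtain y where yX: "y \<in> X" and y: "\<Phi> y = y" by blast
    have yJ: "apply_bcontfun y t = J y t" for t using \<Phi>[OF yX] y by simp
    show "\<exists>y. y 0 = x0 \<and> (\<forall>t. \<bar>t\<bar> < h \<longrightarrow> (y has_vector_derivative f (y t)) (at t))"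
    proof (intro exI[of _ "apply_bcontfun y"] conjI allI impI)
      show "apply_bcontfun y 0 = x0" using yJ[of 0] ch(2) by (simp add: J_def)
      fix t assume t: "\<bar>t\<bar> < h"
      let ?F = "\<lambda>\<tau>. f (apply_bcontfun y \<tau>)"
      have tin: "t \<in> {- h<..<h}" using t by auto
      have "((\<lambda>u. integral {- h..u} ?F) has_vector_derivative ?F t) (at t within {- h..h})"
        by (rule integral_has_vector_derivative[OF cy]) (use t in auto)
      then have "((\<lambda>u. integral {- h..u} ?F) has_vector_derivative ?F t) (at t within {- h<..<h})"
        by (rule has_vector_derivative_within_subset) auto
      then have "((\<lambda>u. integral {- h..u} ?F) has_vector_derivative ?F t) (at t)"
        by (simp only: at_within_open[OF tin open_greaterThanLessThan])
      then have "((\<lambda>u. x0 + (integral {- h..u} ?F - integral {- h..0} ?F)) has_vector_derivative 0 + (?F t - 0)) (at t)"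
        by (intro has_vector_derivative_add has_vector_derivative_diff has_vector_derivative_const)
      then have "((\<lambda>u. x0 + (integral {- h..u} ?F - integral {- h..0} ?F)) has_vector_derivative ?F t) (at t)"
        by simp
      then show "(apply_bcontfun y has_vector_derivative ?F t) (at t)"
      proof (rule has_vector_derivative_transform_within_open[OF _ open_greaterThanLessThan tin])
        fix s assume "s \<in> {- h<..<h}"
        then have "\<bar>s\<bar> \<le> h" by auto
        then show "x0 + (integral {- h..s} ?F - integral {- h..0} ?F) = apply_bcontfun y s"
          using yJ[of s] c_id[of s] by (simp add: J_def)
      qed
    qed
  qed
qed

lemma vector_derivative_bound:
  fixes y :: "real \<Rightarrow> 'a::real_normed_vector"
  assumes "convex S" "\<And>t. t \<in> S \<Longrightarrow> (y has_vector_derivative y' t) (at t)" "\<And>t. t \<in> S \<Longrightarrow> norm (y' t) \<le> B"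
    "s \<in> S" "t \<in> S"
  shows "norm (y t - y s) \<le> B * \<bar>t - s\<bar>"
proof -
  have "norm (y t - y s) \<le> B * norm (t - s)"
  proof (rule differentiable_bound[OF assms(1)])
    fix \<tau> assume \<tau>: "\<tau> \<in> S"
    show "(y has_derivative (\<lambda>h. h *\<^sub>R y' \<tau>)) (at \<tau> within S)"
      using assms(2)[OF \<tau>] by (auto simp: has_vector_derivative_def intro: has_derivative_at_withinI)
    show "onorm (\<lambda>h. h *\<^sub>R y' \<tau>) \<le> B"
    proof (rule onorm_le)
      fix h :: real
      show "norm (h *\<^sub>R y' \<tau>) \<le> B * norm h"
        using mult_left_mono[OF assms(3)[OF \<tau>], of "\<bar>h\<bar>"] by (simp add: mult.commute)
    qed
  qed (use assms in auto)
  then show ?thesis by simp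
qed

text \<open>Connectedness of the interval: the set where two solutions agree is closed, and it is open because on an interval of
  length less than \<open>1/L\<close> the maximum of their distance is at most half of itself.\<close>

lemma ode_unique:
  fixes f :: "'a::real_normed_vector \<Rightarrow> 'a"
  assumes f: "lipschitz_on_balls f" and I: "open I" "is_interval I" "t0 \<in> I"
    and y: "\<And>t. t \<in> I \<Longrightarrow> (y has_vector_derivative f (y t)) (at t)"
    and z: "\<And>t. t \<in> I \<Longrightarrow> (z has_vector_derivative f (z t)) (at t)"
    and eq: "y t0 = z t0" and t: "t \<in> I"
  shows "y t = z t"
proof -
  have con: "connected I" using I(2) by (simp add: is_interval_connected_1)
  have cy: "continuous_on I y" and cz: "continuous_on I z"
    using y z by (auto intro!: continuous_at_imp_continuous_on has_vector_derivative_continuous)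
  have loc: "\<exists>T. openin (top_of_set I) T \<and> a \<in> T \<and> (\<forall>x\<in>T. y x = z x)" if a: "a \<in> I" "y a = z a" for a
  proof -
    define R where "R = norm (y a) + 1"
    obtain L where L: "L \<ge> 0" and lip: "\<And>v w. norm v \<le> R \<Longrightarrow> norm w \<le> R \<Longrightarrow> norm (f v - f w) \<le> L * norm (v - w)"
      using f unfolding lipschitz_on_balls_def by blast
    have "isCont y a" "isCont z a" using y[OF a(1)] z[OF a(1)] by (auto intro: has_vector_derivative_continuous)
    then obtain d1 d2 where d: "d1 > 0" "d2 > 0" "\<And>\<tau>. dist \<tau> a < d1 \<Longrightarrow> dist (y \<tau>) (y a) < 1" "\<And>\<tau>. dist \<tau> a < d2 \<Longrightarrow> dist (z \<tau>) (z a) < 1"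
      unfolding continuous_at by (metis less_numeral_extra(1) tendsto_def continuous_at_eps_delta continuous_at)
    obtain d3 where d3: "d3 > 0" "ball a d3 \<subseteq> I" using I(1) a(1) open_contains_ball by blast
    define \<eta> where "\<eta> = min (min (d1 / 2) (d2 / 2)) (min (d3 / 2) (1 / (2 * (L + 1))))"
    have \<eta>: "\<eta> > 0" using d d3 L by (simp add: \<eta>_def)
    have \<eta>L: "L * \<eta> \<le> 1 / 2"
    proof -
      have "(L + 1) * \<eta> \<le> (L + 1) * (1 / (2 * (L + 1)))" using L by (intro mult_left_mono) (auto simp: \<eta>_def)
      also have "\<dots> = 1 / 2" using L by simp
      finally show ?thesis using \<eta> by (simp add: algebra_simps)
    qed
    let ?S = "{a - \<eta>..a + \<eta>}"
    have inS: "\<tau> \<in> I" "norm (y \<tau>) \<le> R" "norm (z \<tau>) \<le> R" if "\<tau> \<in> ?S" for \<tau>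
    proof -
      have da: "dist \<tau> a \<le> \<eta>" using that by (auto simp: dist_real_def)
      moreover have "\<eta> < d1" "\<eta> < d2" "\<eta> < d3" using d d3 by (auto simp: \<eta>_def)
      ultimately have "dist \<tau> a < d1" "dist \<tau> a < d2" "dist \<tau> a < d3" by auto
      then show "\<tau> \<in> I" "norm (y \<tau>) \<le> R" "norm (z \<tau>) \<le> R"
        using d(3,4)[of \<tau>] d3(2) a(2) norm_triangle_sub[of "y \<tau>" "y a"] norm_triangle_sub[of "z \<tau>" "z a"]
        by (auto simp: R_def dist_norm dist_commute subset_iff)
    qed
    have "continuous_on ?S (\<lambda>\<tau>. norm (y \<tau> - z \<tau>))"
      using inS(1) by (intro continuous_intros continuous_on_subset[OF cy] continuous_on_subset[OF cz]) auto
    then obtain m where m: "m \<in> ?S" "\<And>\<tau>. \<tau> \<in> ?S \<Longrightarrow> norm (y \<tau> - z \<tau>) \<le> norm (y m - z m)"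
      using continuous_attains_sup[of ?S "\<lambda>\<tau>. norm (y \<tau> - z \<tau>)"] \<eta> by auto
    have "norm ((y m - z m) - (y a - z a)) \<le> (L * norm (y m - z m)) * \<bar>m - a\<bar>"
    proof (rule vector_derivative_bound[of ?S "\<lambda>\<tau>. y \<tau> - z \<tau>" "\<lambda>\<tau>. f (y \<tau>) - f (z \<tau>)"])
      fix \<tau> assume \<tau>: "\<tau> \<in> ?S"
      show "((\<lambda>\<tau>. y \<tau> - z \<tau>) has_vector_derivative f (y \<tau>) - f (z \<tau>)) (at \<tau>)"
        using y z inS(1)[OF \<tau>] by (intro has_vector_derivative_diff) auto
      show "norm (f (y \<tau>) - f (z \<tau>)) \<le> L * norm (y m - z m)"
        using lip[OF inS(2,3)[OF \<tau>]] mult_left_mono[OF m(2)[OF \<tau>] L] by simp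
    qed (use m \<eta> in auto)
    also have "\<dots> \<le> (L * norm (y m - z m)) * \<eta>" using m(1) L by (intro mult_left_mono) auto
    also have "\<dots> = (L * \<eta>) * norm (y m - z m)" by simp
    also have "\<dots> \<le> 1 / 2 * norm (y m - z m)" by (rule mult_right_mono[OF \<eta>L]) simp
    finally have "norm (y m - z m) = 0" using a(2) by simp
    then have "y \<tau> = z \<tau>" if "\<tau> \<in> ?S" for \<tau> using m(2)[OF that] by simp
    moreover have "openin (top_of_set I) {a - \<eta><..<a + \<eta>}"
      using inS(1) by (intro open_subset) auto
    ultimately show ?thesis using \<eta> by (intro exI[of _ "{a - \<eta><..<a + \<eta>}"]) auto
  qed
  let ?E = "{t \<in> I. y t = z t}"
  have "closedin (top_of_set I) ?E" using continuous_closedin_preimage_constant[of I "\<lambda>t. y t - z t" 0] cy cz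
    by (simp add: continuous_on_diff)
  moreover have "openin (top_of_set I) ?E"
  proof (subst openin_subopen, intro ballI)
    fix a assume "a \<in> ?E"
    then obtain T where T: "openin (top_of_set I) T" "a \<in> T" "\<forall>x\<in>T. y x = z x" using loc[of a] by auto
    then show "\<exists>T. openin (top_of_set I) T \<and> a \<in> T \<and> T \<subseteq> ?E"
      using openin_imp_subset[OF T(1)] by blast
  qed
  ultimately have "?E = {} \<or> ?E = I" using con unfolding connected_clopen by blast
  then show ?thesis using I(3) eq t by blast
qed

text \<open>The maximal solution is the union of all solutions, which agree on overlaps. If it stays in a ball up to a time \<open>b\<close>,
  then solutions starting at any of its points live for a time depending only on that ball, so that one started just
  before \<open>b\<close> continues past \<open>b\<close>.\<close>

lemma maximal_ode_solution:
  fixes f :: "'a::banach \<Rightarrow> 'a"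
  assumes f: "lipschitz_on_balls f"
  obtains I y where "ode_solution f x0 I y"
    "\<And>J z. ode_solution f x0 J z \<Longrightarrow> J \<subseteq> I \<and> (\<forall>t\<in>J. z t = y t)"
    "\<And>b R. 0 < b \<Longrightarrow> {0..<b} \<subseteq> I \<Longrightarrow> (\<And>t. t \<in> {0..<b} \<Longrightarrow> norm (y t) \<le> R) \<Longrightarrow> b \<in> I"
proof -
  define Sol where "Sol = {(J, z). ode_solution f x0 J z}"
  define I where "I = (\<Union>(J, z)\<in>Sol. J)"
  define y where "y t = (SOME v. \<exists>J z. ode_solution f x0 J z \<and> t \<in> J \<and> v = z t)" for t
  have agree: "z t = z' t" if s: "ode_solution f x0 J z" "ode_solution f x0 J' z'" and t: "t \<in> J" "t \<in> J'" for J z J' z' t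
    by (rule ode_unique[OF f, of "J \<inter> J'" 0]) (use s t in \<open>auto simp: ode_solution_def is_interval_Int open_Int\<close>)
  have y_eq: "y t = z t" if s: "ode_solution f x0 J z" and t: "t \<in> J" for J z t
  proof -
    have "\<exists>v J z. ode_solution f x0 J z \<and> t \<in> J \<and> v = z t" using s t by blast
    then have "\<exists>J z. ode_solution f x0 J z \<and> t \<in> J \<and> y t = z t" unfolding y_def by (rule someI_ex)
    then show ?thesis using agree[OF _ s _ t] by metis
  qed
  have sub: "J \<subseteq> I" if "ode_solution f x0 J z" for J z using that by (auto simp: I_def Sol_def)
  obtain h z where h: "h > 0" and z: "z 0 = x0" "\<And>t. \<bar>t\<bar> < h \<Longrightarrow> (z has_vector_derivative f (z t)) (at t)"
    using picard_lindelof[OF f, of "norm x0"] by blast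
  have ex: "ode_solution f x0 {-h<..<h} z" using h z by (auto simp: ode_solution_def is_interval_oo)
  have sol: "ode_solution f x0 I y"
    unfolding ode_solution_def
  proof (intro conjI ballI)
    show "open I" unfolding I_def by (intro open_UN) (auto simp: Sol_def ode_solution_def)
    show "0 \<in> I" using sub[OF ex] h by auto
    have "connected I" unfolding I_def
      by (intro connected_Union) (auto simp: Sol_def ode_solution_def is_interval_connected_1)
    then show "is_interval I" by (simp add: is_interval_connected_1)
    show "y 0 = x0" using y_eq[OF ex, of 0] h z by simp
    fix t assume "t \<in> I"
    then obtain J z where s: "ode_solution f x0 J z" and t: "t \<in> J" by (auto simp: I_def Sol_def)
    have "(z has_vector_derivative f (y t)) (at t)" using s t y_eq[OF s t] by (simp add: ode_solution_def)
    then show "(y has_vector_derivative f (y t)) (at t)"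
      by (rule has_vector_derivative_transform_within_open[of _ _ _ J]) (use s t y_eq[OF s] in \<open>auto simp: ode_solution_def\<close>)
  qed
  have ext: "b \<in> I" if b: "0 < b" "{0..<b} \<subseteq> I" and R: "\<And>t. t \<in> {0..<b} \<Longrightarrow> norm (y t) \<le> R" for b R
  proof -
    obtain h where h: "h > 0" and loc: "\<And>x0. norm x0 \<le> R \<Longrightarrow> \<exists>y. y 0 = x0 \<and> (\<forall>t. \<bar>t\<bar> < h \<longrightarrow> (y has_vector_derivative f (y t)) (at t))"
      using picard_lindelof[OF f, of R] by blast
    define t0 where "t0 = max 0 (b - h / 2)"
    have t0: "t0 \<in> {0..<b}" "b < t0 + h" using b h by (auto simp: t0_def)
    obtain z where z: "z 0 = y t0" "\<And>t. \<bar>t\<bar> < h \<Longrightarrow> (z has_vector_derivative f (z t)) (at t)"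
      using loc[OF R[OF t0(1)]] by blast
    let ?J = "{t0 - h<..<t0 + h}"
    define z' where "z' t = z (t - t0)" for t
    have z': "(z' has_vector_derivative f (z' t)) (at t)" if "t \<in> ?J" for t
    proof -
      have "((\<lambda>t. t - t0) has_vector_derivative 1) (at t)" by (auto intro!: derivative_eq_intros)
      from vector_diff_chain_at[OF this z(2)[of "t - t0"]] that
      show ?thesis by (simp add: z'_def[abs_def] o_def abs_less_iff)
    qed
    have yI: "(y has_vector_derivative f (y t)) (at t)" if "t \<in> I" for t using sol that by (simp add: ode_solution_def)
    have I: "open (I \<inter> ?J)" "is_interval (I \<inter> ?J)" "t0 \<in> I \<inter> ?J"
      using sol t0 b h by (auto simp: ode_solution_def is_interval_Int is_interval_oo open_Int)
    have ov: "y t = z' t" if "t \<in> I \<inter> ?J" for t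
    proof (rule ode_unique[OF f I])
      show "(y has_vector_derivative f (y t)) (at t)" if "t \<in> I \<inter> ?J" for t by (rule yI[OF IntD1[OF that]])
      show "(z' has_vector_derivative f (z' t)) (at t)" if "t \<in> I \<inter> ?J" for t by (rule z'[OF IntD2[OF that]])
      show "y t0 = z' t0" by (simp add: z'_def z)
      show "t \<in> I \<inter> ?J" by (rule that)
    qed
    define w where "w t = (if t \<in> I then y t else z' t)" for t
    have w1: "w t = y t" if "t \<in> I" for t using that by (simp add: w_def)
    have w2: "w t = z' t" if "t \<in> ?J" for t using that ov by (simp add: w_def)
    have "ode_solution f x0 (I \<union> ?J) w"
      unfolding ode_solution_def
    proof (intro conjI ballI)
      show "open (I \<union> ?J)" using sol by (simp add: ode_solution_def open_Un)
      show "0 \<in> I \<union> ?J" "w 0 = x0" using sol by (auto simp: ode_solution_def w_def)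
      have "t0 \<in> I \<inter> ?J" using t0 b h by auto
      then have "connected (I \<union> ?J)"
        using sol by (intro connected_Un) (auto simp: ode_solution_def is_interval_connected_1)
      then show "is_interval (I \<union> ?J)" by (simp add: is_interval_connected_1)
      fix t assume "t \<in> I \<union> ?J"
      then show "(w has_vector_derivative f (w t)) (at t)"
      proof
        assume t: "t \<in> I"
        have "(y has_vector_derivative f (w t)) (at t)" using yI[OF t] w1[OF t] by simp
        then show ?thesis
          by (rule has_vector_derivative_transform_within_open[of _ _ _ I]) (use sol t w1 in \<open>auto simp: ode_solution_def\<close>)
      next
        assume t: "t \<in> ?J"
        have "(z' has_vector_derivative f (w t)) (at t)" using z'[OF t] w2[OF t] by simp
        then show ?thesis
          by (rule has_vector_derivative_transform_within_open[of _ _ _ ?J]) (use t w2 in auto)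
      qed
    qed
    from sub[OF this] show "b \<in> I" using t0 h by auto
  qed
  show ?thesis
  proof (rule that[OF sol])
    show "J \<subseteq> I \<and> (\<forall>t\<in>J. z t = y t)" if "ode_solution f x0 J z" for J z
      using sub[OF that] y_eq[OF that] by simp
  qed (rule ext)
qed

section \<open>Uniqueness of Fourier coefficients and the filtered initial data\<close>

text \<open>Polynomials that are uniformly bounded on \<open>[-2, 2]\<close> and converge there pointwise to the indicator function of the
  positive numbers, obtained from the ramps \<open>max 0 (min 1 (m x))\<close> by the Weierstrass theorem. The interval contains all
  differences of two cosines.\<close>

definition step_poly :: "nat \<Rightarrow> real \<Rightarrow> real" where
  "step_poly m = (SOME p. real_polynomial_function p \<and>
     (\<forall>x\<in>{-2..2}. \<bar>max 0 (min 1 (real m * x)) - p x\<bar> < 1 / real (Suc m)))"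

lemma step_poly:
  "real_polynomial_function (step_poly m)"
  "x \<in> {-2..2} \<Longrightarrow> \<bar>max 0 (min 1 (real m * x)) - step_poly m x\<bar> < 1 / real (Suc m)"
proof -
  have "continuous_on {-2..2} (\<lambda>x. max 0 (min 1 (real m * x)))"
    by (intro continuous_intros)
  then obtain p where "real_polynomial_function p" "\<And>x. x \<in> {-2..2} \<Longrightarrow> \<bar>max 0 (min 1 (real m * x)) - p x\<bar> < 1 / real (Suc m)"
    using Stone_Weierstrass_real_polynomial_function[of "{-2..2::real}" "\<lambda>x. max 0 (min 1 (real m * x))" "1 / real (Suc m)"]
    by (auto simp: compact_Icc)
  then have "\<exists>p. real_polynomial_function p \<and> (\<forall>x\<in>{-2..2}. \<bar>max 0 (min 1 (real m * x)) - p x\<bar> < 1 / real (Suc m))"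
    by blast
  from someI_ex[OF this, folded step_poly_def]
  show "real_polynomial_function (step_poly m)" "x \<in> {-2..2} \<Longrightarrow> \<bar>max 0 (min 1 (real m * x)) - step_poly m x\<bar> < 1 / real (Suc m)"
    by auto
qed

lemma step_poly_bound:
  assumes "x \<in> {-2..2}" shows "\<bar>step_poly m x\<bar> \<le> 2"
proof -
  have "1 / real (Suc m) \<le> 1" by simp
  moreover have "0 \<le> max 0 (min 1 (real m * x))" "max 0 (min 1 (real m * x)) \<le> 1" by auto
  ultimately show ?thesis using step_poly(2)[OF assms, of m] unfolding abs_less_iff abs_le_iff by linarith
qed

lemma step_poly_limit:
  assumes "x \<in> {-2..2}" shows "(\<lambda>m. step_poly m x) \<longlonglongrightarrow> (if x > 0 then 1 else 0)"
proof -
  have lim: "(\<lambda>m. max 0 (min 1 (real m * x))) \<longlonglongrightarrow> (if x > 0 then 1 else 0)"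
  proof (cases "x > 0")
    case True
    obtain M where M: "1 < real M * x" using reals_Archimedean3[OF True] by blast
    have "\<forall>\<^sub>F m in sequentially. max 0 (min 1 (real m * x)) = 1"
      using eventually_ge_at_top[of M]
    proof eventually_elim
      case (elim m)
      then have "real M * x \<le> real m * x" using True by (intro mult_right_mono) auto
      then show ?case using M by simp
    qed
    then show ?thesis using True by (simp add: tendsto_eventually)
  next
    case False
    then have "real m * x \<le> 0" for m by (simp add: mult_nonneg_nonpos)
    then have "max 0 (min 1 (real m * x)) = 0" for m
      by (intro max_absorb1) (simp add: min.coboundedI2)
    then show ?thesis using False by simp
  qed
  have "(\<lambda>m. max 0 (min 1 (real m * x)) - step_poly m x) \<longlonglongrightarrow> 0"
    by (rule Lim_null_comparison[OF _ LIMSEQ_inverse_real_of_nat])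
       (use step_poly(2)[OF assms] in \<open>auto intro!: always_eventually less_imp_le simp: inverse_eq_divide\<close>)
  from tendsto_diff[OF lim this] show ?thesis by simp
qed

lemma trig_poly_real_polynomial_1:
  fixes p :: "real \<Rightarrow> real"
  assumes "real_polynomial_function p" "trig_poly (cplx g)"
  shows "trig_poly (\<lambda>x. complex_of_real (p (g x)))"
proof -
  obtain a n where p: "p = (\<lambda>x. \<Sum>i\<le>n. a i * x ^ i)"
    using assms(1) unfolding real_polynomial_function_iff_sum by blast
  have "trig_poly (\<lambda>x. (cplx g x) ^ i)" for i
    by (induction i) (auto intro: trig_poly_const trig_poly_mult assms(2))
  then have "trig_poly (\<lambda>x. \<Sum>i\<le>n. complex_of_real (a i) * (cplx g x) ^ i)"
    by (intro trig_poly_sum trig_poly_cmult)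
  then show ?thesis by (simp add: p)
qed

lemma freq_dot_axis: "freq_dot (axis j 1) x = x $ j"
  by (simp add: freq_dot_def axis_def if_distrib if_distribR cong: if_cong)

lemma trig_poly_cos_coordinate: "trig_poly (\<lambda>x. complex_of_real (cos (x $ j - c) - d))"
proof -
  have "complex_of_real (cos (x $ j - c) - d)
      = (cis (- c) / 2 * character (axis j 1) x + cis c / 2 * character (- axis j 1) x) - complex_of_real d" for x
  proof -
    have "cis (- c) * character (axis j 1) x = cis (x $ j - c)" "cis c * character (- axis j 1) x = cis (- (x $ j - c))"
      by (simp_all add: character_def freq_dot_minus freq_dot_axis cis_mult)
    moreover have "cis (- y) = cnj (cis y)" for y by (simp add: cis_cnj)
    ultimately have "cis (- c) / 2 * character (axis j 1) x + cis c / 2 * character (- axis j 1) x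
        = (cis (x $ j - c) + cnj (cis (x $ j - c))) / 2"
      by (simp only: times_divide_eq_left add_divide_distrib)
    then show ?thesis by (simp add: complex_add_cnj)
  qed
  then show ?thesis
    by (simp only:) (intro trig_poly_diff trig_poly_add trig_poly_cmult trig_poly_character trig_poly_const)
qed

lemma cos_gt_cos_iff:
  assumes "0 < \<rho>" "\<rho> < pi" "\<bar>y\<bar> < 2 * pi - \<rho>"
  shows "cos y - cos \<rho> > 0 \<longleftrightarrow> \<bar>y\<bar> < \<rho>"
proof (cases "\<bar>y\<bar> \<le> pi")
  case True
  have "cos \<rho> < cos \<bar>y\<bar> \<longleftrightarrow> \<bar>y\<bar> < \<rho>" using cos_mono_less_eq[of \<rho> "\<bar>y\<bar>"] assms True by auto
  then show ?thesis by simp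
next
  case False
  have "cos y = cos (2 * pi - \<bar>y\<bar>)" by (simp add: cos_diff)
  moreover have "cos (2 * pi - \<bar>y\<bar>) < cos \<rho>"
    by (rule cos_monotone_0_pi) (use assms False in auto)
  ultimately show ?thesis using False assms by auto
qed

text \<open>A function with vanishing Fourier coefficients is orthogonal to all trigonometric polynomials. By dominated convergence
  it is orthogonal to the indicator of every cube inside the cell, because the indicator of an interval with centre \<open>c\<close> and
  radius \<open>\<rho>\<close> is a bounded pointwise limit of polynomials in \<open>cos (x - c) - cos \<rho>\<close>. Lebesgue differentiation
  concludes.\<close>

lemma fourier_uniqueness:
  fixes f :: "real ^ 'd \<Rightarrow> real"
  assumes meas: "f \<in> borel_measurable lebesgue" and bd: "AE x in lebesgue. \<bar>f x\<bar> \<le> B"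
    and zero: "\<And>k. fhat (cplx f) k = 0"
  shows "AE x in lebesgue. x \<in> box 0 (\<chi> j. 2 * pi) \<longrightarrow> f x = 0"
proof -
  let ?cell = "torus_cell :: (real ^ 'd) set"
  define F where "F x = indicator ?cell x * f x" for x
  have cell: "?cell \<in> sets lebesgue" "emeasure lebesgue ?cell < \<infinity>"
    using fmeasurableD[OF torus_cell_lmeasurable] fmeasurableD2[OF torus_cell_lmeasurable, where 'a1 = 'd] by (auto simp: less_top)
  have F[measurable]: "F \<in> borel_measurable lebesgue"
    unfolding F_def[abs_def] using cell(1) meas by measurable
  have Fb: "AE x in lebesgue. \<bar>F x\<bar> \<le> \<bar>B\<bar>" using bd by eventually_elim (auto simp: F_def indicator_def)
  have F0: "F x = 0" if "x \<notin> ?cell" for x using that by (simp add: F_def)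
  have intF: "integrable lebesgue F"
    by (rule integrableI_bounded_set[OF cell(1) F cell(2)]) (use Fb F0 in \<open>auto elim: eventually_mono\<close>)
  have int_trig: "integrable lebesgue (\<lambda>x. complex_of_real (F x) * p x)" and zero_trig: "(LINT x|lebesgue. complex_of_real (F x) * p x) = 0"
    if p: "trig_poly p" for p
  proof -
    have ich: "integrable lebesgue (\<lambda>x. complex_of_real (F x) * character k x)" for k
    proof (rule Bochner_Integration.integrable_bound[OF intF])
      have "character k \<in> borel_measurable lebesgue"
        using borel_measurable_continuous_onI[OF continuous_character[of UNIV k]] by (simp add: measurable_completion)
      then show "(\<lambda>x. complex_of_real (F x) * character k x) \<in> borel_measurable lebesgue" using F by measurable
    qed (simp add: norm_mult)
    have zch: "(LINT x|lebesgue. complex_of_real (F x) * character k x) = 0" for k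
    proof -
      have "(LINT x|lebesgue. complex_of_real (F x) * character k x) = (LINT x:?cell|lebesgue. cplx f x * character (- (- k)) x)"
        unfolding set_lebesgue_integral_def by (rule Bochner_Integration.integral_cong) (auto simp: F_def indicator_def)
      then show ?thesis using zero[of "- k"] by (simp add: fhat_def torus_mean_def)
    qed
    have e: "(\<lambda>x. complex_of_real (F x) * p x) = (\<lambda>x. \<Sum>k\<in>spectrum p. fhat p k * (complex_of_real (F x) * character k x))"
      using trig_poly_expand[OF p trig_poly_finite_spectrum[OF p] order_refl] by (auto simp: sum_distrib_left mult_ac)
    show "integrable lebesgue (\<lambda>x. complex_of_real (F x) * p x)"
      unfolding e by (intro Bochner_Integration.integrable_sum integrable_mult_right ich)
    show "(LINT x|lebesgue. complex_of_real (F x) * p x) = 0"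
      unfolding e by (subst Bochner_Integration.integral_sum) (auto intro: integrable_mult_right ich simp: zch)
  qed
  have box: "integral (cbox a (a + h *\<^sub>R One)) F = 0"
    if h: "0 < h" and a: "\<And>j. 0 < a $ j" "\<And>j. a $ j + h < 2 * pi" for a :: "real ^ 'd" and h
  proof -
    let ?Q = "box a (a + h *\<^sub>R One)"
    define q where "q j x = cos (x $ j - (a $ j + h / 2)) - cos (h / 2)" for j and x :: "real ^ 'd"
    have q2: "q j x \<in> {-2..2}" for j x
      using cos_ge_minus_one[of "x $ j - (a $ j + h / 2)"] cos_le_one[of "x $ j - (a $ j + h / 2)"]
        cos_ge_minus_one[of "h / 2"] cos_le_one[of "h / 2"]
      unfolding q_def atLeastAtMost_iff by linarith
    define G where "G m x = F x * (\<Prod>j\<in>UNIV. step_poly m (q j x))" for m x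
    have h2: "h / 2 < pi" using a[of undefined] by simp
    have One: "(One :: real ^ 'd) $ j = 1" for j
    proof -
      have "axis j 1 \<in> (Basis :: (real ^ 'd) set)" by (auto simp: Basis_vec_def)
      then have "(One :: real ^ 'd) \<bullet> axis j 1 = 1" by (simp add: inner_sum_left inner_Basis)
      then show ?thesis by (simp only: inner_axis) simp
    qed
    have memQ: "x \<in> ?Q \<longleftrightarrow> (\<forall>j. a $ j < x $ j \<and> x $ j < a $ j + h)" for x
      by (simp add: mem_box_cart One del: sum_component)
    have tp: "trig_poly (\<lambda>x. complex_of_real (\<Prod>j\<in>UNIV. step_poly m (q j x)))" for m
      unfolding of_real_prod q_def
      by (intro trig_poly_prod trig_poly_real_polynomial_1[OF step_poly(1)] trig_poly_cos_coordinate)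
    have zG: "(LINT x|lebesgue. G m x) = 0" for m
    proof -
      have "complex_of_real (LINT x|lebesgue. G m x) = (LINT x|lebesgue. complex_of_real (G m x))"
        by (rule integral_complex_of_real[symmetric])
      also have "\<dots> = 0" using zero_trig[OF tp[of m]] by (simp add: G_def)
      finally show ?thesis by simp
    qed
    have lim: "(\<lambda>m. G m x) \<longlonglongrightarrow> F x * indicator ?Q x" for x
    proof (cases "x \<in> ?cell")
      case True
      then have x: "0 \<le> x $ j" "x $ j \<le> 2 * pi" for j by (simp_all add: torus_cell_def mem_box_cart)
      have iff: "q j x > 0 \<longleftrightarrow> a $ j < x $ j \<and> x $ j < a $ j + h" for j
      proof -
        have "\<bar>x $ j - (a $ j + h / 2)\<bar> < 2 * pi - h / 2"
          using x[of j] a[of j] h by (simp only: abs_less_iff) linarith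
        from cos_gt_cos_iff[OF _ h2 this] h have "q j x > 0 \<longleftrightarrow> \<bar>x $ j - (a $ j + h / 2)\<bar> < h / 2"
          by (simp add: q_def)
        also have "\<dots> \<longleftrightarrow> a $ j < x $ j \<and> x $ j < a $ j + h"
          unfolding abs_less_iff by (auto simp: field_simps)
        finally show ?thesis .
      qed
      have "(\<lambda>m. \<Prod>j\<in>UNIV. step_poly m (q j x)) \<longlonglongrightarrow> (\<Prod>j\<in>UNIV. if q j x > 0 then 1 else 0)"
        by (intro tendsto_prod step_poly_limit q2)
      moreover have "(\<Prod>j\<in>UNIV. if q j x > 0 then 1 else (0::real)) = indicator ?Q x"
      proof (cases "x \<in> ?Q")
        case True
        then have "q j x > 0" for j by (simp add: iff memQ)
        then show ?thesis using True by simp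
      next
        case False
        then obtain j where "\<not> q j x > 0" by (auto simp: iff memQ)
        then show ?thesis using False by (auto simp: prod_zero_iff)
      qed
      ultimately show ?thesis unfolding G_def by (intro tendsto_mult_left) simp
    next
      case False then show ?thesis by (simp add: G_def F0)
    qed
    have Gm: "G m \<in> borel_measurable lebesgue" for m
    proof -
      have "(\<lambda>x. \<Prod>j\<in>UNIV. step_poly m (q j x)) \<in> borel_measurable lebesgue"
        using borel_measurable_continuous_onI[OF trig_poly_cplx_continuous[OF tp[of m]]]
        by (simp add: measurable_completion)
      then show ?thesis unfolding G_def[abs_def] using F by measurable
    qed
    have Qm: "indicator ?Q \<in> borel_measurable (lebesgue :: (real ^ 'd) measure)"
      by (intro borel_measurable_indicator) simp
    have "(\<lambda>m. LINT x|lebesgue. G m x) \<longlonglongrightarrow> (LINT x|lebesgue. F x * indicator ?Q x)"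
    proof (rule integral_dominated_convergence[where w = "\<lambda>x. 2 ^ CARD('d) * \<bar>F x\<bar>"])
      show "(\<lambda>x. F x * indicator ?Q x) \<in> borel_measurable lebesgue" using F Qm by measurable
      show "integrable lebesgue (\<lambda>x. 2 ^ CARD('d) * \<bar>F x\<bar>)" using intF by simp
      show "AE x in lebesgue. norm (G m x) \<le> 2 ^ CARD('d) * \<bar>F x\<bar>" for m
      proof (intro always_eventually allI)
        fix x
        have "\<bar>\<Prod>j\<in>UNIV. step_poly m (q j x)\<bar> \<le> (\<Prod>j\<in>(UNIV::'d set). 2)"
          unfolding abs_prod by (intro prod_mono) (auto intro!: step_poly_bound q2)
        then have "\<bar>F x\<bar> * \<bar>\<Prod>j\<in>UNIV. step_poly m (q j x)\<bar> \<le> \<bar>F x\<bar> * 2 ^ CARD('d)"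
          by (intro mult_left_mono) auto
        then show "norm (G m x) \<le> 2 ^ CARD('d) * \<bar>F x\<bar>" by (simp add: G_def abs_mult mult.commute)
      qed
    qed (use lim Gm in auto)
    then have z: "(LINT x|lebesgue. F x * indicator ?Q x) = 0" using zG by (simp add: LIMSEQ_const_iff)
    have absF: "F absolutely_integrable_on ?Q"
      unfolding set_integrable_def by (rule integrable_mult_indicator[OF _ intF]) simp
    have "integral (cbox a (a + h *\<^sub>R One)) F = integral ?Q F" by (rule integral_open_interval[symmetric])
    also have "\<dots> = (LINT x:?Q|lebesgue. F x)" using set_lebesgue_integral_eq_integral(2)[OF absF] by simp
    also have "\<dots> = 0" using z by (simp add: set_lebesgue_integral_def mult.commute)
    finally show ?thesis .
  qed
  have "F integrable_on cbox a b" for a b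
  proof -
    have "F absolutely_integrable_on cbox a b"
      unfolding set_integrable_def by (rule integrable_mult_indicator[OF _ intF]) simp
    then show ?thesis by (rule set_lebesgue_integral_eq_integral(1))
  qed
  then obtain Z where Z: "negligible Z" and leb: "\<And>x e. x \<notin> Z \<Longrightarrow> 0 < e \<Longrightarrow>
      \<exists>d>0. \<forall>h. 0 < h \<and> h < d \<longrightarrow> norm (integral (cbox x (x + h *\<^sub>R One)) F /\<^sub>R h ^ DIM(real ^ 'd) - F x) < e"
    using integrable_ccontinuous_explicit[of F] by metis
  have "f x = 0" if x: "x \<notin> Z" "x \<in> box 0 (\<chi> j. 2 * pi)" for x
  proof -
    have xb: "0 < x $ j" "x $ j < 2 * pi" for j using x(2) by (simp_all add: mem_box_cart)
    define \<delta> where "\<delta> = Min (range (\<lambda>j. 2 * pi - x $ j))"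
    have \<delta>: "0 < \<delta>" "\<delta> \<le> 2 * pi - x $ j" for j using xb by (auto simp: \<delta>_def)
    have "norm (F x) < e" if e: "0 < e" for e
    proof -
      obtain d where d: "d > 0" "\<And>h. 0 < h \<and> h < d \<Longrightarrow> norm (integral (cbox x (x + h *\<^sub>R One)) F /\<^sub>R h ^ DIM(real ^ 'd) - F x) < e"
        using leb[OF x(1) e] by blast
      define h where "h = min (d / 2) (\<delta> / 2)"
      have h: "0 < h" "h < d" "h < \<delta>" using d(1) \<delta>(1) by (auto simp: h_def)
      have "integral (cbox x (x + h *\<^sub>R One)) F = 0"
      proof (rule box[OF h(1)])
        fix j show "0 < x $ j" by (rule xb)
        show "x $ j + h < 2 * pi" using \<delta>(2)[of j] h(3) by simp
      qed
      then show ?thesis using d(2)[of h] h by simp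
    qed
    then have "F x = 0" by (metis less_irrefl zero_less_norm_iff)
    moreover have "x \<in> ?cell" using x(2) box_subset_cbox unfolding torus_cell_def by blast
    ultimately show ?thesis by (simp add: F_def)
  qed
  then have "{x. \<not> (x \<in> box 0 (\<chi> j. 2 * pi) \<longrightarrow> f x = 0)} \<subseteq> Z" by blast
  moreover have "Z \<in> null_sets lebesgue" using Z by (simp add: negligible_iff_null_sets)
  ultimately show ?thesis by (intro AE_I'[of Z]) auto
qed

lemma freq_box_mono:
  assumes "N \<le> N'" shows "freq_box N \<subseteq> freq_box N'"
proof
  fix k :: "int ^ 'd" assume "k \<in> freq_box N"
  then have "\<bar>k $ j\<bar> \<le> int N" for j by (simp add: freq_box_def)
  moreover have "int N \<le> int N'" using assms by simp
  ultimately show "k \<in> freq_box N'" unfolding freq_box_def using order_trans by blast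
qed

lemma character_period:
  "character k (x + (\<chi> j. 2 * pi * real_of_int (v $ j))) = character k x"
proof -
  have "freq_dot k (x + (\<chi> j. 2 * pi * real_of_int (v $ j))) = freq_dot k x + 2 * pi * real_of_int (\<Sum>j\<in>UNIV. k $ j * v $ j)"
    by (simp add: freq_dot_def distrib_left sum.distrib sum_distrib_left mult_ac)
  moreover have "cis (2 * pi * real_of_int m) = 1" for m by (rule cis_multiple_2pi) simp
  ultimately show ?thesis unfolding character_def by (simp only: cis_mult[symmetric] mult_1_right)
qed

lemma lowpass_period:
  "lowpass N f (x + (\<chi> j. 2 * pi * real_of_int (v $ j))) = lowpass N f x"
proof -
  have "complex_of_real (lowpass N f (x + (\<chi> j. 2 * pi * real_of_int (v $ j))) $ i) = complex_of_real (lowpass N f x $ i)" for i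
    unfolding lowpass_complex character_period ..
  then show ?thesis by (simp add: vec_eq_iff)
qed

text \<open>The partial sums \<open>P\<^sub>N U\<^sup>0\<close> converge uniformly at rate \<open>1/N\<close>; by uniqueness of Fourier coefficients the limit
  is the continuous representative of \<open>U\<^sup>0\<close>. Its values lie in the closed set \<open>K\<close>, because a continuous function that is in
  a closed set almost everywhere is in it everywhere.\<close>

lemma lowpass_near_values:
  assumes s: "s > real CARD('d) / 2 + 1"
  shows "\<exists>C>0. \<forall>(U0 :: real ^ 'd \<Rightarrow> real ^ 'n) K N x. U0 \<in> Hs s \<and> compact K \<and> (AE x in lebesgue. U0 x \<in> K) \<and> 1 \<le> N \<longrightarrow>
     (\<exists>y\<in>K. norm (lowpass N U0 x - y) \<le> C * Hs_norm s U0 / real N)"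
proof -
  obtain C where C: "C > 0" and l1: "\<And>F a. finite F \<Longrightarrow>
     (\<Sum>k\<in>F. japanese_bracket (k :: int ^ 'd) * \<bar>a k\<bar>) \<le> C * L2_set (\<lambda>k. japanese_bracket k powr s * a k) F"
    using weighted_l1_le_l2[OF s] by blast
  define C' where "C' = real CARD('n) * C"
  have C': "C' > 0" using C by (simp add: C'_def)
  have "\<exists>y\<in>K. norm (lowpass N U0 x - y) \<le> C' * Hs_norm s U0 / real N"
    if U0: "U0 \<in> Hs s" and K: "compact K" and AEK: "AE x in lebesgue. U0 x \<in> K" and N1: "1 \<le> N"
    for U0 :: "real ^ 'd \<Rightarrow> real ^ 'n" and K N x
  proof -
    define m where "m = Hs_norm s U0"
    have m: "0 \<le> m" by (simp add: m_def Hs_norm_nonneg)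
    define l where "l N x i = lowpass N U0 x $ i" for N x i
    have tail: "\<bar>l N' x i - l N x i\<bar> \<le> C * m / real N" if "1 \<le> N" "N \<le> N'" for N N' x i
    proof -
      let ?D = "freq_box N' - freq_box N :: (int ^ 'd) set"
      have sub: "freq_box N \<subseteq> (freq_box N' :: (int ^ 'd) set)" by (rule freq_box_mono[OF that(2)])
      have "complex_of_real (l N' x i - l N x i) = (\<Sum>k\<in>?D. fhat (cpt U0 i) k * character k x)"
        unfolding l_def of_real_diff lowpass_complex by (simp add: sum_diff[OF finite_freq_box sub])
      then have "\<bar>l N' x i - l N x i\<bar> = norm (\<Sum>k\<in>?D. fhat (cpt U0 i) k * character k x)"
        by (metis norm_of_real)
      also have "\<dots> \<le> (\<Sum>k\<in>?D. norm (fhat (cpt U0 i) k))"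
        by (rule order_trans[OF norm_sum]) (simp add: norm_mult)
      also have "\<dots> \<le> (\<Sum>k\<in>?D. japanese_bracket k * \<bar>norm (fhat (cpt U0 i) k)\<bar> / real N)"
      proof (rule sum_mono)
        fix k :: "int ^ 'd" assume "k \<in> ?D"
        then obtain j where "\<bar>k $ j\<bar> > int N" by (auto simp: freq_box_def not_le)
        then have "real N \<le> \<bar>real_of_int (k $ j)\<bar>" by linarith
        then have "real N \<le> japanese_bracket k" using abs_component_le_japanese_bracket[of k j] by linarith
        then have "real N * norm (fhat (cpt U0 i) k) \<le> japanese_bracket k * norm (fhat (cpt U0 i) k)"
          by (rule mult_right_mono) simp
        then show "norm (fhat (cpt U0 i) k) \<le> japanese_bracket k * \<bar>norm (fhat (cpt U0 i) k)\<bar> / real N"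
          using that(1) by (simp add: pos_le_divide_eq mult.commute)
      qed
      also have "\<dots> = (\<Sum>k\<in>?D. japanese_bracket k * \<bar>norm (fhat (cpt U0 i) k)\<bar>) / real N"
        by (simp add: sum_divide_distrib)
      also have "\<dots> \<le> (C * L2_set (\<lambda>k. japanese_bracket k powr s * norm (fhat (cpt U0 i) k)) ?D) / real N"
        by (intro divide_right_mono l1) auto
      also have "\<dots> \<le> C * m / real N"
        unfolding m_def by (intro divide_right_mono mult_left_mono Hs_L2_set_le[OF U0]) (use C in auto)
      finally show ?thesis .
    qed
    have rate0: "(\<lambda>N. C * m / real N) \<longlonglongrightarrow> 0"
      by (rule real_tendsto_divide_at_top[OF tendsto_const filterlim_real_sequentially])
    have "\<exists>g. (\<lambda>N. l N x i) \<longlonglongrightarrow> g" for x i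
    proof -
      have "Cauchy (\<lambda>N. l N x i)"
      proof (rule CauchyI')
        fix e :: real assume "0 < e"
        then have "\<forall>\<^sub>F N in sequentially. C * m / real N < e" by (rule order_tendstoD(2)[OF rate0])
        then obtain M where M: "\<And>N. M \<le> N \<Longrightarrow> C * m / real N < e" by (auto simp: eventually_sequentially)
        show "\<exists>M. \<forall>p\<ge>M. \<forall>n>p. dist (l p x i) (l n x i) < e"
        proof (intro exI[of _ "max 1 M"] allI impI)
          fix p n assume "max 1 M \<le> p" "p < n"
          then show "dist (l p x i) (l n x i) < e"
            using tail[of p n x i] M[of p] by (simp add: dist_real_def abs_minus_commute)
        qed
      qed
      then show ?thesis by (simp add: Cauchy_convergent_iff convergent_def)
    qed
    then obtain g where g: "\<And>x i. (\<lambda>N. l N x i) \<longlonglongrightarrow> g x i" by metis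
    have gl: "\<bar>g x i - l N x i\<bar> \<le> C * m / real N" if "1 \<le> N" for N x i
    proof (rule Lim_bounded)
      show "(\<lambda>N'. \<bar>l N' x i - l N x i\<bar>) \<longlonglongrightarrow> \<bar>g x i - l N x i\<bar>" by (intro tendsto_intros g)
      show "\<forall>n\<ge>N. \<bar>l n x i - l N x i\<bar> \<le> C * m / real N" using tail[OF that] by blast
    qed
    have contl: "continuous_on A (\<lambda>x. l N x i)" for A N i
      unfolding l_def by (intro trig_poly_cplx_continuous bandlimited_trig_poly[OF bandlimited_lowpass])
    have unif: "uniform_limit UNIV (\<lambda>N x. l N x i) (\<lambda>x. g x i) sequentially" for i
    proof (rule uniform_limitI)
      fix e :: real assume "0 < e"
      then have "\<forall>\<^sub>F N in sequentially. C * m / real N < e" by (rule order_tendstoD(2)[OF rate0])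
      then show "\<forall>\<^sub>F N in sequentially. \<forall>x\<in>UNIV. dist (l N x i) (g x i) < e"
        using eventually_ge_at_top[of 1]
      proof eventually_elim
        case (elim N)
        show ?case
        proof
          fix x show "dist (l N x i) (g x i) < e"
            using gl[of N x i] elim by (simp add: dist_real_def abs_minus_commute)
        qed
      qed
    qed
    have contg: "continuous_on UNIV (\<lambda>x. g x i)" for i
      by (rule uniform_limit_theorem[OF always_eventually[OF allI[OF contl]] unif]) simp
    \<comment> \<open>The limit has the coefficients of \<open>U0\<close>, since the partial sum of degree \<open>N\<close> has them for frequencies in the box.\<close>
    have hatg: "fhat (\<lambda>x. complex_of_real (g x i)) k = fhat (cpt U0 i) k" for i k
    proof -
      have rate: "norm (fhat (\<lambda>x. complex_of_real (g x i)) k - fhat (cpt U0 i) k) \<le> C * m / real N" if N: "1 \<le> N" "k \<in> freq_box N" for N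
      proof -
        have "fhat (\<lambda>x. complex_of_real (l N x i)) k = fhat (cpt U0 i) k"
          unfolding l_def using N(2) by (simp add: fhat_lowpass)
        moreover have "fhat (\<lambda>x. complex_of_real (g x i) - complex_of_real (l N x i)) k
            = fhat (\<lambda>x. complex_of_real (g x i)) k - fhat (\<lambda>x. complex_of_real (l N x i)) k"
          by (intro fhat_diff continuous_intros contg contl)
        moreover have "norm (fhat (\<lambda>x. complex_of_real (g x i) - complex_of_real (l N x i)) k) \<le> C * m / real N"
        proof (rule fhat_bound)
          show "continuous_on UNIV (\<lambda>x. complex_of_real (g x i) - complex_of_real (l N x i))"
            by (intro continuous_intros contg contl)
          show "norm (complex_of_real (g x i) - complex_of_real (l N x i)) \<le> C * m / real N" for x
            using gl[OF N(1), of x i] unfolding of_real_diff[symmetric] norm_of_real .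
        qed
        ultimately show ?thesis by simp
      qed
      obtain N0 where N0: "{k} \<subseteq> freq_box N0" using finite_subset_freq_box[of "{k}"] by auto
      have "\<forall>N\<ge>max 1 N0. norm (fhat (\<lambda>x. complex_of_real (g x i)) k - fhat (cpt U0 i) k) \<le> C * m / real N"
      proof (intro allI impI)
        fix N assume N: "max 1 N0 \<le> N"
        then have "k \<in> freq_box N" using N0 freq_box_mono[of N0 N] by auto
        then show "norm (fhat (\<lambda>x. complex_of_real (g x i)) k - fhat (cpt U0 i) k) \<le> C * m / real N"
          using N by (intro rate) auto
      qed
      then have "norm (fhat (\<lambda>x. complex_of_real (g x i)) k - fhat (cpt U0 i) k) \<le> 0"
        by (intro LIMSEQ_le_const[OF rate0]) blast
      then show ?thesis by simp
    qed
    have U0m: "(\<lambda>x. U0 x $ i) \<in> borel_measurable lebesgue" for i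
    proof -
      have "U0 \<in> borel_measurable lebesgue" using U0 by (simp add: Hs_def torus_L2_def)
      then show ?thesis
        by (rule measurable_compose[OF _ borel_measurable_continuous_onI]) (intro continuous_intros)
    qed
    have gm: "(\<lambda>x. g x i) \<in> borel_measurable lebesgue" for i
      using borel_measurable_continuous_onI[OF contg[of i]] by (simp add: measurable_completion)
    obtain B where B: "\<And>y. y \<in> K \<Longrightarrow> norm y \<le> B" using compact_imp_bounded[OF K] bounded_iff by blast
    have U0b: "AE x in lebesgue. \<bar>U0 x $ i\<bar> \<le> B" for i
      using AEK by eventually_elim (use B component_le_norm_cart order_trans in blast)
    have gb: "\<bar>g x i\<bar> \<le> C * m + wiener_norm 0 (cpt (lowpass 1 U0) i)" for x i
    proof -
      have "\<bar>l 1 x i\<bar> \<le> wiener_norm 0 (cpt (lowpass 1 U0) i)"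
        using norm_le_wiener_norm[OF bandlimited_trig_poly[OF bandlimited_lowpass, of 1 U0 i], of x] by (simp add: l_def)
      then show ?thesis using gl[of 1 x i] by simp
    qed
    have ae: "AE x in lebesgue. x \<in> box 0 (\<chi> j. 2 * pi) \<longrightarrow> U0 x $ i - g x i = 0" for i
    proof (rule fourier_uniqueness)
      show "(\<lambda>x. U0 x $ i - g x i) \<in> borel_measurable lebesgue" using U0m gm by measurable
      show "AE x in lebesgue. \<bar>U0 x $ i - g x i\<bar> \<le> B + (C * m + wiener_norm 0 (cpt (lowpass 1 U0) i))"
        using U0b[of i]
      proof eventually_elim
        case (elim x) then show ?case using gb[of x i] by linarith
      qed
      fix k
      have si: "set_integrable lebesgue torus_cell (\<lambda>x. complex_of_real (f x) * character (- k) x)"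
        if f: "f \<in> borel_measurable lebesgue" "AE x in lebesgue. \<bar>f x\<bar> \<le> B'" for f :: "real ^ 'd \<Rightarrow> real" and B'
        unfolding set_integrable_def
      proof (rule integrableI_bounded_set[where A = torus_cell and B = B'])
        show c: "torus_cell \<in> sets (lebesgue :: (real ^ 'd) measure)" by (rule fmeasurableD[OF torus_cell_lmeasurable])
        show "emeasure lebesgue (torus_cell :: (real ^ 'd) set) < \<infinity>"
          using fmeasurableD2[OF torus_cell_lmeasurable[where 'a = 'd]] by (simp add: less_top)
        have "character (- k) \<in> borel_measurable lebesgue"
          using borel_measurable_continuous_onI[OF continuous_character[of UNIV "- k"]] by (simp add: measurable_completion)
        then show "(\<lambda>x. indicat_real torus_cell x *\<^sub>R (complex_of_real (f x) * character (- k) x)) \<in> borel_measurable lebesgue"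
          using f(1) c by measurable
        show "AE x in lebesgue. x \<in> torus_cell \<longrightarrow> norm (indicat_real torus_cell x *\<^sub>R (complex_of_real (f x) * character (- k) x)) \<le> B'"
          using f(2) by eventually_elim (simp add: norm_mult)
      qed auto
      have "fhat (\<lambda>x. complex_of_real (U0 x $ i - g x i)) k = fhat (cpt U0 i) k - fhat (\<lambda>x. complex_of_real (g x i)) k"
        unfolding fhat_def torus_mean_def of_real_diff left_diff_distrib
        by (subst set_integral_diff(2)[OF si[OF U0m U0b] si[OF gm always_eventually[OF allI[OF gb]]]])
           (simp add: diff_divide_distrib)
      then show "fhat (\<lambda>x. complex_of_real (U0 x $ i - g x i)) k = 0" by (simp add: hatg)
    qed
    define G where "G x = (\<chi> i. g x i)" for x
    have contG: "continuous_on UNIV G" unfolding G_def by (intro continuous_on_vec_lambda contg)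
    have "AE x in lebesgue. \<forall>i. x \<in> box 0 (\<chi> j. 2 * pi) \<longrightarrow> U0 x $ i - g x i = 0"
      using AE_finite_allI[OF finite_class.finite_UNIV ae] by simp
    then have "AE x in lebesgue. x \<in> box 0 (\<chi> j. 2 * pi) \<longrightarrow> G x \<in> K"
      using AEK
    proof eventually_elim
      case (elim x)
      show ?case
      proof
        assume "x \<in> box 0 (\<chi> j. 2 * pi)"
        then have "G x = U0 x" using elim by (simp add: G_def vec_eq_iff)
        then show "G x \<in> K" using elim by simp
      qed
    qed
    then obtain Z where Z: "Z \<in> null_sets lebesgue" "\<And>x. x \<notin> Z \<Longrightarrow> x \<in> box 0 (\<chi> j. 2 * pi) \<Longrightarrow> G x \<in> K"
      by (elim AE_E3) (auto simp: space_completion)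
    have clK: "closed K" using K by (rule compact_imp_closed)
    have Gbox: "G x \<in> K" if "x \<in> box 0 (\<chi> j. 2 * pi)" for x
    proof (rule ccontr)
      assume nK: "G x \<notin> K"
      let ?O = "box 0 (\<chi> j. 2 * pi) \<inter> G -` (- K)"
      have "open ?O" using contG clK by (intro open_Int open_box open_vimage) (auto simp: open_Compl)
      moreover have "?O \<noteq> {}" using that nK by blast
      moreover have "?O \<subseteq> Z" using Z(2) by auto
      ultimately show False
        using open_not_negligible[of ?O] negligible_subset[of Z ?O] Z(1) by (simp add: negligible_iff_null_sets)
    qed
    have Gcell: "G x \<in> K" if x: "x \<in> torus_cell" for x
    proof -
      have ne: "box 0 (\<chi> j. 2 * pi) \<noteq> ({} :: (real ^ 'd) set)" by (auto simp: interval_ne_empty_cart)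
      have "x \<in> closure (box 0 (\<chi> j. 2 * pi))" using x closure_box[OF ne] by (simp add: torus_cell_def)
      moreover have "G ` closure (box 0 (\<chi> j. 2 * pi)) \<subseteq> K"
        by (rule image_closure_subset[OF continuous_on_subset[OF contG] clK]) (use Gbox in auto)
      ultimately show ?thesis by blast
    qed
    \<comment> \<open>Periodicity extends the inclusion from the closed cell to all of space.\<close>
    have GK: "G x \<in> K" for x
    proof -
      define v :: "int ^ 'd" where "v = (\<chi> j. - \<lfloor>x $ j / (2 * pi)\<rfloor>)"
      let ?y = "x + (\<chi> j. 2 * pi * real_of_int (v $ j))"
      have "0 \<le> ?y $ j \<and> ?y $ j \<le> 2 * pi" for j
      proof -
        have "2 * pi * real_of_int \<lfloor>x $ j / (2 * pi)\<rfloor> \<le> 2 * pi * (x $ j / (2 * pi))"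
          "2 * pi * (x $ j / (2 * pi)) \<le> 2 * pi * (real_of_int \<lfloor>x $ j / (2 * pi)\<rfloor> + 1)"
          by (intro mult_left_mono; linarith?; simp)+
        then show ?thesis by (simp add: v_def algebra_simps)
      qed
      then have "?y \<in> torus_cell" by (simp add: torus_cell_def mem_box_cart)
      then have "G ?y \<in> K" by (rule Gcell)
      moreover have "G ?y = G x"
      proof -
        have "g ?y i = g x i" for i
          by (rule LIMSEQ_unique[OF g]) (use g[of x i] in \<open>simp add: l_def lowpass_period\<close>)
        then show ?thesis by (simp add: G_def)
      qed
      ultimately show ?thesis by simp
    qed
    have "norm (lowpass N U0 x - G x) \<le> (\<Sum>i\<in>UNIV. \<bar>(lowpass N U0 x - G x) $ i\<bar>)"
      by (rule norm_le_l1_cart)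
    also have "\<dots> \<le> (\<Sum>i\<in>(UNIV::'n set). C * m / real N)"
    proof (rule sum_mono)
      fix i show "\<bar>(lowpass N U0 x - G x) $ i\<bar> \<le> C * m / real N"
        using gl[OF N1, of x i] by (simp add: G_def l_def abs_minus_commute)
    qed
    finally have "norm (lowpass N U0 x - G x) \<le> C' * Hs_norm s U0 / real N"
      by (simp add: C'_def m_def mult_ac)
    then show ?thesis using GK by blast
  qed
  then show ?thesis using C' by blast
qed

section \<open>The filtered system as an ordinary differential equation\<close>

lemma lipschitz_on_ballsE:
  assumes "lipschitz_on_balls f"
  obtains L where "L \<ge> 0" "\<And>x y. norm x \<le> R \<Longrightarrow> norm y \<le> R \<Longrightarrow> norm (f x - f y) \<le> L * norm (x - y)"
  using assms unfolding lipschitz_on_balls_def by blast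

lemma real_polynomial_lipschitz_on_balls:
  "real_polynomial_function p \<Longrightarrow> lipschitz_on_balls p"
proof (induction p rule: real_polynomial_function.induct)
  case (linear f)
  obtain K where K: "\<And>x. norm (f x) \<le> norm x * K" using bounded_linear.bounded[OF linear] by blast
  have "norm (f x - f y) \<le> \<bar>K\<bar> * norm (x - y)" for x y
  proof -
    have "norm (f x - f y) = norm (f (x - y))" by (simp add: linear_diff[OF bounded_linear.linear[OF linear]])
    also have "\<dots> \<le> norm (x - y) * \<bar>K\<bar>" using K[of "x - y"] by (meson abs_ge_self mult_left_mono norm_ge_zero order_trans)
    finally show ?thesis by (simp add: mult.commute)
  qed
  then show ?case unfolding lipschitz_on_balls_def by (intro allI exI[of _ "\<bar>K\<bar>"]) auto
next
  case (const c)
  show ?case unfolding lipschitz_on_balls_def by (intro allI exI[of _ 0]) auto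
next
  case (add f g)
  show ?case unfolding lipschitz_on_balls_def
  proof
    fix R
    obtain L where L: "L \<ge> 0" "\<And>x y. norm x \<le> R \<Longrightarrow> norm y \<le> R \<Longrightarrow> norm (f x - f y) \<le> L * norm (x - y)"
      by (rule lipschitz_on_ballsE[OF add.IH(1)]) blast
    obtain M where M: "M \<ge> 0" "\<And>x y. norm x \<le> R \<Longrightarrow> norm y \<le> R \<Longrightarrow> norm (g x - g y) \<le> M * norm (x - y)"
      by (rule lipschitz_on_ballsE[OF add.IH(2)]) blast
    have "norm (f x + g x - (f y + g y)) \<le> (L + M) * norm (x - y)" if "norm x \<le> R" "norm y \<le> R" for x y
      using norm_triangle_ineq[of "f x - f y" "g x - g y"] L(2)[OF that] M(2)[OF that] by (simp add: algebra_simps)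
    then show "\<exists>L\<ge>0. \<forall>x y. norm x \<le> R \<longrightarrow> norm y \<le> R \<longrightarrow> norm (f x + g x - (f y + g y)) \<le> L * norm (x - y)"
      using L(1) M(1) by (intro exI[of _ "L + M"]) auto
  qed
next
  case (mult f g)
  show ?case unfolding lipschitz_on_balls_def
  proof
    fix R
    obtain L where L: "L \<ge> 0" "\<And>x y. norm x \<le> \<bar>R\<bar> \<Longrightarrow> norm y \<le> \<bar>R\<bar> \<Longrightarrow> norm (f x - f y) \<le> L * norm (x - y)"
      by (rule lipschitz_on_ballsE[OF mult.IH(1)]) blast
    obtain M where M: "M \<ge> 0" "\<And>x y. norm x \<le> \<bar>R\<bar> \<Longrightarrow> norm y \<le> \<bar>R\<bar> \<Longrightarrow> norm (g x - g y) \<le> M * norm (x - y)"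
      by (rule lipschitz_on_ballsE[OF mult.IH(2)]) blast
    define a b where "a = norm (f 0) + L * \<bar>R\<bar>" and "b = norm (g 0) + M * \<bar>R\<bar>"
    have ab: "a \<ge> 0" "b \<ge> 0" using L M by (auto simp: a_def b_def)
    have fa: "norm (f x) \<le> a" and gb: "norm (g x) \<le> b" if "norm x \<le> \<bar>R\<bar>" for x
    proof -
      have "L * norm (x - 0) \<le> L * \<bar>R\<bar>" "M * norm (x - 0) \<le> M * \<bar>R\<bar>" using that L M by (auto intro: mult_left_mono)
      then show "norm (f x) \<le> a" "norm (g x) \<le> b"
        using L(2)[of x 0] M(2)[of x 0] that norm_triangle_sub[of "f x" "f 0"] norm_triangle_sub[of "g x" "g 0"]
        by (auto simp: a_def b_def)
    qed
    have "norm (f x * g x - f y * g y) \<le> (a * M + L * b) * norm (x - y)" if "norm x \<le> R" "norm y \<le> R" for x y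
    proof -
      have xy: "norm x \<le> \<bar>R\<bar>" "norm y \<le> \<bar>R\<bar>" using that by auto
      have "f x * g x - f y * g y = f x * (g x - g y) + (f x - f y) * g y" by (simp add: algebra_simps)
      then have "norm (f x * g x - f y * g y) \<le> norm (f x) * norm (g x - g y) + norm (f x - f y) * norm (g y)"
        using norm_triangle_ineq[of "f x * (g x - g y)" "(f x - f y) * g y"] by (simp add: abs_mult)
      also have "\<dots> \<le> a * (M * norm (x - y)) + (L * norm (x - y)) * b"
        by (intro add_mono mult_mono fa gb L M xy) (use ab L in auto)
      finally show ?thesis by (simp add: algebra_simps)
    qed
    then show "\<exists>L\<ge>0. \<forall>x y. norm x \<le> R \<longrightarrow> norm y \<le> R \<longrightarrow> norm (f x * g x - f y * g y) \<le> L * norm (x - y)"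
      using ab L(1) M(1) by (intro exI[of _ "a * M + L * b"]) auto
  qed
qed

lemma bandlimited_component_bound:
  assumes "bandlimited N f" shows "\<bar>f x $ i\<bar> \<le> wiener_norm 0 (cpt f i)"
  using norm_le_wiener_norm[OF bandlimited_trig_poly[OF assms, of i], of x] by simp

lemma bandlimited_norm_bound:
  fixes f :: "real ^ 'd \<Rightarrow> real ^ 'n"
  assumes "bandlimited N f" shows "norm (f x) \<le> (\<Sum>i\<in>UNIV. wiener_norm 0 (cpt f i))"
  by (rule order_trans[OF norm_le_l1_cart sum_mono[OF bandlimited_component_bound[OF assms]]])

lemma bandlimited_bcontfun:
  fixes f :: "real ^ 'd \<Rightarrow> real ^ 'n"
  assumes "bandlimited N f" shows "f \<in> bcontfun"
  unfolding bcontfun_def using bandlimited_continuous[OF assms] bandlimited_norm_bound[OF assms]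
  by (auto simp: bounded_iff)

lemma apply_Bcontfun_bandlimited:
  fixes f :: "real ^ 'd \<Rightarrow> real ^ 'n"
  shows "bandlimited N f \<Longrightarrow> apply_bcontfun (Bcontfun f) = f"
  by (rule Bcontfun_inverse[OF bandlimited_bcontfun])

lemma bcontfun_component_bound: "\<bar>apply_bcontfun (w :: (real ^ 'd) \<Rightarrow>\<^sub>C (real ^ 'n)) x $ i\<bar> \<le> norm w"
  using component_le_norm_cart[of "apply_bcontfun w x" i] norm_bounded[of w x] by linarith

lemma bounded_linear_bcontfun_component:
  "bounded_linear (\<lambda>w :: (real ^ 'd) \<Rightarrow>\<^sub>C (real ^ 'n). apply_bcontfun w x $ i)"
  by (rule bounded_linear_intro[where K = 1]) (auto simp: plus_bcontfun.rep_eq scaleR_bcontfun.rep_eq bcontfun_component_bound)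

lemma bounded_linear_bcontfun_fhat:
  "bounded_linear (\<lambda>w :: (real ^ 'd) \<Rightarrow>\<^sub>C (real ^ 'n). fhat (cpt (apply_bcontfun w) i) k)"
proof (rule bounded_linear_intro[where K = 1])
  have c: "continuous_on UNIV (cpt (apply_bcontfun w) i)" for w :: "(real ^ 'd) \<Rightarrow>\<^sub>C (real ^ 'n)"
    by (intro continuous_intros) auto
  show "fhat (cpt (apply_bcontfun (v + w)) i) k = fhat (cpt (apply_bcontfun v) i) k + fhat (cpt (apply_bcontfun w) i) k"
    for v w :: "(real ^ 'd) \<Rightarrow>\<^sub>C (real ^ 'n)"
    using fhat_add[OF c c, of v w k] by (simp add: plus_bcontfun.rep_eq)
  show "fhat (cpt (apply_bcontfun (r *\<^sub>R w)) i) k = r *\<^sub>R fhat (cpt (apply_bcontfun w) i) k"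
    for r and w :: "(real ^ 'd) \<Rightarrow>\<^sub>C (real ^ 'n)"
  proof -
    have "cpt (apply_bcontfun (r *\<^sub>R w)) i = (\<lambda>x. complex_of_real r * cpt (apply_bcontfun w) i x)"
      by (simp add: scaleR_bcontfun.rep_eq)
    then show ?thesis by (simp only: fhat_cmult scaleR_conv_of_real[of r "fhat (cpt (apply_bcontfun w) i) k"])
  qed
  show "norm (fhat (cpt (apply_bcontfun w) i) k) \<le> norm w * 1" for w :: "(real ^ 'd) \<Rightarrow>\<^sub>C (real ^ 'n)"
    using fhat_bound[OF c, of w "norm w"] bcontfun_component_bound[of w _ i] by simp
qed

lemma wiener_norm_le_coefficients:
  fixes f :: "real ^ 'd \<Rightarrow> real ^ 'n"
  assumes "bandlimited N f" "\<And>k. k \<in> freq_box N \<Longrightarrow> norm (fhat (cpt f i) k) \<le> B"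
  shows "wiener_norm r (cpt f i) \<le> (\<Sum>k\<in>(freq_box N :: (int ^ 'd) set). japanese_bracket k powr r) * B"
  unfolding wiener_norm_eq[OF bandlimited_trig_poly[OF assms(1)] finite_freq_box bandlimited_spectrum[OF assms(1)]] sum_distrib_right
  by (intro sum_mono mult_left_mono assms(2)) auto

lemma partial_x_diff:
  assumes "bandlimited N f" "bandlimited N g"
  shows "partial_x j (\<lambda>x. f x - g x) x $ i = partial_x j f x $ i - partial_x j g x $ i"
proof -
  have "complex_of_real (partial_x j f x $ i - partial_x j g x $ i) = complex_of_real (partial_x j (\<lambda>x. f x - g x) x $ i)"
  proof -
    have P: "complex_of_real (partial_x j h x $ i) = (\<Sum>k\<in>freq_box N. \<i> * of_int (k $ j) * fhat (cpt h i) k * character k x)"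
      if "bandlimited N h" for h
      using fun_cong[OF partial_x_bandlimited[OF that, of j i], of x]
      unfolding fourier_multiplier_eq[OF bandlimited_trig_poly[OF that] finite_freq_box bandlimited_spectrum[OF that]] .
    have h: "fhat (cpt (\<lambda>x. f x - g x) i) k = fhat (cpt f i) k - fhat (cpt g i) k" for k
      using fhat_diff[of "cpt f i" "cpt g i" k] trig_poly_continuous[OF bandlimited_trig_poly[OF assms(1)]]
        trig_poly_continuous[OF bandlimited_trig_poly[OF assms(2)]] by simp
    show ?thesis
      unfolding of_real_diff P[OF assms(1)] P[OF assms(2)] P[OF bandlimited_diff[OF assms]] h
      by (simp add: algebra_simps sum_subtractf)
  qed
  then show ?thesis by (metis of_real_eq_iff)
qed

text \<open>The equation as a vector field on bounded continuous functions. The argument is filtered first: this makes the field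
  defined and Lipschitz on balls of the whole Banach space, as derivatives of a function of degree \<open>N\<close> are bounded by
  its supremum, and changes nothing along solutions.\<close>

definition filtered_field :: "('d \<Rightarrow> real ^ 'n \<Rightarrow> real ^ 'n ^ 'n) \<Rightarrow> nat \<Rightarrow> ((real ^ 'd) \<Rightarrow>\<^sub>C (real ^ 'n)) \<Rightarrow> ((real ^ 'd) \<Rightarrow>\<^sub>C (real ^ 'n))" where
  "filtered_field A N w = Bcontfun (filtered_rhs A N (lowpass N (apply_bcontfun w)))"

lemma apply_filtered_field: "apply_bcontfun (filtered_field A N w) = filtered_rhs A N (lowpass N (apply_bcontfun w))"
  unfolding filtered_field_def by (rule apply_Bcontfun_bandlimited[OF bandlimited_filtered_rhs])

lemma filtered_field_lipschitz:
  fixes A :: "'d::finite \<Rightarrow> real ^ 'n \<Rightarrow> real ^ 'n ^ 'n"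
  assumes A: "\<And>j a b. real_polynomial_function (\<lambda>U. A j U $ a $ b)"
  shows "lipschitz_on_balls (filtered_field A N)"
  unfolding lipschitz_on_balls_def
proof
  fix R :: real
  define \<alpha> where "\<alpha> = (\<Sum>k\<in>(freq_box N :: (int ^ 'd) set). japanese_bracket k powr 1)"
  have \<alpha>: "0 \<le> \<alpha>" by (simp add: \<alpha>_def sum_nonneg)
  define R' where "R' = real CARD('n) * (\<alpha> * \<bar>R\<bar>)"
  have R': "0 \<le> R'" using \<alpha> by (simp add: R'_def)
  have "\<exists>L\<ge>0. \<forall>p::'d \<times> 'n \<times> 'n. \<forall>x y. norm x \<le> R' \<longrightarrow> norm y \<le> R' \<longrightarrow>
      norm (A (fst p) x $ fst (snd p) $ snd (snd p) - A (fst p) y $ fst (snd p) $ snd (snd p)) \<le> L * norm (x - y)"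
  proof (rule uniform_bound_finite)
    show "\<exists>L\<ge>0. \<forall>x y. norm x \<le> R' \<longrightarrow> norm y \<le> R' \<longrightarrow>
      norm (A (fst p) x $ fst (snd p) $ snd (snd p) - A (fst p) y $ fst (snd p) $ snd (snd p)) \<le> L * norm (x - y)" for p
      using real_polynomial_lipschitz_on_balls[OF A] unfolding lipschitz_on_balls_def by blast
  qed (meson mult_right_mono norm_ge_zero order_trans)
  then obtain L where L: "L \<ge> 0" "\<And>j a b x y. norm x \<le> R' \<Longrightarrow> norm y \<le> R' \<Longrightarrow>
      \<bar>A j x $ a $ b - A j y $ a $ b\<bar> \<le> L * norm (x - y)"
    by (metis fst_conv snd_conv real_norm_def)
  define a0 where "a0 = (\<Sum>p\<in>(UNIV :: ('d \<times> 'n \<times> 'n) set). \<bar>A (fst p) 0 $ fst (snd p) $ snd (snd p)\<bar>) + L * R'"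
  have a0: "0 \<le> a0" using L R' by (simp add: a0_def sum_nonneg)
  have Ab: "\<bar>A j x $ a $ b\<bar> \<le> a0" if "norm x \<le> R'" for j a b x
  proof -
    have "\<bar>A j 0 $ a $ b\<bar> \<le> (\<Sum>p\<in>(UNIV :: ('d \<times> 'n \<times> 'n) set). \<bar>A (fst p) 0 $ fst (snd p) $ snd (snd p)\<bar>)"
      using member_le_sum[of "(j, a, b)" "UNIV :: ('d \<times> 'n \<times> 'n) set" "\<lambda>p. \<bar>A (fst p) 0 $ fst (snd p) $ snd (snd p)\<bar>"] by simp
    moreover have "L * norm (x - 0) \<le> L * R'" using that L by (intro mult_left_mono) auto
    ultimately show ?thesis using L(2)[of x 0 j a b] that R' unfolding a0_def by simp
  qed
  define \<beta> where "\<beta> = real (card (freq_box N :: (int ^ 'd) set))"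
  define M where "M = real CARD('n) * (\<beta> * (real CARD('d) * (real CARD('n) * (a0 * \<alpha> + L * (real CARD('n) * \<alpha>) * (\<alpha> * \<bar>R\<bar>)))))"
  have M: "0 \<le> M" unfolding M_def \<beta>_def using a0 \<alpha> L by simp
  have "norm (filtered_field A N v - filtered_field A N w) \<le> M * norm (v - w)" if vw: "norm v \<le> R" "norm w \<le> R" for v w
  proof -
    define f g where "f = lowpass N (apply_bcontfun v)" and "g = lowpass N (apply_bcontfun w)"
    have bf: "bandlimited N f" and bg: "bandlimited N g" by (simp_all add: f_def g_def bandlimited_lowpass)
    note bd = bandlimited_diff[OF bf bg]
    define \<delta> where "\<delta> = norm (v - w)"
    have hf: "fhat (cpt f i) k = fhat (cpt (apply_bcontfun v) i) k" and hg: "fhat (cpt g i) k = fhat (cpt (apply_bcontfun w) i) k"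
      if "k \<in> freq_box N" for i k using that by (simp_all add: f_def g_def fhat_lowpass)
    interpret bl: bounded_linear "\<lambda>w :: (real ^ 'd) \<Rightarrow>\<^sub>C (real ^ 'n). fhat (cpt (apply_bcontfun w) i) k" for i k
      by (rule bounded_linear_bcontfun_fhat)
    have hb: "norm (fhat (cpt (apply_bcontfun v) i) k) \<le> norm v" for v :: "(real ^ 'd) \<Rightarrow>\<^sub>C (real ^ 'n)" and i k
    proof (rule fhat_bound)
      show "continuous_on UNIV (cpt (apply_bcontfun v) i)" by (intro continuous_intros) auto
    qed (simp add: bcontfun_component_bound)
    have wf: "wiener_norm 1 (cpt f i) \<le> \<alpha> * \<bar>R\<bar>" and wg: "wiener_norm 1 (cpt g i) \<le> \<alpha> * \<bar>R\<bar>" for i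
    proof -
      have c: "norm (fhat (cpt f i) k) \<le> \<bar>R\<bar>" "norm (fhat (cpt g i) k) \<le> \<bar>R\<bar>" if k: "k \<in> freq_box N" for k
        unfolding hf[OF k] hg[OF k] using hb[of v i k] hb[of w i k] vw by linarith+
      show "wiener_norm 1 (cpt f i) \<le> \<alpha> * \<bar>R\<bar>"
        unfolding \<alpha>_def by (rule wiener_norm_le_coefficients[OF bf c(1)])
      show "wiener_norm 1 (cpt g i) \<le> \<alpha> * \<bar>R\<bar>"
        unfolding \<alpha>_def by (rule wiener_norm_le_coefficients[OF bg c(2)])
    qed
    have wd: "wiener_norm 1 (cpt (\<lambda>x. f x - g x) i) \<le> \<alpha> * \<delta>" for i
      unfolding \<alpha>_def
    proof (rule wiener_norm_le_coefficients[OF bd])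
      fix k :: "int ^ 'd" assume k: "k \<in> freq_box N"
      have "fhat (cpt (\<lambda>x. f x - g x) i) k = fhat (cpt f i) k - fhat (cpt g i) k"
        using fhat_diff[of "cpt f i" "cpt g i" k] trig_poly_continuous[OF bandlimited_trig_poly[OF bf]]
        trig_poly_continuous[OF bandlimited_trig_poly[OF bg]] by simp
      also have "\<dots> = fhat (cpt (apply_bcontfun (v - w)) i) k" unfolding hf[OF k] hg[OF k] bl.diff ..
      finally show "norm (fhat (cpt (\<lambda>x. f x - g x) i) k) \<le> \<delta>" using hb[of "v - w" i k] by (simp add: \<delta>_def)
    qed
    have nb: "norm (h x) \<le> real CARD('n) * W" if "bandlimited N h" "\<And>i. wiener_norm 1 (cpt h i) \<le> W" for h :: "real ^ 'd \<Rightarrow> real ^ 'n" and x W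
    proof -
      have "norm (h x) \<le> (\<Sum>i\<in>(UNIV :: 'n set). W)"
        by (rule order_trans[OF bandlimited_norm_bound[OF that(1)]]) (intro sum_mono order_trans[OF wiener_norm_0_le_1] that(2))
      then show ?thesis by simp
    qed
    have pb: "\<bar>partial_x j h x $ i\<bar> \<le> W" if "bandlimited N h" "\<And>i. wiener_norm 1 (cpt h i) \<le> W" for h :: "real ^ 'd \<Rightarrow> real ^ 'n" and x W j i
      using bandlimited_component_bound[OF bandlimited_partial_x[OF that(1)], of j x i] wiener_norm_partial_x[OF that(1), of j i] that(2)[of i] by linarith
    let ?F = "\<lambda>f y. \<Sum>j\<in>UNIV. A j (f y) *v partial_x j f y"
    have Fc: "?F f y $ a = (\<Sum>j\<in>UNIV. \<Sum>b\<in>UNIV. A j (f y) $ a $ b * partial_x j f y $ b)" for f y a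
      by (simp add: matrix_vector_mult_def)
    have Fd: "\<bar>?F f y $ a - ?F g y $ a\<bar> \<le> real CARD('d) * (real CARD('n) * (a0 * \<alpha> + L * (real CARD('n) * \<alpha>) * (\<alpha> * \<bar>R\<bar>))) * \<delta>" for y a
    proof -
      have "\<bar>?F f y $ a - ?F g y $ a\<bar> = \<bar>\<Sum>j\<in>UNIV. \<Sum>b\<in>UNIV. A j (f y) $ a $ b * partial_x j f y $ b - A j (g y) $ a $ b * partial_x j g y $ b\<bar>"
        unfolding Fc by (simp add: sum_subtractf)
      also have "\<dots> \<le> (\<Sum>j\<in>(UNIV::'d set). \<Sum>b\<in>(UNIV::'n set). a0 * (\<alpha> * \<delta>) + (L * (real CARD('n) * (\<alpha> * \<delta>))) * (\<alpha> * \<bar>R\<bar>))"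
      proof (intro order_trans[OF sum_abs] sum_mono)
        fix j b
        have "A j (f y) $ a $ b * partial_x j f y $ b - A j (g y) $ a $ b * partial_x j g y $ b
          = A j (f y) $ a $ b * partial_x j (\<lambda>x. f x - g x) y $ b + (A j (f y) $ a $ b - A j (g y) $ a $ b) * partial_x j g y $ b"
          unfolding partial_x_diff[OF bf bg] by (simp add: algebra_simps)
        also have "\<bar>\<dots>\<bar> \<le> \<bar>A j (f y) $ a $ b\<bar> * \<bar>partial_x j (\<lambda>x. f x - g x) y $ b\<bar> + \<bar>A j (f y) $ a $ b - A j (g y) $ a $ b\<bar> * \<bar>partial_x j g y $ b\<bar>"
          by (rule order_trans[OF abs_triangle_ineq]) (simp add: abs_mult)
        also have "\<dots> \<le> a0 * (\<alpha> * \<delta>) + (L * (real CARD('n) * (\<alpha> * \<delta>))) * (\<alpha> * \<bar>R\<bar>)"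
        proof (intro add_mono mult_mono)
          have n: "norm (f y) \<le> R'" "norm (g y) \<le> R'"
            unfolding R'_def by (rule nb[OF bf wf], rule nb[OF bg wg])
          show "\<bar>A j (f y) $ a $ b\<bar> \<le> a0" by (rule Ab[OF n(1)])
          show "\<bar>A j (f y) $ a $ b - A j (g y) $ a $ b\<bar> \<le> L * (real CARD('n) * (\<alpha> * \<delta>))"
            by (rule order_trans[OF L(2)[OF n] mult_left_mono[OF nb[OF bd wd] L(1)]])
          show "\<bar>partial_x j (\<lambda>x. f x - g x) y $ b\<bar> \<le> \<alpha> * \<delta>" by (rule pb[OF bd wd])
          show "\<bar>partial_x j g y $ b\<bar> \<le> \<alpha> * \<bar>R\<bar>" by (rule pb[OF bg wg])
        qed (use a0 L \<alpha> in \<open>auto simp: \<delta>_def\<close>)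
        finally show "\<bar>A j (f y) $ a $ b * partial_x j f y $ b - A j (g y) $ a $ b * partial_x j g y $ b\<bar>
          \<le> a0 * (\<alpha> * \<delta>) + (L * (real CARD('n) * (\<alpha> * \<delta>))) * (\<alpha> * \<bar>R\<bar>)" .
      qed
      also have "\<dots> = real CARD('d) * (real CARD('n) * (a0 * \<alpha> + L * (real CARD('n) * \<alpha>) * (\<alpha> * \<bar>R\<bar>))) * \<delta>"
        by (simp add: algebra_simps)
      finally show ?thesis .
    qed
    have cF: "continuous_on UNIV (cpt (?F h) a)" if "bandlimited N h" for h a
      unfolding flux_component
      by (intro continuous_on_sum continuous_on_mult continuous_on_of_real continuous_on_real_polynomial[OF A bandlimited_continuous[OF that]]
          trig_poly_continuous bandlimited_trig_poly[OF bandlimited_partial_x[OF that]])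
    let ?W = "real CARD('d) * (real CARD('n) * (a0 * \<alpha> + L * (real CARD('n) * \<alpha>) * (\<alpha> * \<bar>R\<bar>))) * \<delta>"
    have comp: "\<bar>filtered_rhs A N f x $ a - filtered_rhs A N g x $ a\<bar> \<le> \<beta> * ?W" for x a
    proof -
      have "norm (complex_of_real (filtered_rhs A N f x $ a - filtered_rhs A N g x $ a))
          = norm (\<Sum>k\<in>freq_box N. (fhat (cpt (?F g) a) k - fhat (cpt (?F f) a) k) * character k x)"
        unfolding filtered_rhs_def by (simp add: lowpass_complex left_diff_distrib sum_subtractf)
      also have "\<dots> \<le> (\<Sum>k\<in>(freq_box N :: (int ^ 'd) set). ?W)"
      proof (intro order_trans[OF norm_sum] sum_mono)
        fix k :: "int ^ 'd"
        have "norm (fhat (\<lambda>x. cpt (?F g) a x - cpt (?F f) a x) k) \<le> ?W"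
        proof (rule fhat_bound)
          show "continuous_on UNIV (\<lambda>x. cpt (?F g) a x - cpt (?F f) a x)"
            by (intro continuous_on_diff cF bf bg)
          show "norm (cpt (?F g) a y - cpt (?F f) a y) \<le> ?W" for y
            using Fd[of y a] unfolding of_real_diff[symmetric] norm_of_real by (simp only: abs_minus_commute)
        qed
        then show "norm ((fhat (cpt (?F g) a) k - fhat (cpt (?F f) a) k) * character k x) \<le> ?W"
          unfolding fhat_diff[OF cF[OF bg] cF[OF bf]] by (simp add: norm_mult)
      qed
      finally show ?thesis by (simp only: norm_of_real sum_constant \<beta>_def)
    qed
    show ?thesis
    proof (rule norm_bound)
      fix x
      have "norm (apply_bcontfun (filtered_field A N v - filtered_field A N w) x)
         = norm (filtered_rhs A N f x - filtered_rhs A N g x)"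
        by (simp add: minus_bcontfun.rep_eq apply_filtered_field f_def g_def)
      also have "\<dots> \<le> (\<Sum>a\<in>(UNIV::'n set). \<beta> * ?W)"
        by (rule order_trans[OF norm_le_l1_cart sum_mono]) (simp add: comp)
      also have "\<dots> = M * norm (v - w)" by (simp add: M_def \<delta>_def)
      finally show "norm (apply_bcontfun (filtered_field A N v - filtered_field A N w) x) \<le> M * norm (v - w)" .
    qed
  qed
  then show "\<exists>L\<ge>0. \<forall>x y. norm x \<le> R \<longrightarrow> norm y \<le> R \<longrightarrow> norm (filtered_field A N x - filtered_field A N y) \<le> L * norm (x - y)"
    using M by blast
qed

lemma fhat_bandlimited_diff:
  assumes "bandlimited N f" "bandlimited N g"
  shows "fhat (cpt (\<lambda>x. f x - g x) i) k = fhat (cpt f i) k - fhat (cpt g i) k"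
  using fhat_diff[of "cpt f i" "cpt g i" k] trig_poly_continuous[OF bandlimited_trig_poly[OF assms(1)]]
    trig_poly_continuous[OF bandlimited_trig_poly[OF assms(2)]] by simp

lemma Hs_norm_tendsto_0:
  fixes f :: "'a \<Rightarrow> real ^ 'd \<Rightarrow> real ^ 'n"
  assumes b: "\<forall>\<^sub>F \<tau> in F. bandlimited N (f \<tau>)" and c: "\<And>i k. ((\<lambda>\<tau>. fhat (cpt (f \<tau>) i) k) \<longlongrightarrow> 0) F"
  shows "((\<lambda>\<tau>. Hs_norm s (f \<tau>)) \<longlongrightarrow> 0) F"
proof (rule Lim_null_comparison)
  let ?B = "\<lambda>\<tau>. \<Sum>i\<in>UNIV. \<Sum>k\<in>freq_box N. norm (fhat (cpt (f \<tau>) i) k)"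
  let ?a = "real CARD('n) * (\<Sum>k\<in>(freq_box N :: (int ^ 'd) set). japanese_bracket k powr s)"
  show "\<forall>\<^sub>F \<tau> in F. norm (Hs_norm s (f \<tau>)) \<le> ?a * ?B \<tau>"
    using b
  proof eventually_elim
    case (elim \<tau>)
    have "Hs_norm s (f \<tau>) \<le> ?a * ?B \<tau>"
    proof (rule Hs_norm_le_coefficients[OF elim])
      fix i and k :: "int ^ 'd" assume k: "k \<in> freq_box N"
      have "norm (fhat (cpt (f \<tau>) i) k) \<le> (\<Sum>k\<in>freq_box N. norm (fhat (cpt (f \<tau>) i) k))"
        by (rule member_le_sum[OF k]) auto
      also have "\<dots> \<le> ?B \<tau>"
        by (rule member_le_sum[of i UNIV "\<lambda>i. \<Sum>k\<in>freq_box N. norm (fhat (cpt (f \<tau>) i) k)"]) (auto intro: sum_nonneg)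
      finally show "norm (fhat (cpt (f \<tau>) i) k) \<le> ?B \<tau>" .
    qed
    then show ?case by (simp add: Hs_norm_nonneg)
  qed
  have "((\<lambda>\<tau>. ?a * ?B \<tau>) \<longlongrightarrow> ?a * (\<Sum>i\<in>(UNIV :: 'n set). \<Sum>k\<in>(freq_box N :: (int ^ 'd) set). 0)) F"
    by (intro tendsto_mult_left tendsto_sum tendsto_norm_zero c)
  then show "((\<lambda>\<tau>. ?a * ?B \<tau>) \<longlongrightarrow> 0) F" by simp
qed

lemma eventually_in_within: "\<forall>\<^sub>F \<tau> in at t within I. \<tau> \<in> I"
  by (simp add: eventually_at_filter)

lemma Hs_continuous_on_bandlimited:
  assumes b: "\<And>t. t \<in> I \<Longrightarrow> bandlimited N (u t)" and c: "\<And>i k. continuous_on I (\<lambda>t. fhat (cpt (u t) i) k)"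
  shows "Hs_continuous_on s I u"
  unfolding Hs_continuous_on_def
proof (intro conjI ballI)
  fix t assume t: "t \<in> I"
  show "u t \<in> Hs s" by (rule Hs_norm_bandlimited(1)[OF b[OF t]])
  show "((\<lambda>\<tau>. Hs_norm s (\<lambda>x. u \<tau> x - u t x)) \<longlongrightarrow> 0) (at t within I)"
  proof (rule Hs_norm_tendsto_0)
    show "\<forall>\<^sub>F \<tau> in at t within I. bandlimited N (\<lambda>x. u \<tau> x - u t x)"
      using eventually_in_within by eventually_elim (intro bandlimited_diff b t)
    fix i k
    have "((\<lambda>\<tau>. fhat (cpt (u \<tau>) i) k - fhat (cpt (u t) i) k) \<longlongrightarrow> 0) (at t within I)"
      using c[of i k] t unfolding continuous_on_def by (intro LIM_zero) auto
    moreover have "\<forall>\<^sub>F \<tau> in at t within I. fhat (cpt (u \<tau>) i) k - fhat (cpt (u t) i) k = fhat (cpt (\<lambda>x. u \<tau> x - u t x) i) k"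
      using eventually_in_within by eventually_elim (rule fhat_bandlimited_diff[symmetric, OF b b[OF t]])
    ultimately show "((\<lambda>\<tau>. fhat (cpt (\<lambda>x. u \<tau> x - u t x) i) k) \<longlongrightarrow> 0) (at t within I)"
      by (rule Lim_transform_eventually)
  qed
qed

lemma Hs_C1_on_bandlimited:
  assumes b: "\<And>t. t \<in> I \<Longrightarrow> bandlimited N (u t)" and bw: "\<And>t. t \<in> I \<Longrightarrow> bandlimited N (w t)"
    and d: "\<And>t i k. t \<in> I \<Longrightarrow> ((\<lambda>t. fhat (cpt (u t) i) k) has_vector_derivative fhat (cpt (w t) i) k) (at t within I)"
    and cw: "\<And>i k. continuous_on I (\<lambda>t. fhat (cpt (w t) i) k)"
  shows "Hs_C1_on s I u"
  unfolding Hs_C1_on_def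
proof (intro conjI exI[of _ w] ballI)
  show "Hs_continuous_on s I u"
    by (rule Hs_continuous_on_bandlimited[OF b]) (auto intro!: continuous_on_vector_derivative d)
  show "Hs_continuous_on s I w" by (rule Hs_continuous_on_bandlimited[OF bw cw])
  fix t assume t: "t \<in> I"
  let ?q = "\<lambda>\<tau> x. (u \<tau> x - u t x) /\<^sub>R (\<tau> - t) - w t x"
  show "((\<lambda>\<tau>. Hs_norm s (?q \<tau>)) \<longlongrightarrow> 0) (at t within I)"
  proof (rule Hs_norm_tendsto_0)
    show "\<forall>\<^sub>F \<tau> in at t within I. bandlimited N (?q \<tau>)"
      using eventually_in_within by eventually_elim (intro bandlimited_diff bandlimited_scaleR b bw t)
    fix i k
    let ?c = "\<lambda>\<tau>. fhat (cpt (u \<tau>) i) k" and ?d = "fhat (cpt (w t) i) k"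
    have "((\<lambda>\<tau>. (1 / norm (\<tau> - t)) *\<^sub>R (?c \<tau> - (?c t + (\<tau> - t) *\<^sub>R ?d))) \<longlongrightarrow> 0) (at t within I)"
      using d[OF t, of i k] unfolding has_vector_derivative_def has_derivative_within by simp
    then have l: "((\<lambda>\<tau>. norm ((1 / norm (\<tau> - t)) *\<^sub>R (?c \<tau> - (?c t + (\<tau> - t) *\<^sub>R ?d)))) \<longlongrightarrow> 0) (at t within I)"
      by (rule tendsto_norm_zero)
    have "\<forall>\<^sub>F \<tau> in at t within I. \<tau> \<noteq> t" by (simp add: eventually_at_filter)
    then have "\<forall>\<^sub>F \<tau> in at t within I. norm ((1 / norm (\<tau> - t)) *\<^sub>R (?c \<tau> - (?c t + (\<tau> - t) *\<^sub>R ?d))) = norm (fhat (cpt (?q \<tau>) i) k)"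
      using eventually_in_within
    proof eventually_elim
      case (elim \<tau>)
      have bd: "bandlimited N (\<lambda>x. u \<tau> x - u t x)" by (intro bandlimited_diff b t elim)
      have "fhat (cpt (?q \<tau>) i) k = fhat (cpt (\<lambda>x. (u \<tau> x - u t x) /\<^sub>R (\<tau> - t)) i) k - ?d"
        by (rule fhat_bandlimited_diff[OF bandlimited_scaleR[OF bd] bw[OF t]])
      also have "cpt (\<lambda>x. (u \<tau> x - u t x) /\<^sub>R (\<tau> - t)) i = (\<lambda>x. complex_of_real (inverse (\<tau> - t)) * cpt (\<lambda>x. u \<tau> x - u t x) i x)"
        by (simp add: of_real_mult)
      also have "fhat \<dots> k = complex_of_real (inverse (\<tau> - t)) * (?c \<tau> - ?c t)"
        unfolding fhat_cmult fhat_bandlimited_diff[OF b[OF elim(2)] b[OF t]] ..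
      finally have q: "fhat (cpt (?q \<tau>) i) k = complex_of_real (inverse (\<tau> - t)) * (?c \<tau> - ?c t) - ?d" .
      have "?c \<tau> - (?c t + (\<tau> - t) *\<^sub>R ?d) = complex_of_real (\<tau> - t) * fhat (cpt (?q \<tau>) i) k"
      proof -
        have i: "complex_of_real (\<tau> - t) * complex_of_real (inverse (\<tau> - t)) = 1"
          unfolding of_real_mult[symmetric] using elim(1) by simp
        have alg: "p - (q + a * e) = a * (b * (p - q) - e)" if "a * b = 1" for a b p q e :: complex
          using that by (simp add: right_diff_distrib mult.assoc[symmetric])
        have s: "(\<tau> - t) *\<^sub>R ?d = complex_of_real (\<tau> - t) * ?d" by (rule scaleR_conv_of_real)
        show ?thesis unfolding q s by (rule alg[OF i])
      qed
      then show ?case using elim(1) by (simp add: norm_mult del: of_real_diff)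
    qed
    from Lim_transform_eventually[OF l this]
    have "((\<lambda>\<tau>. norm (fhat (cpt (?q \<tau>) i) k)) \<longlongrightarrow> 0) (at t within I)" .
    then show "((\<lambda>\<tau>. fhat (cpt (?q \<tau>) i) k) \<longlongrightarrow> 0) (at t within I)" by (rule tendsto_norm_zero_cancel)
  qed
qed

text \<open>Writes a bandlimited function as a real linear combination of fixed elements of the Banach space. Differentiability of
  the coefficients thus gives differentiability in the supremum norm.\<close>

lemma bcontfun_synthesis:
  fixes f :: "real ^ 'd \<Rightarrow> real ^ 'n"
  assumes "bandlimited N f"
  shows "Bcontfun f = (\<Sum>i\<in>UNIV. \<Sum>k\<in>freq_box N.
     Re (fhat (cpt f i) k) *\<^sub>R Bcontfun (\<lambda>x. Re (character k x) *\<^sub>R axis i 1)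
     + Im (fhat (cpt f i) k) *\<^sub>R Bcontfun (\<lambda>x. - Im (character k x) *\<^sub>R axis i 1))" (is "_ = ?R")
proof (rule bcontfun_eqI)
  fix x
  have e: "apply_bcontfun (Bcontfun (\<lambda>x. h (character k x) *\<^sub>R axis i 1 :: real ^ 'n)) = (\<lambda>x. h (character k x) *\<^sub>R axis i 1)"
    if h: "continuous_on UNIV h" "\<And>z. \<bar>h z\<bar> \<le> norm z" for h :: "complex \<Rightarrow> real" and k :: "int ^ 'd" and i
  proof (rule Bcontfun_inverse)
    have "continuous_on UNIV (\<lambda>x. h (character k x))"
      by (rule continuous_on_compose2[OF h(1) continuous_character]) auto
    then have "continuous_on UNIV (\<lambda>x. h (character k x) *\<^sub>R axis i 1 :: real ^ 'n)" by (intro continuous_intros)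
    moreover have "bounded (range (\<lambda>x. h (character k x) *\<^sub>R axis i 1 :: real ^ 'n))"
    proof (rule boundedI)
      fix v assume "v \<in> range (\<lambda>x. h (character k x) *\<^sub>R axis i 1 :: real ^ 'n)"
      then obtain x where "v = h (character k x) *\<^sub>R axis i 1" by blast
      then show "norm v \<le> 1" using h(2)[of "character k x"] by simp
    qed
    ultimately show "(\<lambda>x. h (character k x) *\<^sub>R axis i 1 :: real ^ 'n) \<in> bcontfun" by (simp add: bcontfun_def)
  qed
  have "apply_bcontfun ?R x $ j = f x $ j" for j
  proof -
    interpret bounded_linear "\<lambda>w :: (real ^ 'd) \<Rightarrow>\<^sub>C (real ^ 'n). apply_bcontfun w x $ j"
      by (rule bounded_linear_bcontfun_component)
    have "apply_bcontfun ?R x $ j = (\<Sum>i\<in>UNIV. \<Sum>k\<in>freq_box N.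
      Re (fhat (cpt f i) k) * (Re (character k x) * axis i 1 $ j) + Im (fhat (cpt f i) k) * (- Im (character k x) * axis i 1 $ j))"
      unfolding sum add scale
      using e[of Re] e[of "\<lambda>z. - Im z"] by (simp add: abs_Re_le_cmod abs_Im_le_cmod continuous_intros)
    also have "\<dots> = (\<Sum>i\<in>UNIV. if i = j then Re (\<Sum>k\<in>freq_box N. fhat (cpt f i) k * character k x) else 0)"
      by (intro sum.cong refl) (simp add: axis_def)
    also have "\<dots> = Re (cpt f j x)"
      using trig_poly_expand[OF bandlimited_trig_poly[OF assms, of j] finite_freq_box bandlimited_spectrum[OF assms], where x = x]
      by (simp del: Re_complex_of_real)
    finally show ?thesis by simp
  qed
  then show "apply_bcontfun (Bcontfun f) x = apply_bcontfun ?R x"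
    by (simp add: apply_Bcontfun_bandlimited[OF assms] vec_eq_iff)
qed

lemma classical_imp_ode_solution:
  assumes sol: "classical_solution A N s U0 I u"
  shows "ode_solution (filtered_field A N) (Bcontfun (lowpass N U0)) I (\<lambda>t. Bcontfun (u t))"
  unfolding ode_solution_def
proof (intro conjI ballI)
  show I: "open I" "is_interval I" "0 \<in> I" using sol unfolding classical_solution_def by auto
  have "u 0 = lowpass N U0" using sol unfolding classical_solution_def by auto
  then show "Bcontfun (u 0) = Bcontfun (lowpass N U0)" by simp
  fix t assume t: "t \<in> I"
  note b = classical_solution_bandlimited[OF sol]
  let ?w = "filtered_rhs A N (u t)"
  have "((\<lambda>t. \<Sum>i\<in>UNIV. \<Sum>k\<in>freq_box N.
     Re (fhat (cpt (u t) i) k) *\<^sub>R Bcontfun (\<lambda>x. Re (character k x) *\<^sub>R axis i 1)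
     + Im (fhat (cpt (u t) i) k) *\<^sub>R Bcontfun (\<lambda>x. - Im (character k x) *\<^sub>R axis i 1))
    has_vector_derivative (\<Sum>i\<in>UNIV. \<Sum>k\<in>freq_box N.
     Re (fhat (cpt ?w i) k) *\<^sub>R Bcontfun (\<lambda>x. Re (character k x) *\<^sub>R axis i 1)
     + Im (fhat (cpt ?w i) k) *\<^sub>R Bcontfun (\<lambda>x. - Im (character k x) *\<^sub>R axis i 1))) (at t)"
    by (intro has_vector_derivative_sum has_vector_derivative_add
        bounded_linear.has_vector_derivative[OF bounded_linear_compose[OF bounded_linear_scaleR_left bounded_linear_Re]]
        bounded_linear.has_vector_derivative[OF bounded_linear_compose[OF bounded_linear_scaleR_left bounded_linear_Im]]
        classical_solution_coefficient_derivative(1)[OF sol t])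
  also have "(\<Sum>i\<in>UNIV. \<Sum>k\<in>freq_box N.
     Re (fhat (cpt ?w i) k) *\<^sub>R Bcontfun (\<lambda>x. Re (character k x) *\<^sub>R axis i 1)
     + Im (fhat (cpt ?w i) k) *\<^sub>R Bcontfun (\<lambda>x. - Im (character k x) *\<^sub>R axis i 1)) = Bcontfun ?w"
    by (rule bcontfun_synthesis[symmetric, OF bandlimited_filtered_rhs])
  also have "Bcontfun ?w = filtered_field A N (Bcontfun (u t))"
    by (simp add: filtered_field_def apply_Bcontfun_bandlimited[OF b[OF t]] lowpass_bandlimited[OF b[OF t]])
  finally show "((\<lambda>t. Bcontfun (u t)) has_vector_derivative filtered_field A N (Bcontfun (u t))) (at t)"
    by (rule has_vector_derivative_transform_within_open[OF _ I(1) t]) (rule bcontfun_synthesis[symmetric, OF b])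
qed

lemma has_derivative_character:
  "(character k has_derivative (\<lambda>\<xi>. of_real (freq_dot k \<xi>) * (\<i> * character k x))) (at x)"
proof -
  have "bounded_linear (freq_dot k)"
    unfolding freq_dot_def by (intro bounded_linear_sum bounded_linear_const_mult bounded_linear_vec_nth)
  note D = bounded_linear_imp_has_derivative[OF this, of "at x"]
  show ?thesis
    unfolding character_def[abs_def] cis_conv_exp
    by (rule has_derivative_eq_rhs[OF has_derivative_compose[OF has_derivative_mult_right[OF has_derivative_of_real[OF D]]
          DERIV_exp[unfolded has_field_derivative_def]]])
       (simp add: fun_eq_iff mult_ac)
qed

lemma Re_of_real_times: "Re (complex_of_real r * z) = r * Re z"
  by simp

text \<open>A finite sum of characters with coefficients that are continuously differentiable in time is continuously
  differentiable jointly in time and space.\<close>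

lemma spacetime_C1_bandlimited:
  fixes u w :: "real \<Rightarrow> real ^ 'd \<Rightarrow> real ^ 'n"
  assumes I: "open I"
    and b: "\<And>t. t \<in> I \<Longrightarrow> bandlimited N (u t)" and bw: "\<And>t. t \<in> I \<Longrightarrow> bandlimited N (w t)"
    and d: "\<And>t i k. t \<in> I \<Longrightarrow> ((\<lambda>t. fhat (cpt (u t) i) k) has_vector_derivative fhat (cpt (w t) i) k) (at t)"
    and cw: "\<And>i k. continuous_on I (\<lambda>t. fhat (cpt (w t) i) k)"
  shows "spacetime_C1_on I u"
proof -
  have cu: "continuous_on I (\<lambda>t. fhat (cpt (u t) i) k)" for i k
    by (rule continuous_on_vector_derivative) (rule has_vector_derivative_at_within[OF d])
  let ?G = "\<lambda>f m z. (\<chi> i. Re (\<Sum>k\<in>freq_box N. m k * fhat (cpt (f (fst z)) i) k * character k (snd z))) :: real ^ 'n"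
  let ?ut = "?G w (\<lambda>k. 1)" and ?ud = "\<lambda>j. ?G u (\<lambda>k. \<i> * of_int (k $ j))"
  have cG: "continuous_on (I \<times> UNIV) (?G f m)" if "\<And>i k. continuous_on I (\<lambda>t. fhat (cpt (f t) i) k)"
    for f :: "real \<Rightarrow> real ^ 'd \<Rightarrow> real ^ 'n" and m
  proof -
    have "continuous_on (I \<times> UNIV) (\<lambda>z. fhat (cpt (f (fst z)) i) k)" for i k
      by (rule continuous_on_compose2[OF that continuous_on_fst[OF continuous_on_id]]) auto
    moreover have "continuous_on (I \<times> UNIV) (\<lambda>z. character k (snd z))" for k :: "int ^ 'd"
      by (rule continuous_on_compose2[OF continuous_character[of UNIV] continuous_on_snd[OF continuous_on_id]]) auto
    ultimately show ?thesis
      by (intro continuous_on_vec_lambda continuous_on_Re continuous_on_sum continuous_on_mult continuous_on_const) auto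
  qed
  define D :: "real \<times> (real ^ 'd) \<Rightarrow> (real \<times> (real ^ 'd)) \<Rightarrow>\<^sub>L (real ^ 'n)" where
    "D z = (blinfun_scaleR_left (?ut z) o\<^sub>L fst_blinfun)
        + (\<Sum>j\<in>UNIV. (blinfun_scaleR_left (?ud j z) o\<^sub>L blinfun_inner_left (axis j 1)) o\<^sub>L snd_blinfun)" for z
  have Dapp: "blinfun_apply (D z) (h, \<xi>) = h *\<^sub>R ?ut z + (\<Sum>j\<in>UNIV. (\<xi> $ j) *\<^sub>R ?ud j z)" for z h \<xi>
    by (simp add: D_def blinfun.add_left blinfun.sum_left fst_blinfun.rep_eq snd_blinfun.rep_eq inner_axis inner_axis' vector_scaleR_component)
  have "continuous_on (I \<times> UNIV) D"
    unfolding D_def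
    by (intro continuous_intros bounded_linear.continuous_on[OF bounded_linear_blinfun_scaleR_left] cG[OF cw] cG[OF cu])
  moreover have "((\<lambda>(t, x). u t x) has_derivative blinfun_apply (D z)) (at z)" if z: "z \<in> I \<times> UNIV" for z
  proof -
    obtain t x where tx: "z = (t, x)" "t \<in> I" using z by auto
    have "((\<lambda>z. ?G u (\<lambda>k. 1) z $ i) has_derivative (\<lambda>h. blinfun_apply (D z) h $ i)) (at z)" for i
    proof -
      let ?c = "\<lambda>k t. fhat (cpt (u t) i) k"
      have dc: "((\<lambda>z. ?c k (fst z)) has_derivative (\<lambda>h. fst h *\<^sub>R fhat (cpt (w t) i) k)) (at z)" for k
      proof -
        have "(?c k has_derivative (\<lambda>h. h *\<^sub>R fhat (cpt (w t) i) k)) (at (fst z))"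
          using d[OF tx(2), of i k] by (simp add: tx(1) has_vector_derivative_def)
        from has_derivative_compose[OF has_derivative_fst[OF has_derivative_ident] this] show ?thesis .
      qed
      have dx: "((\<lambda>z. character k (snd z)) has_derivative (\<lambda>h. of_real (freq_dot k (snd h)) * (\<i> * character k x))) (at z)" for k :: "int ^ 'd"
      proof -
        have "(character k has_derivative (\<lambda>\<xi>. of_real (freq_dot k \<xi>) * (\<i> * character k x))) (at (snd z))"
          using has_derivative_character[of k x] by (simp add: tx(1))
        from has_derivative_compose[OF has_derivative_snd[OF has_derivative_ident] this] show ?thesis .
      qed
      have "((\<lambda>z. Re (\<Sum>k\<in>freq_box N. ?c k (fst z) * character k (snd z))) has_derivative
        (\<lambda>h. Re (\<Sum>k\<in>freq_box N. ?c k (fst z) * (of_real (freq_dot k (snd h)) * (\<i> * character k x)) + (fst h *\<^sub>R fhat (cpt (w t) i) k) * character k (snd z)))) (at z)"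
        by (intro has_derivative_Re has_derivative_sum has_derivative_mult dc dx)
      moreover have "Re (\<Sum>k\<in>freq_box N. ?c k (fst z) * (of_real (freq_dot k (snd h)) * (\<i> * character k x)) + (fst h *\<^sub>R fhat (cpt (w t) i) k) * character k (snd z))
         = blinfun_apply (D z) h $ i" for h
      proof -
        obtain a \<xi> where h: "h = (a, \<xi>)" by (cases h)
        have "(\<Sum>k\<in>freq_box N. ?c k t * (of_real (freq_dot k \<xi>) * (\<i> * character k x)))
            = (\<Sum>j\<in>UNIV. of_real (\<xi> $ j) * (\<Sum>k\<in>freq_box N. \<i> * of_int (k $ j) * ?c k t * character k x))"
          by (simp add: freq_dot_def sum_distrib_left sum_distrib_right sum.swap[of _ _ UNIV] mult_ac)
        then have "Re (\<Sum>k\<in>freq_box N. ?c k t * (of_real (freq_dot k \<xi>) * (\<i> * character k x)))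
            = (\<Sum>j\<in>UNIV. \<xi> $ j * Re (\<Sum>k\<in>freq_box N. \<i> * of_int (k $ j) * ?c k t * character k x))"
          by (simp only: Re_sum[of _ UNIV] Re_of_real_times)
        moreover have "Re (\<Sum>k\<in>freq_box N. (a *\<^sub>R fhat (cpt (w t) i) k) * character k x)
            = a * Re (\<Sum>k\<in>freq_box N. 1 * fhat (cpt (w t) i) k * character k x)"
          by (simp add: sum_distrib_left scaleR_conv_of_real algebra_simps)
        ultimately show ?thesis
          unfolding h Dapp by (simp only: tx fst_conv snd_conv sum.distrib plus_complex.simps vector_add_component
            vector_scaleR_component sum_component vec_lambda_beta real_scaleR_def add.commute)
      qed
      ultimately show ?thesis by simp
    qed
    then have "(?G u (\<lambda>k. 1) has_derivative blinfun_apply (D z)) (at z)" by (rule has_derivative_vecI)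
    then show ?thesis
    proof (rule has_derivative_transform_within_open)
      show "open (I \<times> (UNIV :: (real ^ 'd) set))" using I by (intro open_Times) auto
      show "z \<in> I \<times> UNIV" by (rule z)
      fix y :: "real \<times> (real ^ 'd)" assume "y \<in> I \<times> UNIV"
      then have by_: "bandlimited N (u (fst y))" using b by auto
      have "u (fst y) (snd y) $ i = Re (\<Sum>k\<in>freq_box N. 1 * fhat (cpt (u (fst y)) i) k * character k (snd y))" for i
        using arg_cong[where f = Re, OF trig_poly_expand[OF bandlimited_trig_poly[OF by_, of i] finite_freq_box bandlimited_spectrum[OF by_], of "snd y"]]
        by (simp only: Re_complex_of_real mult_1_left)
      then show "?G u (\<lambda>k. 1) y = (case y of (t, x) \<Rightarrow> u t x)" by (simp add: vec_eq_iff split_beta)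
    qed
  qed
  ultimately show ?thesis unfolding spacetime_C1_on_def by blast
qed

lemma ode_solution_imp_classical:
  fixes A :: "'d::finite \<Rightarrow> real ^ 'n \<Rightarrow> real ^ 'n ^ 'n"
  assumes A: "\<And>j a b. real_polynomial_function (\<lambda>U. A j U $ a $ b)"
    and sol: "ode_solution (filtered_field A N) (Bcontfun (lowpass N U0)) I y"
  shows "classical_solution A N s U0 I (\<lambda>t. apply_bcontfun (y t))"
    and "Hs_C1_on s' I (\<lambda>t. apply_bcontfun (y t))"
    and "\<And>t. t \<in> I \<Longrightarrow> bandlimited N (apply_bcontfun (y t))"
proof -
  let ?u = "\<lambda>t. apply_bcontfun (y t)"
  let ?v = "\<lambda>t. apply_bcontfun (filtered_field A N (y t))"
  have I: "open I" "is_interval I" "0 \<in> I" "y 0 = Bcontfun (lowpass N U0)"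
    and dy: "\<And>t. t \<in> I \<Longrightarrow> (y has_vector_derivative filtered_field A N (y t)) (at t)"
    using sol unfolding ode_solution_def by auto
  have init: "?u 0 = lowpass N U0" by (simp add: I(4) apply_Bcontfun_bandlimited[OF bandlimited_lowpass])
  have bv: "bandlimited N (?v t)" for t unfolding apply_filtered_field by (rule bandlimited_filtered_rhs)
  have dcomp: "((\<lambda>t. ?u t x $ i) has_vector_derivative ?v t x $ i) (at t)" if "t \<in> I" for t x i
    by (rule bounded_linear.has_vector_derivative[OF bounded_linear_bcontfun_component dy[OF that]])
  have dhat: "((\<lambda>t. fhat (cpt (?u t) i) k) has_vector_derivative fhat (cpt (?v t) i) k) (at t)" if "t \<in> I" for t i k
    by (rule bounded_linear.has_vector_derivative[OF bounded_linear_bcontfun_fhat dy[OF that]])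
  show b: "bandlimited N (?u t)" if "t \<in> I" for t
    by (rule bandlimited_evolution[OF I(2,3) that _ bv dcomp dhat]) (simp_all add: init bandlimited_lowpass)
  have v: "?v t = filtered_rhs A N (?u t)" if "t \<in> I" for t
    unfolding apply_filtered_field lowpass_bandlimited[OF b[OF that]] ..
  have cy: "continuous_on I y"
    by (rule continuous_on_vector_derivative) (rule has_vector_derivative_at_within[OF dy])
  have "continuous_on I (\<lambda>t. filtered_field A N (y t))"
    by (rule continuous_on_compose2[OF lipschitz_on_balls_continuous[OF filtered_field_lipschitz[of A, OF A]] cy]) simp
  then have cv: "continuous_on I (\<lambda>t. fhat (cpt (?v t) i) k)" for i k
    by (rule bounded_linear.continuous_on[OF bounded_linear_bcontfun_fhat])
  have C1: "Hs_C1_on r I ?u" for r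
    by (rule Hs_C1_on_bandlimited[OF b bv has_vector_derivative_at_within[OF dhat] cv])
  show "Hs_C1_on s' I ?u" by (rule C1)
  show "classical_solution A N s U0 I ?u"
    unfolding classical_solution_def
  proof (intro conjI ballI allI I)
    show "Hs_continuous_on s I ?u" using C1[of s] unfolding Hs_C1_on_def by blast
    show "spacetime_C1_on I ?u" by (rule spacetime_C1_bandlimited[OF I(1) b bv dhat cv])
    show "?u 0 x = lowpass N U0 x" for x by (simp add: init)
    fix t x assume t: "t \<in> I"
    have "((\<lambda>\<tau>. ?u \<tau> x) has_vector_derivative ?v t x) (at t)"
      by (rule has_vector_derivative_vecI) (use dcomp[OF t] in \<open>simp add: has_real_derivative_iff_has_vector_derivative\<close>)
    then have "vector_derivative (\<lambda>\<tau>. ?u \<tau> x) (at t) = filtered_rhs A N (?u t) x"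
      unfolding v[OF t] by (rule vector_derivative_at)
    then show "vector_derivative (\<lambda>\<tau>. ?u \<tau> x) (at t) + lowpass N (\<lambda>y. \<Sum>j\<in>UNIV. A j (?u t y) *v partial_x j (?u t) y) x = 0"
      by (simp add: filtered_rhs_def)
  qed
qed

instance bcontfun :: (metric_space, banach) banach ..

text \<open>The notion of solution does not depend on \<open>s\<close>, because solutions are bandlimited and correspond to those of one
  ordinary differential equation. The continuation criterion is stated in the Wiener norm, which dominates the supremum
  norm with a constant independent of \<open>N\<close>.\<close>

lemma filtered_system_maximal_solution:
  fixes A :: "'d::finite \<Rightarrow> real ^ 'n \<Rightarrow> real ^ 'n ^ 'n"
  assumes A: "\<And>j a b. real_polynomial_function (\<lambda>U. A j U $ a $ b)"
  obtains I u where "maximal_solution A N s U0 I u"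
    "\<And>J v. classical_solution A N s U0 J v \<Longrightarrow> J \<subseteq> I \<and> (\<forall>t\<in>J. v t = u t)"
    "\<And>J v. maximal_solution A N s U0 J v \<Longrightarrow> J = I \<and> (\<forall>t\<in>I. v t = u t)"
    "\<And>s'. Hs_C1_on s' I u"
    "\<And>b R. 0 < b \<Longrightarrow> {0..<b} \<subseteq> I \<Longrightarrow> (\<And>t i. t \<in> {0..<b} \<Longrightarrow> wiener_norm 1 (cpt (u t) i) \<le> R) \<Longrightarrow> b \<in> I"
proof -
  obtain I y where y: "ode_solution (filtered_field A N) (Bcontfun (lowpass N U0)) I y"
    and ymax: "\<And>J z. ode_solution (filtered_field A N) (Bcontfun (lowpass N U0)) J z \<Longrightarrow> J \<subseteq> I \<and> (\<forall>t\<in>J. z t = y t)"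
    and yext: "\<And>b R. 0 < b \<Longrightarrow> {0..<b} \<subseteq> I \<Longrightarrow> (\<And>t. t \<in> {0..<b} \<Longrightarrow> norm (y t) \<le> R) \<Longrightarrow> b \<in> I"
    using maximal_ode_solution[OF filtered_field_lipschitz[of A N, OF A], of "Bcontfun (lowpass N U0)"] by blast
  define u where "u t = apply_bcontfun (y t)" for t
  note cls = ode_solution_imp_classical[of A N U0 I y, OF A y, folded u_def]
  have sub: "J \<subseteq> I \<and> (\<forall>t\<in>J. v t = u t)" if "classical_solution A N s U0 J v" for J v
  proof -
    have J: "J \<subseteq> I" "\<And>t. t \<in> J \<Longrightarrow> Bcontfun (v t) = y t" using ymax[OF classical_imp_ode_solution[OF that]] by auto
    have "v t = u t" if t: "t \<in> J" for t
      using J(2)[OF t] apply_Bcontfun_bandlimited[OF classical_solution_bandlimited[OF \<open>classical_solution A N s U0 J v\<close> t]]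
      by (simp add: u_def)
    then show ?thesis using J by blast
  qed
  have mx: "maximal_solution A N s U0 I u"
    unfolding maximal_solution_def using cls(1)[of s] sub by blast
  show ?thesis
  proof (rule that[OF mx sub])
    show "J = I \<and> (\<forall>t\<in>I. v t = u t)" if m: "maximal_solution A N s U0 J v" for J v
    proof -
      have J: "J \<subseteq> I" "\<And>t. t \<in> J \<Longrightarrow> v t = u t" using sub[of J v] m unfolding maximal_solution_def by auto
      have "\<not> J \<subset> I"
      proof
        assume "J \<subset> I"
        moreover have "\<forall>t\<in>J. u t = v t" using J(2) by simp
        ultimately show False using m cls(1)[of s] unfolding maximal_solution_def by blast
      qed
      then show ?thesis using J by auto
    qed
    show "Hs_C1_on s' I u" for s' using cls(2) by blast
    show "b \<in> I" if b: "0 < b" "{0..<b} \<subseteq> I" and R: "\<And>t i. t \<in> {0..<b} \<Longrightarrow> wiener_norm 1 (cpt (u t) i) \<le> R" for b R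
    proof (rule yext[OF b])
      fix t assume t: "t \<in> {0..<b}"
      then have bt: "bandlimited N (u t)" using cls(3) b by blast
      show "norm (y t) \<le> (\<Sum>i\<in>(UNIV :: 'n set). R)"
      proof (rule norm_bound)
        fix x
        have "norm (u t x) \<le> (\<Sum>i\<in>UNIV. wiener_norm 0 (cpt (u t) i))" by (rule bandlimited_norm_bound[OF bt])
        also have "\<dots> \<le> (\<Sum>i\<in>(UNIV :: 'n set). R)"
          by (intro sum_mono order_trans[OF wiener_norm_0_le_1 R[OF t]])
        finally show "norm (apply_bcontfun (y t) x) \<le> (\<Sum>i\<in>(UNIV :: 'n set). R)" by (simp add: u_def)
      qed
    qed
  qed
qed

section \<open>Continuation and the uniform existence time\<close>

text \<open>Continuous induction: if the bound \<open>B\<close> up to a time \<open>t\<close> implies the strict bound at \<open>t\<close>, it is never reached.\<close>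

lemma first_exit:
  fixes \<phi> :: "real \<Rightarrow> real"
  assumes c: "continuous_on {0..b} \<phi>" and init: "\<phi> 0 < B"
    and step: "\<And>t. t \<in> {0..b} \<Longrightarrow> (\<And>\<tau>. \<tau> \<in> {0..t} \<Longrightarrow> \<phi> \<tau> \<le> B) \<Longrightarrow> \<phi> t < B"
    and t: "t \<in> {0..b}"
  shows "\<phi> t < B"
proof (rule ccontr)
  assume "\<not> \<phi> t < B"
  define S where "S = {0..b} \<inter> \<phi> -` {B..}"
  have S: "t \<in> S" using t \<open>\<not> \<phi> t < B\<close> by (simp add: S_def)
  have "closed S" unfolding S_def by (rule continuous_closed_preimage[OF c]) auto
  then have "compact S" unfolding compact_eq_bounded_closed S_def by (auto intro: bounded_subset[OF bounded_closed_interval])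
  then obtain t0 where t0: "t0 \<in> S" "\<And>\<tau>. \<tau> \<in> S \<Longrightarrow> t0 \<le> \<tau>"
    using compact_attains_inf[of S] S by blast
  have t0b: "0 \<le> t0" "t0 \<le> b" "B \<le> \<phi> t0" using t0(1) by (auto simp: S_def)
  have "\<exists>x\<ge>0. x \<le> t0 \<and> \<phi> x = B"
    by (rule IVT') (use init t0b in \<open>auto intro: continuous_on_subset[OF c]\<close>)
  then obtain x where x: "0 \<le> x" "x \<le> t0" "\<phi> x = B" by blast
  then have "x \<in> S" using t0b by (simp add: S_def)
  then have "x = t0" using t0(2)[of x] x by simp
  then have eq: "\<phi> t0 = B" using x by simp
  have "\<phi> t0 < B"
  proof (rule step)
    show "t0 \<in> {0..b}" using t0b by simp
    fix \<tau> assume \<tau>: "\<tau> \<in> {0..t0}"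
    show "\<phi> \<tau> \<le> B"
    proof (rule ccontr)
      assume "\<not> \<phi> \<tau> \<le> B"
      then have "\<tau> \<in> S" using \<tau> t0b by (simp add: S_def)
      then have "\<tau> = t0" using t0(2)[of \<tau>] \<tau> by simp
      then show False using eq \<open>\<not> \<phi> \<tau> \<le> B\<close> by simp
    qed
  qed
  then show False using eq by simp
qed

lemma wiener_norm_le_Hs_norm:
  assumes s: "s > real CARD('d) / 2 + 1"
  shows "\<exists>c>0. \<forall>N (U :: real ^ 'd \<Rightarrow> real ^ 'n) i. bandlimited N U \<longrightarrow> wiener_norm 1 (cpt U i) \<le> c * Hs_norm s U"
proof -
  obtain C where C: "C > 0" and l1: "\<And>F a. finite F \<Longrightarrow>
     (\<Sum>k\<in>F. japanese_bracket (k :: int ^ 'd) * \<bar>a k\<bar>) \<le> C * L2_set (\<lambda>k. japanese_bracket k powr s * a k) F"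
    using weighted_l1_le_l2[OF s] by blast
  have "wiener_norm 1 (cpt U i) \<le> C * Hs_norm s U" if U: "bandlimited N U" for N and U :: "real ^ 'd \<Rightarrow> real ^ 'n" and i
  proof -
    note b = bandlimited_trig_poly[OF U] bandlimited_spectrum[OF U]
    have "wiener_norm 1 (cpt U i) = (\<Sum>k\<in>freq_box N. japanese_bracket k * \<bar>norm (fhat (cpt U i) k)\<bar>)"
      by (simp add: wiener_norm_eq[OF b(1) finite_freq_box b(2)])
    also have "\<dots> \<le> C * L2_set (\<lambda>k. japanese_bracket k powr s * norm (fhat (cpt U i) k)) (freq_box N)"
      by (rule l1) simp
    also have "\<dots> = C * sobolev_norm s (cpt U i)"
      by (simp only: sobolev_norm_eq[OF b(1) finite_freq_box b(2)])
    also have "\<dots> \<le> C * Hs_norm s U"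
      using C by (intro mult_left_mono sobolev_norm_le_Hs_norm[OF U]) auto
    finally show ?thesis .
  qed
  then show ?thesis using C by blast
qed

lemma Hs_norm_continuous:
  assumes b: "\<And>t. t \<in> I \<Longrightarrow> bandlimited N (u t)" and c: "Hs_continuous_on s I u"
  shows "continuous_on I (\<lambda>t. Hs_norm s (u t))"
  unfolding continuous_on_def
proof
  fix t assume t: "t \<in> I"
  have l: "((\<lambda>\<tau>. Hs_norm s (\<lambda>x. u \<tau> x - u t x)) \<longlongrightarrow> 0) (at t within I)"
    using c t unfolding Hs_continuous_on_def by blast
  have "((\<lambda>\<tau>. Hs_norm s (u \<tau>) - Hs_norm s (u t)) \<longlongrightarrow> 0) (at t within I)"
  proof (rule Lim_null_comparison[OF _ l])
    show "\<forall>\<^sub>F \<tau> in at t within I. norm (Hs_norm s (u \<tau>) - Hs_norm s (u t)) \<le> Hs_norm s (\<lambda>x. u \<tau> x - u t x)"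
      using eventually_in_within
    proof eventually_elim
      case (elim \<tau>)
      have sw: "Hs_norm s (\<lambda>x. u t x - u \<tau> x) = Hs_norm s (\<lambda>x. u \<tau> x - u t x)"
      proof -
        have "norm (fourier_coeff (\<lambda>x. u t x - u \<tau> x) k) = norm (fourier_coeff (\<lambda>x. u \<tau> x - u t x) k)" for k
        proof -
          have "(norm (fourier_coeff (\<lambda>x. u t x - u \<tau> x) k))\<^sup>2 = (norm (fourier_coeff (\<lambda>x. u \<tau> x - u t x) k))\<^sup>2"
            unfolding norm_fourier_coeff_sq fhat_bandlimited_diff[OF b[OF t] b[OF elim]] fhat_bandlimited_diff[OF b[OF elim] b[OF t]]
            by (simp add: norm_minus_commute)
          then show ?thesis by simp
        qed
        then show ?thesis by (simp add: Hs_norm_def)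
      qed
      show ?case
        using Hs_norm_triangle_diff[OF b[OF elim] b[OF t], of s] Hs_norm_triangle_diff[OF b[OF t] b[OF elim], of s] sw
        by (simp add: abs_le_iff)
    qed
  qed
  then show "((\<lambda>t. Hs_norm s (u t)) \<longlongrightarrow> Hs_norm s (u t)) (at t within I)"
    by (rule LIM_zero_cancel)
qed

lemma interval_first_exit:
  assumes I: "open I" "is_interval I" "(0::real) \<in> I" and T: "0 \<le> T" "T \<notin> I"
  obtains b where "0 < b" "b \<le> T" "b \<notin> I" "{0..<b} \<subseteq> I"
proof -
  have "closed ({0..T} \<inter> - I)" using I(1) by (intro closed_Int) (auto simp: closed_Compl)
  then have "compact ({0..T} \<inter> - I)"
    unfolding compact_eq_bounded_closed by (auto intro: bounded_subset[OF bounded_closed_interval])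
  moreover have "{0..T} \<inter> - I \<noteq> {}" using T by auto
  ultimately obtain b where b: "b \<in> {0..T} \<inter> - I" "\<And>x. x \<in> {0..T} \<inter> - I \<Longrightarrow> b \<le> x"
    using compact_attains_inf[of "{0..T} \<inter> - I"] by blast
  show ?thesis
  proof
    show "0 < b" using b(1) I(3) by (cases "b = 0") auto
    show "b \<le> T" "b \<notin> I" using b(1) by simp_all
    show "{0..<b} \<subseteq> I"
    proof
      fix x assume x: "x \<in> {0..<b}"
      show "x \<in> I"
      proof (rule ccontr)
        assume "x \<notin> I"
        then have "x \<in> {0..T} \<inter> - I" using b(1) x by simp
        then have "b \<le> x" by (rule b(2))
        then show False using x by simp
      qed
    qed
  qed
qed

lemma interval_contains: "is_interval I \<Longrightarrow> (0::real) \<in> I \<Longrightarrow> t \<in> I \<Longrightarrow> {0..t} \<subseteq> I"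
  by (intro subsetI) (rule mem_is_interval_1_I[of I 0 t], simp_all)

text \<open>The first bound keeps the values of the solution near those of the data; the second one controls all norms of the
  displacement when the degree is bounded.\<close>

lemma displacement:
  fixes A :: "'d::finite \<Rightarrow> real ^ 'n \<Rightarrow> real ^ 'n ^ 'n"
  assumes sol: "classical_solution A N s U0 I u" and t: "0 \<le> t" "{0..t} \<subseteq> I"
    and rhs: "\<And>\<tau> a. \<tau> \<in> {0..t} \<Longrightarrow> wiener_norm 0 (cpt (filtered_rhs A N (u \<tau>)) a) \<le> B"
  shows "norm (u t x - u 0 x) \<le> real CARD('n) * (B * t)"
    and "norm (fhat (cpt (u t) i) k - fhat (cpt (u 0) i) k) \<le> B * t"
proof -
  have "norm (u t x $ i - u 0 x $ i) \<le> B * \<bar>t - 0\<bar>" for i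
  proof (rule vector_derivative_bound[of "{0..t}" "\<lambda>t. u t x $ i" "\<lambda>t. filtered_rhs A N (u t) x $ i"])
    fix \<tau> assume \<tau>: "\<tau> \<in> {0..t}"
    show "((\<lambda>t. u t x $ i) has_vector_derivative filtered_rhs A N (u \<tau>) x $ i) (at \<tau>)"
      by (rule classical_solution_coefficient_derivative(2)[OF sol]) (use \<tau> t in auto)
    show "norm (filtered_rhs A N (u \<tau>) x $ i) \<le> B"
      using bandlimited_component_bound[OF bandlimited_filtered_rhs, of A N "u \<tau>" x i] rhs[OF \<tau>, of i] by simp
  qed (use t in auto)
  then have "norm (u t x - u 0 x) \<le> (\<Sum>i\<in>(UNIV :: 'n set). B * t)"
    using t by (intro order_trans[OF norm_le_l1_cart] sum_mono) auto
  then show "norm (u t x - u 0 x) \<le> real CARD('n) * (B * t)" by simp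
  have "norm (fhat (cpt (u t) i) k - fhat (cpt (u 0) i) k) \<le> B * \<bar>t - 0\<bar>"
  proof (rule vector_derivative_bound[of "{0..t}" "\<lambda>t. fhat (cpt (u t) i) k" "\<lambda>t. fhat (cpt (filtered_rhs A N (u t)) i) k"])
    fix \<tau> assume \<tau>: "\<tau> \<in> {0..t}"
    show "((\<lambda>t. fhat (cpt (u t) i) k) has_vector_derivative fhat (cpt (filtered_rhs A N (u \<tau>)) i) k) (at \<tau>)"
      by (rule classical_solution_coefficient_derivative(1)[OF sol]) (use \<tau> t in auto)
    show "norm (fhat (cpt (filtered_rhs A N (u \<tau>)) i) k) \<le> B"
      using fhat_le_wiener_norm[OF bandlimited_trig_poly[OF bandlimited_filtered_rhs], of A N "u \<tau>" i k] rhs[OF \<tau>, of i] by simp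
  qed (use t in auto)
  then show "norm (fhat (cpt (u t) i) k - fhat (cpt (u 0) i) k) \<le> B * t" using t by simp
qed

lemma Hs_norm_zero: "Hs_norm s (\<lambda>x. 0 :: real ^ 'n) = 0"
  by (simp add: Hs_norm_def fourier_coeff_def norm_vec_def L2_set_def)

lemma zero_data_global_solution:
  fixes A :: "'d::finite \<Rightarrow> real ^ 'n \<Rightarrow> real ^ 'n ^ 'n"
  assumes A: "\<And>j a b. real_polynomial_function (\<lambda>U. A j U $ a $ b)"
    and U0: "U0 \<in> Hs s" "Hs_norm s U0 = 0"
  shows "classical_solution A N s U0 UNIV (\<lambda>t x. 0)"
proof -
  have b0: "bandlimited N (\<lambda>x::real^'d. 0 :: real ^ 'n)"
    by (simp add: bandlimited_def trig_poly_zero)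
  have "Hs_norm s (lowpass N U0) = 0"
    using Hs_norm_lowpass_le[OF U0(1), of N] Hs_norm_nonneg[of s "lowpass N U0"] U0(2) by simp
  then have "sobolev_norm s (cpt (lowpass N U0) i) = 0" for i
    using sobolev_norm_le_Hs_norm[OF bandlimited_lowpass, of s N U0 i] sobolev_norm_nonneg[of s "cpt (lowpass N U0) i"] by linarith
  then have "L2_set (\<lambda>k. japanese_bracket k powr s * norm (fhat (cpt (lowpass N U0) i) k)) (freq_box N) = 0" for i
    by (simp only: sobolev_norm_eq[OF bandlimited_trig_poly[OF bandlimited_lowpass] finite_freq_box bandlimited_spectrum[OF bandlimited_lowpass]])
  then have "fhat (cpt (lowpass N U0) i) k = 0" if "k \<in> freq_box N" for i k
    using that by (auto simp: L2_set_eq_0_iff)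
  then have low: "lowpass N U0 = (\<lambda>x. 0)"
    by (intro bandlimited_eqI[OF bandlimited_lowpass b0]) simp
  have ap0: "apply_bcontfun (0 :: (real ^ 'd) \<Rightarrow>\<^sub>C (real ^ 'n)) = (\<lambda>x. 0)" by (simp add: zero_bcontfun.rep_eq fun_eq_iff)
  have p0: "partial_x j (\<lambda>x::real^'d. 0 :: real ^ 'n) = (\<lambda>x. 0)" for j
    by (simp add: partial_x_def fun_eq_iff)
  have l0: "lowpass N (\<lambda>x::real^'d. 0 :: real ^ 'n) = (\<lambda>x. 0)" by (rule lowpass_bandlimited[OF b0])
  have f0: "filtered_field A N 0 = 0"
    by (rule bcontfun_eqI) (simp add: apply_filtered_field ap0 l0 filtered_rhs_def p0 matrix_vector_mult_0_right)
  have "Bcontfun (\<lambda>x::real^'d. 0 :: real ^ 'n) = 0"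
    by (rule bcontfun_eqI) (simp add: apply_Bcontfun_bandlimited[OF b0] ap0)
  then have "ode_solution (filtered_field A N) (Bcontfun (lowpass N U0)) UNIV (\<lambda>t. 0)"
    by (simp add: ode_solution_def low f0)
  from ode_solution_imp_classical(1)[of A N U0, OF A this, of s] show ?thesis by (simp add: ap0)
qed

context symmetrizable_system
begin

text \<open>The energy estimate with \<open>r = s'\<close>, where the bound in \<open>H\<^sup>s\<close> supplies the one in the Wiener norm. If \<open>U0\<close> is not in
  \<open>H\<^sup>s\<^sup>'\<close>, the right-hand side is infinite.\<close>

lemma higher_regularity_bound:
  assumes s: "s > real CARD('d) / 2 + 1" and s': "s' \<ge> s" and K: "compact K" "K \<subseteq> \<U>" and M: "M > 0"
  shows "\<exists>C>0. \<forall>N U0 I u T. U0 \<in> Hs s \<and> maximal_solution A N s U0 I u \<and> 0 < T \<and> T \<in> I \<and>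
     (\<forall>t\<in>{0..T}. Hs_norm s (u t) \<le> M) \<and> (\<forall>t\<in>{0..T}. \<forall>x. u t x \<in> K) \<longrightarrow>
     (\<forall>t\<in>{0..T}. Hs_enorm s' (u t) \<le> ennreal C * Hs_enorm s' U0 * ennreal (exp (C * M * t)))"
proof -
  have s1: "1 \<le> s'" using s s' by (simp add: order_trans[of 1 "real CARD('d) / 2 + 1"])
  obtain c where c: "c > 0" and W: "\<And>N (U :: real ^ 'd \<Rightarrow> real ^ 'n) i. bandlimited N U \<Longrightarrow> wiener_norm 1 (cpt U i) \<le> c * Hs_norm s U"
    using wiener_norm_le_Hs_norm[OF s, where 'n = 'n] by blast
  obtain \<kappa> where \<kappa>: "\<kappa> \<ge> 1" and en: "\<forall>r\<ge>1. \<forall>R\<ge>0. \<exists>C>0. energy_growth K \<kappa> r R C"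
    using energy_estimate[OF K] by (elim exE conjE) (rule that)
  have R0: "0 \<le> c * M" using c M by simp
  obtain C where C: "C > 0" and est: "energy_growth K \<kappa> s' (c * M) C"
    using en[rule_format, OF s1 R0] by (elim exE conjE) (rule that)
  define Cs where "Cs = max \<kappa> (C * c)"
  have Cs: "Cs > 0" "\<kappa> \<le> Cs" "C * c \<le> Cs" using \<kappa> by (auto simp: Cs_def)
  show ?thesis
  proof (intro exI[of _ Cs] conjI Cs(1) allI impI ballI)
    fix N U0 I u T t
    assume H: "U0 \<in> Hs s \<and> maximal_solution A N s U0 I u \<and> 0 < T \<and> T \<in> I \<and>
     (\<forall>t\<in>{0..T}. Hs_norm s (u t) \<le> M) \<and> (\<forall>t\<in>{0..T}. \<forall>x. u t x \<in> K)" and t: "t \<in> {0..T}"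
    have sol: "classical_solution A N s U0 I u" using H unfolding maximal_solution_def by blast
    have TI: "{0..T} \<subseteq> I" using sol H interval_contains unfolding classical_solution_def by blast
    have bl: "bandlimited N (u \<tau>)" if "\<tau> \<in> {0..T}" for \<tau>
      by (rule classical_solution_bandlimited[OF sol]) (use that TI in auto)
    have u0: "u 0 = lowpass N U0" using sol unfolding classical_solution_def by auto
    have Wt: "wiener_norm 1 (cpt (u \<tau>) i) \<le> c * M" if "\<tau> \<in> {0..T}" for \<tau> i
    proof -
      have "c * Hs_norm s (u \<tau>) \<le> c * M" using H that c by (intro mult_left_mono) auto
      then show ?thesis using W[OF bl[OF that], of i] by linarith
    qed
    have main: "Hs_norm s' (u t) \<le> \<kappa> * Hs_norm s' (u 0) * exp (C * (c * M) * t)"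
      using est[unfolded energy_growth_def] sol TI Wt H t by blast
    show "Hs_enorm s' (u t) \<le> ennreal Cs * Hs_enorm s' U0 * ennreal (exp (Cs * M * t))"
    proof (cases "U0 \<in> Hs s'")
      case False
      then show ?thesis using Cs(1) by (simp add: Hs_enorm_def ennreal_mult_top ennreal_top_mult)
    next
      case True
      have t0: "0 \<le> t" using t by simp
      have "Hs_norm s' (u t) \<le> \<kappa> * Hs_norm s' (u 0) * exp (C * (c * M) * t)" by (rule main)
      also have "\<dots> \<le> Cs * Hs_norm s' U0 * exp (Cs * M * t)"
      proof (intro mult_mono Cs(2))
        show "Hs_norm s' (u 0) \<le> Hs_norm s' U0" unfolding u0 by (rule Hs_norm_lowpass_le[OF True])
        have "(C * c) * (M * t) \<le> Cs * (M * t)" by (rule mult_right_mono[OF Cs(3)]) (use M t0 in simp)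
        then show "exp (C * (c * M) * t) \<le> exp (Cs * M * t)" by (simp add: mult_ac)
      qed (use Cs in \<open>auto simp: Hs_norm_nonneg\<close>)
      finally have "ennreal (Hs_norm s' (u t)) \<le> ennreal (Cs * Hs_norm s' U0 * exp (Cs * M * t))"
        by (rule ennreal_leI)
      also have "\<dots> = ennreal Cs * ennreal (Hs_norm s' U0) * ennreal (exp (Cs * M * t))"
        using Cs(1) by (simp add: ennreal_mult Hs_norm_nonneg)
      finally show ?thesis
        using True Hs_norm_bandlimited(1)[OF bl[OF t], of s'] by (simp add: Hs_enorm_def)
    qed
  qed
qed

text \<open>The bound \<open>|u(t)|\<^sub>s \<le> 2 \<kappa> m\<close>, with \<open>m\<close> the norm of \<open>U0\<close>, is propagated by continuous induction. Where the data are
  close to \<open>K \<union> {0}\<close> the energy estimate gives a factor smaller than \<open>2\<close> over \<open>\<kappa> m\<close>. Otherwise \<open>N \<le> N0\<close> and \<open>m > \<delta>\<close>, and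
  the displacement alone is smaller than \<open>m\<close>. The role of \<open>\<delta>\<close> is that in this case a displacement bounded by a constant
  is also bounded by \<open>m\<close>.\<close>

lemma uniform_existence_time:
  assumes s: "s > real CARD('d) / 2 + 1" and M: "M > 0" and K: "compact K" "K \<subseteq> \<U>"
  shows "\<exists>C>0. \<exists>T>0. \<forall>N\<ge>1. \<forall>U0. admissible_data s M K U0 \<longrightarrow>
     (\<exists>I u. maximal_solution A N s U0 I u \<and>
        (\<forall>J v. maximal_solution A N s U0 J v \<longrightarrow> J = I \<and> (\<forall>t\<in>I. v t = u t)) \<and>
        lifespan T (Hs_norm s U0) \<subseteq> I \<and>
        (\<forall>t \<in> lifespan T (Hs_norm s U0).
           Hs_norm s (u t) \<le> C * Hs_norm s U0 * exp (C * Hs_norm s U0 * t) \<and>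
           C * Hs_norm s U0 * exp (C * Hs_norm s U0 * t) \<le> 2 * C * Hs_norm s U0) \<and>
        (\<forall>s'\<ge>s. Hs_C1_on s' I u))"
    (is "\<exists>C>0. \<exists>T>0. \<forall>N\<ge>1. \<forall>U0. _ \<longrightarrow> ?Concl C T N U0")
proof -
  have s1: "1 \<le> s" using s by (simp add: order_trans[of 1 "real CARD('d) / 2 + 1"])
  obtain c where c: "c > 0" and W: "\<And>N (U :: real ^ 'd \<Rightarrow> real ^ 'n) i. bandlimited N U \<Longrightarrow> wiener_norm 1 (cpt U i) \<le> c * Hs_norm s U"
    using wiener_norm_le_Hs_norm[OF s, where 'n = 'n] by blast
  have "compact (insert 0 K)" "insert 0 K \<subseteq> \<U>" using K U_zero by auto
  then obtain e where e: "e > 0" "(\<Union>x\<in>insert 0 K. cball x e) \<subseteq> \<U>"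
    using compact_subset_open_imp_cball_epsilon_subset[OF _ U_open] by blast
  \<comment> \<open>One half of the margin \<open>e\<close> is for the distance of the data from \<open>K \<union> {0}\<close>, the other half for the displacement.\<close>
  define \<rho> where "\<rho> = e / 2"
  have \<rho>: "\<rho> > 0" using e by (simp add: \<rho>_def)
  define K1 where "K1 = (\<Union>x\<in>insert 0 K. cball x e)"
  have "K1 = {x + y | x y. x \<in> insert 0 K \<and> y \<in> cball 0 e}"
  proof (intro set_eqI iffI)
    fix z assume "z \<in> K1"
    then obtain x where x: "x \<in> insert 0 K" "z \<in> cball x e" unfolding K1_def by blast
    then have "z = x + (z - x)" "z - x \<in> cball 0 e" by (simp_all add: dist_norm norm_minus_commute)
    then show "z \<in> {x + y | x y. x \<in> insert 0 K \<and> y \<in> cball 0 e}" using x(1) by blast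
  next
    fix z assume "z \<in> {x + y | x y. x \<in> insert 0 K \<and> y \<in> cball 0 e}"
    then obtain x y where "z = x + y" "x \<in> insert 0 K" "norm y \<le> e" by auto
    then show "z \<in> K1" unfolding K1_def by (intro UN_I[of x]) (auto simp: dist_norm)
  qed
  then have K1: "compact K1" "K1 \<subseteq> \<U>"
    using compact_sums[OF \<open>compact (insert 0 K)\<close> compact_cball[of 0 e]] e by (simp_all add: K1_def)
  obtain \<kappa> where \<kappa>: "\<kappa> \<ge> 1" and en: "\<forall>r\<ge>1. \<forall>R\<ge>0. \<exists>C>0. energy_growth K1 \<kappa> r R C"
    using energy_estimate[OF K1] by (elim exE conjE) (rule that)
  \<comment> \<open>Bounds the Wiener norm by \<open>G m\<close> as long as \<open>|u|\<^sub>s \<le> 2 \<kappa> m\<close>. Here \<open>\<kappa>\<close> must be known before \<open>R = G M\<close> is chosen.\<close>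
  define G where "G = c * (2 * \<kappa>)"
  have G: "G > 0" using c \<kappa> by (simp add: G_def)
  have R0: "0 \<le> G * M" using G M by simp
  obtain Ce where Ce: "Ce > 0" and est: "energy_growth K1 \<kappa> s (G * M) Ce"
    using en[rule_format, OF s1 R0] by (elim exE conjE) (rule that)
  obtain Cw where Cw: "Cw > 0" and rhs: "\<forall>N U w. bandlimited N U \<and> (\<forall>i. wiener_norm 1 (cpt U i) \<le> w) \<and> w \<le> G * M \<longrightarrow>
     (\<forall>a. wiener_norm 0 (cpt (filtered_rhs A N U) a) \<le> Cw * w)"
    using filtered_rhs_wiener_bound[of A, OF A_poly R0] by (elim exE conjE) (rule that)
  obtain cL where cL: "cL > 0" and near: "\<forall>(U0 :: real ^ 'd \<Rightarrow> real ^ 'n) K N x. U0 \<in> Hs s \<and> compact K \<and> (AE x in lebesgue. U0 x \<in> K) \<and> 1 \<le> N \<longrightarrow>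
     (\<exists>y\<in>K. norm (lowpass N U0 x - y) \<le> cL * Hs_norm s U0 / real N)"
    using lowpass_near_values[OF s, where 'n = 'n] by (elim exE conjE) (rule that)
  \<comment> \<open>From \<open>N0\<close> on, the filtered data are within \<open>\<rho>\<close> of \<open>K\<close>.\<close>
  obtain N0 :: nat where N0: "cL * M / \<rho> \<le> real N0" using real_arch_simple by blast
  define n where "n = real CARD('n)"
  have n: "n \<ge> 1" by (simp add: n_def Suc_leI)
  \<comment> \<open>Data of norm at most \<open>\<delta>\<close> are within \<open>\<rho>\<close> of \<open>0\<close>.\<close>
  define \<delta> where "\<delta> = \<rho> / (n * c)"
  have \<delta>: "\<delta> > 0" using \<rho> n c by (simp add: \<delta>_def)
  \<comment> \<open>Bounds the \<open>H\<^sup>s\<close> norm of a function of degree at most \<open>N0\<close> by its largest coefficient.\<close>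
  define a where "a = n * (\<Sum>k\<in>(freq_box N0 :: (int ^ 'd) set). japanese_bracket k powr s) + 1"
  have a: "a > 0" unfolding a_def using n by (intro add_nonneg_pos mult_nonneg_nonneg sum_nonneg) auto
  \<comment> \<open>In this order: the displacement is at most \<open>\<rho>\<close>; the exponential in the energy estimate is less than \<open>2\<close>; for
    \<open>N \<le> N0\<close> the displacement in \<open>H\<^sup>s\<close> is less than \<open>\<delta>\<close>; the exponential in the conclusion is at most \<open>2\<close>.\<close>
  define T where "T = min (min (\<rho> / (n * Cw * G)) (ln 2 / (2 * Ce * G))) (min (\<delta> / (2 * a * Cw * G)) (ln 2 / (2 * \<kappa>)))"
  have pos: "n * Cw * G > 0" "2 * Ce * G > 0" "2 * a * Cw * G > 0" "2 * \<kappa> > 0" using n Cw G Ce a \<kappa> by auto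
  have T: "T > 0" unfolding T_def using pos \<rho> \<delta> by simp
  have T1: "(n * Cw * G) * T \<le> \<rho>" and T2: "(2 * Ce * G) * T \<le> ln 2" and T3: "(2 * a * Cw * G) * T \<le> \<delta>" and T4: "(2 * \<kappa>) * T \<le> ln 2"
  proof -
    have "T \<le> \<rho> / (n * Cw * G)" "T \<le> ln 2 / (2 * Ce * G)" "T \<le> \<delta> / (2 * a * Cw * G)" "T \<le> ln 2 / (2 * \<kappa>)" by (auto simp: T_def)
    then show "(n * Cw * G) * T \<le> \<rho>" "(2 * Ce * G) * T \<le> ln 2" "(2 * a * Cw * G) * T \<le> \<delta>" "(2 * \<kappa>) * T \<le> ln 2"
      using pos by (simp_all only: pos_le_divide_eq mult.commute)
  qed
  define C where "C = 2 * \<kappa>"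
  have C: "C > 0" using \<kappa> by (simp add: C_def)
  show ?thesis
  proof (rule exI[of _ C], rule conjI[OF C], rule exI[of _ T], rule conjI[OF T], intro allI impI)
    fix N :: nat and U0 :: "real ^ 'd \<Rightarrow> real ^ 'n"
    assume N1: "1 \<le> N" and adm: "admissible_data s M K U0"
    define m where "m = Hs_norm s U0"
    have U0: "U0 \<in> Hs s" and mM: "m \<le> M" and AEK: "AE x in lebesgue. U0 x \<in> K"
      using adm by (simp_all add: admissible_data_def m_def)
    have m0: "0 \<le> m" by (simp add: m_def Hs_norm_nonneg)
    obtain I u where mx: "maximal_solution A N s U0 I u"
      and sub: "\<And>J v. classical_solution A N s U0 J v \<Longrightarrow> J \<subseteq> I \<and> (\<forall>t\<in>J. v t = u t)"
      and uniq: "\<And>J v. maximal_solution A N s U0 J v \<Longrightarrow> J = I \<and> (\<forall>t\<in>I. v t = u t)"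
      and C1: "\<And>s'. Hs_C1_on s' I u"
      and ext: "\<And>b R. 0 < b \<Longrightarrow> {0..<b} \<subseteq> I \<Longrightarrow> (\<And>t i. t \<in> {0..<b} \<Longrightarrow> wiener_norm 1 (cpt (u t) i) \<le> R) \<Longrightarrow> b \<in> I"
      by (rule filtered_system_maximal_solution[of A N s U0, OF A_poly]) blast
    have sol: "classical_solution A N s U0 I u" using mx unfolding maximal_solution_def by blast
    have I: "open I" "is_interval I" "0 \<in> I" using sol unfolding classical_solution_def by auto
    have u0: "u 0 = lowpass N U0" using sol unfolding classical_solution_def by auto
    have bl: "bandlimited N (u t)" if "t \<in> I" for t by (rule classical_solution_bandlimited[OF sol that])
    have u0m: "Hs_norm s (u 0) \<le> m" unfolding u0 m_def by (rule Hs_norm_lowpass_le[OF U0])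
    have key: "lifespan T m \<subseteq> I \<and> (\<forall>t\<in>lifespan T m. Hs_norm s (u t) \<le> 2 * \<kappa> * m)"
    proof (cases "m = 0")
      case True
      then have "UNIV \<subseteq> I \<and> (\<forall>t\<in>UNIV. (\<lambda>x. 0) = u t)"
        using sub[OF zero_data_global_solution[of A, OF A_poly U0]] by (simp add: m_def)
      then have "lifespan T m \<subseteq> I" "\<And>t. u t = (\<lambda>x. 0)" by auto
      then show ?thesis using True by (simp add: Hs_norm_zero)
    next
      case False
      then have m: "m > 0" using m0 by simp
      have hc: "Hs_continuous_on s I u" using sol unfolding classical_solution_def by blast
      have cont: "continuous_on I (\<lambda>t. Hs_norm s (u t))"
        by (rule Hs_norm_continuous[OF bl hc])
      have step: "Hs_norm s (u t) < 2 * \<kappa> * m"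
        if t: "t \<in> I" "0 \<le> t" "t \<le> T / m" and bd: "\<And>\<tau>. \<tau> \<in> {0..t} \<Longrightarrow> Hs_norm s (u \<tau>) \<le> 2 * \<kappa> * m" for t
      proof -
        have tI: "{0..t} \<subseteq> I" by (rule interval_contains[OF I(2,3) t(1)])
        have mt: "m * t \<le> T" using t(3) m by (simp add: pos_le_divide_eq mult.commute)
        have Gm: "G * m \<le> G * M" using mM G by (intro mult_left_mono) auto
        have Wt: "wiener_norm 1 (cpt (u \<tau>) i) \<le> G * m" if "\<tau> \<in> {0..t}" for \<tau> i
        proof -
          have "c * Hs_norm s (u \<tau>) \<le> c * (2 * \<kappa> * m)" using bd[OF that] c by (intro mult_left_mono) auto
          then show ?thesis using W[OF bl, of \<tau> i] that tI by (auto simp: G_def mult_ac)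
        qed
        have rt: "wiener_norm 0 (cpt (filtered_rhs A N (u \<tau>)) b) \<le> Cw * (G * m)" if "\<tau> \<in> {0..t}" for \<tau> b
          using rhs[rule_format, of N "u \<tau>" "G * m" b] bl Wt[OF that] that tI Gm by blast
        show ?thesis
        proof (cases "N0 \<le> N \<or> m \<le> \<delta>")
          case True
          have close: "\<exists>y\<in>insert 0 K. norm (u 0 x - y) \<le> \<rho>" for x
            using True
          proof
            assume NN: "N0 \<le> N"
            obtain y where y: "y \<in> K" "norm (lowpass N U0 x - y) \<le> cL * m / real N"
              using near[rule_format, of U0 K N x] U0 K(1) AEK N1 by (auto simp: m_def)
            have "cL * m \<le> cL * M" using mM cL by (intro mult_left_mono) auto
            also have "\<dots> \<le> real N0 * \<rho>" using N0 \<rho> by (simp add: pos_divide_le_eq)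
            also have "\<dots> \<le> real N * \<rho>" using NN \<rho> by (intro mult_right_mono) auto
            finally have "cL * m / real N \<le> \<rho>" using N1 by (simp add: pos_divide_le_eq mult.commute)
            then have "norm (lowpass N U0 x - y) \<le> \<rho>" using y(2) by linarith
            then show ?thesis unfolding u0 using y(1) by blast
          next
            assume md: "m \<le> \<delta>"
            have "norm (u 0 x) \<le> (\<Sum>i\<in>UNIV. wiener_norm 0 (cpt (u 0) i))" by (rule bandlimited_norm_bound[OF bl[OF I(3)]])
            also have "\<dots> \<le> (\<Sum>i\<in>(UNIV :: 'n set). c * m)"
            proof (rule sum_mono)
              fix i
              have "c * Hs_norm s (u 0) \<le> c * m" using u0m c by (intro mult_left_mono) auto
              then show "wiener_norm 0 (cpt (u 0) i) \<le> c * m"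
                using wiener_norm_0_le_1[of "cpt (u 0) i"] W[OF bl[OF I(3)], of i] by linarith
            qed
            also have "\<dots> = n * c * m" by (simp add: n_def)
            also have "\<dots> \<le> n * c * \<delta>" using md n c by (intro mult_left_mono) auto
            also have "\<dots> = \<rho>" using n c by (simp add: \<delta>_def)
            finally show ?thesis by (intro bexI[of _ 0]) auto
          qed
          have inK1: "u \<tau> x \<in> K1" if \<tau>: "\<tau> \<in> {0..t}" for \<tau> x
          proof -
            obtain y where y: "y \<in> insert 0 K" "norm (u 0 x - y) \<le> \<rho>" using close by blast
            have "norm (u \<tau> x - u 0 x) \<le> real CARD('n) * (Cw * (G * m) * \<tau>)"
              by (rule displacement(1)[OF sol]) (use \<tau> tI rt in auto)
            also have "\<dots> = (n * Cw * G) * (m * \<tau>)" by (simp add: n_def mult_ac)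
            also have "\<dots> \<le> (n * Cw * G) * T"
            proof (rule mult_left_mono)
              have "m * \<tau> \<le> m * t" using \<tau> m by (intro mult_left_mono) auto
              then show "m * \<tau> \<le> T" using mt by simp
            qed (use pos in auto)
            also have "\<dots> \<le> \<rho>" by (rule T1)
            finally have "norm (u \<tau> x - u 0 x) \<le> \<rho>" .
            then have "norm (u \<tau> x - y) \<le> e"
              using y(2) norm_triangle_ineq[of "u \<tau> x - u 0 x" "u 0 x - y"] by (simp add: \<rho>_def)
            then show ?thesis unfolding K1_def using y(1) by (intro UN_I[of y]) (simp_all add: dist_norm norm_minus_commute)
          qed
          have "Hs_norm s (u t) \<le> \<kappa> * Hs_norm s (u 0) * exp (Ce * (G * m) * t)"
            using est[unfolded energy_growth_def, rule_format, of N s U0 I u t "G * m" t] sol tI Gm inK1 Wt t(2) by auto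
          also have "\<dots> \<le> \<kappa> * m * exp (ln 2 / 2)"
          proof (intro mult_mono)
            have "(Ce * G) * (m * t) \<le> (Ce * G) * T" using mt Ce G by (intro mult_left_mono) auto
            then show "exp (Ce * (G * m) * t) \<le> exp (ln 2 / 2)" using T2 by (simp add: mult_ac)
          qed (use \<kappa> u0m m Hs_norm_nonneg in auto)
          also have "\<dots> < \<kappa> * m * 2"
          proof (rule mult_strict_left_mono)
            have "exp (ln 2 / 2) < exp (ln (2::real))" by (simp only: exp_less_cancel_iff) simp
            then show "exp (ln 2 / 2) < (2::real)" by simp
          qed (use \<kappa> m in simp)
          finally show ?thesis by (simp add: mult_ac)
        next
          case False
          then have NN: "N \<le> N0" and md: "\<delta> < m" by auto
          have "Hs_norm s (u t) \<le> Hs_norm s (u 0) + Hs_norm s (\<lambda>x. u t x - u 0 x)"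
            by (rule Hs_norm_triangle_diff[OF bl[OF t(1)] bl[OF I(3)]])
          also have "Hs_norm s (\<lambda>x. u t x - u 0 x)
              \<le> (real CARD('n) * (\<Sum>k\<in>(freq_box N :: (int ^ 'd) set). japanese_bracket k powr s)) * (Cw * (G * m) * t)"
          proof (rule Hs_norm_le_coefficients[OF bandlimited_diff[OF bl[OF t(1)] bl[OF I(3)]]])
            fix i k
            show "norm (fhat (cpt (\<lambda>x. u t x - u 0 x) i) k) \<le> Cw * (G * m) * t"
              unfolding fhat_bandlimited_diff[OF bl[OF t(1)] bl[OF I(3)]]
              by (rule displacement(2)[OF sol t(2) tI rt])
          qed
          also have "\<dots> \<le> a * (Cw * (G * m) * t)"
          proof (rule mult_right_mono)
            have "(\<Sum>k\<in>(freq_box N :: (int ^ 'd) set). japanese_bracket k powr s) \<le> (\<Sum>k\<in>(freq_box N0 :: (int ^ 'd) set). japanese_bracket k powr s)"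
              by (rule sum_mono2[OF finite_freq_box freq_box_mono[OF NN]]) simp
            then have "n * (\<Sum>k\<in>(freq_box N :: (int ^ 'd) set). japanese_bracket k powr s) \<le> n * (\<Sum>k\<in>(freq_box N0 :: (int ^ 'd) set). japanese_bracket k powr s)"
              using n by (intro mult_left_mono) auto
            then show "real CARD('n) * (\<Sum>k\<in>(freq_box N :: (int ^ 'd) set). japanese_bracket k powr s) \<le> a"
              unfolding a_def n_def by linarith
          qed (use Cw G m t in auto)
          also have "\<dots> = (a * Cw * G) * (m * t)" by (simp add: mult_ac)
          also have "\<dots> \<le> (a * Cw * G) * T" using mt a Cw G by (intro mult_left_mono) auto
          also have "\<dots> < m" using T3 md \<delta> by simp
          finally have "Hs_norm s (u t) < 2 * m" using u0m by simp
          also have "2 * m \<le> 2 * \<kappa> * m" using \<kappa> m by simp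
          finally show ?thesis .
        qed
      qed
      have init: "Hs_norm s (u 0) < 2 * \<kappa> * m"
      proof -
        have "1 * m \<le> \<kappa> * m" using \<kappa> m by (intro mult_right_mono) auto
        then show ?thesis using u0m m by (simp only: mult_1_left mult.assoc)
      qed
      have bound: "Hs_norm s (u t) < 2 * \<kappa> * m" if t: "t \<in> I" "0 \<le> t" "t \<le> T / m" for t
      proof (rule first_exit[of t "\<lambda>t. Hs_norm s (u t)"])
        have tI: "{0..t} \<subseteq> I" by (rule interval_contains[OF I(2,3) t(1)])
        show "continuous_on {0..t} (\<lambda>t. Hs_norm s (u t))" by (rule continuous_on_subset[OF cont tI])
        show "Hs_norm s (u 0) < 2 * \<kappa> * m" by (rule init)
        show "t \<in> {0..t}" using t by simp
        fix t' assume t': "t' \<in> {0..t}" and h: "\<And>\<tau>. \<tau> \<in> {0..t'} \<Longrightarrow> Hs_norm s (u \<tau>) \<le> 2 * \<kappa> * m"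
        show "Hs_norm s (u t') < 2 * \<kappa> * m"
          by (rule step[OF _ _ _ h]) (use t' t tI in auto)
      qed
      \<comment> \<open>The bound excludes that the maximal interval ends before \<open>T / m\<close>.\<close>
      have "T / m \<in> I"
      proof (rule ccontr)
        assume "T / m \<notin> I"
        moreover have "0 \<le> T / m" using T m by simp
        ultimately obtain b where b: "0 < b" "b \<le> T / m" "b \<notin> I" "{0..<b} \<subseteq> I"
          using interval_first_exit[OF I] by blast
        have "b \<in> I"
        proof (rule ext[OF b(1,4)])
          fix t i assume t: "t \<in> {0..<b}"
          then have tI: "t \<in> I" using b(4) by blast
          have "c * Hs_norm s (u t) \<le> c * (2 * \<kappa> * m)"
            using bound[OF tI] t b(2) c by (intro mult_left_mono) auto
          then show "wiener_norm 1 (cpt (u t) i) \<le> c * (2 * \<kappa> * m)" using W[OF bl[OF tI], of i] by linarith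
        qed
        then show False using b(3) by blast
      qed
      then have sub_I: "{0..T / m} \<subseteq> I" by (rule interval_contains[OF I(2,3)])
      have ls: "lifespan T m = {0..T / m}" using m by (simp add: lifespan_def)
      show ?thesis
        unfolding ls
      proof (intro conjI sub_I ballI)
        fix t assume t: "t \<in> {0..T / m}"
        show "Hs_norm s (u t) \<le> 2 * \<kappa> * m"
          by (rule less_imp_le, rule bound) (use t sub_I in auto)
      qed
    qed
    have bounds: "Hs_norm s (u t) \<le> C * m * exp (C * m * t) \<and> C * m * exp (C * m * t) \<le> 2 * C * m" if t: "t \<in> lifespan T m" for t
    proof -
      have t0: "0 \<le> t" using t by (auto simp: lifespan_def split: if_splits)
      have Cm: "0 \<le> C * m" using C m0 by simp
      have "1 \<le> exp (C * m * t)" using Cm t0 by simp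
      then have "C * m * 1 \<le> C * m * exp (C * m * t)" by (rule mult_left_mono[OF _ Cm])
      moreover have "Hs_norm s (u t) \<le> C * m" using key t by (auto simp: C_def)
      moreover have "exp (C * m * t) \<le> 2"
      proof (cases "m = 0")
        case False
        then have "m * t \<le> T" using t m0 by (simp add: lifespan_def pos_le_divide_eq mult.commute)
        then have "C * (m * t) \<le> C * T" using C by (intro mult_left_mono) auto
        then have "C * m * t \<le> ln 2" using T4 by (simp add: C_def mult_ac)
        then have "exp (C * m * t) \<le> exp (ln 2)" by (simp only: exp_le_cancel_iff)
        then show ?thesis by simp
      qed simp
      then have "C * m * exp (C * m * t) \<le> C * m * 2" by (rule mult_left_mono[OF _ Cm])
      ultimately show ?thesis by simp
    qed
    show "?Concl C T N U0"
    proof (intro exI[of _ I] exI[of _ u] conjI mx)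
      show "\<forall>J v. maximal_solution A N s U0 J v \<longrightarrow> J = I \<and> (\<forall>t\<in>I. v t = u t)" using uniq by blast
      show "lifespan T (Hs_norm s U0) \<subseteq> I" using key unfolding m_def by blast
      show "\<forall>t \<in> lifespan T (Hs_norm s U0).
           Hs_norm s (u t) \<le> C * Hs_norm s U0 * exp (C * Hs_norm s U0 * t) \<and>
           C * Hs_norm s U0 * exp (C * Hs_norm s U0 * t) \<le> 2 * C * Hs_norm s U0"
        unfolding m_def[symmetric] by (intro ballI bounds)
      show "\<forall>s'\<ge>s. Hs_C1_on s' I u" using C1 by blast
    qed
  qed
qed

end

theorem proposition3p9:
  fixes A :: "'d::finite \<Rightarrow> real ^ 'n::finite \<Rightarrow> real ^ 'n ^ 'n"
    and S :: "real ^ 'n \<Rightarrow> real ^ 'n ^ 'n"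
    and S0 :: "'d \<Rightarrow> real ^ 'n ^ 'n"
    and \<U> :: "(real ^ 'n) set"
    and s :: real
  assumes A_poly: "\<And>j a b. real_polynomial_function (\<lambda>U. A j U $ a $ b)"
    and U_open: "open \<U>" and U_zero: "0 \<in> \<U>"
    and S_poly: "\<And>a b. real_polynomial_function (\<lambda>U. S U $ a $ b)"
    and S_sym: "\<And>U. U \<in> \<U> \<Longrightarrow> transpose (S U) = S U"
    and S_pos: "\<And>U v. U \<in> \<U> \<Longrightarrow> v \<noteq> 0 \<Longrightarrow> v \<bullet> (S U *v v) > 0"
    and S0_sym: "\<And>j. transpose (S0 j) = S0 j"
    and A_eq: "\<And>j U. U \<in> \<U> \<Longrightarrow> A j U = S0 j ** S U"
    and s_gt: "s > real CARD('d) / 2 + 1"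
  shows
    "(\<forall>M K. M > 0 \<and> compact K \<and> K \<subseteq> \<U> \<longrightarrow>
       (\<exists>C>0. \<exists>T>0. \<forall>N\<ge>1. \<forall>U0. admissible_data s M K U0 \<longrightarrow>
         (\<exists>I u. maximal_solution A N s U0 I u \<and>
            (\<forall>J v. maximal_solution A N s U0 J v \<longrightarrow> J = I \<and> (\<forall>t\<in>I. v t = u t)) \<and>
            lifespan T (Hs_norm s U0) \<subseteq> I \<and>
            (\<forall>t \<in> lifespan T (Hs_norm s U0).
               Hs_norm s (u t) \<le> C * Hs_norm s U0 * exp (C * Hs_norm s U0 * t) \<and>
               C * Hs_norm s U0 * exp (C * Hs_norm s U0 * t) \<le> 2 * C * Hs_norm s U0) \<and>
            (\<forall>s'\<ge>s. Hs_C1_on s' I u))))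
     \<and>
     (\<forall>s' Ms Ks. s' \<ge> s \<and> Ms > 0 \<and> compact Ks \<and> Ks \<subseteq> \<U> \<longrightarrow>
       (\<exists>Cs>0. \<forall>M K. M > 0 \<and> compact K \<and> K \<subseteq> \<U> \<longrightarrow>
         (\<forall>N\<ge>1. \<forall>U0. admissible_data s M K U0 \<longrightarrow>
           (\<forall>I u Ts. maximal_solution A N s U0 I u \<and> 0 < Ts \<and> Ts \<in> I \<and>
              (\<forall>t\<in>{0..Ts}. Hs_norm s (u t) \<le> Ms) \<and>
              (\<forall>t\<in>{0..Ts}. \<forall>x. u t x \<in> Ks) \<longrightarrow>
              (\<forall>t\<in>{0..Ts}.
                 Hs_enorm s' (u t) \<le> ennreal Cs * Hs_enorm s' U0 * ennreal (exp (Cs * Ms * t)))))))"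
proof -
  interpret symmetrizable_system A S S0 \<U>
    by unfold_locales (fact A_poly U_open U_zero S_poly S_sym S_pos S0_sym A_eq)+
  show ?thesis
  proof (intro conjI allI impI)
    fix M :: real and K :: "(real ^ 'n) set" assume "M > 0 \<and> compact K \<and> K \<subseteq> \<U>"
    then show "\<exists>C>0. \<exists>T>0. \<forall>N\<ge>1. \<forall>U0. admissible_data s M K U0 \<longrightarrow>
         (\<exists>I u. maximal_solution A N s U0 I u \<and>
            (\<forall>J v. maximal_solution A N s U0 J v \<longrightarrow> J = I \<and> (\<forall>t\<in>I. v t = u t)) \<and>
            lifespan T (Hs_norm s U0) \<subseteq> I \<and>
            (\<forall>t \<in> lifespan T (Hs_norm s U0).
               Hs_norm s (u t) \<le> C * Hs_norm s U0 * exp (C * Hs_norm s U0 * t) \<and>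
               C * Hs_norm s U0 * exp (C * Hs_norm s U0 * t) \<le> 2 * C * Hs_norm s U0) \<and>
            (\<forall>s'\<ge>s. Hs_C1_on s' I u))"
      by (intro uniform_existence_time[OF s_gt]) auto
  next
    fix s' Ms :: real and Ks :: "(real ^ 'n) set" assume H0: "s' \<ge> s \<and> Ms > 0 \<and> compact Ks \<and> Ks \<subseteq> \<U>"
    obtain C where C: "C > 0" and bd: "\<forall>N U0 I u T. U0 \<in> Hs s \<and> maximal_solution A N s U0 I u \<and> 0 < T \<and> T \<in> I \<and>
     (\<forall>t\<in>{0..T}. Hs_norm s (u t) \<le> Ms) \<and> (\<forall>t\<in>{0..T}. \<forall>x. u t x \<in> Ks) \<longrightarrow>
     (\<forall>t\<in>{0..T}. Hs_enorm s' (u t) \<le> ennreal C * Hs_enorm s' U0 * ennreal (exp (C * Ms * t)))"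
      using higher_regularity_bound[OF s_gt, of s' Ks Ms] H0 by (elim exE conjE) (blast intro: that)
    show "\<exists>Cs>0. \<forall>M K. M > 0 \<and> compact K \<and> K \<subseteq> \<U> \<longrightarrow>
         (\<forall>N\<ge>1. \<forall>U0. admissible_data s M K U0 \<longrightarrow>
           (\<forall>I u Ts. maximal_solution A N s U0 I u \<and> 0 < Ts \<and> Ts \<in> I \<and>
              (\<forall>t\<in>{0..Ts}. Hs_norm s (u t) \<le> Ms) \<and>
              (\<forall>t\<in>{0..Ts}. \<forall>x. u t x \<in> Ks) \<longrightarrow>
              (\<forall>t\<in>{0..Ts}.
                 Hs_enorm s' (u t) \<le> ennreal Cs * Hs_enorm s' U0 * ennreal (exp (Cs * Ms * t)))))"
    proof (intro exI[of _ C] conjI C allI impI)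
      fix M K N U0 I u Ts
      assume "admissible_data s M K U0"
        and H: "maximal_solution A N s U0 I u \<and> 0 < Ts \<and> Ts \<in> I \<and>
              (\<forall>t\<in>{0..Ts}. Hs_norm s (u t) \<le> Ms) \<and> (\<forall>t\<in>{0..Ts}. \<forall>x. u t x \<in> Ks)"
      then have "U0 \<in> Hs s" by (simp add: admissible_data_def)
      then show "\<forall>t\<in>{0..Ts}. Hs_enorm s' (u t) \<le> ennreal C * Hs_enorm s' U0 * ennreal (exp (C * Ms * t))"
        using bd[rule_format, OF conjI[OF _ H]] by blast
    qed
  qed
qed

end
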